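(* If $n\ge 2$, then the number of conjugacy classes in $P_n(\mathbb{R}P^2)$ of elements of order $4$ (that is, the number of $P_n(\mathbb{R}P^2)$-conjugacy classes of pure braids of order $4$ of the real projective plane) is equal to $(n-2)!\,(2n-1)$.
   Context: For a compact connected surface $M$, $F_n(M)$ is the space of ordered $n$-tuples of distinct points of $M$, and the pure braid group is $P_n(M)=\pi_1(F_n(M))$; it is a normal subgroup of the braid group $B_n(M)=\pi_1(F_n(M)/S_n)$ with quotient $S_n$. The group $B_n(\mathbb{R}P^2)$ has a presentation (Van Buskirk) with generators $\sigma_1,\dots,\sigma_{n-1},\rho_1,\dots,\rho_n$ and relations: $\sigma_i\sigma_j=\sigma_j\sigma_i$ if $|i-j|\ge2$; $\sigma_i\sigma_{i+1}\sigma_i=\sigma_{i+1}\sigma_i\sigma_{i+1}$ for $1\le i\le n-2$; $\sigma_i\rho_j=\rho_j\sigma_i$ for $j\ne i,i+1$; $\rho_{i+1}=\sigma_i^{-1}\rho_i\sigma_i^{-1}$ for $1\le i\le n-1$; $\rho_{i+1}^{-1}\rho_i^{-1}\rho_{i+1}\rho_i=\sigma_i^2$ for $1\le i\le n-1$; $\rho_1^2=\sigma_1\sigma_2\cdots\sigma_{n-2}\sigma_{n-1}^2\sigma_{n-2}\cdots\sigma_2\sigma_1$. $P_n(\mathbb{R}P^2)$ is the kernel of the homomorphism to $S_n$ sending $\sigma_i$ to $(i,i+1)$ and each $\rho_j$ to the identity. *)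

theory Defs
  imports "HOL-Analysis.Analysis" "HOL-Algebra.Multiplicative_Group"
begin

section \<open>The real projective plane\<close>

typedef projective_plane = "{{x, - x} |x :: real ^ 3. norm x = 1}"
proof -
  have "norm (axis 1 1 :: real ^ 3) = 1" by simp
  then show ?thesis by blast
qed

definition sphere_proj :: "real ^ 3 \<Rightarrow> projective_plane" where
  "sphere_proj x = Abs_projective_plane {x, - x}"

lemma sphere_proj_eq_iff:
  assumes "norm x = 1" "norm y = 1"
  shows "sphere_proj x = sphere_proj y \<longleftrightarrow> x = y \<or> x = - y"
proof -
  have "{x, - x} \<in> {{x, - x} |x :: real ^ 3. norm x = 1}"
    and "{y, - y} \<in> {{x, - x} |x :: real ^ 3. norm x = 1}"
    using assms by blast+
  then have "sphere_proj x = sphere_proj y \<longleftrightarrow> {x, - x} = {y, - y}"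
    unfolding sphere_proj_def by (rule Abs_projective_plane_inject)
  also have "\<dots> \<longleftrightarrow> x = y \<or> x = - y"
    unfolding doubleton_eq_iff by (metis minus_minus)
  finally show ?thesis .
qed

lemma sphere_proj_surj: "sphere_proj ` sphere 0 1 = UNIV"
proof -
  have "\<exists>x\<in>sphere 0 1. y = sphere_proj x" for y
    by (cases y) (auto simp: sphere_proj_def)
  then show ?thesis by blast
qed

instantiation projective_plane :: topological_space
begin

definition open_projective_plane :: "projective_plane set \<Rightarrow> bool" where
  "open_projective_plane U \<longleftrightarrow>
     openin (top_of_set (sphere 0 1)) {x \<in> sphere 0 1. sphere_proj x \<in> U}"

instance
proof
  show "open (UNIV :: projective_plane set)"
    unfolding open_projective_plane_def by (simp only: UNIV_I simp_thms Collect_mem_eq openin_subtopology_self)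
next
  fix U V :: "projective_plane set"
  assume "open U" "open V"
  then have "openin (top_of_set (sphere 0 1))
      ({x \<in> sphere 0 1. sphere_proj x \<in> U} \<inter> {x \<in> sphere 0 1. sphere_proj x \<in> V})"
    unfolding open_projective_plane_def by (rule openin_Int)
  moreover have "{x \<in> sphere 0 1. sphere_proj x \<in> U} \<inter> {x \<in> sphere 0 1. sphere_proj x \<in> V}
      = {x \<in> sphere 0 1. sphere_proj x \<in> U \<inter> V}" by blast
  ultimately show "open (U \<inter> V)" unfolding open_projective_plane_def by simp
next
  fix K :: "projective_plane set set"
  assume "\<forall>U\<in>K. open U"
  then have "openin (top_of_set (sphere 0 1)) (\<Union>U\<in>K. {x \<in> sphere 0 1. sphere_proj x \<in> U})"
    unfolding open_projective_plane_def by blast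
  moreover have "(\<Union>U\<in>K. {x \<in> sphere 0 1. sphere_proj x \<in> U})
      = {x \<in> sphere 0 1. sphere_proj x \<in> \<Union>K}" by blast
  ultimately show "open (\<Union>K)" unfolding open_projective_plane_def by simp
qed

end

lemma quotient_map_sphere_proj:
  "quotient_map (top_of_set (sphere 0 1)) euclidean sphere_proj"
  unfolding quotient_map_def topspace_euclidean_subtopology topspace_euclidean
  using sphere_proj_surj by (auto simp: open_projective_plane_def)

section \<open>Fundamental groups\<close>

definition loops_at :: "'a::topological_space set \<Rightarrow> 'a \<Rightarrow> (real \<Rightarrow> 'a) set" where
  "loops_at S a = {p. path p \<and> path_image p \<subseteq> S \<and> pathstart p = a \<and> pathfinish p = a}"

definition loop_homotopy ::
    "'a::topological_space set \<Rightarrow> 'a \<Rightarrow> ((real \<Rightarrow> 'a) \<times> (real \<Rightarrow> 'a)) set" where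
  "loop_homotopy S a = {(p, q). p \<in> loops_at S a \<and> q \<in> loops_at S a \<and> homotopic_paths S p q}"

definition fundamental_group ::
    "'a::topological_space set \<Rightarrow> 'a \<Rightarrow> (real \<Rightarrow> 'a) set monoid" where
  "fundamental_group S a =
     \<lparr>carrier = loops_at S a // loop_homotopy S a,
      mult = (\<lambda>A B. \<Union>p\<in>A. \<Union>q\<in>B. loop_homotopy S a `` {p +++ q}),
      one = loop_homotopy S a `` {\<lambda>_. a}\<rparr>"

lemma loops_atD:
  assumes "p \<in> loops_at S a"
  shows "path p" "path_image p \<subseteq> S" "pathstart p = a" "pathfinish p = a"
  using assms by (auto simp: loops_at_def)

lemma const_loop_in_loops_at: "a \<in> S \<Longrightarrow> (\<lambda>_. a) \<in> loops_at S a"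
  by (auto simp: loops_at_def path_def path_image_def pathstart_def pathfinish_def)

lemma join_in_loops_at:
  assumes "p \<in> loops_at S a" "q \<in> loops_at S a"
  shows "p +++ q \<in> loops_at S a"
  using loops_atD[OF assms(1)] loops_atD[OF assms(2)]
  by (simp add: loops_at_def subset_path_image_join)

lemma reversepath_in_loops_at: "p \<in> loops_at S a \<Longrightarrow> reversepath p \<in> loops_at S a"
  by (simp add: loops_at_def)

lemma equiv_loop_homotopy: "equiv (loops_at S a) (loop_homotopy S a)"
proof (rule equivI)
  show "loop_homotopy S a \<subseteq> loops_at S a \<times> loops_at S a"
    by (auto simp: loop_homotopy_def)
  show "refl_on (loops_at S a) (loop_homotopy S a)"
    by (auto simp: refl_on_def loop_homotopy_def loops_at_def)
  show "sym (loop_homotopy S a)"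
    by (auto simp: sym_def loop_homotopy_def intro: homotopic_paths_sym)
  show "trans (loop_homotopy S a)"
    by (auto simp: trans_def loop_homotopy_def intro: homotopic_paths_trans)
qed

lemma homotopic_paths_join_const:
  fixes p :: "real \<Rightarrow> 'a::topological_space"
  assumes "p \<in> loops_at S a"
  shows "homotopic_paths S (p +++ (\<lambda>_. a)) p"
proof -
  have "homotopic_paths S p (p +++ (\<lambda>_. a))"
  proof (rule homotopic_paths_reparametrize[where f = "\<lambda>t. min (2 * t) 1"])
    fix t :: real
    assume "t \<in> {0..1}"
    then show "(p +++ (\<lambda>_. a)) t = p (min (2 * t) 1)"
      using loops_atD(4)[OF assms] by (auto simp: joinpaths_def pathfinish_def min_def)
  qed (use loops_atD[OF assms] in \<open>auto intro!: continuous_intros\<close>)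
  then show ?thesis by (rule homotopic_paths_sym)
qed

lemma homotopic_paths_const_join:
  fixes p :: "real \<Rightarrow> 'a::topological_space"
  assumes "p \<in> loops_at S a"
  shows "homotopic_paths S ((\<lambda>_. a) +++ p) p"
proof -
  have "homotopic_paths S p ((\<lambda>_. a) +++ p)"
  proof (rule homotopic_paths_reparametrize[where f = "\<lambda>t. max (2 * t - 1) 0"])
    fix t :: real
    assume "t \<in> {0..1}"
    then show "((\<lambda>_. a) +++ p) t = p (max (2 * t - 1) 0)"
      using loops_atD(3)[OF assms] by (auto simp: joinpaths_def pathstart_def max_def)
  qed (use loops_atD[OF assms] in \<open>auto intro!: continuous_intros\<close>)
  then show ?thesis by (rule homotopic_paths_sym)
qed

lemma homotopic_paths_reversepath_join:
  fixes p :: "real \<Rightarrow> 'a::topological_space"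
  assumes "p \<in> loops_at S a"
  shows "homotopic_paths S (reversepath p +++ p) (\<lambda>_. a)"
proof -
  note p = loops_atD[OF assms]
  define f :: "real \<times> real \<Rightarrow> real"
    where "f z = max \<bar>2 * snd z - 1\<bar> (fst z)" for z
  have f: "f z \<in> {0..1}" if "z \<in> {0..1} \<times> {0..1}" for z
    using that by (auto simp: f_def)
  have cf: "continuous_on ({0..1} \<times> {0..1}) f"
    unfolding f_def by (intro continuous_intros)
  have "continuous_on ({0..1} \<times> {0..1}) (\<lambda>z. p (f z))"
    by (rule continuous_on_compose2[OF p(1)[unfolded path_def] cf]) (use f in blast)
  moreover have "(\<lambda>z. p (f z)) \<in> {0..1} \<times> {0..1} \<rightarrow> S"
    using f p(2) by (auto simp: path_image_def)
  moreover have "p (f (0, t)) = (reversepath p +++ p) t" if "t \<in> {0..1}" for t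
    using that by (auto simp: f_def joinpaths_def reversepath_def)
  moreover have "p (f (1, t)) = a" if "t \<in> {0..1}" for t
  proof -
    have "f (1, t) = 1" using that by (auto simp: f_def)
    then show ?thesis using p(4) by (simp add: pathfinish_def)
  qed
  moreover have "pathstart ((\<lambda>z. p (f z)) \<circ> Pair t) = a \<and> pathfinish ((\<lambda>z. p (f z)) \<circ> Pair t) = a"
    if "t \<in> {0..1}" for t
    using that p(4) by (auto simp: f_def pathstart_def pathfinish_def max_def)
  ultimately show ?thesis
    unfolding homotopic_paths using p by (intro exI[of _ "\<lambda>z. p (f z)"]) auto
qed

lemma loop_homotopy_join:
  assumes "(p, p') \<in> loop_homotopy S a" "(q, q') \<in> loop_homotopy S a"
  shows "(p +++ q, p' +++ q') \<in> loop_homotopy S a"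
proof -
  have mem: "p \<in> loops_at S a" "p' \<in> loops_at S a" "q \<in> loops_at S a" "q' \<in> loops_at S a"
    and hom: "homotopic_paths S p p'" "homotopic_paths S q q'"
    using assms by (auto simp: loop_homotopy_def)
  have "homotopic_paths S (p +++ q) (p' +++ q')"
    using hom loops_atD(4)[OF mem(1)] loops_atD(3)[OF mem(3)]
    by (intro homotopic_paths_join) simp_all
  then show ?thesis
    using mem by (simp add: loop_homotopy_def join_in_loops_at)
qed

lemma fundamental_group_mult_class:
  assumes "p \<in> loops_at S a" "q \<in> loops_at S a"
  shows "(loop_homotopy S a `` {p}) \<otimes>\<^bsub>fundamental_group S a\<^esub> (loop_homotopy S a `` {q})
           = loop_homotopy S a `` {p +++ q}"
proof -
  let ?R = "loop_homotopy S a" and ?C = "loop_homotopy S a `` {p +++ q}"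
  have const: "?R `` {p' +++ q'} = ?C" if "p' \<in> ?R `` {p}" "q' \<in> ?R `` {q}" for p' q'
  proof -
    have "(p +++ q, p' +++ q') \<in> ?R"
      using that by (intro loop_homotopy_join) simp_all
    from equiv_class_eq[OF equiv_loop_homotopy this] show ?thesis by (rule sym)
  qed
  have self: "p \<in> ?R `` {p}" "q \<in> ?R `` {q}"
    using equiv_class_self[OF equiv_loop_homotopy] assms by blast+
  have "(\<Union>p'\<in>?R `` {p}. \<Union>q'\<in>?R `` {q}. ?R `` {p' +++ q'})
          = (\<Union>p'\<in>?R `` {p}. \<Union>q'\<in>?R `` {q}. ?C)"
    by (intro SUP_cong refl const)
  also have "\<dots> = ?C"
    using self by blast
  finally show ?thesis
    by (simp add: fundamental_group_def)
qed

lemma group_fundamental_group: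
  assumes "a \<in> S"
  shows "group (fundamental_group S a)"
proof -
  let ?R = "loop_homotopy S a" and ?G = "fundamental_group S a"
  have carr: "carrier ?G = loops_at S a // ?R"
    and one: "\<one>\<^bsub>?G\<^esub> = ?R `` {\<lambda>_. a}"
    by (simp_all add: fundamental_group_def)
  have cls: "?R `` {p} \<in> carrier ?G" if "p \<in> loops_at S a" for p
    unfolding carr using that by (rule quotientI)
  have eq: "?R `` {p} = ?R `` {q}"
    if "p \<in> loops_at S a" "q \<in> loops_at S a" "homotopic_paths S p q" for p q
    by (rule equiv_class_eq[OF equiv_loop_homotopy]) (use that in \<open>simp add: loop_homotopy_def\<close>)
  note [simp] = fundamental_group_mult_class join_in_loops_at reversepath_in_loops_at
    const_loop_in_loops_at[OF assms]
  show ?thesis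
  proof (rule groupI)
    fix x y
    assume "x \<in> carrier ?G" "y \<in> carrier ?G"
    then show "x \<otimes>\<^bsub>?G\<^esub> y \<in> carrier ?G"
      unfolding carr by (auto elim!: quotientE intro!: quotientI)
  next
    show "\<one>\<^bsub>?G\<^esub> \<in> carrier ?G"
      unfolding one by (rule cls) simp
  next
    fix x y z
    assume "x \<in> carrier ?G" "y \<in> carrier ?G" "z \<in> carrier ?G"
    then obtain p q r where pqr: "p \<in> loops_at S a" "q \<in> loops_at S a" "r \<in> loops_at S a"
      and "x = ?R `` {p}" "y = ?R `` {q}" "z = ?R `` {r}"
      unfolding carr by (auto elim!: quotientE)
    moreover have "?R `` {p +++ (q +++ r)} = ?R `` {(p +++ q) +++ r}"
    proof (rule eq)
      show "homotopic_paths S (p +++ (q +++ r)) ((p +++ q) +++ r)"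
        using loops_atD[OF pqr(1)] loops_atD[OF pqr(2)] loops_atD[OF pqr(3)]
        by (intro homotopic_paths_assoc) simp_all
    qed (use pqr in simp_all)
    ultimately show "x \<otimes>\<^bsub>?G\<^esub> y \<otimes>\<^bsub>?G\<^esub> z = x \<otimes>\<^bsub>?G\<^esub> (y \<otimes>\<^bsub>?G\<^esub> z)"
      by simp
  next
    fix x
    assume "x \<in> carrier ?G"
    then obtain p where p: "p \<in> loops_at S a" and x: "x = ?R `` {p}"
      unfolding carr by (auto elim!: quotientE)
    show "\<one>\<^bsub>?G\<^esub> \<otimes>\<^bsub>?G\<^esub> x = x"
      using p by (simp add: x one) (intro eq homotopic_paths_const_join, simp_all)
    have "?R `` {reversepath p} \<otimes>\<^bsub>?G\<^esub> x = \<one>\<^bsub>?G\<^esub>"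
      using p by (simp add: x one) (intro eq homotopic_paths_reversepath_join, simp_all)
    then show "\<exists>y\<in>carrier ?G. y \<otimes>\<^bsub>?G\<^esub> x = \<one>\<^bsub>?G\<^esub>"
      using cls p by (meson reversepath_in_loops_at)
  qed
qed

section \<open>Configuration spaces and pure braid groups\<close>

text \<open>Tuples are extensional functions on \<open>{..<n}\<close>, with the topology induced from the
  product topology on the function type. As all coordinates outside \<open>{..<n}\<close> have the
  same fixed value, this is the topology of the \<open>n\<close>-fold product.\<close>

definition configuration_space :: "nat \<Rightarrow> 'a set \<Rightarrow> (nat \<Rightarrow> 'a) set" where
  "configuration_space n M = {x \<in> {..<n} \<rightarrow>\<^sub>E M. inj_on x {..<n}}"

definition pure_braid_group ::
    "nat \<Rightarrow> 'a::topological_space set \<Rightarrow> (nat \<Rightarrow> 'a) \<Rightarrow> (real \<Rightarrow> nat \<Rightarrow> 'a) set monoid" where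
  "pure_braid_group n M b = fundamental_group (configuration_space n M) b"

lemma group_pure_braid_group:
  "b \<in> configuration_space n M \<Longrightarrow> group (pure_braid_group n M b)"
  unfolding pure_braid_group_def by (rule group_fundamental_group)

section \<open>Conjugacy classes\<close>

definition conjugacy_class :: "('a, 'b) monoid_scheme \<Rightarrow> 'a \<Rightarrow> 'a set" where
  "conjugacy_class G x = {g \<otimes>\<^bsub>G\<^esub> x \<otimes>\<^bsub>G\<^esub> inv\<^bsub>G\<^esub> g |g. g \<in> carrier G}"

end

theory Submission
  imports Defs "HOL-Combinatorics.Permutations"

begin

text \<open>Conjugacy classes of a fundamental group are free homotopy classes of loops
  (\<open>conjugate_iff_homotopic_loops\<close>). A configuration of \<open>n\<close> points of the
  projective plane lifts to \<open>n\<close> vectors spanning distinct lines, uniquely up to signs.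
  A loop therefore lifts to a path that ends at a sign change \<open>sg e\<close> of its start, and
  a free homotopy lifts to one through such twisted paths (\<open>loop_lift\<close>,
  \<open>loops_lift\<close>). The model elements are the paths \<open>rotloop c\<close>: a
  configuration \<open>c\<close> of lines that are horizontal or vertical makes a half turn about
  the vertical axis, after which every line is back in place. The square is the full turn, which is
  not contractible (\<open>rotation_not_null\<close>), and the fourth power turns through 4\<pi>,
  which is (\<open>homotopic_spin\<close>); so the order is four.

  Conversely, every pure braid of order four is freely homotopic to such a rotation
  (\<open>order_four_special\<close>), by induction on \<open>n\<close>. The fibre of forgetting the
  last line is the complement of the other lines. Over a special configuration this fibre, or a
  covering of it, consists of two convex halves joined by convex bridges, and its loops are words in
  involutive letters (locale \<open>comb\<close>). Words show that the fibre group has no elements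
  of order two (\<open>special_null_square\<close>) and trivial centre
  (\<open>special_central\<close>), and that a path twisted by the half turn or its negative whose
  double is null contracts to a fixed point (\<open>special_twisted\<close>).
  \<open>transport\<close> provides homotopy lifting, and the trivial centre makes the fibre group
  inject (\<open>fiber_null\<close>). Hence the order stays four when a line is forgotten
  (\<open>order_four_forget\<close>). If the remaining lines already rotate, then in the frame
  turning with them the last line describes a twisted path with null double and contracts to a fixed
  line (\<open>order_four_extend\<close>). With two lines the fibre is a circle up to homotopy, and
  a logarithm settles the case (\<open>order_four_base\<close>).

  A special configuration deforms to a model determined by its type: which line, if any, is
  vertical, and the cyclic order of the horizontal ones (\<open>special_has_type\<close>). Different
  types are not homotopic (\<open>types_distinct\<close>): the signs \<open>e\<close> reveal the
  vertical line, and the cyclic order of three horizontal lines is preserved, as is seen by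
  following a spinor of two lines and a nonvanishing complex function of three lines along the
  homotopy (\<open>rotloop_orientation\<close>, \<open>rotloop_cyclic\<close>). Since m lines have
  (m-1)! cyclic orders, there are n (n-2)! + (n-1)! types (\<open>card_types\<close>).\<close>

section \<open>Paths and twisted free homotopies\<close>

lemma homotopic_paths_image_convex:
 fixes f :: "'a::real_normed_vector => 'b::topological_space"
 assumes C: "convex C" and f: "continuous_on C f" "f \<in> C \<rightarrow> S"
  and g: "path g" "path_image g \<subseteq> C" and h: "path h" "path_image h \<subseteq> C"
  and "pathstart g = pathstart h" "pathfinish g = pathfinish h"
 shows "homotopic_paths S (f \<circ> g) (f \<circ> h)"
proof (rule homotopic_paths_continuous_image[OF _ f])
 show "homotopic_paths C g h"
 proof (rule homotopic_paths_linear)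
  fix t :: real assume "t \<in> {0..1}"
  then have "g t \<in> C" "h t \<in> C" using g h by (auto simp: path_image_def)
  then show "closed_segment (g t) (h t) \<subseteq> C" using C by (simp add: closed_segment_subset)
 qed (use assms in auto)
qed

text \<open>The straight homotopy between the two clocks \<open>f\<close> and \<open>g\<close> is
  carried over by \<open>P\<close>.\<close>

lemma homotopic_paths_by_reparam:
 fixes P :: "real => 'b::topological_space"
 assumes P: "continuous_on {a..b} P" "P \<in> {a..b} \<rightarrow> S"
  and f: "continuous_on {0..1} f" "f \<in> {0..1} \<rightarrow> {a..b}"
  and g: "continuous_on {0..1} g" "g \<in> {0..1} \<rightarrow> {a..b}"
  and "f 0 = g 0" "f 1 = g 1"
  and p: "!!t. t \<in> {0..1} ==> p t = P (f t)" and q: "!!t. t \<in> {0..1} ==> q t = P (g t)"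
 shows "homotopic_paths S p q"
proof -
 have *: "homotopic_paths S (P \<circ> f) (P \<circ> g)"
  by (rule homotopic_paths_image_convex[OF _ P])
    (use assms in "auto simp: path_def path_image_def pathstart_def pathfinish_def")
 note ** = homotopic_paths_imp_path[OF *] homotopic_paths_imp_subset[OF *]
 have "homotopic_paths S (P \<circ> f) p" "homotopic_paths S (P \<circ> g) q"
  by (rule homotopic_paths_eq; use ** p q in auto)+
 with * show ?thesis
  by (meson homotopic_paths_sym homotopic_paths_trans)
qed

text \<open>The boundary of a square read both ways. This is how a free homotopy becomes a
  commutation relation between loops.\<close>

lemma homotopic_square:
 assumes h: "continuous_on ({0..1::real} \<times> {0..1::real}) h" "h \<in> {0..1} \<times> {0..1} \<rightarrow> S"
 shows "homotopic_paths S ((%t. h (0, t)) +++ (%s. h (s, 1))) ((%s. h (s, 0)) +++ (%t. h (1, t)))"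
proof -
 let ?l = "linepath (0, 0) (0, 1) +++ linepath (0, 1) (1, 1) :: real => real \<times> real"
 let ?r = "linepath (0, 0) (1, 0) +++ linepath (1, 0) (1, 1) :: real => real \<times> real"
 have C: "convex ({0..1} \<times> {0..1::real} :: (real \<times> real) set)"
  by (intro convex_Times) auto
 have sub: "closed_segment a b \<subseteq> {0..1} \<times> {0..1::real}"
  if "a \<in> {0..1} \<times> {0..1::real}" "b \<in> {0..1} \<times> {0..1::real}" for a b :: "real \<times> real"
  using that C by (simp add: closed_segment_subset)
 have im: "path_image ?l \<subseteq> {0..1} \<times> {0..1}" "path_image ?r \<subseteq> {0..1} \<times> {0..1}"
  by ((intro subset_path_image_join)?; unfold path_image_linepath; rule sub; simp)+
 have *: "homotopic_paths S (h \<circ> ?l) (h \<circ> ?r)"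
  by (rule homotopic_paths_image_convex[OF C h]) (use im in auto)
 note ** = homotopic_paths_imp_path[OF *] homotopic_paths_imp_subset[OF *]
 have "homotopic_paths S (h \<circ> ?l) ((%t. h (0, t)) +++ (%s. h (s, 1)))"
    "homotopic_paths S (h \<circ> ?r) ((%s. h (s, 0)) +++ (%t. h (1, t)))"
  by (rule homotopic_paths_eq; use ** in "auto simp: joinpaths_def linepath_def")+
 with * show ?thesis
  by (meson homotopic_paths_sym homotopic_paths_trans)
qed

text \<open>When \<open>E\<close> is a deck transformation of a covering, the paths with
  \<open>r 1 = E (r 0)\<close> lift loops of the base, and this relation lifts their free homotopy.
  With \<open>E\<close> the identity it is \<open>homotopic_loops\<close>.\<close>

definition twisted_homotopic ::
  "('a::topological_space => 'a) => 'a set => (real => 'a) => (real => 'a) => bool" where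
 "twisted_homotopic E S p q \<longleftrightarrow> homotopic_with_canon (%r. r 1 = E (r 0)) {0..1} S p q"

lemma twisted_homotopic:
 "twisted_homotopic E S p q \<longleftrightarrow>
   (\<exists>h. continuous_on ({0..1::real} \<times> {0..1::real}) h \<and> h \<in> {0..1} \<times> {0..1} \<rightarrow> S \<and>
    (\<forall>t\<in>{0..1}. h (0, t) = p t) \<and> (\<forall>t\<in>{0..1}. h (1, t) = q t) \<and>
    (\<forall>s\<in>{0..1}. h (s, 1) = E (h (s, 0))))"
 unfolding twisted_homotopic_def by (subst homotopic_with) auto

lemma twisted_homotopicI:
 assumes "continuous_on ({0..1::real} \<times> {0..1::real}) (%z. h (fst z) (snd z))"
  and "!!s t. s \<in> {0..1} ==> t \<in> {0..1} ==> h s t \<in> S"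
  and "!!t. t \<in> {0..1} ==> h 0 t = p t" "!!t. t \<in> {0..1} ==> h 1 t = q t"
  and "!!s. s \<in> {0..1} ==> h s 1 = E (h s 0)"
 shows "twisted_homotopic E S p q"
 unfolding twisted_homotopic
 by (rule exI[of _ "%z. h (fst z) (snd z)"]) (use assms in auto)

lemma twisted_homotopicE:
 assumes "twisted_homotopic E S p q"
 obtains h where "continuous_on ({0..1::real} \<times> {0..1::real}) (%z. h (fst z) (snd z))"
  and "!!s t. s \<in> {0..1} ==> t \<in> {0..1} ==> h s t \<in> S"
  and "!!t. t \<in> {0..1} ==> h 0 t = p t" "!!t. t \<in> {0..1} ==> h 1 t = q t"
  and "!!s. s \<in> {0..1} ==> h s 1 = E (h s 0)"
proof -
 from assms obtain h where "continuous_on ({0..1::real} \<times> {0..1::real}) h" "h \<in> {0..1} \<times> {0..1} \<rightarrow> S"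
    "\<forall>t\<in>{0..1}. h (0, t) = p t" "\<forall>t\<in>{0..1}. h (1, t) = q t"
    "\<forall>s\<in>{0..1}. h (s, 1) = E (h (s, 0))"
  unfolding twisted_homotopic by blast
 then show thesis
  by (intro that[of "%s t. h (s, t)"]) (auto simp: Pi_iff)
qed

lemma twisted_homotopic_trans [trans]:
 "twisted_homotopic E S p q ==> twisted_homotopic E S q r ==> twisted_homotopic E S p r"
 unfolding twisted_homotopic_def by (rule homotopic_with_trans)

lemma twisted_homotopic_refl:
 "path p ==> path_image p \<subseteq> S ==> p 1 = E (p 0) ==> twisted_homotopic E S p p"
 unfolding twisted_homotopic_def by (auto simp: path_def path_image_def)

lemma twisted_homotopic_cong:
 assumes "twisted_homotopic E S p q" "!!t. t \<in> {0..1} ==> p t = p' t" "!!t. t \<in> {0..1} ==> q t = q' t"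
 shows "twisted_homotopic E S p' q'"
 using assms unfolding twisted_homotopic by (metis atLeastAtMost_iff)

lemma twisted_homotopic_id: "twisted_homotopic (%x. x) S p q \<longleftrightarrow> homotopic_loops S p q"
 by (simp add: twisted_homotopic_def homotopic_loops_def pathfinish_def pathstart_def)

lemma homotopic_paths_imp_twisted:
 assumes "homotopic_paths S p q" "p 1 = E (p 0)"
 shows "twisted_homotopic E S p q"
proof -
 from assms(1) obtain h where "continuous_on ({0..1::real} \<times> {0..1::real}) h" "h \<in> {0..1} \<times> {0..1} \<rightarrow> S"
   "\<forall>x\<in>{0..1}. h (0, x) = p x" "\<forall>x\<in>{0..1}. h (1, x) = q x"
   "\<forall>t\<in>{0..1}. h (t, 0) = p 0 \<and> h (t, 1) = p 1"
  unfolding homotopic_paths pathstart_def pathfinish_def o_def by blast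
 with assms(2) show ?thesis unfolding twisted_homotopic by (intro exI[of _ h]) auto
qed

lemma twisted_homotopicD:
 assumes "twisted_homotopic E S p q"
 shows "path p" "path q" "path_image p \<subseteq> S" "path_image q \<subseteq> S" "p 1 = E (p 0)" "q 1 = E (q 0)"
 using homotopic_with_imp_continuous[OF assms[unfolded twisted_homotopic_def]]
  homotopic_with_imp_property[OF assms[unfolded twisted_homotopic_def]]
  homotopic_with_imp_funspace1[OF assms[unfolded twisted_homotopic_def]]
  homotopic_with_imp_funspace2[OF assms[unfolded twisted_homotopic_def]]
 by (auto simp: path_def path_image_def)

text \<open>The start slides along \<open>k\<close> while the end follows along
  \<open>E \<circ> k\<close>; without a twist this conjugates the loop by \<open>k\<close>.\<close>

lemma twisted_homotopic_move:
 fixes p :: "real => 'a::topological_space"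
 assumes p: "path p" "path_image p \<subseteq> S" "p 1 = E (p 0)"
  and k: "path k" "path_image k \<subseteq> S" "k 0 = p 0"
  and E: "continuous_on S E" "E \<in> S \<rightarrow> S"
 obtains q where "twisted_homotopic E S p q" "q 0 = k 1"
  "E = (%x. x) ==> homotopic_paths S q (reversepath k +++ (p +++ k))"
proof -
 \<comment> \<open>\<open>P\<close> runs through \<open>k\<close> backwards, then \<open>p\<close>,
   then \<open>E \<circ> k\<close>, over the interval from -1 to 2; the homotopy widens the window
   from [0, 1] to [-1, 2].\<close>
 define P where "P x = (if x \<le> 0 then k (- x) else if x \<le> 1 then p x else E (k (x - 1)))" for x
 have P0: "P x = k (- x)" if "x \<le> 0" for x using that by (simp add: P_def)
 have P1: "P x = p x" if "0 \<le> x" "x \<le> 1" for x using that k by (auto simp: P_def)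
 have P2: "P x = E (k (x - 1))" if "1 \<le> x" for x using that k p by (auto simp: P_def)
 have cE: "continuous_on {1..2} (%x. E (k (x - 1)))"
  by (rule continuous_on_compose2[OF E(1)])
    (use k in "auto simp: path_def path_image_def intro!: continuous_intros continuous_on_compose2[OF k(1)[unfolded path_def]]")
 have c1: "continuous_on {-1..0} P" "continuous_on {0..1} P" "continuous_on {1..2} P"
  subgoal by (subst continuous_on_cong[OF refl, where g = "%x. k (- x)"])
     (auto simp: P0 intro!: continuous_intros continuous_on_compose2[OF k(1)[unfolded path_def]])
  subgoal by (subst continuous_on_cong[OF refl, where g = p]) (use p in "auto simp: P1 path_def")
  subgoal by (subst continuous_on_cong[OF refl P2]) (use cE in auto)
  done
 have "continuous_on ({-1..0} \<union> {0..1} \<union> {1..2}) P"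
  by (intro continuous_on_closed_Un c1 closed_Un) auto
 then have cP: "continuous_on {-1..2} P"
  by (rule continuous_on_subset) auto
 have PS: "P x \<in> S" if "x \<in> {-1..2}" for x
 proof -
  from that consider "x \<in> {-1..0}" | "x \<in> {0..1}" | "x \<in> {1..2}" by fastforce
  then show ?thesis
   using p k E by cases (auto simp: P0 P1 P2 path_image_def Pi_iff image_subset_iff)
 qed
 show thesis
 proof
  show "twisted_homotopic E S p (%t. P (3 * t - 1))"
  proof (rule twisted_homotopicI)
   have in12: "(1 + 2 * s) * t - s \<in> {-1..2}" if "s \<in> {0..1}" "t \<in> {0..1}" for s t :: real
   proof -
    define X where "X = (1 + 2 * s) * t"
    have "X \<le> (1 + 2 * s) * 1" "0 \<le> X"
     unfolding X_def using that by (auto intro!: mult_left_mono simp del: mult_1_right)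
    then show ?thesis unfolding X_def[symmetric] using that by simp
   qed
   show "continuous_on ({0..1::real} \<times> {0..1::real}) (%z. P ((1 + 2 * fst z) * snd z - fst z))"
    by (rule continuous_on_compose2[OF cP]) (use in12 in "auto intro!: continuous_intros")
   show "P ((1 + 2 * s) * t - s) \<in> S" if "s \<in> {0..1}" "t \<in> {0..1}" for s t :: real
    using PS in12 that by blast
   show "P ((1 + 2 * s) * 1 - s) = E (P ((1 + 2 * s) * 0 - s))" if "s \<in> {0..1}" for s
    using that by (simp add: P0 P2)
  qed (auto simp: P1 algebra_simps)
  show "P (3 * 0 - 1) = k 1" by (simp add: P0)
  assume Eid: "E = (%x. x)"
  let ?g = "%t. if t \<le> 1/2 then 2 * t - 1 else if t \<le> 3/4 then 4 * t - 2 else 4 * t - 2 :: real"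
  show "homotopic_paths S (%t. P (3 * t - 1)) (reversepath k +++ (p +++ k))"
  proof (rule homotopic_paths_by_reparam[OF cP, where f = "%t. 3 * t - 1" and g = ?g])
   show "continuous_on {0..1} ?g"
   proof -
    have "continuous_on ({..1/2} \<union> {1/2..}) (%t. if t \<le> 1/2 then 2 * t - 1 else 4 * t - 2 :: real)"
     by (intro continuous_on_If continuous_intros) auto
    then show ?thesis by (rule continuous_on_subset[OF continuous_on_eq]) auto
   qed
   fix t :: real assume t: "t \<in> {0..1}"
   show "(reversepath k +++ (p +++ k)) t = P (?g t)"
   proof (cases "t \<le> 1/2")
    case True then show ?thesis using t by (simp add: joinpaths_def reversepath_def P0 algebra_simps)
   next
    case F: False
    show ?thesis
    proof (cases "t \<le> 3/4")
     case True then show ?thesis using t F by (simp add: joinpaths_def P1 algebra_simps)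
    next
     case False then show ?thesis using t F by (simp add: joinpaths_def P2 algebra_simps Eid)
    qed
   qed
  qed (use PS in "auto intro!: continuous_intros")
 qed
qed

text \<open>Cutting the annulus along the track of the base point, \<open>p\<close> is homotopic to
  this track followed by a constant path and the same track backwards.\<close>

lemma homotopic_loops_const_imp_homotopic_paths:
 fixes p :: "real => 'a::topological_space"
 assumes "homotopic_loops S p (%_. a)"
 shows "homotopic_paths S p (%_. pathstart p)"
proof -
 from assms[folded twisted_homotopic_id] obtain h where
  h: "continuous_on ({0..1::real} \<times> {0..1::real}) (%z. h (fst z) (snd z))"
   "!!s t. s \<in> {0..1} ==> t \<in> {0..1} ==> h s t \<in> S"
   "!!t. t \<in> {0..1} ==> h 0 t = p t" "!!t. t \<in> {0..1} ==> h 1 t = a"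
   "!!s. s \<in> {0..1} ==> h s 1 = h s 0"
  by (rule twisted_homotopicE) blast
 let ?C = "{0..1} \<times> {0..1::real} :: (real \<times> real) set"
 have C: "convex ?C" by (intro convex_Times) auto
 define H where "H z = h (fst z) (snd z)" for z
 have H: "continuous_on ?C H" "H \<in> ?C \<rightarrow> S" using h unfolding H_def by auto
 let ?r = "linepath (0, 0) (1, 0) +++ (linepath (1, 0) (1, 1) +++ linepath (1, 1) (0, 1)) :: real => real \<times> real"
 let ?s = "linepath (0, 0) (1, 0) +++ (linepath (1, 0) (1, 0) +++ linepath (1, 0) (0, 0)) :: real => real \<times> real"
 have sub: "closed_segment a b \<subseteq> ?C" if "a \<in> ?C" "b \<in> ?C" for a b
  using that C by (simp add: closed_segment_subset)
 have im: "path_image (linepath (0, 0) (0, 1)) \<subseteq> ?C" "path_image ?r \<subseteq> ?C" "path_image ?s \<subseteq> ?C"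
  "path_image (linepath (0, 0) (0, 0)) \<subseteq> ?C"
  by ((intro subset_path_image_join)?; unfold path_image_linepath; rule sub; simp)+
 have 1: "homotopic_paths S (H \<circ> linepath (0, 0) (0, 1)) (H \<circ> ?r)"
  by (rule homotopic_paths_image_convex[OF C H]) (use im in auto)
 have 3: "homotopic_paths S (H \<circ> ?s) (H \<circ> linepath (0, 0) (0, 0))"
  by (rule homotopic_paths_image_convex[OF C H]) (use im in auto)
 have e: "H (?r t) = H (?s t)" if "t \<in> {0..1}" for t
  using that h(4,5) by (auto simp: joinpaths_def linepath_def H_def)
 have 2: "homotopic_paths S (H \<circ> ?r) (H \<circ> ?s)"
  using 1 e by (intro homotopic_paths_eq) (auto dest: homotopic_paths_imp_path homotopic_paths_imp_subset)
 have 0: "homotopic_paths S (H \<circ> linepath (0, 0) (0, 1)) p"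
  using 1 h(3) by (intro homotopic_paths_eq)
   (auto simp: linepath_def H_def dest: homotopic_paths_imp_path homotopic_paths_imp_subset)
 have 4: "homotopic_paths S (H \<circ> linepath (0, 0) (0, 0)) (%_. pathstart p)"
  using 3 h(3) by (intro homotopic_paths_eq)
   (auto simp: linepath_def H_def pathstart_def dest: homotopic_paths_imp_path homotopic_paths_imp_subset)
 show ?thesis using 0 1 2 3 4 by (meson homotopic_paths_sym homotopic_paths_trans)
qed

lemma null_loop_iff:
 fixes p :: "real => 'a::topological_space"
 shows "(\<exists>a. homotopic_loops S p (%_. a)) \<longleftrightarrow> homotopic_paths S p (%_. pathstart p)"
proof
 assume "homotopic_paths S p (%_. pathstart p)"
 then have "homotopic_loops S p (%_. pathstart p)"
  by (intro homotopic_paths_imp_homotopic_loops)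
    (auto dest: homotopic_paths_imp_pathfinish simp: pathfinish_def)
 then show "\<exists>a. homotopic_loops S p (%_. a)" by blast
qed (use homotopic_loops_const_imp_homotopic_paths in blast)

text \<open>A homotopy of paths fixes the endpoints, so a null \<open>p\<close> is automatically
  closed.\<close>

definition null_loop :: "'a::topological_space set => (real => 'a) => bool" where
 "null_loop S p \<longleftrightarrow> homotopic_paths S p (%_. pathstart p)"

lemma null_loop_homotopic:
 assumes "homotopic_loops S p q" shows "null_loop S p \<longleftrightarrow> null_loop S q"
 unfolding null_loop_def null_loop_iff[symmetric]
 using assms by (meson homotopic_loops_sym homotopic_loops_trans)

lemma null_loop_homotopic_paths:
 assumes "homotopic_paths S p q" shows "null_loop S p \<longleftrightarrow> null_loop S q"
 using assms unfolding null_loop_def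
 by (metis homotopic_paths_imp_pathstart homotopic_paths_sym homotopic_paths_trans)

lemma null_loop_subset: "null_loop S p ==> S \<subseteq> T ==> null_loop T p"
 unfolding null_loop_def by (rule homotopic_paths_subset)

text \<open>If \<open>p\<close> lifts a loop and \<open>p 1 = E (p 0)\<close>, this path lifts the
  square of that loop; it closes up when \<open>E\<close> is an involution.\<close>

definition twice :: "('a::topological_space => 'a) => (real => 'a) => real => 'a" where
 "twice E p = p +++ (E \<circ> p)"

lemma twisted_homotopic_twice:
 assumes tw: "twisted_homotopic E S p q" and E: "continuous_on S E" "E \<in> S \<rightarrow> S" "!!x. x \<in> S ==> E (E x) = x"
 shows "homotopic_loops S (twice E p) (twice E q)"
proof -
 from tw obtain h where
  h: "continuous_on ({0..1::real} \<times> {0..1::real}) (%z. h (fst z) (snd z))"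
   "!!s t. s \<in> {0..1} ==> t \<in> {0..1} ==> h s t \<in> S"
   "!!t. t \<in> {0..1} ==> h 0 t = p t" "!!t. t \<in> {0..1} ==> h 1 t = q t"
   "!!s. s \<in> {0..1} ==> h s 1 = E (h s 0)"
  by (rule twisted_homotopicE) blast
 show ?thesis
  unfolding twisted_homotopic_id[symmetric]
 proof (rule twisted_homotopicI)
  show "continuous_on ({0..1::real} \<times> {0..1::real}) (%z. (h (fst z) +++ (E \<circ> h (fst z))) (snd z))"
   by (rule continuous_on_homotopic_join_lemma)
     (use h in "auto simp: pathfinish_def pathstart_def intro!: continuous_on_compose2[OF E(1)]")
  show "(h s +++ (E \<circ> h s)) t \<in> S" if "s \<in> {0..1}" "t \<in> {0..1}" for s t
   using that h(2) E(2) by (auto simp: joinpaths_def Pi_iff)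
  show "(h s +++ (E \<circ> h s)) 1 = (h s +++ (E \<circ> h s)) 0" if "s \<in> {0..1}" for s
   using that h(2,5) E(3) by (auto simp: joinpaths_def)
 qed (use h in "auto simp: twice_def joinpaths_def")
qed

lemma homotopic_loops_join:
 assumes "homotopic_loops S p q"
 shows "homotopic_loops S (p +++ p) (q +++ q)"
 using twisted_homotopic_twice[of "%x. x" S p q] assms
 by (simp add: twisted_homotopic_id twice_def o_def continuous_on_id)

section \<open>Lines as vectors, and a substitute for isotopy extension\<close>

section \<open>Configurations of lines and their transport\<close>

text \<open>A vector stands for the line it spans, so this lies over the configuration space of the
  projective plane, with sign changes and rescalings as the ambiguity. Entries from \<open>n\<close>
  on are unconstrained, so that forgetting the last line is the inclusion of
  \<open>conf (Suc n)\<close> in \<open>conf n\<close>.\<close>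

definition conf :: "nat => (nat => real ^ 3) set" where
 "conf n = {x. (\<forall>i<n. x i ~= 0) \<and> (\<forall>i<n. \<forall>j<n. i ~= j --> cross3 (x i) (x j) ~= 0)}"

text \<open>The possible values of entry \<open>n\<close> over a given \<open>c\<close>, that is,
  the fibre of the map forgetting that line.\<close>

definition off_lines :: "nat => (nat => real ^ 3) => (real ^ 3) set" where
 "off_lines n c = {x. \<forall>i<n. cross3 (c i) x ~= 0}"

lemma cross3_eq_0_iff_scaleR:
 assumes "a ~= 0" shows "cross3 a x = 0 \<longleftrightarrow> (\<exists>l. x = l *\<^sub>R a)"
 using assms by (auto simp: cross_eq_0 collinear_lemma cross_mult_right)

lemma off_linesI: "(!!i. i < n ==> cross3 (c i) x ~= 0) ==> x \<in> off_lines n c"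
 and off_linesD: "x \<in> off_lines n c ==> i < n ==> cross3 (c i) x ~= 0"
 by (auto simp: off_lines_def)

lemma conf_Suc_iff:
 assumes "1 \<le> n" shows "x \<in> conf (Suc n) \<longleftrightarrow> x \<in> conf n \<and> x n \<in> off_lines n x"
proof -
 have "cross3 (x n) (x i) = - cross3 (x i) (x n)" for i by (rule cross_skew)
 moreover have "x n ~= 0" if "x n \<in> off_lines n x"
  using off_linesD[OF that, of 0] assms by auto
 ultimately show ?thesis
  by (auto simp: conf_def off_lines_def less_Suc_eq)
qed

lemma conf_subset: "m \<le> n ==> conf n \<subseteq> conf m"
 unfolding conf_def by fastforce

text \<open>The coordinate of \<open>x\<close> along \<open>c\<close>, pulled towards 0 by
  \<open>A\<close> times the norm of \<open>cross3 c x\<close> and cut off there. It is 1 at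
  \<open>c\<close>, vanishes outside a double cone around the line, and is homogeneous also for
  negative factors.\<close>

definition line_coord :: "real => real ^ 3 => real ^ 3 => real" where
 "line_coord A c x = max 0 ((x \<bullet> c) / (c \<bullet> c) - A * norm (cross3 c x)) + min 0 ((x \<bullet> c) / (c \<bullet> c) + A * norm (cross3 c x))"

lemma line_coord_scaleR: "line_coord A c (l *\<^sub>R x) = l * line_coord A c x"
proof -
 define u where "u = (x \<bullet> c) / (c \<bullet> c)"
 define w where "w = A * norm (cross3 c x)"
 have 1: "((l *\<^sub>R x) \<bullet> c) / (c \<bullet> c) = l * u" by (simp add: u_def)
 have 2: "A * norm (cross3 c (l *\<^sub>R x)) = \<bar>l\<bar> * w" by (simp add: w_def cross_mult_right)
 have "max 0 (l * u - \<bar>l\<bar> * w) + min 0 (l * u + \<bar>l\<bar> * w) = l * (max 0 (u - w) + min 0 (u + w))"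
 proof (cases "0 \<le> l")
  case True
  then have "l * max 0 (u - w) = max (l * 0) (l * (u - w))" "l * min 0 (u + w) = min (l * 0) (l * (u + w))"
   by (simp_all add: max_mult_distrib_left min_mult_distrib_left)
  then show ?thesis using True by (simp add: algebra_simps)
 next
  case False
  then have "l * max 0 (u - w) = min (l * 0) (l * (u - w))" "l * min 0 (u + w) = max (l * 0) (l * (u + w))"
   by (simp_all add: max_mult_distrib_left min_mult_distrib_left)
  then show ?thesis using False by (simp add: algebra_simps)
 qed
 then show ?thesis unfolding line_coord_def 1 2 by (simp add: u_def w_def)
qed

lemma line_coord_self: "c ~= 0 ==> line_coord A c c = 1"
 by (simp add: line_coord_def)

lemma line_coord_zero:
 assumes "\<bar>x \<bullet> c\<bar> / (c \<bullet> c) \<le> A * norm (cross3 c x)"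
 shows "line_coord A c x = 0"
proof -
 have "\<bar>(x \<bullet> c) / (c \<bullet> c)\<bar> \<le> A * norm (cross3 c x)" using assms by simp
 then show ?thesis unfolding line_coord_def by linarith
qed

lemma line_coord_lipschitz:
 assumes "0 \<le> A" "c ~= 0"
 shows "\<bar>line_coord A c x - line_coord A c y\<bar> \<le> 2 * (1 / norm c + A * norm c) * norm (x - y)"
proof -
 define u where "u x = (x \<bullet> c) / (c \<bullet> c)" for x
 define w where "w x = A * norm (cross3 c x)" for x
 have "u x - u y = ((x - y) \<bullet> c) / (c \<bullet> c)"
  by (simp add: u_def inner_diff_left diff_divide_distrib)
 then have "\<bar>u x - u y\<bar> \<le> (norm (x - y) * norm c) / (c \<bullet> c)"
  using Cauchy_Schwarz_ineq2[of "x - y" c] by (simp add: divide_right_mono)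
 also have "\<dots> = norm (x - y) / norm c"
  using assms by (simp add: dot_square_norm power2_eq_square field_simps)
 finally have 1: "\<bar>u x - u y\<bar> \<le> norm (x - y) / norm c" .
 have "norm (cross3 c z) \<le> norm c * norm z" for z
 proof -
  have "(norm (cross3 c z))\<^sup>2 \<le> (norm c * norm z)\<^sup>2"
   unfolding norm_cross power_mult_distrib by simp
  then show ?thesis by (rule power2_le_imp_le) auto
 qed
 moreover have "\<bar>norm (cross3 c x) - norm (cross3 c y)\<bar> \<le> norm (cross3 c (x - y))"
  by (metis norm_triangle_ineq3 right_diff_distrib cross_minus_right cross_add_right diff_conv_add_uminus)
 ultimately have "\<bar>norm (cross3 c x) - norm (cross3 c y)\<bar> \<le> norm c * norm (x - y)"
  by (meson order_trans)
 then have "A * \<bar>norm (cross3 c x) - norm (cross3 c y)\<bar> \<le> A * (norm c * norm (x - y))"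
  using assms by (intro mult_left_mono) auto
 then have 2: "\<bar>w x - w y\<bar> \<le> A * norm c * norm (x - y)"
  using assms by (simp add: w_def abs_mult flip: right_diff_distrib)
 have "\<bar>line_coord A c x - line_coord A c y\<bar> \<le> 2 * (\<bar>u x - u y\<bar> + \<bar>w x - w y\<bar>)"
 proof -
  have "\<bar>max 0 a - max 0 b\<bar> \<le> \<bar>a - b\<bar>" "\<bar>min 0 a - min 0 b\<bar> \<le> \<bar>a - b\<bar>" for a b :: real
   by (auto simp: max_def min_def)
  note m = this(1)[of "u x - w x" "u y - w y"] this(2)[of "u x + w x" "u y + w y"]
  have "line_coord A c x - line_coord A c y =
    (max 0 (u x - w x) - max 0 (u y - w y)) + (min 0 (u x + w x) - min 0 (u y + w y))"
   unfolding line_coord_def u_def w_def by simp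
  moreover have "\<bar>(u x - w x) - (u y - w y)\<bar> \<le> \<bar>u x - u y\<bar> + \<bar>w x - w y\<bar>"
   "\<bar>(u x + w x) - (u y + w y)\<bar> \<le> \<bar>u x - u y\<bar> + \<bar>w x - w y\<bar>" by linarith+
  moreover have "d = a + b ==> \<bar>a\<bar> \<le> s ==> \<bar>b\<bar> \<le> s ==> \<bar>d\<bar> \<le> 2 * s" for d a b s :: real
   by linarith
  ultimately show ?thesis using m by (meson order_trans)
 qed
 also have "\<dots> \<le> 2 * (norm (x - y) / norm c + A * norm c * norm (x - y))"
  using 1 2 by (intro mult_left_mono add_mono) auto
 also have "\<dots> = 2 * (1 / norm c + A * norm c) * norm (x - y)"
  by (simp only: ring_distribs divide_inverse mult_1 mult.assoc mult.left_commute[of 2] mult.commute[of "norm (x - y)"])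
 finally show ?thesis .
qed

text \<open>Adds a displacement that is meant to take \<open>c i\<close> to \<open>c' i\<close> and
  lives in double cones around the lines, narrow for large \<open>A\<close>.\<close>

definition push :: "real => nat => (nat => real ^ 3) => (nat => real ^ 3) => real ^ 3 => real ^ 3" where
 "push A n c c' x = x + (\<Sum>i<n. line_coord A (c i) x *\<^sub>R (c' i - c i))"

lemma push_scaleR: "push A n c c' (l *\<^sub>R x) = l *\<^sub>R push A n c c' x"
 by (simp add: push_def line_coord_scaleR scaleR_right_distrib scaleR_right.sum)

lemma push_same: "(!!i. i < n ==> c' i = c i) ==> push A n c c' x = x"
 by (simp add: push_def)

lemma push_sign:
 assumes "!!i. i < n ==> (e i = 1 \<or> e i = - 1) \<and> d i = e i *\<^sub>R c i \<and> d' i = e i *\<^sub>R c' i"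
 shows "push A n d d' x = push A n c c' x"
proof -
 have "line_coord A (d i) x *\<^sub>R (d' i - d i) = line_coord A (c i) x *\<^sub>R (c' i - c i)" if "i < n" for i
 proof -
  have "max 0 (- u - w) + min 0 (- u + w) = - (max 0 (u - w) + min 0 (u + w))" for u w :: real
   by (auto simp: max_def min_def)
  from this[of "(x \<bullet> c i) / (c i \<bullet> c i)" "A * norm (cross3 (c i) x)"]
  have "line_coord A (- c i) x = - line_coord A (c i) x"
   unfolding line_coord_def by simp
  then show ?thesis using assms[OF that] by (auto simp: algebra_simps)
 qed
 then show ?thesis unfolding push_def by simp
qed

text \<open>A map that differs from the identity by a contraction is injective. As it takes each
  line \<open>c i\<close> onto the line \<open>c' i\<close>, injectivity keeps all other points off
  the new lines.\<close>

lemma push_avoids: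
 assumes A: "0 \<le> A" and c: "!!i. i < n ==> c i ~= 0 \<and> c' i ~= 0"
  and sep: "!!i j. i < n ==> j < n ==> i ~= j ==> \<bar>c j \<bullet> c i\<bar> / (c i \<bullet> c i) \<le> A * norm (cross3 (c i) (c j))"
  and small: "(\<Sum>i<n. 2 * (1 / norm (c i) + A * norm (c i)) * norm (c' i - c i)) < 1"
  and x: "x \<in> off_lines n c"
 shows "push A n c c' x \<in> off_lines n c'"
proof (rule off_linesI)
 \<comment> \<open>By \<open>sep\<close> each \<open>c j\<close> lies outside the cones of the other
   lines, so only its own summand acts on it.\<close>
 have pc: "push A n c c' (c j) = c' j" if "j < n" for j
 proof -
  have "line_coord A (c i) (c j) *\<^sub>R (c' i - c i) = (if i = j then c' j - c j else 0)" if "i < n" for i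
  proof (cases "i = j")
   case True then show ?thesis using line_coord_self c[OF that] by simp
  next
   case False then show ?thesis using line_coord_zero[OF sep[OF that \<open>j < n\<close>]] by simp
  qed
  then have "(\<Sum>i<n. line_coord A (c i) (c j) *\<^sub>R (c' i - c i)) = (\<Sum>i<n. if i = j then c' j - c j else 0)"
   by (intro sum.cong) auto
  also have "\<dots> = c' j - c j" using that by simp
  finally show ?thesis by (simp add: push_def)
 qed
 \<comment> \<open>\<open>small\<close> bounds the Lipschitz constant of the displacement by a
   number below 1.\<close>
 have inj: "x = y" if "push A n c c' x = push A n c c' y" for x y
 proof (rule ccontr)
  let ?h = "%x. \<Sum>i<n. line_coord A (c i) x *\<^sub>R (c' i - c i)"
  assume "x ~= y"
  have "x - y = ?h y - ?h x" using that by (simp add: push_def algebra_simps)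
  also have "\<dots> = (\<Sum>i<n. (line_coord A (c i) y - line_coord A (c i) x) *\<^sub>R (c' i - c i))"
   by (simp only: scaleR_left_diff_distrib sum_subtractf)
  finally have "norm (x - y) \<le> (\<Sum>i<n. norm ((line_coord A (c i) y - line_coord A (c i) x) *\<^sub>R (c' i - c i)))"
   by (simp only: norm_sum)
  also have "\<dots> \<le> (\<Sum>i<n. (2 * (1 / norm (c i) + A * norm (c i)) * norm (x - y)) * norm (c' i - c i))"
   unfolding norm_scaleR
   by (intro sum_mono mult_right_mono)
     (use line_coord_lipschitz[OF A] c in "auto simp: abs_minus_commute")
  also have "\<dots> = (\<Sum>i<n. 2 * (1 / norm (c i) + A * norm (c i)) * norm (c' i - c i)) * norm (x - y)"
   by (simp only: sum_distrib_right mult.assoc mult.commute[of "norm (x - y)"])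
  also have "\<dots> < 1 * norm (x - y)"
   using small \<open>x ~= y\<close> by (intro mult_strict_right_mono) auto
  finally show False by simp
 qed
 fix i assume i: "i < n"
 show "cross3 (c' i) (push A n c c' x) ~= 0"
 proof
  assume "cross3 (c' i) (push A n c c' x) = 0"
  then obtain l where "push A n c c' x = l *\<^sub>R c' i"
   using c[OF i] cross3_eq_0_iff_scaleR by blast
  then have "push A n c c' x = push A n c c' (l *\<^sub>R c i)"
   by (simp add: push_scaleR pc i)
  then have "x = l *\<^sub>R c i" by (rule inj)
  then show False using off_linesD[OF x i] by (simp add: cross_mult_right)
 qed
qed

lemma continuous_on_push:
 fixes f :: "'a::t2_space => real ^ 3"
 assumes "!!i. i < n ==> continuous_on X (%z. c z i)" "!!i. i < n ==> continuous_on X (%z. c' z i)"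
  and "continuous_on X f" and "!!z i. z \<in> X ==> i < n ==> c z i ~= 0"
 shows "continuous_on X (%z. push A n (c z) (c' z) (f z))"
 unfolding push_def line_coord_def
 by (intro continuous_intros continuous_on_max continuous_on_min continuous_on_cross assms)
   (use assms in auto)

primrec transport_steps ::
  "real => nat => (nat => nat => real ^ 3) => nat => real ^ 3 => real ^ 3" where
 "transport_steps A n c 0 x = x"
| "transport_steps A n c (Suc k) x = push A n (c k) (c (Suc k)) (transport_steps A n c k x)"

lemma transport_steps_scaleR: "transport_steps A n c k (l *\<^sub>R x) = l *\<^sub>R transport_steps A n c k x"
 by (induction k) (simp_all add: push_scaleR)

lemma transport_steps_same:
 assumes "!!k i. i < n ==> c k i = c 0 i" shows "transport_steps A n c k x = x"
proof (induction k)
 case (Suc k)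
 have "push A n (c k) (c (Suc k)) x = x"
  by (rule push_same) (metis assms)
 then show ?case using Suc by simp
qed simp

lemma transport_steps_sign:
 assumes "!!k i. i < n ==> (e i = 1 \<or> e i = - 1) \<and> d k i = e i *\<^sub>R c k i"
 shows "transport_steps A n d k x = transport_steps A n c k x"
proof (induction k)
 case (Suc k)
 have "push A n (d k) (d (Suc k)) y = push A n (c k) (c (Suc k)) y" for y
  by (rule push_sign[where e = e]) (use assms in blast)
 then show ?case using Suc by simp
qed simp

text \<open>Plays the role of homotopy lifting for the map forgetting a line: a motion of the lines
  is cut into steps short enough for \<open>push_avoids\<close>, with constants uniform by
  compactness of \<open>Z\<close>. The further conclusions (no motion where the lines rest,
  dependence on the vectors only up to sign, homogeneity) are what lets lifted homotopies respect
  base points and sign twists.\<close>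

theorem transport:
 fixes h :: "real => 'z::metric_space => nat => real ^ 3"
 assumes Z: "compact Z"
  and h: "!!i. i < n ==> continuous_on ({0..1} \<times> Z) (%z. h (fst z) (snd z) i)"
  and hc: "!!s z. s \<in> {0..1} ==> z \<in> Z ==> h s z \<in> conf n"
 obtains T :: "real => 'z => real ^ 3 => real ^ 3"
 where "continuous_on ({0..1} \<times> Z \<times> UNIV) (%(s, z, x). T s z x)"
  and "!!z x. z \<in> Z ==> T 0 z x = x"
  and "!!s z x. s \<in> {0..1} ==> z \<in> Z ==> x \<in> off_lines n (h 0 z) ==> T s z x \<in> off_lines n (h s z)"
  and "!!s z x. s \<in> {0..1} ==> z \<in> Z ==> (!!s i. s \<in> {0..1} ==> i < n ==> h s z i = h 0 z i) ==> T s z x = x"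
  and "!!s z z' e x. s \<in> {0..1} ==> z \<in> Z ==> z' \<in> Z ==>
      (!!s i. s \<in> {0..1} ==> i < n ==> (e i = 1 \<or> e i = - 1) \<and> h s z' i = e i *\<^sub>R h s z i) ==> T s z' x = T s z x"
  and "!!s z l x. T s z (l *\<^sub>R x) = l *\<^sub>R T s z x"
proof -
 let ?X = "{0..1::real} \<times> Z"
 have X: "compact ?X" using Z by (intro compact_Times) auto
 have nz: "h s z i ~= 0" if "s \<in> {0..1}" "z \<in> Z" "i < n" for s z i
  using hc[OF that(1,2)] that(3) by (auto simp: conf_def)
 have nx: "cross3 (h s z i) (h s z j) ~= 0" if "s \<in> {0..1}" "z \<in> Z" "i < n" "j < n" "i ~= j" for s z i j
  using hc[OF that(1,2)] that(3-) by (auto simp: conf_def)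
 have bdd: "\<exists>B\<ge>0. \<forall>z\<in>?X. f z \<le> B" if "continuous_on ?X f" for f :: "real \<times> 'z => real"
 proof -
  have "bounded (f ` ?X)" using compact_continuous_image[OF that X] compact_imp_bounded by blast
  then obtain B where B: "B > 0" "!!x. x \<in> f ` ?X ==> norm x \<le> B" unfolding bounded_pos by blast
  have "f z \<le> B" if "z \<in> ?X" for z
   using B(2)[OF imageI[OF that]] by simp
  with B(1) show ?thesis by (intro exI[of _ B]) simp
 qed
 define r where "r i j z = \<bar>h (fst z) (snd z) j \<bullet> h (fst z) (snd z) i\<bar> / (h (fst z) (snd z) i \<bullet> h (fst z) (snd z) i)
   / norm (cross3 (h (fst z) (snd z) i) (h (fst z) (snd z) j))" for i j and z :: "real \<times> 'z"
 have "\<exists>B\<ge>0. \<forall>z\<in>?X. r i j z \<le> B" if "i < n" "j < n" "i ~= j" for i j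
 proof (rule bdd)
  show "continuous_on ?X (r i j)"
   unfolding r_def
   by (intro continuous_on_divide continuous_on_rabs continuous_on_inner continuous_on_norm continuous_on_cross h that)
     (use nz nx that in auto)
 qed
 then have "\<forall>i j. \<exists>B. i < n --> j < n --> i ~= j --> 0 \<le> B \<and> (\<forall>z\<in>?X. r i j z \<le> B)"
  by blast
 then obtain B where B: "!!i j. i < n ==> j < n ==> i ~= j ==> 0 \<le> B i j \<and> (\<forall>z\<in>?X. r i j z \<le> B i j)"
  unfolding choice_iff by blast
 \<comment> \<open>Large enough that every line avoids the cones around the others, at all
   parameters at once.\<close>
 define A where "A = (\<Sum>i<n. \<Sum>j<n. \<bar>B i j\<bar>)"
 have A0: "0 \<le> A" unfolding A_def by (intro sum_nonneg) auto
 have BA: "B i j \<le> A" if "i < n" "j < n" for i j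
 proof -
  have "B i j \<le> \<bar>B i j\<bar>" by simp
  also have "\<dots> \<le> (\<Sum>j<n. \<bar>B i j\<bar>)"
   by (rule member_le_sum[of j "{..<n}" "%j. \<bar>B i j\<bar>"]) (use that in auto)
  also have "\<dots> \<le> A" unfolding A_def
   by (rule member_le_sum[of i "{..<n}" "%i. \<Sum>j<n. \<bar>B i j\<bar>"]) (use that in "auto intro!: sum_nonneg")
  finally show ?thesis .
 qed
 have sep: "\<bar>h s z j \<bullet> h s z i\<bar> / (h s z i \<bullet> h s z i) \<le> A * norm (cross3 (h s z i) (h s z j))"
  if "s \<in> {0..1}" "z \<in> Z" "i < n" "j < n" "i ~= j" for s z i j
 proof -
  have "r i j (s, z) \<le> A" using B[OF that(3-5)] BA[OF that(3,4)] that(1,2) by force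
  moreover have "norm (cross3 (h s z i) (h s z j)) > 0" using nx that by auto
  ultimately show ?thesis unfolding r_def by (simp only: pos_divide_le_eq fst_conv snd_conv)
 qed
 have "\<exists>K\<ge>0. \<forall>z\<in>?X. 2 * (1 / norm (h (fst z) (snd z) i) + A * norm (h (fst z) (snd z) i)) \<le> K" if "i < n" for i
 proof (rule bdd)
  have "continuous_on ?X (%z. norm (h (fst z) (snd z) i))" by (intro continuous_on_norm h that)
  moreover from this have "continuous_on ?X (%z. 1 / norm (h (fst z) (snd z) i))"
   by (intro continuous_on_divide continuous_on_const) (use nz that in auto)
  ultimately show "continuous_on ?X (%z. 2 * (1 / norm (h (fst z) (snd z) i) + A * norm (h (fst z) (snd z) i)))"
   by (intro continuous_on_mult continuous_on_add continuous_on_const)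
 qed
 then have "\<forall>i. \<exists>K. i < n --> K \<ge> 0 \<and> (\<forall>z\<in>?X. 2 * (1 / norm (h (fst z) (snd z) i) + A * norm (h (fst z) (snd z) i)) \<le> K)"
  by blast
 then obtain K where K: "!!i. i < n ==> K i \<ge> 0 \<and> (\<forall>z\<in>?X. 2 * (1 / norm (h (fst z) (snd z) i) + A * norm (h (fst z) (snd z) i)) \<le> K i)"
  unfolding choice_iff by blast
 define L where "L = 1 + (\<Sum>i<n. K i)"
 have L0: "L > 0" unfolding L_def using K by (intro add_pos_nonneg sum_nonneg) auto
 have KL: "K i \<le> L" if "i < n" for i
 proof -
  have "K i \<le> (\<Sum>i<n. K i)" by (rule member_le_sum) (use that K in auto)
  then show ?thesis by (simp add: L_def)
 qed
 \<comment> \<open>If a step moves each line by at most \<open>eps\<close>, the sum in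
   \<open>push_avoids\<close> is at most n/(2(n+1)).\<close>
 define eps where "eps = 1 / (2 * L * (1 + real n))"
 have eps0: "eps > 0" using L0 by (simp add: eps_def)
 have "\<exists>d>0. \<forall>z\<in>?X. \<forall>z'\<in>?X. dist z' z < d --> dist (h (fst z') (snd z') i) (h (fst z) (snd z) i) < eps" if "i < n" for i
  using compact_uniformly_continuous[OF h[OF that] X] eps0 unfolding uniformly_continuous_on_def by blast
 then have "\<forall>i. \<exists>d. i < n --> d > 0 \<and> (\<forall>z\<in>?X. \<forall>z'\<in>?X. dist z' z < d --> dist (h (fst z') (snd z') i) (h (fst z) (snd z) i) < eps)"
  by blast
 then obtain d where d: "!!i. i < n ==> d i > 0 \<and> (\<forall>z\<in>?X. \<forall>z'\<in>?X. dist z' z < d i --> dist (h (fst z') (snd z') i) (h (fst z) (snd z) i) < eps)"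
  unfolding choice_iff by blast
 define dd where "dd = Min (insert 1 (d ` {..<n}))"
 have dd0: "dd > 0" unfolding dd_def using d by (subst Min_gr_iff) auto
 have ddd: "dd \<le> d i" if "i < n" for i unfolding dd_def using that by (intro Min_le) auto
 obtain N where N: "1 / dd < real N" using reals_Archimedean2 by blast
 have "0 < 1 / dd" using dd0 by simp
 then have N0: "N > 0" using N by (metis of_nat_0_less_iff order_less_trans)
 have N1: "1 / real N < dd" using N dd0 N0 by (simp add: field_simps)
 \<comment> \<open>The clock stops at \<open>s\<close>, so the same number \<open>N\<close> of steps
   serves every \<open>s\<close>, idle steps being identities.\<close>
 define p where "p s k = min s (real k / real N)" for s k
 have p01: "p s k \<in> {0..1}" if "s \<in> {0..1}" for s k using that by (auto simp: p_def)
 have pd: "\<bar>p s (Suc k) - p s k\<bar> < dd" if "s \<in> {0..1}" for s k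
 proof -
  have "\<bar>min s (a + b) - min s a\<bar> \<le> b" if "0 \<le> b" for a b :: real
   using that by (auto simp: min_def)
  from this[of "1 / real N" "real k / real N"]
  have "\<bar>p s (Suc k) - p s k\<bar> \<le> 1 / real N"
   unfolding p_def by (simp add: add_divide_distrib add.commute)
  then show ?thesis using N1 by simp
 qed
 define T where "T s z x = transport_steps A n (%k. h (p s k) z) N x" for s z x
 have step: "push A n (h (p s k) z) (h (p s (Suc k)) z) x \<in> off_lines n (h (p s (Suc k)) z)"
  if s: "s \<in> {0..1}" and z: "z \<in> Z" and x: "x \<in> off_lines n (h (p s k) z)" for s z k x
 proof (rule push_avoids[OF A0])
  show "h (p s k) z i ~= 0 \<and> h (p s (Suc k)) z i ~= 0" if "i < n" for i using nz p01 s z that by blast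
  show "\<bar>h (p s k) z j \<bullet> h (p s k) z i\<bar> / (h (p s k) z i \<bullet> h (p s k) z i) \<le> A * norm (cross3 (h (p s k) z i) (h (p s k) z j))"
   if "i < n" "j < n" "i ~= j" for i j using sep p01 s z that by blast
  have "(\<Sum>i<n. 2 * (1 / norm (h (p s k) z i) + A * norm (h (p s k) z i)) * norm (h (p s (Suc k)) z i - h (p s k) z i)) \<le> (\<Sum>i<n. L * eps)"
  proof (intro sum_mono mult_mono)
   fix i assume "i \<in> {..<n}"
   then have i: "i < n" by simp
   have m: "(p s k, z) \<in> ?X" "(p s (Suc k), z) \<in> ?X" using p01 s z by auto
   show "2 * (1 / norm (h (p s k) z i) + A * norm (h (p s k) z i)) \<le> L"
    using order_trans[OF bspec[OF conjunct2[OF K[OF i]] m(1)] KL[OF i]] by (simp only: fst_conv snd_conv)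
   have "dist (p s (Suc k), z) (p s k, z) < d i"
    using pd[OF s, of k] ddd[OF i] by (simp add: dist_Pair_Pair dist_real_def)
   then have "dist (h (p s (Suc k)) z i) (h (p s k) z i) < eps" using bspec[OF bspec[OF conjunct2[OF d[OF i]] m(1)] m(2)] by (simp only: fst_conv snd_conv)
   then show "norm (h (p s (Suc k)) z i - h (p s k) z i) \<le> eps" by (simp add: dist_norm)
  qed (use L0 in auto)
  also have "\<dots> = real n / (2 * (1 + real n))" using L0 by (simp add: eps_def)
  also have "\<dots> < 1" by (subst divide_less_eq_1_pos) auto
  finally show "(\<Sum>i<n. 2 * (1 / norm (h (p s k) z i) + A * norm (h (p s k) z i)) * norm (h (p s (Suc k)) z i - h (p s k) z i)) < 1" .
 qed (rule x)
 show thesis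
 proof
  have "continuous_on ({0..1} \<times> Z \<times> UNIV) (%w. transport_steps A n (%k. h (p (fst w) k) (fst (snd w))) K (snd (snd w)))" for K
  proof (induction K)
   case 0 show ?case by (simp add: continuous_intros)
  next
   case (Suc k)
   have *: "continuous_on ({0..1} \<times> Z \<times> (UNIV :: (real ^ 3) set)) (%w. h (p (fst w) m) (fst (snd w)) i)" if "i < n" for i m
    by (rule continuous_on_compose2[OF h[OF that], of _ "%w. (p (fst w) m, fst (snd w))", simplified])
      (use p01 in "auto simp: p_def intro!: continuous_intros continuous_on_min")
   show ?case unfolding transport_steps.simps
    by (rule continuous_on_push[OF * * Suc]) (use nz p01 in auto)
  qed
  from this[of N] show "continuous_on ({0..1} \<times> Z \<times> UNIV) (%(s, z, x). T s z x)"
   by (simp add: T_def case_prod_beta)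
  show "T 0 z x = x" for z x
   unfolding T_def by (rule transport_steps_same) (simp add: p_def)
  show "T s z x \<in> off_lines n (h s z)" if "s \<in> {0..1}" "z \<in> Z" "x \<in> off_lines n (h 0 z)" for s z x
  proof -
   have "transport_steps A n (%k. h (p s k) z) k x \<in> off_lines n (h (p s k) z)" for k
   proof (induction k)
    case 0 show ?case using that by (simp add: p_def)
   next
    case (Suc k) show ?case using step[OF that(1,2) Suc] by simp
   qed
   from this[of N] show ?thesis using that N0 by (simp add: T_def p_def)
  qed
  show "T s z x = x" if "s \<in> {0..1}" "!!s i. s \<in> {0..1} ==> i < n ==> h s z i = h 0 z i" for s z x
   unfolding T_def by (rule transport_steps_same) (metis p01 that)
  show "T s z' x = T s z x" if "s \<in> {0..1}"
   "!!s i. s \<in> {0..1} ==> i < n ==> (e i = 1 \<or> e i = - 1) \<and> h s z' i = e i *\<^sub>R h s z i" for s z z' e x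
   unfolding T_def by (rule transport_steps_sign[where e = e]) (use p01 that in blast)
  show "T s z (l *\<^sub>R x) = l *\<^sub>R T s z x" for s z l x
   by (simp add: T_def transport_steps_scaleR)
 qed
qed

section \<open>Local systems and the homotopy invariance of their monodromy\<close>

section \<open>Parallel transport of discrete data along paths\<close>

text \<open>Bisection of the interval; it turns statements about short pieces of a path into
  statements about the whole path.\<close>

lemma interval_induct:
 fixes a b :: real
 assumes "a \<le> b"
  and trans: "!!x y z. a \<le> x ==> x \<le> y ==> y \<le> z ==> z \<le> b ==> P x y ==> P y z ==> P x z"
  and local: "!!t. a \<le> t ==> t \<le> b ==>
    \<exists>d>0. \<forall>x y. a \<le> x --> x \<le> t --> t \<le> y --> y \<le> b --> y - x < d --> P x y"
 shows "P a b"
proof -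
 have "a \<le> a --> b \<le> b --> P a b"
 proof (rule Bolzano[of a b "%x y. a \<le> x --> y \<le> b --> P x y"])
  fix t assume "a \<le> t" "t \<le> b"
  from local[OF this] obtain d where
   "d > 0" "\<forall>x y. a \<le> x --> x \<le> t --> t \<le> y --> y \<le> b --> y - x < d --> P x y" by blast
  then show "\<exists>d>0. \<forall>x y. x \<le> t \<and> t \<le> y \<and> y - x < d --> a \<le> x --> y \<le> b --> P x y"
   by (intro exI[of _ d]) blast
 next
  fix x y z
  assume "a \<le> x --> y \<le> b --> P x y" "a \<le> y --> z \<le> b --> P y z" and le: "x \<le> y" "y \<le> z"
  then show "a \<le> x --> z \<le> b --> P x z"
   using trans[of x y z] order_trans[of a x y] order_trans[of y z b] by blast
 qed (rule \<open>a \<le> b\<close>)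
 then show ?thesis by simp
qed

text \<open>A local system with fibre \<open>St\<close>: open charts and transition maps
  \<open>g C D\<close> that are constant on overlaps. Transporting \<open>St\<close> along paths
  yields homotopy invariants.\<close>

locale flat_bundle =
 fixes charts :: "'a::topological_space set set"
  and g :: "'a set => 'a set => 'st => 'st"
  and St :: "'st set"
 assumes open_chart: "C \<in> charts ==> open C"
  and g_St: "C \<in> charts ==> D \<in> charts ==> w \<in> St ==> g C D w \<in> St"
  and g_id: "C \<in> charts ==> w \<in> St ==> g C C w = w"
  and g_cocycle: "C \<in> charts ==> D \<in> charts ==> E \<in> charts ==> x \<in> C ==> x \<in> D ==> x \<in> E ==> w \<in> St
    ==> g D E (g C D w) = g C E w"
begin

text \<open>\<open>f t C\<close> is the value at time \<open>t\<close> as read in chart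
  \<open>C\<close>. The last clause asks for local constancy in one chart;
  \<open>flat_section_local\<close> gives it in all charts.\<close>

definition flat_section :: "(real => 'a) => real => real => (real => 'a set => 'st) => bool" where
 "flat_section p a b f \<longleftrightarrow> continuous_on {a..b} p \<and>
   (\<forall>t\<in>{a..b}. \<forall>C\<in>charts. p t \<in> C --> f t C \<in> St) \<and>
   (\<forall>t\<in>{a..b}. \<forall>C\<in>charts. \<forall>D\<in>charts. p t \<in> C --> p t \<in> D --> f t D = g C D (f t C)) \<and>
   (\<forall>t\<in>{a..b}. \<exists>C\<in>charts. p t \<in> C \<and> (\<exists>d>0. \<forall>s\<in>{a..b}. \<bar>s - t\<bar> < d --> p s \<in> C \<and> f s C = f t C))"

lemma flat_sectionD:
 assumes "flat_section p a b f"
 shows "continuous_on {a..b} p"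
  and "t \<in> {a..b} ==> C \<in> charts ==> p t \<in> C ==> f t C \<in> St"
  and "t \<in> {a..b} ==> C \<in> charts ==> D \<in> charts ==> p t \<in> C ==> p t \<in> D ==> f t D = g C D (f t C)"
  and "t \<in> {a..b} ==> \<exists>C\<in>charts. p t \<in> C \<and> (\<exists>d>0. \<forall>s\<in>{a..b}. \<bar>s - t\<bar> < d --> p s \<in> C \<and> f s C = f t C)"
proof -
 note d = assms[unfolded flat_section_def]
 show "continuous_on {a..b} p" using d by (rule conjunct1)
 show "t \<in> {a..b} ==> C \<in> charts ==> p t \<in> C ==> f t C \<in> St"
  using d[THEN conjunct2, THEN conjunct1] by simp
 show "t \<in> {a..b} ==> C \<in> charts ==> D \<in> charts ==> p t \<in> C ==> p t \<in> D ==> f t D = g C D (f t C)"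
  using d[THEN conjunct2, THEN conjunct2, THEN conjunct1] by blast
 show "t \<in> {a..b} ==> \<exists>C\<in>charts. p t \<in> C \<and> (\<exists>d>0. \<forall>s\<in>{a..b}. \<bar>s - t\<bar> < d --> p s \<in> C \<and> f s C = f t C)"
  using d[THEN conjunct2, THEN conjunct2, THEN conjunct2] by (rule bspec)
qed

lemma continuous_near:
 assumes "continuous_on {a..b} p" "t \<in> {a..b}" "p t \<in> C" "open C"
 obtains d :: real where "d > 0" "!!s. s \<in> {a..b} ==> \<bar>s - t\<bar> < d ==> p s \<in> C"
proof -
 have "openin (top_of_set {a..b}) ({a..b} \<inter> p -` C)"
  using assms continuous_openin_preimage_gen by blast
 then obtain e where "e > 0" "!!s. s \<in> {a..b} ==> dist s t < e ==> s \<in> {a..b} \<inter> p -` C"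
  using assms(2,3) unfolding openin_euclidean_subtopology_iff by blast
 then show thesis by (intro that[of e]) (auto simp: dist_real_def)
qed

lemma flat_section_local:
 assumes f: "flat_section p a b f" and t: "t \<in> {a..b}" and D: "D \<in> charts" "p t \<in> D"
 obtains d where "d > 0" "!!s. s \<in> {a..b} ==> \<bar>s - t\<bar> < d ==> p s \<in> D \<and> f s D = f t D"
proof -
 obtain C d where C: "C \<in> charts" "p t \<in> C" "d > 0"
  and d: "!!s. s \<in> {a..b} ==> \<bar>s - t\<bar> < d ==> p s \<in> C \<and> f s C = f t C"
  using flat_sectionD(4)[OF f t] by blast
 obtain e where e: "e > 0" "!!s. s \<in> {a..b} ==> \<bar>s - t\<bar> < e ==> p s \<in> D"
  using continuous_near[OF flat_sectionD(1)[OF f] t D(2) open_chart[OF D(1)]] by blast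
 show thesis
 proof (rule that[of "min d e"])
  fix s assume s: "s \<in> {a..b}" "\<bar>s - t\<bar> < min d e"
  then have *: "p s \<in> C" "f s C = f t C" "p s \<in> D" using d e by auto
  have "f s D = g C D (f s C)" using flat_sectionD(3)[OF f s(1) C(1) D(1) *(1,3)] .
  also have "\<dots> = f t D" using flat_sectionD(3)[OF f t C(1) D(1) C(2) D(2)] *(2) by simp
  finally show "p s \<in> D \<and> f s D = f t D" using *(3) by simp
 qed (use C(3) e(1) in simp)
qed

lemma flat_section_subset:
 assumes "flat_section p a b f" "a \<le> a'" "b' \<le> b"
 shows "flat_section p a' b' f"
proof -
 have sub: "{a'..b'} \<subseteq> {a..b}" using assms by auto
 have "\<exists>C\<in>charts. p t \<in> C \<and> (\<exists>d>0. \<forall>s\<in>{a'..b'}. \<bar>s - t\<bar> < d --> p s \<in> C \<and> f s C = f t C)"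
  if "t \<in> {a'..b'}" for t
 proof -
  from that sub have "t \<in> {a..b}" by blast
  from flat_sectionD(4)[OF assms(1) this] obtain C d where
   "C \<in> charts" "p t \<in> C" "d > 0" "\<forall>s\<in>{a..b}. \<bar>s - t\<bar> < d --> p s \<in> C \<and> f s C = f t C" by blast
  then show ?thesis using sub by (intro bexI[of _ C] conjI exI[of _ d]) blast+
 qed
 moreover have "continuous_on {a'..b'} p"
  using flat_sectionD(1)[OF assms(1)] sub by (rule continuous_on_subset)
 ultimately show ?thesis
  unfolding flat_section_def
 proof (intro conjI ballI impI)
  fix t assume "t \<in> {a'..b'}"
  then have t: "t \<in> {a..b}" using sub by blast
  show "f t C \<in> St" if "C \<in> charts" "p t \<in> C" for C
   using flat_sectionD(2)[OF assms(1) t that] .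
  show "f t D = g C D (f t C)" if "C \<in> charts" "D \<in> charts" "p t \<in> C" "p t \<in> D" for C D
   using flat_sectionD(3)[OF assms(1) t that] .
 qed
qed

definition transp :: "(real => 'a) => real => real => 'a set => 'a set => 'st => 'st => bool" where
 "transp p a b C D w v \<longleftrightarrow> C \<in> charts \<and> D \<in> charts \<and> p a \<in> C \<and> p b \<in> D \<and>
   (\<exists>f. flat_section p a b f \<and> f a C = w \<and> f b D = v)"

lemma transpD:
 assumes "transp p a b C D w v" shows "C \<in> charts" "D \<in> charts" "p a \<in> C" "p b \<in> D"
 using assms unfolding transp_def by simp_all

lemma transp_continuous:
 assumes "transp p a b C D w v" shows "continuous_on {a..b} p"
proof -
 from assms obtain f where "flat_section p a b f" unfolding transp_def by blast
 then show ?thesis by (rule flat_sectionD(1))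
qed

lemma agree_at_chart:
 assumes "flat_section p a b f" "flat_section p a b f'" "t \<in> {a..b}" "C \<in> charts" "p t \<in> C" "f t C = f' t C"
  "D \<in> charts" "p t \<in> D"
 shows "f t D = f' t D"
 using flat_sectionD(3)[OF assms(1,3,4,7,5,8)] flat_sectionD(3)[OF assms(2,3,4,7,5,8)] assms(6) by simp

text \<open>Agreement of two sections is a condition on the time that is both open and
  closed.\<close>

lemma flat_section_agree:
 assumes f: "flat_section p a b f" and f': "flat_section p a b f'" and "a \<le> b"
  and C: "C \<in> charts" "p a \<in> C" and D: "D \<in> charts" "p b \<in> D"
 shows "f a C = f' a C \<longleftrightarrow> f b D = f' b D"
proof -
 define A where "A t \<longleftrightarrow> (\<forall>C\<in>charts. p t \<in> C --> f t C = f' t C)" for t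
 have AI: "A t" if "!!D. D \<in> charts ==> p t \<in> D ==> f t D = f' t D" for t
  unfolding A_def using that by blast
 have AD: "f t D = f' t D" if "A t" "D \<in> charts" "p t \<in> D" for t D
  using that unfolding A_def by blast
 have "A a \<longleftrightarrow> A b"
 proof (rule interval_induct[OF \<open>a \<le> b\<close>, where P = "%x y. A x \<longleftrightarrow> A y"])
  fix t assume "a \<le> t" "t \<le> b"
  then have t: "t \<in> {a..b}" by simp
  obtain C where C: "C \<in> charts" "p t \<in> C" using flat_sectionD(4)[OF f t] by blast
  obtain d where d: "d > 0" "!!s. s \<in> {a..b} ==> \<bar>s - t\<bar> < d ==> p s \<in> C \<and> f s C = f t C"
   using flat_section_local[OF f t C] by blast
  obtain d' where d': "d' > 0" "!!s. s \<in> {a..b} ==> \<bar>s - t\<bar> < d' ==> p s \<in> C \<and> f' s C = f' t C"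
   using flat_section_local[OF f' t C] by blast
  have key: "A s \<longleftrightarrow> f t C = f' t C" if "s \<in> {a..b}" "\<bar>s - t\<bar> < min d d'" for s
  proof -
   have s: "p s \<in> C" "f s C = f t C" "f' s C = f' t C" using d(2) d'(2) that by auto
   show ?thesis
   proof
    assume "f t C = f' t C"
    then have e: "f s C = f' s C" using s by simp
    show "A s" by (rule AI) (rule agree_at_chart[OF f f' that(1) C(1) s(1) e])
   qed (use s C AD[of s C] in simp)
  qed
  show "\<exists>d>0. \<forall>x y. a \<le> x --> x \<le> t --> t \<le> y --> y \<le> b --> y - x < d --> (A x \<longleftrightarrow> A y)"
  proof (intro exI[of _ "min d d'"] conjI allI impI)
   fix x y assume "a \<le> x" "x \<le> t" "t \<le> y" "y \<le> b" "y - x < min d d'"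
   then have "x \<in> {a..b}" "\<bar>x - t\<bar> < min d d'" "y \<in> {a..b}" "\<bar>y - t\<bar> < min d d'" by auto
   then show "A x \<longleftrightarrow> A y" using key by blast
  qed (simp add: d(1) d'(1))
 next
  fix x y z assume "A x \<longleftrightarrow> A y" "A y \<longleftrightarrow> A z" then show "A x \<longleftrightarrow> A z" by (rule HOL.trans)
 qed
 moreover have "A a \<longleftrightarrow> f a C = f' a C"
 proof
  assume e: "f a C = f' a C"
  have "a \<in> {a..b}" using \<open>a \<le> b\<close> by simp
  from agree_at_chart[OF f f' this C e] show "A a" by (rule AI)
 qed (rule AD[OF _ C])
 moreover have "A b \<longleftrightarrow> f b D = f' b D"
 proof
  assume e: "f b D = f' b D"
  have "b \<in> {a..b}" using \<open>a \<le> b\<close> by simp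
  from agree_at_chart[OF f f' this D e] show "A b" by (rule AI)
 qed (rule AD[OF _ D])
 ultimately show ?thesis by blast
qed

lemma transp_left_unique:
 assumes "transp p a b C D w v" "transp p a b C D w' v" "a \<le> b" shows "w = w'"
proof -
 from assms obtain f f' where "flat_section p a b f" "f a C = w" "f b D = v" "flat_section p a b f'" "f' a C = w'" "f' b D = v"
  unfolding transp_def by blast
 moreover have "C \<in> charts" "p a \<in> C" "D \<in> charts" "p b \<in> D" using transpD[OF assms(1)] by simp_all
 ultimately show ?thesis using flat_section_agree[of p a b f f' C D] assms(3) by simp
qed

lemma transp_right_unique:
 assumes "transp p a b C D w v" "transp p a b C D w v'" "a \<le> b" shows "v = v'"
proof -
 from assms obtain f f' where "flat_section p a b f" "f a C = w" "f b D = v" "flat_section p a b f'" "f' a C = w" "f' b D = v'"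
  unfolding transp_def by blast
 moreover have "C \<in> charts" "p a \<in> C" "D \<in> charts" "p b \<in> D" using transpD[OF assms(1)] by simp_all
 ultimately show ?thesis using flat_section_agree[of p a b f f' C D] assms(3) by simp
qed

lemma transp_chart:
 assumes p: "continuous_on {a..b} p" "!!t. t \<in> {a..b} ==> p t \<in> E" and E: "E \<in> charts" and "a \<le> b"
  and C: "C \<in> charts" "p a \<in> C" and D: "D \<in> charts" "p b \<in> D" and w: "w \<in> St"
 shows "transp p a b C D w (g E D (g C E w))"
proof -
 have "flat_section p a b (%t F. g E F (g C E w))"
  unfolding flat_section_def
 proof (intro conjI ballI impI)
  show "\<exists>F\<in>charts. p t \<in> F \<and> (\<exists>d>0. \<forall>s\<in>{a..b}. \<bar>s - t\<bar> < d --> p s \<in> F \<and> g E F (g C E w) = g E F (g C E w))"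
   if "t \<in> {a..b}" for t
   using p(2) that E by (intro bexI[of _ E] conjI exI[of _ "1::real"]) auto
  show "g E D (g C E w) = g C' D (g E C' (g C E w))"
   if "t \<in> {a..b}" "C' \<in> charts" "D \<in> charts" "p t \<in> C'" "p t \<in> D" for t C' D
   by (rule g_cocycle[symmetric, OF E that(2,3) p(2)[OF that(1)] that(4,5)]) (rule g_St[OF C(1) E w])
  show "g E C' (g C E w) \<in> St" if "C' \<in> charts" for C'
   by (intro g_St C E w that)
 qed (rule p(1))
 moreover have "g E C (g C E w) = w"
  using g_cocycle[OF C(1) E C(1) C(2) p(2) C(2) w] g_id[OF C(1) w] \<open>a \<le> b\<close> by simp
 ultimately show ?thesis unfolding transp_def using C D by (intro conjI exI[of _ "%t F. g E F (g C E w)"]) simp_all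
qed

lemma transp_trans:
 assumes 1: "transp p a m C E w u" and 2: "transp p m b E D u v" and le: "a \<le> m" "m \<le> b"
 shows "transp p a b C D w v"
proof -
 from 1 obtain f1 where f1: "flat_section p a m f1" "f1 a C = w" "f1 m E = u" unfolding transp_def by blast
 from 2 obtain f2 where f2: "flat_section p m b f2" "f2 m E = u" "f2 b D = v" unfolding transp_def by blast
 have E: "E \<in> charts" "p m \<in> E" using transpD[OF 1] by simp_all
 have m: "m \<in> {a..m}" "m \<in> {m..b}" using le by auto
 have agree: "f1 m F = f2 m F" if "F \<in> charts" "p m \<in> F" for F
  using flat_sectionD(3)[OF f1(1) m(1) E(1) that(1) E(2) that(2)]
   flat_sectionD(3)[OF f2(1) m(2) E(1) that(1) E(2) that(2)] f1 f2 by simp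
 define f where "f t = (if t \<le> m then f1 t else f2 t)" for t
 have fl: "f t F = f1 t F" if "t \<le> m" for t F using that by (simp add: f_def)
 have fr: "f t F = f2 t F" if "m \<le> t" "F \<in> charts" "p t \<in> F" for t F
  using that agree by (cases "t = m") (auto simp: f_def)
 have cont: "continuous_on {a..b} p"
 proof -
  have "continuous_on ({a..m} \<union> {m..b}) p"
   by (intro continuous_on_closed_Un flat_sectionD(1)[OF f1(1)] flat_sectionD(1)[OF f2(1)]) auto
  moreover have "{a..m} \<union> {m..b} = {a..b}" using le by auto
  ultimately show ?thesis by simp
 qed
 have "flat_section p a b f"
  unfolding flat_section_def
 proof (intro conjI ballI impI cont)
  fix t F assume t: "t \<in> {a..b}" and F: "F \<in> charts" "p t \<in> F"
  show "f t F \<in> St"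
  proof (cases "t \<le> m")
   case True then show ?thesis using flat_sectionD(2)[OF f1(1) _ F] t fl by auto
  next
   case False then show ?thesis using flat_sectionD(2)[OF f2(1) _ F] t fr[OF _ F] by auto
  qed
 next
  fix t F G assume t: "t \<in> {a..b}" and F: "F \<in> charts" "G \<in> charts" "p t \<in> F" "p t \<in> G"
  show "f t G = g F G (f t F)"
  proof (cases "t \<le> m")
   case True then show ?thesis using flat_sectionD(3)[OF f1(1) _ F] t fl by auto
  next
   case False then show ?thesis using flat_sectionD(3)[OF f2(1) _ F] t fr[OF _ F(1,3)] fr[OF _ F(2,4)] by auto
  qed
 next
  fix t assume t: "t \<in> {a..b}"
  obtain F where F: "F \<in> charts" "p t \<in> F"
   using flat_sectionD(4)[OF f1(1), of t] flat_sectionD(4)[OF f2(1), of t] t by fastforce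
  have near1: "\<exists>d>0. \<forall>s\<in>{a..b}. \<bar>s - t\<bar> < d --> s \<le> m --> p s \<in> F \<and> f s F = f t F"
  proof (cases "t \<le> m")
   case True
   with t have "t \<in> {a..m}" by simp
   then obtain d where "d > 0" "!!s. s \<in> {a..m} ==> \<bar>s - t\<bar> < d ==> p s \<in> F \<and> f1 s F = f1 t F"
    using flat_section_local[OF f1(1) _ F] by blast
   then show ?thesis using True by (intro exI[of _ d]) (auto simp: fl)
  next
   case False then show ?thesis by (intro exI[of _ "t - m"]) auto
  qed
  have near2: "\<exists>d>0. \<forall>s\<in>{a..b}. \<bar>s - t\<bar> < d --> m \<le> s --> p s \<in> F \<and> f s F = f t F"
  proof (cases "m \<le> t")
   case True
   with t have "t \<in> {m..b}" by simp
   then obtain d where "d > 0" "!!s. s \<in> {m..b} ==> \<bar>s - t\<bar> < d ==> p s \<in> F \<and> f2 s F = f2 t F"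
    using flat_section_local[OF f2(1) _ F] by blast
   then show ?thesis using True F fr by (intro exI[of _ d]) auto
  next
   case False then show ?thesis by (intro exI[of _ "m - t"]) auto
  qed
  from near1 near2 obtain d1 d2 where d: "d1 > 0" "d2 > 0"
   "!!s. s \<in> {a..b} ==> \<bar>s - t\<bar> < d1 ==> s \<le> m ==> p s \<in> F \<and> f s F = f t F"
   "!!s. s \<in> {a..b} ==> \<bar>s - t\<bar> < d2 ==> m \<le> s ==> p s \<in> F \<and> f s F = f t F" by blast
  have "p s \<in> F \<and> f s F = f t F" if "s \<in> {a..b}" "\<bar>s - t\<bar> < min d1 d2" for s
   using d(3,4)[OF that(1)] that(2) by (cases "s \<le> m") auto
  moreover have "min d1 d2 > 0" using d by simp
  ultimately show "\<exists>C\<in>charts. p t \<in> C \<and> (\<exists>d>0. \<forall>s\<in>{a..b}. \<bar>s - t\<bar> < d --> p s \<in> C \<and> f s C = f t C)"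
   using F by blast
 qed
 moreover have "f a C = w" "f b D = v"
  using f1 f2 fl[OF le(1)] fr[OF le(2) transpD(2)[OF 2] transpD(4)[OF 2]] by simp_all
 ultimately show ?thesis using transpD[OF 1] transpD[OF 2] unfolding transp_def by (intro conjI exI[of _ f])
qed

lemma transp_split:
 assumes "transp p a b C D w v" "m \<in> {a..b}" "E \<in> charts" "p m \<in> E"
 obtains u where "u \<in> St" "transp p a m C E w u" "transp p m b E D u v"
proof -
 from assms(1) obtain f where f: "flat_section p a b f" "f a C = w" "f b D = v" unfolding transp_def by blast
 show thesis
 proof (rule that[of "f m E"])
  show "f m E \<in> St" using flat_sectionD(2)[OF f(1) assms(2-4)] .
  show "transp p a m C E w (f m E)" "transp p m b E D (f m E) v"
   using assms(2-4) f(2,3) transpD[OF assms(1)] flat_section_subset[OF f(1), of a m] flat_section_subset[OF f(1), of m b]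
   unfolding transp_def by auto
 qed
qed

lemma transp_affine:
 assumes "transp p (m * a + c) (m * b + c) C D w v" "0 < m" "a \<le> b"
 shows "transp (%t. p (m * t + c)) a b C D w v"
proof -
 from assms obtain f where f: "flat_section p (m * a + c) (m * b + c) f" "f (m * a + c) C = w" "f (m * b + c) D = v"
  unfolding transp_def by blast
 have in': "m * t + c \<in> {m * a + c..m * b + c}" if "t \<in> {a..b}" for t using that assms by auto
 have "flat_section (%t. p (m * t + c)) a b (%t. f (m * t + c))"
  unfolding flat_section_def
 proof (intro conjI ballI impI)
  show "continuous_on {a..b} (%t. p (m * t + c))"
   by (rule continuous_on_compose2[OF flat_sectionD(1)[OF f(1)]]) (use in' in "auto intro!: continuous_intros")
  fix t assume t: "t \<in> {a..b}"
  from flat_sectionD(4)[OF f(1) in'[OF t]] obtain F d where F: "F \<in> charts" "p (m * t + c) \<in> F" "d > 0"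
   and d: "!!s. s \<in> {m * a + c..m * b + c} ==> \<bar>s - (m * t + c)\<bar> < d ==> p s \<in> F \<and> f s F = f (m * t + c) F"
   by blast
  have "p (m * s + c) \<in> F \<and> f (m * s + c) F = f (m * t + c) F" if s: "s \<in> {a..b}" "\<bar>s - t\<bar> < d / m" for s
  proof (rule d[OF in'[OF s(1)]])
   have "\<bar>(m * s + c) - (m * t + c)\<bar> = m * \<bar>s - t\<bar>" using assms(2) by (simp add: abs_mult flip: right_diff_distrib)
   also have "\<dots> < d" using s(2) assms(2) by (simp add: pos_less_divide_eq mult.commute)
   finally show "\<bar>(m * s + c) - (m * t + c)\<bar> < d" .
  qed
  moreover have "d / m > 0" using F assms by simp
  ultimately show "\<exists>C\<in>charts. p (m * t + c) \<in> C \<and> (\<exists>d>0. \<forall>s\<in>{a..b}. \<bar>s - t\<bar> < d --> p (m * s + c) \<in> C \<and> f (m * s + c) C = f (m * t + c) C)"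
   using F by blast
  show "f (m * t + c) C \<in> St" if "C \<in> charts" "p (m * t + c) \<in> C" for C
   using flat_sectionD(2)[OF f(1) in'[OF t] that] .
  show "f (m * t + c) D = g C D (f (m * t + c) C)"
   if "C \<in> charts" "D \<in> charts" "p (m * t + c) \<in> C" "p (m * t + c) \<in> D" for C D
   using flat_sectionD(3)[OF f(1) in'[OF t] that] .
 qed
 then show ?thesis using transpD[OF assms(1)] f(2,3) unfolding transp_def by (intro conjI exI[of _ "%t. f (m * t + c)"])
qed

lemma transp_cong:
 assumes "transp p a b C D w v" "!!t. t \<in> {a..b} ==> p t = q t" "a \<le> b"
 shows "transp q a b C D w v"
proof -
 from assms(1) obtain f where f: "flat_section p a b f" "f a C = w" "f b D = v" unfolding transp_def by blast
 have "flat_section q a b f"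
  unfolding flat_section_def
 proof (intro conjI ballI impI)
  show "continuous_on {a..b} q"
   using flat_sectionD(1)[OF f(1)] assms(2) by (rule continuous_on_eq)
  fix t assume t: "t \<in> {a..b}"
  show "f t C \<in> St" if "C \<in> charts" "q t \<in> C" for C
   using flat_sectionD(2)[OF f(1) t that(1)] that(2) assms(2)[OF t] by simp
  show "f t D = g C D (f t C)" if "C \<in> charts" "D \<in> charts" "q t \<in> C" "q t \<in> D" for C D
   using flat_sectionD(3)[OF f(1) t that(1,2)] that(3,4) assms(2)[OF t] by simp
  from flat_sectionD(4)[OF f(1) t] obtain C d where
   "C \<in> charts" "p t \<in> C" "d > 0" "\<forall>s\<in>{a..b}. \<bar>s - t\<bar> < d --> p s \<in> C \<and> f s C = f t C" by blast
  moreover from this have "\<forall>s\<in>{a..b}. \<bar>s - t\<bar> < d --> q s \<in> C \<and> f s C = f t C"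
   using assms(2) by simp
  moreover have "q t \<in> C" using calculation(2) assms(2)[OF t] by simp
  ultimately show "\<exists>C\<in>charts. q t \<in> C \<and> (\<exists>d>0. \<forall>s\<in>{a..b}. \<bar>s - t\<bar> < d --> q s \<in> C \<and> f s C = f t C)"
   by blast
 qed
 moreover have "q a = p a" "q b = p b" using assms(2,3) by auto
 ultimately show ?thesis using transpD[OF assms(1)] f(2,3) unfolding transp_def by (intro conjI exI[of _ f]) simp_all
qed

lemma transp_join:
 assumes p: "transp p 0 1 C E w u" and q: "transp q 0 1 E D u v" and pq: "pathfinish p = pathstart q"
 shows "transp (p +++ q) 0 1 C D w v"
proof (rule transp_trans[of _ _ "1/2"])
 have "transp (%t. p (2 * t + 0)) 0 (1/2) C E w u" by (rule transp_affine) (simp_all add: p)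
 then show "transp (p +++ q) 0 (1/2) C E w u" by (rule transp_cong) (auto simp: joinpaths_def)
 have "transp (%t. q (2 * t + (- 1))) (1/2) 1 E D u v" by (rule transp_affine) (simp_all add: q)
 then show "transp (p +++ q) (1/2) 1 E D u v"
 proof (rule transp_cong)
  fix t :: real assume t: "t \<in> {1/2..1}"
  show "q (2 * t + (- 1)) = (p +++ q) t"
  proof (cases "t = 1/2")
   case True
   show ?thesis unfolding True using pq by (simp add: joinpaths_def pathstart_def pathfinish_def)
  next
   case False then show ?thesis using t by (simp add: joinpaths_def)
  qed
 qed simp
qed auto

lemma transp_exists:
 assumes p: "continuous_on {a..b} p" "!!t. t \<in> {a..b} ==> p t \<in> \<Union>charts" and "a \<le> b"
  and C: "C \<in> charts" "p a \<in> C" and D: "D \<in> charts" "p b \<in> D" and w: "w \<in> St"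
 obtains v where "v \<in> St" "transp p a b C D w v"
proof -
 let ?P = "%x y. \<forall>C\<in>charts. \<forall>D\<in>charts. \<forall>w\<in>St. p x \<in> C --> p y \<in> D --> (\<exists>v\<in>St. transp p x y C D w v)"
 have "?P a b"
 proof (rule interval_induct[OF \<open>a \<le> b\<close>, where P = ?P])
  fix x y z assume xyz: "a \<le> x" "x \<le> y" "y \<le> z" "z \<le> b" and P: "?P x y" "?P y z"
  obtain E where E: "E \<in> charts" "p y \<in> E" using p(2)[of y] xyz by auto
  show "?P x z"
  proof (intro ballI impI)
   fix C D w assume *: "C \<in> charts" "D \<in> charts" "w \<in> St" "p x \<in> C" "p z \<in> D"
   then obtain u where u: "u \<in> St" "transp p x y C E w u" using P(1) E by blast
   then obtain v where "v \<in> St" "transp p y z E D u v" using P(2) E * by blast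
   with u show "\<exists>v\<in>St. transp p x z C D w v" using transp_trans xyz by blast
  qed
 next
  fix t assume "a \<le> t" "t \<le> b"
  then have t: "t \<in> {a..b}" by simp
  obtain E where E: "E \<in> charts" "p t \<in> E" using p(2)[OF t] by blast
  obtain d where d: "d > 0" "!!s. s \<in> {a..b} ==> \<bar>s - t\<bar> < d ==> p s \<in> E"
   using continuous_near[OF p(1) t E(2) open_chart[OF E(1)]] by blast
  show "\<exists>d>0. \<forall>x y. a \<le> x --> x \<le> t --> t \<le> y --> y \<le> b --> y - x < d --> ?P x y"
  proof (intro exI[of _ d] conjI allI impI ballI)
   fix x y C D w assume *: "a \<le> x" "x \<le> t" "t \<le> y" "y \<le> b" "y - x < d"
    "C \<in> charts" "D \<in> charts" "w \<in> St" "p x \<in> C" "p y \<in> D"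
   have "transp p x y C D w (g E D (g C E w))"
   proof (rule transp_chart[OF _ _ E(1) _ *(6,9,7,10,8)])
    show "continuous_on {x..y} p" using p(1) by (rule continuous_on_subset) (use * in auto)
    show "p s \<in> E" if "s \<in> {x..y}" for s using d(2)[of s] that * by auto
   qed (use * in auto)
   then show "\<exists>v\<in>St. transp p x y C D w v" using g_St E * by blast
  qed (rule d(1))
 qed
 then show thesis using that C D w by blast
qed

text \<open>Each short piece of the path stays in one chart, and so does the same piece of a nearby
  path; there both transports are given by the same composite of transition maps.\<close>

lemma transp_near:
 fixes h :: "real => real => 'a"
 assumes h: "continuous_on ({0..1} \<times> {0..1}) (%z. h (fst z) (snd z))"
  and hU: "!!s t. s \<in> {0..1} ==> t \<in> {0..1} ==> h s t \<in> \<Union>charts"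
  and s0: "s0 \<in> {0..1}" and T: "transp (h s0) 0 1 C D w v" and w: "w \<in> St"
 obtains d where "d > 0" "!!s. s \<in> {0..1} ==> \<bar>s - s0\<bar> < d ==> transp (h s) 0 1 C D w v"
proof -
 have cs: "continuous_on {0..1} (h s)" if "s \<in> {0..1}" for s
  by (rule continuous_on_compose2[OF h, of _ "%t. (s, t)", simplified]) (use that in "auto intro!: continuous_intros")
 have ct: "continuous_on {0..1} (%s. h s t)" if "t \<in> {0..1}" for t
  by (rule continuous_on_compose2[OF h, of _ "%s. (s, t)", simplified]) (use that in "auto intro!: continuous_intros")
 let ?P = "%x y. \<forall>C D w v. w \<in> St --> transp (h s0) x y C D w v -->
   (\<exists>d>0. \<forall>s\<in>{0..1}. \<bar>s - s0\<bar> < d --> transp (h s) x y C D w v)"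
 have "?P 0 1"
 proof (rule interval_induct[of 0 1 ?P])
  fix x y z :: real assume xyz: "0 \<le> x" "x \<le> y" "y \<le> z" "z \<le> 1" and P: "?P x y" "?P y z"
  obtain E where E: "E \<in> charts" "h s0 y \<in> E" using hU[OF s0, of y] xyz by auto
  show "?P x z"
  proof (intro allI impI)
   fix C D w v assume w: "w \<in> St" and *: "transp (h s0) x z C D w v"
   have "y \<in> {x..z}" using xyz by simp
   then obtain u where u: "u \<in> St" "transp (h s0) x y C E w u" "transp (h s0) y z E D u v"
    using transp_split[OF * _ E] by blast
   from P(1) w u obtain d1 where d1: "d1 > 0" "\<forall>s\<in>{0..1}. \<bar>s - s0\<bar> < d1 --> transp (h s) x y C E w u" by blast
   from P(2) u obtain d2 where d2: "d2 > 0" "\<forall>s\<in>{0..1}. \<bar>s - s0\<bar> < d2 --> transp (h s) y z E D u v" by blast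
   show "\<exists>d>0. \<forall>s\<in>{0..1}. \<bar>s - s0\<bar> < d --> transp (h s) x z C D w v"
   proof (rule exI[of _ "min d1 d2"], intro conjI ballI impI)
    fix s :: real assume s: "s \<in> {0..1}" "\<bar>s - s0\<bar> < min d1 d2"
    then have "transp (h s) x y C E w u" "transp (h s) y z E D u v" using d1(2) d2(2) by simp_all
    then show "transp (h s) x z C D w v" using transp_trans xyz(2,3) by blast
   qed (use d1(1) d2(1) in simp)
  qed
 next
  fix t :: real assume "0 \<le> t" "t \<le> 1"
  then have t: "t \<in> {0..1}" by simp
  obtain E where E: "E \<in> charts" "h s0 t \<in> E" using hU[OF s0 t] by auto
  have "openin (top_of_set ({0..1} \<times> {0..1})) (({0..1} \<times> {0..1}) \<inter> (%z. h (fst z) (snd z)) -` E)"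
   using continuous_openin_preimage_gen[OF h open_chart[OF E(1)]] .
  note op = this
  have m: "(s0, t) \<in> ({0..1} \<times> {0..1}) \<inter> (%z. h (fst z) (snd z)) -` E"
   using E(2) s0 t by simp
  obtain e where e0: "e > 0" "\<forall>z\<in>{0..1} \<times> {0..1}. dist z (s0, t) < e --> z \<in> ({0..1} \<times> {0..1}) \<inter> (%z. h (fst z) (snd z)) -` E"
   using bspec[OF conjunct2[OF op[unfolded openin_euclidean_subtopology_iff]] m] by (elim exE conjE)
  have e: "e > 0" "!!z. z \<in> {0..1} \<times> {0..1} ==> dist z (s0, t) < e ==> h (fst z) (snd z) \<in> E"
   using e0(1) bspec[OF e0(2)] by simp_all
  have eE: "h s' t' \<in> E" if "s' \<in> {0..1}" "t' \<in> {0..1}" "\<bar>s' - s0\<bar> < e / 2" "\<bar>t' - t\<bar> < e / 2" for s' t'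
  proof -
   have "dist (s', t') (s0, t) \<le> \<bar>s' - s0\<bar> + \<bar>t' - t\<bar>"
    using sqrt_sum_squares_le_sum_abs[of "s' - s0" "t' - t"] by (simp add: dist_Pair_Pair dist_real_def)
   then have "dist (s', t') (s0, t) < e" using that by linarith
   then show ?thesis using e(2)[of "(s', t')"] that by simp
  qed
  show "\<exists>d>0. \<forall>x y. 0 \<le> x --> x \<le> t --> t \<le> y --> y \<le> 1 --> y - x < d --> ?P x y"
  proof (rule exI[of _ "e / 2"], intro conjI allI impI)
   fix x y C D w v assume *: "0 \<le> x" "x \<le> t" "t \<le> y" "y \<le> 1" "y - x < e / 2" "w \<in> St"
    and tr: "transp (h s0) x y C D w v"
   have CD: "C \<in> charts" "D \<in> charts" "h s0 x \<in> C" "h s0 y \<in> D" using transpD[OF tr] by simp_all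
   have xy: "x \<in> {0..1}" "y \<in> {0..1}" using * by auto
   have tc: "transp (h s) x y C D w (g E D (g C E w))" if "s \<in> {0..1}" "\<bar>s - s0\<bar> < e / 2" "h s x \<in> C" "h s y \<in> D" for s
   proof (rule transp_chart[OF _ _ E(1) _ CD(1) that(3) CD(2) that(4) *(6)])
    show "continuous_on {x..y} (h s)" using cs[OF that(1)] by (rule continuous_on_subset) (use * in auto)
    fix r assume r: "r \<in> {x..y}"
    then have "r \<in> {0..1}" "\<bar>r - t\<bar> < e / 2" using *(1-5) unfolding atLeastAtMost_iff abs_less_iff by linarith+
    then show "h s r \<in> E" using eE[OF \<open>s \<in> {0..1}\<close> _ \<open>\<bar>s - s0\<bar> < e / 2\<close>] by blast
   qed (use * in auto)
   have "x \<le> y" "\<bar>s0 - s0\<bar> < e / 2" using *(2,3) e(1) by simp_all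
   then have v: "v = g E D (g C E w)"
    using transp_right_unique[OF tr tc[OF s0 _ CD(3,4)]] by blast
   obtain d1 where d1: "d1 > 0" "!!s. s \<in> {0..1} ==> \<bar>s - s0\<bar> < d1 ==> h s x \<in> C"
    using continuous_near[OF ct[OF xy(1)] s0 CD(3) open_chart[OF CD(1)]] by blast
   obtain d2 where d2: "d2 > 0" "!!s. s \<in> {0..1} ==> \<bar>s - s0\<bar> < d2 ==> h s y \<in> D"
    using continuous_near[OF ct[OF xy(2)] s0 CD(4) open_chart[OF CD(2)]] by blast
   have "transp (h s) x y C D w v" if "s \<in> {0..1}" "\<bar>s - s0\<bar> < min (e / 2) (min d1 d2)" for s
    unfolding v using that tc[of s] d1(2)[of s] d2(2)[of s] by simp
   moreover have "min (e / 2) (min d1 d2) > 0" using e(1) d1(1) d2(1) by simp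
   ultimately show "\<exists>d>0. \<forall>s\<in>{0..1}. \<bar>s - s0\<bar> < d --> transp (h s) x y C D w v" by blast
  qed (use e(1) in simp)
 qed auto
 then show thesis using T w that by blast
qed

text \<open>By \<open>transp_near\<close> the result of the transport is locally constant in the
  homotopy parameter.\<close>

lemma transp_homotopic:
 assumes hom: "homotopic_paths U p q" and U: "U \<subseteq> \<Union>charts" and T: "transp p 0 1 C D w v" and w: "w \<in> St"
 shows "transp q 0 1 C D w v"
proof -
 from hom obtain k where k: "continuous_on ({0..1::real} \<times> {0..1::real}) k" "k \<in> {0..1} \<times> {0..1} \<rightarrow> U"
   "\<forall>x\<in>{0..1}. k (0, x) = p x" "\<forall>x\<in>{0..1}. k (1, x) = q x"
   "\<forall>t\<in>{0..1}. pathstart (k \<circ> Pair t) = pathstart p \<and> pathfinish (k \<circ> Pair t) = pathfinish p"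
  unfolding homotopic_paths by blast
 define h where "h s t = k (s, t)" for s t
 have h: "continuous_on ({0..1} \<times> {0..1}) (%z. h (fst z) (snd z))" using k by (simp add: h_def)
 have hU: "h s t \<in> \<Union>charts" if "s \<in> {0..1}" "t \<in> {0..1}" for s t
  using k(2) U that unfolding h_def by blast
 have ends: "h s 0 = p 0" "h s 1 = p 1" if "s \<in> {0..1}" for s
  using k(5) that by (auto simp: h_def pathstart_def pathfinish_def)
 have CD: "C \<in> charts" "D \<in> charts" "p 0 \<in> C" "p 1 \<in> D" using transpD[OF T] by simp_all
 have cs: "continuous_on {0..1} (h s)" if "s \<in> {0..1}" for s
  by (rule continuous_on_compose2[OF h, of _ "%t. (s, t)", simplified]) (use that in "auto intro!: continuous_intros")
 define Q where "Q s \<longleftrightarrow> transp (h s) 0 1 C D w v" for s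
 have "Q 0 \<longleftrightarrow> Q 1"
 proof (rule interval_induct[where P = "%x y. Q x \<longleftrightarrow> Q y"])
  fix s0 :: real assume "0 \<le> s0" "s0 \<le> 1"
  then have s0: "s0 \<in> {0..1}" by simp
  obtain v0 where v0: "transp (h s0) 0 1 C D w v0"
   using transp_exists[OF cs[OF s0] hU[OF s0] _ CD(1) _ CD(2) _ w] CD ends[OF s0] by auto
  obtain d where d: "d > 0" "!!s. s \<in> {0..1} ==> \<bar>s - s0\<bar> < d ==> transp (h s) 0 1 C D w v0"
   using transp_near[OF h hU s0 v0 w] by blast
  have key: "Q s \<longleftrightarrow> v = v0" if "s \<in> {0..1}" "\<bar>s - s0\<bar> < d" for s
   using d(2)[OF that] transp_right_unique[OF d(2)[OF that] _ zero_le_one] unfolding Q_def by blast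
  show "\<exists>d>0. \<forall>x y. 0 \<le> x --> x \<le> s0 --> s0 \<le> y --> y \<le> 1 --> y - x < d --> (Q x \<longleftrightarrow> Q y)"
  proof (intro exI[of _ d] conjI allI impI)
   fix x y :: real assume "0 \<le> x" "x \<le> s0" "s0 \<le> y" "y \<le> 1" "y - x < d"
   then have "x \<in> {0..1}" "\<bar>x - s0\<bar> < d" "y \<in> {0..1}" "\<bar>y - s0\<bar> < d" by auto
   then show "Q x \<longleftrightarrow> Q y" using key by blast
  qed (rule d(1))
 next
  fix x y z assume "Q x \<longleftrightarrow> Q y" "Q y \<longleftrightarrow> Q z" then show "Q x \<longleftrightarrow> Q z" by (rule HOL.trans)
 qed simp
 moreover have "Q 0" unfolding Q_def by (rule transp_cong[OF T]) (use k in "auto simp: h_def")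
 ultimately have "Q 1" by blast
 then show ?thesis unfolding Q_def by (rule transp_cong) (use k in "auto simp: h_def")
qed

end

section \<open>Reduced words in a free product of groups of order two\<close>

section \<open>Words in involutive letters\<close>

text \<open>Left multiplication by a generator in the free product of groups of order two, on
  reduced words; these are the \<open>distinct_adj\<close> lists.\<close>

definition act :: "'l => 'l list => 'l list" where
 "act a w = (case w of [] => [a] | b # v => if a = b then v else a # w)"

definition red :: "'l list => 'l list" where
 "red w = foldr act w []"

lemma red_Nil [simp]: "red [] = []" and red_Cons: "red (a # w) = act a (red w)"
 by (simp_all add: red_def)

lemma distinct_adj_act: "distinct_adj w ==> distinct_adj (act a w)"
 by (cases w) (auto simp: act_def distinct_adj_Cons)

lemma act_act: "distinct_adj w ==> act a (act a w) = w"
 by (cases w; cases "tl w") (auto simp: act_def distinct_adj_Cons)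

lemma distinct_adj_foldr_act: "distinct_adj v ==> distinct_adj (foldr act w v)"
 by (induction w) (auto simp: distinct_adj_act)

lemma distinct_adj_red: "distinct_adj (red w)"
 unfolding red_def by (rule distinct_adj_foldr_act) simp

lemma foldr_act_act:
 assumes "distinct_adj w" "distinct_adj v" shows "foldr act (act a w) v = act a (foldr act w v)"
proof (cases w)
 case Nil then show ?thesis by (simp add: act_def)
next
 case (Cons b u)
 show ?thesis
 proof (cases "a = b")
  case True
  then show ?thesis using Cons assms act_act[OF distinct_adj_foldr_act[OF assms(2)], of b u] by (simp add: act_def)
 next
  case False then show ?thesis using Cons by (simp add: act_def)
 qed
qed

lemma foldr_act_red: "distinct_adj v ==> foldr act (red w) v = foldr act w v"
 by (induction w) (simp_all add: red_Cons foldr_act_act distinct_adj_red)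

lemma red_append: "red (u @ v) = foldr act u (red v)"
 by (simp add: red_def)

lemma red_append_cong: "red u = red u' ==> red v = red v' ==> red (u @ v) = red (u' @ v')"
 unfolding red_append by (metis distinct_adj_red foldr_act_red)

lemma red_distinct_adj: "distinct_adj w ==> red w = w"
proof (induction w)
 case (Cons a w)
 then show ?case by (cases w) (auto simp: red_Cons act_def distinct_adj_Cons)
qed simp

lemma red_red [simp]: "red (red w) = red w"
 by (rule red_distinct_adj[OF distinct_adj_red])

lemma even_length_act: "even (length (act a w)) \<longleftrightarrow> odd (length w)"
 by (cases w) (auto simp: act_def)

lemma even_length_red: "even (length (red w)) \<longleftrightarrow> even (length w)"
 by (induction w) (auto simp: red_Cons even_length_act)

lemma set_red: "set (red w) \<subseteq> set w"
proof (induction w)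
 case (Cons a w)
 have "set (act a v) \<subseteq> insert a (set v)" for v by (cases v) (auto simp: act_def)
 then show ?case using Cons by (auto simp: red_Cons)
qed simp

lemma foldr_act_rev: "distinct_adj v ==> foldr act (rev w) (foldr act w v) = v"
proof (induction w)
 case (Cons a w) then show ?case by (simp add: act_act distinct_adj_foldr_act)
qed simp

text \<open>A word of involutions is inverted by reading it backwards.\<close>

lemma red_append_eq_Nil_iff: "red (u @ v) = [] \<longleftrightarrow> red v = red (rev u)"
proof
 assume "red (u @ v) = []"
 then show "red v = red (rev u)"
  using foldr_act_rev[OF distinct_adj_red[of v], of u] by (simp add: red_append) (simp add: red_def)
next
 assume "red v = red (rev u)"
 then have "red (u @ v) = foldr act u (foldr act (rev u) [])" by (simp add: red_append) (simp add: red_def)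
 then show "red (u @ v) = []" using foldr_act_rev[of "[]" "rev u"] by simp
qed

lemma red_map_inj:
 assumes "inj f" shows "red (map f w) = map f (red w)"
proof (induction w)
 case (Cons a w)
 have "act (f a) (map f v) = map f (act a v)" for v
  by (cases v) (auto simp: act_def inj_eq[OF assms])
 then show ?case using Cons by (simp add: red_Cons)
qed simp

text \<open>Describes the reduced words whose product with their image under \<open>s\<close> is
  trivial: peeling off matching outer letters leaves nothing or one letter fixed by
  \<open>s\<close>. The prefix \<open>u\<close> later serves as a conjugator.\<close>

lemma palindrome_cases:
 assumes "w = rev (map s w)" "!!a. s (s a) = a"
 obtains u where "w = u @ rev (map s u)" | u a where "w = u @ [a] @ rev (map s u)" "s a = a"
proof -
 have "(\<exists>u. w = u @ rev (map s u)) \<or> (\<exists>u a. w = u @ [a] @ rev (map s u) \<and> s a = a)"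
  using assms(1)
 proof (induction "length w" arbitrary: w rule: less_induct)
  case less
  show ?case
  proof (cases w)
   case Nil then show ?thesis by (intro disjI1 exI[of _ "[]"]) simp
  next
   case (Cons a v)
   show ?thesis
   proof (cases v rule: rev_cases)
    case Nil
    have "s a = a" using less.prems unfolding Cons Nil by simp
    then show ?thesis unfolding Cons Nil by (intro disjI2 exI[of _ "[]"] exI[of _ a]) simp
   next
    case (snoc x b)
    have "a # x @ [b] = s b # rev (map s x) @ [s a]"
    proof -
     have "rev (map s (a # x @ [b])) = s b # rev (map s x) @ [s a]" by simp
     with less.prems[unfolded Cons snoc] show ?thesis by (rule HOL.trans)
    qed
    then have "x @ [b] = rev (map s x) @ [s a]" by (simp only: list.inject)
    then have *: "x = rev (map s x)" "b = s a" by (simp_all only: append1_eq_conv)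
    have "length x < length w" using Cons snoc by simp
    from less.hyps[OF this *(1)]
    have "(\<exists>u. x = u @ rev (map s u)) \<or> (\<exists>u c. x = u @ [c] @ rev (map s u) \<and> s c = c)" .
    then show ?thesis
    proof (elim disjE exE conjE)
     fix u assume "x = u @ rev (map s u)"
     then show ?thesis unfolding Cons snoc *(2) by (intro disjI1 exI[of _ "a # u"]) simp
    next
     fix u c assume "x = u @ [c] @ rev (map s u)" "s c = c"
     then show ?thesis unfolding Cons snoc *(2) by (intro disjI2 exI[of _ "a # u"] exI[of _ c]) simp
    qed
   qed
  qed
 qed
 then show thesis
 proof (elim disjE exE conjE)
  fix u assume "w = u @ rev (map s u)" then show thesis by (rule that(1))
 next
  fix u a assume "w = u @ [a] @ rev (map s u)" "s a = a" then show thesis by (rule that(2))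
 qed
qed

section \<open>Polygons in a cover by convex sets and their elementary homotopies\<close>

section \<open>Polygonal paths\<close>

fun polygon :: "'v::real_normed_vector list => real => 'v" where
 "polygon [] = linepath 0 0"
| "polygon [x] = linepath x x"
| "polygon (x # y # r) = linepath x y +++ polygon (y # r)"

lemma pathstart_polygon [simp]: "xs ~= [] ==> pathstart (polygon xs) = hd xs"
 by (induction xs rule: polygon.induct) auto

lemma pathfinish_polygon [simp]: "xs ~= [] ==> pathfinish (polygon xs) = last xs"
 by (induction xs rule: polygon.induct) auto

lemma path_polygon [simp]: "path (polygon xs)"
proof (induction xs rule: polygon.induct)
 case 1 show ?case unfolding polygon.simps by (rule path_linepath)
next
 case (2 x) show ?case unfolding polygon.simps by (rule path_linepath)
qed auto

locale convex_cover =
 fixes charts :: "'v::real_normed_vector set set"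
 assumes convex_chart: "C \<in> charts ==> convex C"
begin

definition near :: "'v => 'v => bool" where
 "near x y \<longleftrightarrow> (\<exists>C\<in>charts. x \<in> C \<and> y \<in> C)"

lemma near_segment: "near x y ==> closed_segment x y \<subseteq> \<Union>charts"
 unfolding near_def using closed_segment_subset convex_chart by blast

fun chain :: "'v list => bool" where
 "chain [] \<longleftrightarrow> True"
| "chain [x] \<longleftrightarrow> x \<in> \<Union>charts"
| "chain (x # y # r) \<longleftrightarrow> near x y \<and> chain (y # r)"

lemma chain_image: "chain xs ==> xs ~= [] ==> path_image (polygon xs) \<subseteq> \<Union>charts"
proof (induction xs rule: polygon.induct)
 case (3 x y r)
 then have "path_image (linepath x y) \<subseteq> \<Union>charts" "path_image (polygon (y # r)) \<subseteq> \<Union>charts"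
  using near_segment by (simp_all only: chain.simps path_image_linepath list.simps(3) simp_thms)
 then show ?case unfolding polygon.simps by (rule subset_path_image_join)
qed (simp_all del: linepath_refl)

lemma near_in: "near x y ==> x \<in> \<Union>charts" "near x y ==> y \<in> \<Union>charts"
 unfolding near_def by blast+

lemma chain_Cons: "ys ~= [] ==> chain (x # ys) \<longleftrightarrow> near x (hd ys) \<and> chain ys"
 by (cases ys) auto

inductive eqv :: "'v list => 'v list => bool" where
 refl: "eqv xs xs"
| sym: "eqv xs ys ==> eqv ys xs"
| trans: "eqv xs ys ==> eqv ys zs ==> eqv xs zs"
| skip: "C \<in> charts ==> x \<in> C ==> y \<in> C ==> z \<in> C ==> eqv (us @ x # y # z # vs) (us @ x # z # vs)"
| dup: "eqv (us @ x # x # vs) (us @ x # vs)"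

lemma eqv_context: "eqv xs ys ==> eqv (us @ xs @ vs) (us @ ys @ vs)"
proof (induction rule: eqv.induct)
 case (skip C x y z us' vs')
 then show ?case using eqv.skip[OF skip, of "us @ us'" "vs' @ vs"] by simp
next
 case (dup us' x vs')
 then show ?case using eqv.dup[of "us @ us'" x "vs' @ vs"] by simp
next
 case (refl xs) show ?case by (rule eqv.refl)
next
 case (sym xs ys) show ?case by (rule eqv.sym[OF sym.IH])
next
 case (trans xs ys zs) show ?case by (rule eqv.trans[OF trans.IH])
qed

lemma eqv_Cons: "eqv xs ys ==> eqv (a # xs) (a # ys)"
 using eqv_context[of xs ys "[a]" "[]"] by simp

lemma eqv_append:
 assumes "eqv xs ys" "eqv xs' ys'" shows "eqv (xs @ xs') (ys @ ys')"
proof (rule eqv.trans)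
 show "eqv (xs @ xs') (ys @ xs')" using eqv_context[OF assms(1), of "[]" xs'] by simp
 show "eqv (ys @ xs') (ys @ ys')" using eqv_context[OF assms(2), of ys "[]"] by simp
qed

lemma polygon_Cons_cong:
 assumes "homotopic_paths U (polygon xs) (polygon ys)" "xs ~= []" "ys ~= []" "closed_segment a (hd xs) \<subseteq> U"
 shows "homotopic_paths U (polygon (a # xs)) (polygon (a # ys))"
proof -
 have "hd xs = hd ys" using homotopic_paths_imp_pathstart[OF assms(1)] assms(2,3) by simp
 then have "polygon (a # xs) = linepath a (hd xs) +++ polygon xs" "polygon (a # ys) = linepath a (hd xs) +++ polygon ys"
  using assms(2,3) by (cases xs; cases ys; simp)+
 then show ?thesis using assms by (auto intro!: homotopic_paths_join)
qed

lemma convex_paths_homotopic: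
 assumes "C \<in> charts" "path p" "path q" "path_image p \<subseteq> C" "path_image q \<subseteq> C" "pathstart p = pathstart q" "pathfinish p = pathfinish q"
 shows "homotopic_paths (\<Union>charts) p q"
proof -
 have "homotopic_paths C (id \<circ> p) (id \<circ> q)"
  by (rule homotopic_paths_image_convex[OF convex_chart[OF assms(1)]]) (use assms in auto)
 then show ?thesis using assms(1) by (auto intro: homotopic_paths_subset)
qed

lemma eqv_hd_last: "eqv xs ys ==> hd xs = hd ys \<and> last xs = last ys \<and> (xs = [] \<longleftrightarrow> ys = [])"
proof (induction rule: eqv.induct)
 case (skip C x y z us vs)
 then show ?case by (cases us) auto
next
 case (dup us x vs)
 then show ?case by (cases us) auto
qed auto

lemma eqv_chain: "eqv xs ys ==> chain xs \<longleftrightarrow> chain ys"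
proof (induction rule: eqv.induct)
 case (skip C x y z us vs)
 show ?case
 proof (induction us)
  case Nil
  have "near x y" "near y z" "near x z" using skip unfolding near_def by blast+
  then show ?case by simp
 next
  case (Cons a us)
  have "hd (us @ x # y # z # vs) = hd (us @ x # z # vs)" by (cases us) auto
  then show ?case using Cons by (simp add: chain_Cons)
 qed
next
 case (dup us x vs)
 show ?case
 proof (induction us)
  case Nil
  have "near x x \<longleftrightarrow> x \<in> \<Union>charts" unfolding near_def by blast
  moreover have "chain (x # vs) ==> x \<in> \<Union>charts" using near_in(1) by (cases vs) auto
  ultimately show ?case by auto
 next
  case (Cons a us)
  have "hd (us @ x # x # vs) = hd (us @ x # vs)" by (cases us) auto
  then show ?case using Cons by (simp add: chain_Cons)
 qed
qed auto

lemma eqv_homotopic: "eqv xs ys ==> chain xs ==> xs ~= [] ==> homotopic_paths (\<Union>charts) (polygon xs) (polygon ys)"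
proof (induction rule: eqv.induct)
 case (refl xs) then show ?case using chain_image by simp
next
 case (sym xs ys)
 then have "homotopic_paths (\<Union>charts) (polygon xs) (polygon ys)" using eqv_chain[OF sym.hyps] eqv_hd_last[OF sym.hyps] by simp
 then show ?case by (rule homotopic_paths_sym)
next
 case (trans xs ys zs)
 then have "homotopic_paths (\<Union>charts) (polygon xs) (polygon ys)" "homotopic_paths (\<Union>charts) (polygon ys) (polygon zs)"
  using eqv_chain[OF trans.hyps(1)] eqv_hd_last[OF trans.hyps(1)] by simp_all
 then show ?case by (rule homotopic_paths_trans)
next
 case (skip C x y z us vs)
 show ?case using skip.prems
 proof (induction us)
  case Nil
  then have c: "chain (z # vs)" by simp
  let ?r = "polygon (z # vs)"
  have im: "path_image ?r \<subseteq> \<Union>charts" using chain_image[OF c] by simp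
  have sub: "closed_segment x y \<subseteq> C" "closed_segment y z \<subseteq> C" "closed_segment x z \<subseteq> C"
   using skip closed_segment_subset convex_chart by blast+
  have CU: "C \<subseteq> \<Union>charts" using skip by blast
  have "homotopic_paths (\<Union>charts) (linepath x y +++ (linepath y z +++ ?r)) ((linepath x y +++ linepath y z) +++ ?r)"
   by (rule homotopic_paths_assoc) (use order_trans[OF sub(1) CU] order_trans[OF sub(2) CU] im in "simp_all add: path_image_linepath")
  also have "homotopic_paths (\<Union>charts) ((linepath x y +++ linepath y z) +++ ?r) (linepath x z +++ ?r)"
  proof (rule homotopic_paths_join)
   show "homotopic_paths (\<Union>charts) (linepath x y +++ linepath y z) (linepath x z)"
    by (rule convex_paths_homotopic[OF skip(1)])
      (use sub in "simp_all add: path_image_linepath subset_path_image_join")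
  qed (use im in simp_all)
  finally show ?case by simp
 next
  case (Cons a us)
  have h: "chain (us @ x # y # z # vs)" "near a (hd (us @ x # y # z # vs))" using Cons.prems by (auto simp: chain_Cons)
  then have "homotopic_paths (\<Union>charts) (polygon (a # (us @ x # y # z # vs))) (polygon (a # (us @ x # z # vs)))"
   using Cons.IH near_segment by (intro polygon_Cons_cong) auto
  then show ?case by simp
 qed
next
 case (dup us x vs)
 show ?case using dup
 proof (induction us)
  case Nil
  then have c: "chain (x # vs)" by simp
  then show ?case using homotopic_paths_lid'[of "polygon (x # vs)" "\<Union>charts" x] chain_image[OF c] by (simp del: linepath_refl)
 next
  case (Cons a us)
  have h: "chain (us @ x # x # vs)" "near a (hd (us @ x # x # vs))" using Cons.prems by (auto simp: chain_Cons)
  then have "homotopic_paths (\<Union>charts) (polygon (a # (us @ x # x # vs))) (polygon (a # (us @ x # vs)))"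
   using Cons.IH near_segment by (intro polygon_Cons_cong) auto
  then show ?case by simp
 qed
qed

lemma polygon_append:
 "chain (xs @ [z]) ==> chain (z # ys) ==>
  homotopic_paths (\<Union>charts) (polygon (xs @ [z]) +++ polygon (z # ys)) (polygon (xs @ z # ys))"
proof (induction xs)
 case Nil
 have "homotopic_paths (\<Union>charts) (linepath z z +++ polygon (z # ys)) (polygon (z # ys))"
  by (rule homotopic_paths_lid') (use chain_image[OF Nil(2)] in simp_all)
 then show ?case unfolding append_Nil polygon.simps(2) .
next
 case (Cons a xs)
 let ?p = "polygon (xs @ [z])" and ?q = "polygon (z # ys)" and ?b = "hd (xs @ [z])"
 have b: "hd (xs @ z # ys) = ?b" by (cases xs) auto
 have h: "chain (xs @ [z])" "near a ?b" using Cons.prems by (auto simp: chain_Cons)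
 have e: "polygon (a # xs @ [z]) = linepath a ?b +++ ?p" "polygon (a # xs @ z # ys) = linepath a ?b +++ polygon (xs @ z # ys)"
  by (cases xs; simp)+
 have im: "path_image ?p \<subseteq> \<Union>charts" "path_image ?q \<subseteq> \<Union>charts" "closed_segment a ?b \<subseteq> \<Union>charts"
  using chain_image[OF h(1)] chain_image[OF Cons.prems(2)] near_segment[OF h(2)] by auto
 have "homotopic_paths (\<Union>charts) ((linepath a ?b +++ ?p) +++ ?q) (linepath a ?b +++ (?p +++ ?q))"
  by (rule homotopic_paths_sym, rule homotopic_paths_assoc) (use im in "simp_all add: path_image_linepath")
 moreover have "homotopic_paths (\<Union>charts) (linepath a ?b +++ (?p +++ ?q)) (linepath a ?b +++ polygon (xs @ z # ys))"
  by (rule homotopic_paths_join[OF _ Cons.IH[OF h(1) Cons.prems(2)]]) (use im in "simp_all add: path_image_linepath")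
 ultimately show ?case unfolding append_Cons e by (rule homotopic_paths_trans)
qed

end

lemma red_map_red: "red (map f (red w)) = red (map f w)"
proof (induction w)
 case (Cons a w)
 have "red (map f (act a v)) = act (f a) (red (map f v))" for v
  by (cases v) (auto simp: act_def[of a] red_Cons act_act distinct_adj_red)
 then show ?case using Cons by (simp add: red_Cons)
qed simp

section \<open>Combs: the word of a path is a complete homotopy invariant\<close>

section \<open>Two convex sets joined by convex bridges\<close>

text \<open>A thickened graph with two vertices \<open>N\<close> and \<open>S\<close> and one edge
  for each bridge in \<open>BB\<close>, a possibly infinite family. Up to homotopy a path is given
  by the word of bridges that it crosses; letters are involutions because crossing a bridge twice in
  succession leads there and back.\<close>

locale comb =
 fixes N S :: "'v::real_normed_vector set" and BB :: "'v set set"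
 assumes open_N: "open N" and convex_N: "convex N" and N_ne: "N ~= {}"
  and open_S: "open S" and convex_S: "convex S" and S_ne: "S ~= {}"
  and NS: "N \<inter> S = {}"
  and open_B: "B \<in> BB ==> open B" and convex_B: "B \<in> BB ==> convex B"
  and B_N: "B \<in> BB ==> B \<inter> N ~= {}" and B_S: "B \<in> BB ==> B \<inter> S ~= {}"
  and B_disj: "B \<in> BB ==> B' \<in> BB ==> x \<in> B ==> x \<in> B' ==> B = B'"
begin

definition charts :: "'v set set" where "charts = insert N (insert S BB)"

text \<open>A crossing is counted at the \<open>S\<close> end of a bridge; the bridge itself counts
  as part of the \<open>N\<close> side.\<close>

definition change :: "'v set => 'v set => 'v set list => 'v set list" where
 "change C D = (if C = S \<and> D \<in> BB then act D else if C \<in> BB \<and> D = S then act C else (%w. w))"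

definition letters :: "'v set => 'v set => 'v set list" where
 "letters C D = (if C = S \<and> D \<in> BB then [D] else if C \<in> BB \<and> D = S then [C] else [])"

lemma NS_neq [simp]: "N ~= S" "S ~= N" and NB [simp]: "N \<notin> BB" and SB [simp]: "S \<notin> BB"
 using NS N_ne S_ne B_S[of N] B_N[of S] by (auto simp: Int_commute)

lemma B_neq [simp]: "B \<in> BB ==> B ~= N" "B \<in> BB ==> B ~= S"
 by auto

lemma charts_cases:
 assumes "C \<in> charts" obtains "C = N" | "C = S" | "C \<in> BB"
 using assms unfolding charts_def by blast

lemma in_charts [simp]: "N \<in> charts" "S \<in> charts" "B \<in> BB ==> B \<in> charts"
 by (auto simp: charts_def)

lemma change_letters: "change E C w = foldr act (letters C E) w"
 unfolding change_def letters_def by auto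

lemma chart_pair_cases:
 assumes "C \<in> charts" "E \<in> charts" "x \<in> C" "x \<in> E"
 obtains "C = E" | "C = N" "E \<in> BB" | "C \<in> BB" "E = N" | "C = S" "E \<in> BB" | "C \<in> BB" "E = S"
 using assms NS B_disj unfolding charts_def by blast

sublocale convex_cover charts
 by unfold_locales (auto simp: charts_def convex_N convex_S convex_B)

sublocale flat_bundle charts change "{w. distinct_adj w}"
proof
 show "open C" if "C \<in> charts" for C using that by (auto simp: charts_def open_N open_S open_B)
 show "change C D w \<in> {w. distinct_adj w}" if "w \<in> {w. distinct_adj w}" for C D w
  using that by (simp add: change_def distinct_adj_act)
 show "change C C w = w" for C w by (auto simp: change_def)
 fix C D E x and w :: "'v set list"
 assume *: "C \<in> charts" "D \<in> charts" "E \<in> charts" "x \<in> C" "x \<in> D" "x \<in> E" "w \<in> {w. distinct_adj w}"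
 then have w: "distinct_adj w" by simp
 show "change D E (change C D w) = change C E w"
 proof (cases "x \<in> S")
  case False
  then have "C ~= S" "D ~= S" "E ~= S" using * by auto
  then show ?thesis by (simp add: change_def)
 next
  case True
  then have "x \<notin> N" using NS by blast
  then have **: "C = S \<or> C \<in> BB" "D = S \<or> D \<in> BB" "E = S \<or> E \<in> BB" using * by (auto simp: charts_def)
  have e: "C \<in> BB ==> D \<in> BB ==> D = C" "C \<in> BB ==> E \<in> BB ==> E = C" "D \<in> BB ==> E \<in> BB ==> E = D"
   using B_disj *(4-6) by blast+
  show ?thesis
   using ** by (elim disjE) (auto simp: change_def act_act[OF w] dest: e)
 qed
qed

text \<open>\<open>ws\<close> is a word of the path, not necessarily reduced: transport takes
  \<open>foldr act ws v\<close> at the start to \<open>v\<close> at the end. The parity clause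
  records whether the path changes sides.\<close>

definition hol :: "(real => 'v) => real => real => 'v set => 'v set => 'v set list => bool" where
 "hol p a b C D ws \<longleftrightarrow> set ws \<subseteq> BB \<and> (((C = S) = (D = S)) = even (length ws)) \<and>
   (\<forall>v. distinct_adj v --> transp p a b C D (foldr act ws v) v)"

lemma holD:
 assumes "hol p a b C D ws"
 shows "set ws \<subseteq> BB" "((C = S) = (D = S)) = even (length ws)"
  "distinct_adj v ==> transp p a b C D (foldr act ws v) v"
  "C \<in> charts" "D \<in> charts" "p a \<in> C" "p b \<in> D" "continuous_on {a..b} p"
proof -
 note d = assms[unfolded hol_def]
 show "set ws \<subseteq> BB" "((C = S) = (D = S)) = even (length ws)" using d by simp_all
 have 1: "transp p a b C D (foldr act ws v) v" if "distinct_adj v" for v using d that by simp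
 show "distinct_adj v ==> transp p a b C D (foldr act ws v) v" by (rule 1)
 have "distinct_adj ([] :: 'v set list)" by simp
 from transpD[OF 1[OF this]] transp_continuous[OF 1[OF this]]
 show "C \<in> charts" "D \<in> charts" "p a \<in> C" "p b \<in> D" "continuous_on {a..b} p" by simp_all
qed

lemma hol_red_cong:
 assumes "hol p a b C D ws" "red ws = red ws'" "set ws' \<subseteq> BB"
 shows "hol p a b C D ws'"
proof -
 have "foldr act ws v = foldr act ws' v" if "distinct_adj v" for v
  using assms(2) foldr_act_red[OF that] by metis
 moreover have "even (length ws) = even (length ws')"
  using assms(2) even_length_red by metis
 ultimately show ?thesis using assms unfolding hol_def by simp
qed

lemma parity_trans: "((a = b) = x) ==> ((b = c) = y) ==> ((a = c) = (x = y))" for a b c x y :: bool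
 by blast

lemma hol_trans:
 assumes "hol p a m C E ws" "hol p m b E D ws'" "a \<le> m" "m \<le> b"
 shows "hol p a b C D (ws @ ws')"
 unfolding hol_def
proof (intro conjI allI impI)
 show "set (ws @ ws') \<subseteq> BB"
  using holD(1)[OF assms(1)] holD(1)[OF assms(2)] by simp
 show "((C = S) = (D = S)) = even (length (ws @ ws'))"
  unfolding length_append even_add by (rule parity_trans[OF holD(2)[OF assms(1)] holD(2)[OF assms(2)]])
 fix v :: "'v set list" assume v: "distinct_adj v"
 show "transp p a b C D (foldr act (ws @ ws') v) v"
  using transp_trans[OF holD(3)[OF assms(1) distinct_adj_foldr_act[OF v]] holD(3)[OF assms(2) v] assms(3,4)] by simp
qed

lemma hol_join:
 assumes "hol p 0 1 C E ws" "hol q 0 1 E D ws'" "pathfinish p = pathstart q"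
 shows "hol (p +++ q) 0 1 C D (ws @ ws')"
 unfolding hol_def
proof (intro conjI allI impI)
 show "set (ws @ ws') \<subseteq> BB"
  using holD(1)[OF assms(1)] holD(1)[OF assms(2)] by simp
 show "((C = S) = (D = S)) = even (length (ws @ ws'))"
  unfolding length_append even_add by (rule parity_trans[OF holD(2)[OF assms(1)] holD(2)[OF assms(2)]])
 fix v :: "'v set list" assume v: "distinct_adj v"
 show "transp (p +++ q) 0 1 C D (foldr act (ws @ ws') v) v"
  using transp_join[OF holD(3)[OF assms(1) distinct_adj_foldr_act[OF v]] holD(3)[OF assms(2) v] assms(3)] by simp
qed

lemma parity_letters:
 assumes "C \<in> charts" "E \<in> charts" "x \<in> C" "x \<in> E"
 shows "((C = S) = (E = S)) = even (length (letters C E))" "set (letters C E) \<subseteq> BB"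
proof -
 have "((C = S) = (E = S)) = even (length (letters C E)) \<and> set (letters C E) \<subseteq> BB"
  using assms
 proof (cases rule: chart_pair_cases)
  case 1 then show ?thesis unfolding letters_def by (cases "E = S") simp_all
 qed (simp_all add: letters_def)
 then show "((C = S) = (E = S)) = even (length (letters C E))" "set (letters C E) \<subseteq> BB" by simp_all
qed

lemma hol_chart:
 assumes "continuous_on {a..b} p" "!!t. t \<in> {a..b} ==> p t \<in> E" and E: "E \<in> charts" and ab: "a \<le> b"
  and C: "C \<in> charts" "p a \<in> C" and D: "D \<in> charts" "p b \<in> D"
 shows "hol p a b C D (letters C E @ letters E D)"
 unfolding hol_def
proof (intro conjI allI impI)
 have ends: "p a \<in> E" "p b \<in> E" using assms(2) ab by auto
 show "set (letters C E @ letters E D) \<subseteq> BB"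
  using parity_letters(2)[OF C(1) E C(2) ends(1)] parity_letters(2)[OF E D(1) ends(2) D(2)] by simp
 show "((C = S) = (D = S)) = even (length (letters C E @ letters E D))"
  unfolding length_append even_add
  by (rule parity_trans[OF parity_letters(1)[OF C(1) E C(2) ends(1)] parity_letters(1)[OF E D(1) ends(2) D(2)]])
 fix v :: "'v set list" assume v: "distinct_adj v"
 let ?u = "foldr act (letters E D) v" and ?w = "foldr act (letters C E @ letters E D) v"
 have w: "?w \<in> {w. distinct_adj w}" using v by (simp add: distinct_adj_foldr_act)
 have u: "?u \<in> {w. distinct_adj w}" using v by (simp add: distinct_adj_foldr_act)
 have vv: "v \<in> {w. distinct_adj w}" using v by simp
 have "change C E ?w = change C E (change E C ?u)" by (simp add: change_letters)
 also have "\<dots> = ?u" using g_cocycle[OF E C(1) E ends(1) C(2) ends(1) u] g_id[OF E u] by simp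
 finally have "change E D (change C E ?w) = change E D (change D E v)" by (simp add: change_letters)
 also have "\<dots> = v" using g_cocycle[OF D(1) E D(1) D(2) ends(2) D(2) vv] g_id[OF D(1) vv] by simp
 finally show "transp p a b C D ?w v"
  using transp_chart[OF assms(1,2) E ab C D w] by simp
qed

lemma hol_homotopic:
 assumes "homotopic_paths (\<Union>charts) p q" "hol p 0 1 C D ws"
 shows "hol q 0 1 C D ws"
 unfolding hol_def
proof (intro conjI allI impI)
 show "set ws \<subseteq> BB" "((C = S) = (D = S)) = even (length ws)" by (rule holD(1,2)[OF assms(2)])+
 fix v :: "'v set list" assume v: "distinct_adj v"
 then have "foldr act ws v \<in> {w. distinct_adj w}" by (simp add: distinct_adj_foldr_act)
 then show "transp q 0 1 C D (foldr act ws v) v"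
  by (rule transp_homotopic[OF assms(1) order_refl holD(3)[OF assms(2) v]])
qed

lemma hol_unique:
 assumes "hol p a b C D ws" "hol p a b C D ws'" "a \<le> b" shows "red ws = red ws'"
proof -
 have n: "distinct_adj ([] :: 'v set list)" by simp
 show ?thesis unfolding red_def
  by (rule transp_left_unique[OF holD(3)[OF assms(1) n] holD(3)[OF assms(2) n] assms(3)])
qed

definition bN :: 'v where "bN = (SOME x. x \<in> N)"
definition bS :: 'v where "bS = (SOME x. x \<in> S)"
definition pN :: "'v set => 'v" where "pN B = (SOME x. x \<in> B \<inter> N)"
definition pS :: "'v set => 'v" where "pS B = (SOME x. x \<in> B \<inter> S)"

lemma bN [simp]: "bN \<in> N" unfolding bN_def using N_ne some_in_eq by blast
lemma bS [simp]: "bS \<in> S" unfolding bS_def using S_ne some_in_eq by blast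
lemma pN [simp]: assumes "B \<in> BB" shows "pN B \<in> B" "pN B \<in> N"
 using someI_ex[of "%x. x \<in> B \<inter> N"] B_N[OF assms] unfolding pN_def by blast+
lemma pS [simp]: assumes "B \<in> BB" shows "pS B \<in> B" "pS B \<in> S"
 using someI_ex[of "%x. x \<in> B \<inter> S"] B_S[OF assms] unfolding pS_def by blast+

definition base :: "bool => 'v" where "base s = (if s then bS else bN)"
definition side :: "bool => 'v set" where "side s = (if s then S else N)"
definition pt :: "bool => 'v set => 'v" where "pt s B = (if s then pS B else pN B)"

lemma base_side [simp]: "base s \<in> side s" and side_charts [simp]: "side s \<in> charts"
 and pt [simp]: "B \<in> BB ==> pt s B \<in> B" "B \<in> BB ==> pt s B \<in> side s"
 by (auto simp: base_def side_def pt_def)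

text \<open>The way from a chart to the base point of its side, where a bridge belongs to the side
  of \<open>N\<close>.\<close>

definition tail :: "'v set => 'v list" where
 "tail C = (if C \<in> BB then [pt False C, base False] else [base (C = S)])"

primrec track :: "'v set list => bool => 'v list" where
 "track [] s = []"
| "track (a # w) s = pt s a # pt (\<not> s) a # base (\<not> s) # track w (\<not> s)"

text \<open>The standard polygon of a word: to a base point, across the bridges one after the other,
  and out to \<open>y\<close>.\<close>

definition route :: "'v => 'v set => 'v set list => 'v set => 'v => 'v list" where
 "route x C ws D y = x # tail C @ track ws (C = S) @ rev (tail D) @ [y]"

declare eqv.trans [trans]

lemma skip0: "C \<in> charts ==> x \<in> C ==> y \<in> C ==> z \<in> C ==> eqv (x # y # z # vs) (x # z # vs)"
 using eqv.skip[of C x y z "[]"] by simp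

lemma dup0: "eqv (x # x # vs) (x # vs)"
 using eqv.dup[of "[]"] by simp

lemma back0: "C \<in> charts ==> x \<in> C ==> y \<in> C ==> eqv (x # y # x # vs) (x # vs)"
 using skip0[of C x y x vs] dup0 eqv.trans by blast

lemma route_chart:
 assumes C: "C \<in> charts" "x \<in> C" "y \<in> C"
 shows "eqv [x, y] (x # tail C @ rev (tail C) @ [y])"
 using C(1)
proof (cases rule: charts_cases)
 case 3
 have "eqv (x # pt False C # base False # base False # pt False C # [y]) (x # pt False C # base False # pt False C # [y])"
  by (intro eqv_Cons dup0)
 also have "eqv \<dots> (x # pt False C # [y])"
  by (intro eqv_Cons back0[of "side False"]) (use 3 in auto)
 also have "eqv \<dots> [x, y]" by (rule skip0[of C]) (use C 3 in auto)
 finally show ?thesis using 3 by (simp add: tail_def eqv.sym)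
next
 case 1
 have "eqv (x # base False # base False # [y]) (x # base False # [y])" by (intro eqv_Cons dup0)
 also have "eqv \<dots> [x, y]" by (rule skip0[of "side False"]) (use C 1 in "auto simp: side_def base_def")
 finally show ?thesis using 1 by (simp add: tail_def eqv.sym)
next
 case 2
 have "eqv (x # base True # base True # [y]) (x # base True # [y])" by (intro eqv_Cons dup0)
 also have "eqv \<dots> [x, y]" by (rule skip0[of "side True"]) (use C 2 in "auto simp: side_def base_def")
 finally show ?thesis using 2 by (simp add: tail_def eqv.sym)
qed

lemma sideN: "side False = N" and sideS: "side True = S" by (auto simp: side_def)

lemma tail_change:
 assumes CE: "C \<in> charts" "E \<in> charts" "x \<in> C" "x \<in> E"
 shows "eqv (x # tail E) (x # tail C @ track (letters C E) (C = S))"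
 using CE
proof (cases rule: chart_pair_cases)
 case 1 then show ?thesis by (auto simp: letters_def intro: eqv.refl)
next
 case 2
 have "eqv (x # pt False E # [base False]) (x # [base False])"
  by (rule skip0[of N]) (use 2 CE in "auto simp: pt_def base_def")
 then show ?thesis using 2 by (simp add: letters_def tail_def)
next
 case 3
 have "eqv (x # pt False C # [base False]) (x # [base False])"
  by (rule skip0[of N]) (use 3 CE in "auto simp: pt_def base_def")
 then show ?thesis using 3 by (simp add: letters_def tail_def eqv.sym)
next
 case 4
 have "eqv (x # base True # pt True E # pt False E # [base False]) (x # pt True E # pt False E # [base False])"
  by (rule skip0[of S]) (use 4 CE in "auto simp: pt_def base_def")
 also have "eqv \<dots> (x # pt False E # [base False])"
  by (rule skip0[of E]) (use 4 CE in auto)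
 finally show ?thesis using 4 by (simp add: letters_def tail_def eqv.sym)
next
 case 5
 have "eqv (x # pt False C # base False # pt False C # pt True C # [base True]) (x # pt False C # pt True C # [base True])"
  by (intro eqv_Cons back0[of "side False"]) (use 5 in auto)
 also have "eqv \<dots> (x # pt True C # [base True])"
  by (rule skip0[of C]) (use 5 CE in auto)
 also have "eqv \<dots> (x # [base True])"
  by (rule skip0[of S]) (use 5 CE in "auto simp: pt_def base_def")
 finally show ?thesis using 5 by (simp add: letters_def tail_def eqv.sym)
qed

lemma tail_change':
 assumes CE: "C \<in> charts" "E \<in> charts" "y \<in> C" "y \<in> E"
 shows "eqv (base (E = S) # rev (tail E) @ [y]) (base (E = S) # track (letters E C) (E = S) @ rev (tail C) @ [y])"
 using CE
proof (cases rule: chart_pair_cases)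
 case 1 then show ?thesis by (auto simp: letters_def intro: eqv.refl)
next
 case 2
 have "eqv (base False # base False # pt False E # [y]) (base False # base False # [y])"
  by (intro eqv_Cons skip0[of N]) (use 2 CE in "auto simp: pt_def base_def")
 then show ?thesis using 2 by (simp add: letters_def tail_def)
next
 case 3
 have "eqv (base False # base False # pt False C # [y]) (base False # base False # [y])"
  by (intro eqv_Cons skip0[of N]) (use 3 CE in "auto simp: pt_def base_def")
 then show ?thesis using 3 by (simp add: letters_def tail_def eqv.sym)
next
 case 4
 have "eqv (base False # pt False E # pt True E # base True # base True # [y]) (base False # pt False E # pt True E # base True # [y])"
  by (intro eqv_Cons dup0)
 also have "eqv \<dots> (base False # pt False E # pt True E # [y])"
  by (intro eqv_Cons skip0[of S]) (use 4 CE in "auto simp: pt_def base_def")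
 also have "eqv \<dots> (base False # pt False E # [y])"
  by (intro eqv_Cons skip0[of E]) (use 4 CE in auto)
 also have "eqv \<dots> (base False # base False # pt False E # [y])"
  by (rule eqv.sym[OF dup0])
 finally show ?thesis using 4 by (simp add: letters_def tail_def eqv.sym)
next
 case 5
 have "eqv (base True # pt True C # pt False C # base False # base False # pt False C # [y]) (base True # pt True C # pt False C # base False # pt False C # [y])"
  by (intro eqv_Cons dup0)
 also have "eqv \<dots> (base True # pt True C # pt False C # [y])"
  by (intro eqv_Cons back0[of "side False"]) (use 5 in auto)
 also have "eqv \<dots> (base True # pt True C # [y])"
  by (intro eqv_Cons skip0[of C]) (use 5 CE in auto)
 also have "eqv \<dots> (base True # [y])"
  by (rule skip0[of S]) (use 5 CE in "auto simp: pt_def base_def")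
 also have "eqv \<dots> (base True # base True # [y])" by (rule eqv.sym[OF dup0])
 finally show ?thesis using 5 by (simp add: letters_def tail_def eqv.sym)
qed

lemma tail_last: "tail C = butlast (tail C) @ [base (C = S)]"
 unfolding tail_def by auto

lemma track_last: "\<exists>zs. base s # track ws s = zs @ [base (s = even (length ws))]"
proof (induction ws arbitrary: s)
 case (Cons a ws)
 obtain zs where "base (\<not> s) # track ws (\<not> s) = zs @ [base ((\<not> s) = even (length ws))]" using Cons by blast
 then have "base s # track (a # ws) s = (base s # pt s a # pt (\<not> s) a # zs) @ [base ((\<not> s) = even (length ws))]" by simp
 moreover have "((\<not> s) = even (length ws)) = (s = even (length (a # ws)))" by auto
 ultimately show ?case by (simp only:) blast
qed auto

lemma track_append: "track (u @ w) s = track u s @ track w (s = even (length u))"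
proof (induction u arbitrary: s)
 case (Cons a u)
 have "((\<not> s) = even (length u)) = (s = even (length (a # u)))" by auto
 then show ?case using Cons[of "\<not> s"] by simp
qed simp

lemma track_red: "set ws \<subseteq> BB ==> eqv (base s # track ws s) (base s # track (red ws) s)"
proof (induction ws arbitrary: s)
 case (Cons a w)
 have a: "a \<in> BB" using Cons.prems by simp
 have ih: "eqv (base (\<not> s) # track w (\<not> s)) (base (\<not> s) # track (red w) (\<not> s))"
  by (rule Cons.IH) (use Cons.prems in simp)
 have 1: "eqv (base s # track (a # w) s) (base s # pt s a # pt (\<not> s) a # base (\<not> s) # track (red w) (\<not> s))"
  using eqv_context[OF ih, of "[base s, pt s a, pt (\<not> s) a]" "[]"] by simp
 show ?case
 proof (cases "\<exists>v. red w = a # v")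
  case True
  then obtain v where v: "red w = a # v" by blast
  have "eqv (base s # pt s a # pt (\<not> s) a # base (\<not> s) # pt (\<not> s) a # pt s a # base s # track v s)
    (base s # pt s a # pt (\<not> s) a # pt s a # base s # track v s)"
   by (intro eqv_Cons back0[of "side (\<not> s)"]) (use a in auto)
  also have "eqv \<dots> (base s # pt s a # base s # track v s)"
   by (intro eqv_Cons back0[of a]) (use a in auto)
  also have "eqv \<dots> (base s # track v s)"
   by (rule back0[of "side s"]) (use a in auto)
  finally show ?thesis using eqv.trans[OF 1] v by (simp add: red_Cons act_def)
 next
  case False
  then have "red (a # w) = a # red w" by (cases "red w") (auto simp: red_Cons act_def)
  then show ?thesis using 1 by simp
 qed
qed (simp add: eqv.refl)

lemma route_red:
 assumes "set ws \<subseteq> BB" shows "eqv (route x C ws D y) (route x C (red ws) D y)"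
proof -
 have *: "route x C w D y = (x # butlast (tail C)) @ (base (C = S) # track w (C = S)) @ (rev (tail D) @ [y])" for w
  unfolding route_def by (subst tail_last) simp
 show ?thesis unfolding * by (rule eqv_context[OF track_red[OF assms]])
qed

lemma route_join:
 assumes E: "E \<in> charts" "z \<in> E" and par: "((C = S) = (E = S)) = even (length u)"
 shows "eqv (butlast (route x C u E z) @ route z E w D y) (route x C (u @ w) D y)"
proof -
 let ?e = "base (E = S)"
 have t: "eqv (rev (tail E) @ z # tail E) [?e]"
  using E(1)
 proof (cases rule: charts_cases)
  case 3
  have "eqv (base False # pt False E # z # pt False E # [base False]) (base False # pt False E # [base False])"
   by (intro eqv_Cons back0[of E]) (use 3 E in auto)
  also have "eqv \<dots> [base False]" by (rule back0[of "side False"]) (use 3 in auto)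
  finally show ?thesis using 3 by (simp add: tail_def)
 next
  case 1
  have "eqv (base False # z # [base False]) [base False]" by (rule back0[of "side False"]) (use 1 E in "auto simp: side_def base_def")
  then show ?thesis using 1 by (simp add: tail_def)
 next
  case 2
  have "eqv (base True # z # [base True]) [base True]" by (rule back0[of "side True"]) (use 2 E in "auto simp: side_def base_def")
  then show ?thesis using 2 by (simp add: tail_def)
 qed
 have s: "((C = S) = even (length u)) = (E = S)" using par by blast
 obtain zs where zs: "base (C = S) # track u (C = S) = zs @ [?e]"
  using track_last[of "C = S" u] unfolding s by blast
 have 1: "butlast (route x C u E z) = x # tail C @ track u (C = S) @ rev (tail E)"
  unfolding route_def by (simp add: butlast_append)
 have 2: "x # tail C @ track u (C = S) = (x # butlast (tail C) @ zs) @ [?e]"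
  using zs by (subst tail_last) simp
 have "butlast (route x C u E z) @ route z E w D y =
   (x # tail C @ track u (C = S)) @ (rev (tail E) @ z # tail E) @ (track w (E = S) @ rev (tail D) @ [y])"
  unfolding 1 by (simp add: route_def)
 also have "eqv \<dots> ((x # tail C @ track u (C = S)) @ [?e] @ (track w (E = S) @ rev (tail D) @ [y]))"
  by (rule eqv_context[OF t])
 also have "(x # tail C @ track u (C = S)) @ [?e] @ (track w (E = S) @ rev (tail D) @ [y])
   = (x # butlast (tail C) @ zs) @ [?e, ?e] @ (track w (E = S) @ rev (tail D) @ [y])"
  unfolding 2 by simp
 also have "eqv \<dots> ((x # butlast (tail C) @ zs) @ [?e] @ (track w (E = S) @ rev (tail D) @ [y]))"
  by (rule eqv_context[OF dup0])
 also have "(x # butlast (tail C) @ zs) @ [?e] @ (track w (E = S) @ rev (tail D) @ [y])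
   = route x C (u @ w) D y"
  unfolding route_def track_append s append_assoc[symmetric] 2[symmetric] by simp
 finally show ?thesis .
qed

lemma route_chart_word:
 assumes C: "C \<in> charts" "x \<in> C" and D: "D \<in> charts" "y \<in> D" and E: "E \<in> charts" "x \<in> E" "y \<in> E"
 shows "eqv [x, y] (route x C (letters C E @ letters E D) D y)"
proof -
 let ?e = "base (E = S)"
 have s: "((C = S) = even (length (letters C E))) = (E = S)"
  using parity_letters(1)[OF C(1) E(1) C(2) E(2)] by blast
 obtain zs0 where zs0: "base (C = S) # track (letters C E) (C = S) = zs0 @ [?e]"
  using track_last[of "C = S" "letters C E"] unfolding s by blast
 define zs where "zs = x # butlast (tail C) @ zs0"
 have zs: "x # tail C @ track (letters C E) (C = S) = zs @ [?e]"
  using zs0 unfolding zs_def by (subst tail_last) simp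
 have "eqv [x, y] ((x # tail E) @ rev (tail E) @ [y])" using route_chart[OF E] by simp
 also have "eqv \<dots> ((x # tail C @ track (letters C E) (C = S)) @ rev (tail E) @ [y])"
  by (rule eqv_append[OF tail_change[OF C(1) E(1) C(2) E(2)] eqv.refl])
 also have "(x # tail C @ track (letters C E) (C = S)) @ rev (tail E) @ [y] = zs @ (?e # rev (tail E) @ [y]) @ []"
  unfolding zs by simp
 also have "eqv \<dots> (zs @ (?e # track (letters E D) (E = S) @ rev (tail D) @ [y]) @ [])"
  by (rule eqv_context[OF tail_change'[OF D(1) E(1) D(2) E(3)]])
 also have "zs @ (?e # track (letters E D) (E = S) @ rev (tail D) @ [y]) @ []
   = (x # tail C @ track (letters C E) (C = S)) @ track (letters E D) (E = S) @ rev (tail D) @ [y]"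
  unfolding zs by simp
 also have "\<dots> = route x C (letters C E @ letters E D) D y"
  unfolding route_def track_append s by simp
 finally show ?thesis .
qed

lemma chain_append: "chain (xs @ [z]) ==> chain (z # ys) ==> chain (xs @ z # ys)"
proof (induction xs)
 case (Cons a xs)
 have "hd (xs @ [z]) = hd (xs @ z # ys)" by (cases xs) auto
 then show ?case using Cons by (simp add: chain_Cons)
qed simp

text \<open>A short piece lies in one chart, where it is homotopic to the standard polygon of a word
  of at most two letters; polygons of consecutive pieces combine by
  \<open>route_join\<close>.\<close>

lemma path_follows_word:
 assumes p: "path p" "path_image p \<subseteq> \<Union>charts"
  and C: "C \<in> charts" "p 0 \<in> C" and D: "D \<in> charts" "p 1 \<in> D"
 obtains ws where "hol p 0 1 C D ws" "chain (route (p 0) C ws D (p 1))"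
  "homotopic_paths (\<Union>charts) p (polygon (route (p 0) C ws D (p 1)))"
proof -
 define Q where "Q x y C D ws \<longleftrightarrow> hol p x y C D ws \<and> chain (route (p x) C ws D (p y)) \<and>
  homotopic_paths (\<Union>charts) (subpath x y p) (polygon (route (p x) C ws D (p y)))" for x y C D ws
 define P where "P x y \<longleftrightarrow> (\<forall>C\<in>charts. \<forall>D\<in>charts. p x \<in> C --> p y \<in> D --> (\<exists>ws. Q x y C D ws))" for x y
 have pc: "continuous_on {0..1} p" using p(1) by (simp add: path_def)
 have pU: "p t \<in> \<Union>charts" if "t \<in> {0..1}" for t using p(2) that unfolding path_image_def by blast
 have "P 0 1"
 proof (rule interval_induct[where P = P])
  fix x y z :: real assume xyz: "0 \<le> x" "x \<le> y" "y \<le> z" "z \<le> 1" and P1: "P x y" and P2: "P y z"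
  then have y: "y \<in> {0..1}" by simp
  obtain E where E: "E \<in> charts" "p y \<in> E" using pU[OF y] by blast
  show "P x z"
   unfolding P_def
  proof (intro ballI impI)
   fix C D assume CD: "C \<in> charts" "D \<in> charts" "p x \<in> C" "p z \<in> D"
   obtain u where "Q x y C E u" using P1 CD E unfolding P_def by blast
   then have u: "hol p x y C E u" "chain (route (p x) C u E (p y))"
    "homotopic_paths (\<Union>charts) (subpath x y p) (polygon (route (p x) C u E (p y)))" unfolding Q_def by simp_all
   obtain w where "Q y z E D w" using P2 CD E unfolding P_def by blast
   then have w: "hol p y z E D w" "chain (route (p y) E w D (p z))"
    "homotopic_paths (\<Union>charts) (subpath y z p) (polygon (route (p y) E w D (p z)))" unfolding Q_def by simp_all
   define b where "b = butlast (route (p x) C u E (p y))"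
   define r where "r = tl (route (p y) E w D (p z))"
   have b: "route (p x) C u E (p y) = b @ [p y]" unfolding b_def route_def by (simp add: butlast_append)
   have r: "route (p y) E w D (p z) = p y # r" unfolding r_def route_def by simp
   have e: "eqv (b @ p y # r) (route (p x) C (u @ w) D (p z))"
    using route_join[OF E holD(2)[OF u(1)], of "p x" w D "p z"] unfolding b_def[symmetric] r .
   have c: "chain (b @ p y # r)" using chain_append[of b "p y" r] u(2) w(2) unfolding b r by blast
   have "homotopic_paths (\<Union>charts) (subpath x z p) (subpath x y p +++ subpath y z p)"
    by (rule homotopic_paths_sym, rule homotopic_join_subpaths) (use p xyz in auto)
   also have "homotopic_paths (\<Union>charts) (subpath x y p +++ subpath y z p) (polygon (b @ [p y]) +++ polygon (p y # r))"
    using u(3) w(3) unfolding b r by (rule homotopic_paths_join) simp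
   also have "homotopic_paths (\<Union>charts) (polygon (b @ [p y]) +++ polygon (p y # r)) (polygon (b @ p y # r))"
    by (rule polygon_append) (use u(2) w(2) b r in simp_all)
   also have "homotopic_paths (\<Union>charts) (polygon (b @ p y # r)) (polygon (route (p x) C (u @ w) D (p z)))"
    by (rule eqv_homotopic[OF e c]) simp
   finally have "Q x z C D (u @ w)"
    unfolding Q_def using hol_trans[OF u(1) w(1) xyz(2,3)] eqv_chain[OF e] c by simp
   then show "\<exists>ws. Q x z C D ws" by blast
  qed
 next
  fix t :: real assume "0 \<le> t" "t \<le> 1"
  then have t: "t \<in> {0..1}" by simp
  obtain E where E: "E \<in> charts" "p t \<in> E" using pU[OF t] by blast
  obtain d where d: "d > 0" "!!s. s \<in> {0..1} ==> \<bar>s - t\<bar> < d ==> p s \<in> E"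
   using continuous_near[OF pc t E(2) open_chart[OF E(1)]] by blast
  show "\<exists>d>0. \<forall>x y. 0 \<le> x --> x \<le> t --> t \<le> y --> y \<le> 1 --> y - x < d --> P x y"
  proof (rule exI[of _ d], intro conjI allI impI)
   fix x y assume *: "0 \<le> x" "x \<le> t" "t \<le> y" "y \<le> 1" "y - x < d"
   have inE: "p s \<in> E" if "s \<in> {x..y}" for s
   proof -
    have "s \<in> {0..1}" "\<bar>s - t\<bar> < d" using that * unfolding atLeastAtMost_iff abs_less_iff by linarith+
    then show ?thesis by (rule d(2))
   qed
   have xy: "x \<le> y" "x \<in> {x..y}" "y \<in> {x..y}" using * by auto
   show "P x y"
    unfolding P_def
   proof (intro ballI impI)
    fix C D assume CD: "C \<in> charts" "D \<in> charts" "p x \<in> C" "p y \<in> D"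
    let ?ws = "letters C E @ letters E D"
    have e: "eqv [p x, p y] (route (p x) C ?ws D (p y))"
     by (rule route_chart_word[OF CD(1,3,2,4) E(1) inE[OF xy(2)] inE[OF xy(3)]])
    have "near (p x) (p y)" unfolding near_def using E(1) inE[OF xy(2)] inE[OF xy(3)] by blast
    then have c: "chain [p x, p y]" using near_in(2) by simp
    have sub: "path (subpath x y p)" "path_image (subpath x y p) \<subseteq> E"
    proof -
     show "path (subpath x y p)" using p(1) * by (intro path_subpath) auto
     show "path_image (subpath x y p) \<subseteq> E"
      unfolding path_image_subpath using xy inE by auto
    qed
    have "homotopic_paths (\<Union>charts) (subpath x y p) (polygon [p x, p y])"
    proof (rule convex_paths_homotopic[OF E(1) sub(1) _ sub(2)])
     have sg: "closed_segment (p x) (p y) \<subseteq> E" "closed_segment (p y) (p y) \<subseteq> E"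
      using closed_segment_subset[OF _ _ convex_chart[OF E(1)]] inE xy(2,3) by blast+
     show "path_image (polygon [p x, p y]) \<subseteq> E"
      unfolding polygon.simps by (rule subset_path_image_join; simp only: path_image_linepath sg)
    qed auto
    also have "homotopic_paths (\<Union>charts) (polygon [p x, p y]) (polygon (route (p x) C ?ws D (p y)))"
     by (rule eqv_homotopic[OF e c]) simp
    finally have h: "homotopic_paths (\<Union>charts) (subpath x y p) (polygon (route (p x) C ?ws D (p y)))" .
    have "hol p x y C D ?ws"
     by (rule hol_chart[OF _ inE E(1) xy(1) CD(1,3,2,4)])
       (use continuous_on_subset[OF pc] * in auto)
    then have "Q x y C D ?ws" unfolding Q_def using h eqv_chain[OF e] c by blast
    then show "\<exists>ws. Q x y C D ws" by blast
   qed
  qed (rule d(1))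
 qed simp
 then obtain ws where "Q 0 1 C D ws" unfolding P_def using C D by blast
 then show thesis unfolding Q_def subpath_trivial by (elim conjE) (rule that)
qed

text \<open>Both paths deform to the standard polygon of their common reduced word. Together with
  \<open>hol_unique\<close> and \<open>hol_homotopic\<close> this makes the reduced word a complete
  invariant.\<close>

theorem homotopic_if_same_word:
 assumes p: "path_image p \<subseteq> \<Union>charts" "hol p 0 1 C D ws" and q: "path_image q \<subseteq> \<Union>charts" "hol q 0 1 C D ws'"
  and "red ws = red ws'" and ends: "p 0 = q 0" "p 1 = q 1"
 shows "homotopic_paths (\<Union>charts) p q"
proof -
 have pp: "path p" "path q" using holD(8)[OF p(2)] holD(8)[OF q(2)] by (auto simp: path_def)
 have *: "homotopic_paths (\<Union>charts) r (polygon (route (r 0) C (red us) D (r 1)))"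
  if r: "path r" "path_image r \<subseteq> \<Union>charts" "hol r 0 1 C D us" for r us
 proof -
  note h = holD[OF r(3)]
  obtain vs where vs: "hol r 0 1 C D vs" "chain (route (r 0) C vs D (r 1))"
   "homotopic_paths (\<Union>charts) r (polygon (route (r 0) C vs D (r 1)))"
   using path_follows_word[OF r(1,2) h(4,6,5,7)] by blast
  have e: "red vs = red us" using hol_unique[OF vs(1) r(3)] by simp
  have "homotopic_paths (\<Union>charts) (polygon (route (r 0) C vs D (r 1))) (polygon (route (r 0) C (red vs) D (r 1)))"
   by (rule eqv_homotopic[OF route_red[OF holD(1)[OF vs(1)]] vs(2)]) (simp add: route_def)
  with vs(3) show ?thesis unfolding e by (rule homotopic_paths_trans)
 qed
 show ?thesis
  using *[OF pp(1) p] *[OF pp(2) q] assms(5) ends by (metis homotopic_paths_sym homotopic_paths_trans)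
qed

end

section \<open>Squares and commutation of words\<close>

lemma red_rev: "red (rev w) = rev (red w)"
proof -
 have "red (w @ rev w) = []" unfolding red_append_eq_Nil_iff ..
 then have "red (red w @ rev w) = []" using red_append_cong[of "red w" w "rev w" "rev w"] by simp
 then have "red (rev w) = red (rev (red w))" unfolding red_append_eq_Nil_iff .
 also have "\<dots> = rev (red w)" by (rule red_distinct_adj) (simp add: distinct_adj_red)
 finally show ?thesis .
qed

lemma distinct_adj_even_palindrome: "distinct_adj (u @ rev u) ==> u = []"
 by (cases u rule: rev_cases) (auto simp: distinct_adj_append_iff)

text \<open>A trivial square makes the reduced word a palindrome, and a reduced palindrome of even
  length is empty because its two middle letters would coincide.\<close>

lemma red_square_trivial:
 assumes "red (w @ w) = []" "even (length w)" shows "red w = []"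
proof -
 have w: "red w = rev (map (%x. x) (red w))" using assms(1) unfolding red_append_eq_Nil_iff red_rev by simp
 show ?thesis
 proof (rule palindrome_cases[OF w])
  fix u assume "red w = u @ rev (map (%x. x) u)"
  then have u: "red w = u @ rev u" by simp
  then have "u = []" using distinct_adj_red[of w] distinct_adj_even_palindrome[of u] by simp
  then show ?thesis using u by simp
 next
  fix u a assume u: "red w = u @ [a] @ rev (map (%x. x) u)"
  have "even (length (red w))" using assms(2) even_length_red by blast
  then show ?thesis unfolding u by simp
 qed simp
qed

text \<open>With these choices nothing cancels on either side, and the two reduced words begin with
  different letters.\<close>

lemma red_commute_ne:
 assumes "red w ~= []" and "b ~= hd (red w)" "b ~= c" "c ~= hd (red w)" "b' ~= last (red w)" "b' ~= c'"
 shows "red (w @ [b', c']) ~= red ([b, c] @ w)"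
proof -
 have "red (w @ [b', c']) = red (red w @ [b', c'])" by (rule red_append_cong) simp_all
 also have "\<dots> = red w @ [b', c']"
  by (rule red_distinct_adj) (use assms distinct_adj_red[of w] in "simp add: distinct_adj_append_iff")
 finally have 1: "red (w @ [b', c']) = red w @ [b', c']" .
 have "red ([b, c] @ w) = red ([b, c] @ red w)" by (rule red_append_cong) simp_all
 also have "\<dots> = [b, c] @ red w"
  by (rule red_distinct_adj) (use assms distinct_adj_red[of w] in "simp add: distinct_adj_append_iff distinct_adj_Cons")
 finally have 2: "red ([b, c] @ w) = [b, c] @ red w" .
 show ?thesis
 proof
  assume "red (w @ [b', c']) = red ([b, c] @ w)"
  then have "red w @ [b', c'] = [b, c] @ red w" unfolding 1 2 .
  then have "hd (red w @ [b', c']) = b" by simp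
  then show False using assms(1,2) by simp
 qed
qed

section \<open>Realizing words by paths, and the effect of symmetries on words\<close>

context comb
begin

lemma side_eq_S [simp]: "(side s = S) = s"
 by (simp add: side_def)

lemma letters_self [simp]: "letters C C = []"
 by (auto simp: letters_def)

lemma hol_linepath:
 assumes "C \<in> charts" "x \<in> C" "D \<in> charts" "y \<in> D" "E \<in> charts" "x \<in> E" "y \<in> E"
 shows "hol (linepath x y) 0 1 C D (letters C E @ letters E D)" "path_image (linepath x y) \<subseteq> \<Union>charts"
proof -
 have sg: "closed_segment x y \<subseteq> E" using closed_segment_subset[OF assms(6,7) convex_chart[OF assms(5)]] .
 have "linepath x y t \<in> E" if "t \<in> {0..1}" for t
  using sg that unfolding path_image_linepath[symmetric] path_image_def by blast
 then show "hol (linepath x y) 0 1 C D (letters C E @ letters E D)"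
  by (intro hol_chart[of 0 1 _ E]) (use assms path_linepath[of x y] in "simp_all add: path_def linepath_0' linepath_1'")
 show "path_image (linepath x y) \<subseteq> \<Union>charts"
  unfolding path_image_linepath using sg assms(5) by blast
qed

lemma hol_const:
 assumes "C \<in> charts" "x \<in> C" shows "hol (%_. x) 0 1 C C []"
proof -
 have "hol (%_. x) 0 1 C C (letters C C @ letters C C)"
  by (rule hol_chart) (use assms in auto)
 then show ?thesis by simp
qed

definition realized :: "'v => 'v set => 'v set list => 'v set => 'v => bool" where
 "realized x C ws D y \<longleftrightarrow> (\<exists>p. path p \<and> path_image p \<subseteq> \<Union>charts \<and> p 0 = x \<and> p 1 = y \<and> hol p 0 1 C D ws)"

lemma realized_trans:
 assumes "realized x C u E z" "realized z E w D y" shows "realized x C (u @ w) D y"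
proof -
 from assms obtain p q where p: "path p" "path_image p \<subseteq> \<Union>charts" "p 0 = x" "p 1 = z" "hol p 0 1 C E u"
  and q: "path q" "path_image q \<subseteq> \<Union>charts" "q 0 = z" "q 1 = y" "hol q 0 1 E D w"
  unfolding realized_def by blast
 have pq: "pathfinish p = pathstart q" using p q by (simp add: pathstart_def pathfinish_def)
 show ?thesis
  unfolding realized_def
 proof (intro exI[of _ "p +++ q"] conjI)
  show "path (p +++ q)" using p q pq by simp
  show "path_image (p +++ q) \<subseteq> \<Union>charts" using p q by (intro subset_path_image_join)
  show "hol (p +++ q) 0 1 C D (u @ w)" by (rule hol_join[OF p(5) q(5) pq])
 qed (use p q in "simp_all add: joinpaths_def")
qed

lemma realized_line:
 assumes "C \<in> charts" "x \<in> C" "D \<in> charts" "y \<in> D" "E \<in> charts" "x \<in> E" "y \<in> E"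
 shows "realized x C (letters C E @ letters E D) D y"
 unfolding realized_def
 by (intro exI[of _ "linepath x y"]) (use hol_linepath[OF assms] in "simp add: linepath_0' linepath_1'")

lemma hol_reverse:
 assumes p: "path p" "path_image p \<subseteq> \<Union>charts" "hol p 0 1 C D ws"
 shows "hol (reversepath p) 0 1 D C (rev ws)"
proof -
 note h = holD[OF p(3)]
 have r: "path (reversepath p)" "path_image (reversepath p) \<subseteq> \<Union>charts" "reversepath p 0 \<in> D" "reversepath p 1 \<in> C"
 proof -
  show "path (reversepath p)" "path_image (reversepath p) \<subseteq> \<Union>charts" using p(1,2) by simp_all
  show "reversepath p 0 \<in> D" "reversepath p 1 \<in> C" using h(6,7) by (simp_all add: reversepath_def)
 qed
 obtain vs where vs: "hol (reversepath p) 0 1 D C vs"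
  using path_follows_word[OF r(1,2) h(5) r(3) h(4) r(4)] by blast
 have "hol (p +++ reversepath p) 0 1 C C (ws @ vs)" by (rule hol_join[OF p(3) vs]) simp
 moreover have "homotopic_paths (\<Union>charts) (p +++ reversepath p) (linepath (pathstart p) (pathstart p))"
  by (rule homotopic_paths_rinv[OF p(1,2)])
 ultimately have 1: "hol (linepath (p 0) (p 0)) 0 1 C C (ws @ vs)"
  using hol_homotopic unfolding pathstart_def by blast
 have 2: "hol (linepath (p 0) (p 0)) 0 1 C C []"
  using hol_linepath(1)[OF h(4,6,4,6,4,6,6)] by simp
 have "red (ws @ vs) = []" using hol_unique[OF 1 2] by simp
 then have "red vs = red (rev ws)" unfolding red_append_eq_Nil_iff .
 then show ?thesis by (rule hol_red_cong[OF vs]) (use h(1) in simp)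
qed

lemma realized_reverse: assumes "realized x C ws D y" shows "realized y D (rev ws) C x"
proof -
 from assms obtain p where p: "path p" "path_image p \<subseteq> \<Union>charts" "p 0 = x" "p 1 = y" "hol p 0 1 C D ws"
  unfolding realized_def by blast
 show ?thesis
  unfolding realized_def
 proof (intro exI[of _ "reversepath p"] conjI)
  show "reversepath p 0 = y" "reversepath p 1 = x" using p(3,4) by (simp_all add: reversepath_def)
 qed (use p hol_reverse[OF p(1,2,5)] in simp_all)
qed

lemma realized_to_base:
 assumes C: "C \<in> charts" "x \<in> C" shows "realized x C [] (side (C = S)) (base (C = S))"
 using C(1)
proof (cases rule: charts_cases)
 case 3
 have "realized x C (letters C C @ letters C (side False)) (side False) (pt False C)"
  by (rule realized_line) (use C 3 in auto)
 moreover have "realized (pt False C) (side False) (letters (side False) (side False) @ letters (side False) (side False)) (side False) (base False)"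
  by (rule realized_line) (use 3 in auto)
 ultimately have "realized x C ((letters C C @ letters C (side False)) @ (letters (side False) (side False) @ letters (side False) (side False))) (side False) (base False)"
  by (rule realized_trans)
 then show ?thesis using 3 by (simp add: letters_def)
next
 case 1
 have "realized x (side False) (letters (side False) (side False) @ letters (side False) (side False)) (side False) (base False)"
  by (rule realized_line) (use 1 C in "auto simp: side_def base_def")
 then show ?thesis using 1 by (simp add: letters_def sideN)
next
 case 2
 have "realized x (side True) (letters (side True) (side True) @ letters (side True) (side True)) (side True) (base True)"
  by (rule realized_line) (use 2 C in "auto simp: side_def base_def")
 then show ?thesis using 2 by (simp add: letters_def sideS)
qed

lemma realized_base: "set ws \<subseteq> BB ==> realized (base s) (side s) ws (side (s = even (length ws))) (base (s = even (length ws)))"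
proof (induction ws arbitrary: s)
 case Nil
 have "realized (base s) (side s) (letters (side s) (side s) @ letters (side s) (side s)) (side s) (base s)"
  by (rule realized_line) auto
 then show ?case by simp
next
 case (Cons a w)
 then have a: "a \<in> BB" by simp
 have la: "letters (side s) a @ letters a (side (\<not> s)) = [a]"
  using a by (cases s) (simp_all add: letters_def side_def)
 have "realized (base s) (side s) (letters (side s) (side s) @ letters (side s) (side s)) (side s) (pt s a)"
  by (rule realized_line) (use a in auto)
 then have 1: "realized (base s) (side s) [] (side s) (pt s a)" by simp
 have "realized (pt s a) (side s) (letters (side s) a @ letters a (side (\<not> s))) (side (\<not> s)) (pt (\<not> s) a)"
  by (rule realized_line) (use a in auto)
 then have 2: "realized (pt s a) (side s) [a] (side (\<not> s)) (pt (\<not> s) a)" unfolding la .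
 have "realized (pt (\<not> s) a) (side (\<not> s)) (letters (side (\<not> s)) (side (\<not> s)) @ letters (side (\<not> s)) (side (\<not> s))) (side (\<not> s)) (base (\<not> s))"
  by (rule realized_line) (use a in auto)
 then have 3: "realized (pt (\<not> s) a) (side (\<not> s)) [] (side (\<not> s)) (base (\<not> s))" by simp
 have 4: "realized (base (\<not> s)) (side (\<not> s)) w (side ((\<not> s) = even (length w))) (base ((\<not> s) = even (length w)))"
  by (rule Cons.IH) (use Cons.prems in simp)
 from realized_trans[OF realized_trans[OF realized_trans[OF 1 2] 3] 4]
 have "realized (base s) (side s) (a # w) (side ((\<not> s) = even (length w))) (base ((\<not> s) = even (length w)))"
  by simp
 moreover have "((\<not> s) = even (length w)) = (s = even (length (a # w)))" by auto
 ultimately show ?case by simp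
qed

theorem realize_word:
 assumes C: "C \<in> charts" "x \<in> C" and D: "D \<in> charts" "y \<in> D"
  and ws: "set ws \<subseteq> BB" "((C = S) = (D = S)) = even (length ws)"
 obtains p where "path p" "path_image p \<subseteq> \<Union>charts" "p 0 = x" "p 1 = y" "hol p 0 1 C D ws"
proof -
 have s: "((C = S) = even (length ws)) = (D = S)" using ws(2) by blast
 have "realized x C ([] @ ws) (side (D = S)) (base (D = S))"
  using realized_trans[OF realized_to_base[OF C] realized_base[OF ws(1), of "C = S"]] unfolding s .
 from realized_trans[OF this realized_reverse[OF realized_to_base[OF D]]]
 have "realized x C ws D y" by simp
 then show thesis using that unfolding realized_def by blast
qed

lemma null_loop_word:
 assumes "path p" "path_image p \<subseteq> \<Union>charts" "p 0 = p 1" "hol p 0 1 C C ws"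
 shows "null_loop (\<Union>charts) p \<longleftrightarrow> red ws = []"
proof
 note h = holD[OF assms(4)]
 have c: "hol (%_. p 0) 0 1 C C []" by (rule hol_const[OF h(4,6)])
 show "red ws = []" if "null_loop (\<Union>charts) p"
  using hol_unique[OF hol_homotopic[OF that[unfolded null_loop_def pathstart_def] assms(4)] c] by simp
 show "null_loop (\<Union>charts) p" if "red ws = []"
  unfolding null_loop_def pathstart_def
  by (rule homotopic_if_same_word[OF assms(2,4) _ c]) (use h(4,6) assms(3) that in "auto simp: path_image_def")
qed

text \<open>The group of a comb has no elements of order two: closed paths have words of even
  length, to which \<open>red_square_trivial\<close> applies.\<close>

theorem null_loop_of_square:
 assumes p: "path p" "path_image p \<subseteq> \<Union>charts" "p 0 = p 1" and null: "null_loop (\<Union>charts) (p +++ p)"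
 shows "null_loop (\<Union>charts) p"
proof -
 have "p 0 \<in> \<Union>charts" using p(2) unfolding path_image_def by (rule subsetD) simp
 then obtain C where C: "C \<in> charts" "p 0 \<in> C" by blast
 then obtain ws where ws: "hol p 0 1 C C ws" using path_follows_word[OF p(1,2) C C(1)] p(3) by auto
 have ends: "pathfinish p = pathstart p" using p(3) by (simp add: pathstart_def pathfinish_def)
 have "hol (p +++ p) 0 1 C C (ws @ ws)" by (rule hol_join[OF ws ws ends])
 moreover have "path (p +++ p)" "path_image (p +++ p) \<subseteq> \<Union>charts" "(p +++ p) 0 = (p +++ p) 1"
 proof -
  show "path (p +++ p)" using p(1) ends by simp
  show "path_image (p +++ p) \<subseteq> \<Union>charts" using p(2) by (intro subset_path_image_join)
  show "(p +++ p) 0 = (p +++ p) 1" using p(3) by (simp add: joinpaths_def)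
 qed
 ultimately have "red (ws @ ws) = []" using null_loop_word null by blast
 moreover have "even (length ws)" using holD(2)[OF ws] by simp
 ultimately have "red ws = []" by (rule red_square_trivial)
 then show ?thesis using null_loop_word[OF p ws] by simp
qed

text \<open>A symmetry acts on words letter by letter. If it exchanges \<open>N\<close> and
  \<open>S\<close>, a bridge in which the path starts or ends is now counted from its other end,
  which costs the correcting letter \<epsilon>.\<close>

lemma hol_map:
 fixes sw :: bool and \<gamma> :: "'v => 'v" and f :: "'v set => 'v set"
 defines "\<epsilon> \<equiv> %C. if sw \<and> C \<in> BB then [f C] else []"
 assumes \<gamma>: "continuous_on (\<Union>charts) \<gamma>" "!!C x. C \<in> charts ==> x \<in> C ==> \<gamma> x \<in> f C"
  and f: "f N = side sw" "f S = side (\<not> sw)" "!!B. B \<in> BB ==> f B \<in> BB"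
  and p: "path p" "path_image p \<subseteq> \<Union>charts" "hol p 0 1 C D ws"
 shows "hol (\<gamma> \<circ> p) 0 1 (f C) (f D) (\<epsilon> C @ map f ws @ \<epsilon> D)"
proof -
 have fc: "f C \<in> charts" if "C \<in> charts" for C
  using that f by (cases rule: charts_cases) auto
 have \<epsilon>s: "set (\<epsilon> C) \<subseteq> BB" for C using f(3) unfolding \<epsilon>_def by (cases "sw \<and> C \<in> BB") auto
 have \<epsilon>2: "red (\<epsilon> C @ \<epsilon> C) = []" for C by (simp add: \<epsilon>_def red_def act_def)
 \<comment> \<open>At an inner point of a subdivision the correction occurs twice and
   cancels.\<close>
 have mid: "red (u @ \<epsilon> E @ \<epsilon> E @ w) = red (u @ w)" for u w E
 proof -
  have "red ((\<epsilon> E @ \<epsilon> E) @ w) = red ([] @ w)" using \<epsilon>2 by (intro red_append_cong) simp_all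
  then show ?thesis using red_append_cong[of u u "\<epsilon> E @ \<epsilon> E @ w" w] by simp
 qed
 have ls: "set (map f ws) \<subseteq> BB" if "set ws \<subseteq> BB" for ws using that f(3) by auto
 have le: "red (letters (f C) (f E)) = red (\<epsilon> C @ map f (letters C E) @ \<epsilon> E)"
  if "C \<in> charts" "E \<in> charts" "x \<in> C" "x \<in> E" for C E x
  using that
 proof (cases rule: chart_pair_cases)
  case 1
  have "letters (f E) (f E) = []" "letters E E = []" using fc[OF that(2)] by (auto simp: letters_def)
  then show ?thesis using 1 \<epsilon>2 by simp
 qed (use f in "cases sw; simp add: \<epsilon>_def letters_def side_def red_def act_def")+
 define Q where "Q x y C D us \<longleftrightarrow> hol p x y C D us \<and> hol (\<gamma> \<circ> p) x y (f C) (f D) (\<epsilon> C @ map f us @ \<epsilon> D)" for x y C D us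
 define P where "P x y \<longleftrightarrow> (\<forall>C\<in>charts. \<forall>D\<in>charts. p x \<in> C --> p y \<in> D --> (\<exists>us. Q x y C D us))" for x y
 have pc: "continuous_on {0..1} p" using p(1) by (simp add: path_def)
 have pU: "p t \<in> \<Union>charts" if "t \<in> {0..1}" for t using p(2) that unfolding path_image_def by blast
 have gc: "continuous_on {0..1} (\<gamma> \<circ> p)"
  by (rule continuous_on_compose[OF pc continuous_on_subset[OF \<gamma>(1)]]) (use pU in blast)
 have "P 0 1"
 proof (rule interval_induct[where P = P])
  fix x y z :: real assume xyz: "0 \<le> x" "x \<le> y" "y \<le> z" "z \<le> 1" and P1: "P x y" and P2: "P y z"
  then have y: "y \<in> {0..1}" by simp
  obtain E where E: "E \<in> charts" "p y \<in> E" using pU[OF y] by blast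
  show "P x z"
   unfolding P_def
  proof (intro ballI impI)
   fix C D assume CD: "C \<in> charts" "D \<in> charts" "p x \<in> C" "p z \<in> D"
   obtain u where "Q x y C E u" using P1 CD E unfolding P_def by blast
   then have u: "hol p x y C E u" "hol (\<gamma> \<circ> p) x y (f C) (f E) (\<epsilon> C @ map f u @ \<epsilon> E)" unfolding Q_def by simp_all
   obtain w where "Q y z E D w" using P2 CD E unfolding P_def by blast
   then have w: "hol p y z E D w" "hol (\<gamma> \<circ> p) y z (f E) (f D) (\<epsilon> E @ map f w @ \<epsilon> D)" unfolding Q_def by simp_all
   have "hol (\<gamma> \<circ> p) x z (f C) (f D) (\<epsilon> C @ map f (u @ w) @ \<epsilon> D)"
   proof (rule hol_red_cong[OF hol_trans[OF u(2) w(2) xyz(2,3)]])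
    show "red ((\<epsilon> C @ map f u @ \<epsilon> E) @ \<epsilon> E @ map f w @ \<epsilon> D) = red (\<epsilon> C @ map f (u @ w) @ \<epsilon> D)"
     using mid[of "\<epsilon> C @ map f u" E "map f w @ \<epsilon> D"] by simp
    show "set (\<epsilon> C @ map f (u @ w) @ \<epsilon> D) \<subseteq> BB"
     using \<epsilon>s ls[OF holD(1)[OF u(1)]] ls[OF holD(1)[OF w(1)]] by simp
   qed
   then have "Q x z C D (u @ w)" unfolding Q_def using hol_trans[OF u(1) w(1) xyz(2,3)] by simp
   then show "\<exists>us. Q x z C D us" by blast
  qed
 next
  fix t :: real assume "0 \<le> t" "t \<le> 1"
  then have t: "t \<in> {0..1}" by simp
  obtain E where E: "E \<in> charts" "p t \<in> E" using pU[OF t] by blast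
  obtain d where d: "d > 0" "!!s. s \<in> {0..1} ==> \<bar>s - t\<bar> < d ==> p s \<in> E"
   using continuous_near[OF pc t E(2) open_chart[OF E(1)]] by blast
  show "\<exists>d>0. \<forall>x y. 0 \<le> x --> x \<le> t --> t \<le> y --> y \<le> 1 --> y - x < d --> P x y"
  proof (rule exI[of _ d], intro conjI allI impI)
   fix x y assume *: "0 \<le> x" "x \<le> t" "t \<le> y" "y \<le> 1" "y - x < d"
   have inE: "p s \<in> E" if "s \<in> {x..y}" for s
   proof -
    have "s \<in> {0..1}" "\<bar>s - t\<bar> < d" using that * unfolding atLeastAtMost_iff abs_less_iff by linarith+
    then show ?thesis by (rule d(2))
   qed
   have inE': "(\<gamma> \<circ> p) s \<in> f E" if "s \<in> {x..y}" for s using \<gamma>(2)[OF E(1) inE[OF that]] by simp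
   have xy: "x \<le> y" "x \<in> {x..y}" "y \<in> {x..y}" "{x..y} \<subseteq> {0..1}" using * by auto
   show "P x y"
    unfolding P_def
   proof (intro ballI impI)
    fix C D assume CD: "C \<in> charts" "D \<in> charts" "p x \<in> C" "p y \<in> D"
    let ?ws = "letters C E @ letters E D"
    have CD': "(\<gamma> \<circ> p) x \<in> f C" "(\<gamma> \<circ> p) y \<in> f D" using \<gamma>(2) CD by simp_all
    have 1: "hol p x y C D ?ws"
     by (rule hol_chart[OF continuous_on_subset[OF pc xy(4)] inE E(1) xy(1) CD(1,3,2,4)])
    have 2: "hol (\<gamma> \<circ> p) x y (f C) (f D) (letters (f C) (f E) @ letters (f E) (f D))"
     by (rule hol_chart[OF continuous_on_subset[OF gc xy(4)] inE' fc[OF E(1)] xy(1) fc[OF CD(1)] CD'(1) fc[OF CD(2)] CD'(2)])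
    have "hol (\<gamma> \<circ> p) x y (f C) (f D) (\<epsilon> C @ map f ?ws @ \<epsilon> D)"
    proof (rule hol_red_cong[OF 2])
     have "red (letters (f C) (f E) @ letters (f E) (f D)) = red ((\<epsilon> C @ map f (letters C E) @ \<epsilon> E) @ (\<epsilon> E @ map f (letters E D) @ \<epsilon> D))"
      by (rule red_append_cong[OF le[OF CD(1) E(1) CD(3) inE[OF xy(2)]] le[OF E(1) CD(2) inE[OF xy(3)] CD(4)]])
     then show "red (letters (f C) (f E) @ letters (f E) (f D)) = red (\<epsilon> C @ map f ?ws @ \<epsilon> D)"
      using mid[of "\<epsilon> C @ map f (letters C E)" E "map f (letters E D) @ \<epsilon> D"] by simp
     show "set (\<epsilon> C @ map f ?ws @ \<epsilon> D) \<subseteq> BB" using \<epsilon>s ls[OF holD(1)[OF 1]] by simp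
    qed
    with 1 have "Q x y C D ?ws" unfolding Q_def by blast
    then show "\<exists>us. Q x y C D us" by blast
   qed
  qed (rule d(1))
 qed simp
 then obtain us where "Q 0 1 C D us" unfolding P_def using holD(4-7)[OF p(3)] by blast
 then have us: "hol p 0 1 C D us" "hol (\<gamma> \<circ> p) 0 1 (f C) (f D) (\<epsilon> C @ map f us @ \<epsilon> D)" unfolding Q_def by simp_all
 show ?thesis
 proof (rule hol_red_cong[OF us(2)])
  have "red us = red ws" using hol_unique[OF us(1) p(3)] by simp
  then have "red (map f us) = red (map f ws)" using red_map_red by metis
  then show "red (\<epsilon> C @ map f us @ \<epsilon> D) = red (\<epsilon> C @ map f ws @ \<epsilon> D)"
   by (intro red_append_cong) simp_all
  show "set (\<epsilon> C @ map f ws @ \<epsilon> D) \<subseteq> BB" using \<epsilon>s ls[OF holD(1)[OF p(3)]] by simp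
 qed
qed

end

text \<open>The path goes out along \<open>p\<close> to a fixed point of \<open>E\<close> and
  returns along the image; cutting equal amounts off both ends shrinks it to that point while it
  stays twisted.\<close>

lemma twisted_homotopic_const:
 fixes p :: "real => 'a::topological_space"
 assumes p: "path p" "path_image p \<subseteq> S" and E: "continuous_on S E" "E \<in> S \<rightarrow> S" "E (p 1) = p 1"
 shows "twisted_homotopic E S (p +++ reversepath (E \<circ> p)) (%_. p 1)"
proof -
 define P where "P x = (if x \<le> 1 then p x else E (p (2 - x)))" for x
 have P1: "P x = p x" if "x \<le> 1" for x using that by (simp add: P_def)
 have P2: "P x = E (p (2 - x))" if "1 \<le> x" for x using that E(3) by (cases "x = 1") (simp_all add: P_def)
 have pc: "continuous_on {0..1} p" using p(1) by (simp add: path_def)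
 have pS: "p x \<in> S" if "x \<in> {0..1}" for x using p(2) that by (auto simp: path_image_def)
 have "continuous_on {0..1} P" by (rule continuous_on_eq[OF pc]) (simp add: P1)
 moreover have "continuous_on {1..2} P"
 proof (rule continuous_on_eq)
  have "continuous_on {1..2} (%x. p (2 - x))"
   by (rule continuous_on_compose2[OF pc]) (auto intro!: continuous_intros)
  then show "continuous_on {1..2} (%x. E (p (2 - x)))"
   by (rule continuous_on_compose2[OF E(1)]) (use pS in auto)
 qed (simp add: P2)
 ultimately have "continuous_on ({0..1} \<union> {1..2}) P" by (intro continuous_on_closed_Un) auto
 then have cP: "continuous_on {0..2} P" by (rule continuous_on_subset) auto
 have PS: "P x \<in> S" if "x \<in> {0..2}" for x
  using that pS[of x] pS[of "2 - x"] E(2) by (cases "x \<le> 1") (auto simp: P1 P2)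
 have rng: "(1 - s) * (2 * t) + s \<in> {0..2}" if "s \<in> {0..1}" "t \<in> {0..1}" for s t :: real
 proof -
  define X where "X = (1 - s) * (2 * t)"
  have "0 \<le> X" unfolding X_def using that by (intro mult_nonneg_nonneg) auto
  moreover have "X \<le> (1 - s) * 2" unfolding X_def by (rule mult_left_mono) (use that in auto)
  ultimately show ?thesis unfolding X_def[symmetric] using that by simp
 qed
 show ?thesis
 proof (rule twisted_homotopicI)
  show "continuous_on ({0..1} \<times> {0..1}) (%z. P ((1 - fst z) * (2 * snd z) + fst z))"
   by (rule continuous_on_compose2[OF cP]) (use rng in "auto intro!: continuous_intros")
  show "P ((1 - s) * (2 * t) + s) \<in> S" if "s \<in> {0..1}" "t \<in> {0..1}" for s t :: real
   using PS rng that by blast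
  show "P ((1 - s) * (2 * 1) + s) = E (P ((1 - s) * (2 * 0) + s))" if "s \<in> {0..1}" for s :: real
   using that by (simp add: P1 P2 algebra_simps)
  show "P ((1 - 0) * (2 * t) + 0) = (p +++ reversepath (E \<circ> p)) t" if "t \<in> {0..1}" for t
   using that by (cases "t \<le> 1/2") (simp_all add: joinpaths_def reversepath_def P1 P2)
 qed (simp add: P1)
qed

section \<open>Central paths and involutively twisted paths in a comb\<close>

context comb
begin

text \<open>For \<gamma> the identity this says that the centre is trivial; a general \<gamma>
  occurs when \<open>p\<close> is a lift to a covering and \<gamma> the deck transformation joining
  its ends. Three bridges leave room for letters \<open>b\<close>, \<open>c\<close> that cancel
  against neither end of the word of \<open>p\<close>, so commuting forces this word to be empty.
  Commuting then forces \<gamma> to keep a bridge, and \<open>nf\<close> turns this into a fixed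
  start.\<close>

theorem central_loop:
 fixes \<gamma> :: "'v => 'v"
 assumes a: "a1 \<in> BB" "a2 \<in> BB" "a3 \<in> BB" "a1 ~= a2" "a1 ~= a3" "a2 ~= a3"
  and \<gamma>: "continuous_on (\<Union>charts) \<gamma>" "\<gamma> ` N = N" "\<gamma> ` S = S" "!!B. B \<in> BB ==> \<gamma> ` B \<in> BB" "inj \<gamma>"
  and p: "path p" "path_image p \<subseteq> \<Union>charts" "p 1 = \<gamma> (p 0)"
  and comm: "!!q. path q ==> path_image q \<subseteq> \<Union>charts ==> q 0 = p 0 ==> q 1 = p 0 ==>
    homotopic_paths (\<Union>charts) (p +++ (\<gamma> \<circ> q)) (q +++ p)"
  and nf: "!!B. B \<in> BB ==> \<gamma> ` B = B ==> \<gamma> (p 0) = p 0"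
 shows "p 1 = p 0 \<and> null_loop (\<Union>charts) p"
proof -
 let ?f = "(`) \<gamma>"
 have "p 0 \<in> \<Union>charts" using p(2) unfolding path_image_def by (rule subsetD) simp
 then obtain C where C: "C \<in> charts" "p 0 \<in> C" by blast
 have fC: "?f C \<in> charts" "p 1 \<in> ?f C"
  using C \<gamma>(2-4) p(3) by (auto elim!: charts_cases)
 have fS: "?f C = S \<longleftrightarrow> C = S"
  using C(1) \<gamma>(2-4) by (cases rule: charts_cases) auto
 obtain w where w: "hol p 0 1 C (?f C) w" using path_follows_word[OF p(1,2) C fC] by blast
 have key: "red (w @ map ?f [b, c]) = red ([b, c] @ w)" if "b \<in> BB" "c \<in> BB" for b c
 proof -
  have bc: "set [b, c] \<subseteq> BB" "((C = S) = (C = S)) = even (length [b, c])" using that by simp_all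
  obtain q where q: "path q" "path_image q \<subseteq> \<Union>charts" "q 0 = p 0" "q 1 = p 0" "hol q 0 1 C C [b, c]"
   by (rule realize_word[OF C C bc])
  have gq: "hol (\<gamma> \<circ> q) 0 1 (?f C) (?f C) ([] @ map ?f [b, c] @ [])"
   using hol_map[OF \<gamma>(1), of ?f False q C C "[b, c]"] \<gamma>(2-4) q by (simp add: side_def)
  have pq: "pathfinish p = pathstart (\<gamma> \<circ> q)" "pathfinish q = pathstart p"
   using p(3) q(3,4) by (simp_all add: pathstart_def pathfinish_def)
  have 1: "hol (p +++ (\<gamma> \<circ> q)) 0 1 C (?f C) (w @ map ?f [b, c])"
   using hol_join[OF w gq pq(1)] by simp
  have 2: "hol (q +++ p) 0 1 C (?f C) ([b, c] @ w)" by (rule hol_join[OF q(5) w pq(2)])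
  show ?thesis
   by (rule hol_unique[OF hol_homotopic[OF comm[OF q(1-4)] 1] 2]) simp
 qed
 have finj: "?f x = ?f y ==> x = y" for x y using \<gamma>(5) by (simp add: inj_image_eq_iff)
 have rw: "red w = []"
 proof (rule ccontr)
  assume ne: "red w ~= []"
  have fne: "?f a1 ~= ?f a2" "?f a1 ~= ?f a3" "?f a2 ~= ?f a3" using a(4-6) finj[of a1 a2] finj[of a1 a3] finj[of a2 a3] by argo+
  \<comment> \<open>Each of the two conditions rules out at most one of the three bridges, as their
    images are distinct too.\<close>
  have "\<exists>b\<in>{a1, a2, a3}. b ~= x \<and> ?f b ~= y" for x y
  proof (rule ccontr)
   assume "\<not> ?thesis"
   then have "a1 = x \<or> ?f a1 = y" "a2 = x \<or> ?f a2 = y" "a3 = x \<or> ?f a3 = y" by simp_all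
   then show False using a(4-6) fne by (elim disjE) simp_all
  qed
  from this[of "hd (red w)" "last (red w)"]
  obtain b where b: "b \<in> {a1, a2, a3}" "b ~= hd (red w)" "?f b ~= last (red w)" by (elim bexE conjE)
  have "\<exists>c\<in>{a1, a2, a3}. c ~= x \<and> c ~= y" for x y
  proof (rule ccontr)
   assume "\<not> ?thesis"
   then have "a1 = x \<or> a1 = y" "a2 = x \<or> a2 = y" "a3 = x \<or> a3 = y" by simp_all
   then show False using a(4-6) by (elim disjE) simp_all
  qed
  from this[of b "hd (red w)"] obtain c where c: "c \<in> {a1, a2, a3}" "c ~= b" "c ~= hd (red w)" by (elim bexE conjE)
  have "red (w @ [?f b, ?f c]) ~= red ([b, c] @ w)"
   by (rule red_commute_ne[OF ne b(2) c(2)[symmetric] c(3) b(3)]) (use c(2) finj[of b c] in argo)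
  then show False using key[of b c] b(1) c(1) a(1-3) by auto
 qed
 have "red (w @ map ?f [a1, a2]) = red ([] @ map ?f [a1, a2])" "red ([a1, a2] @ w) = red ([a1, a2] @ [])"
  using rw by (intro red_append_cong; simp)+
 then have "red [?f a1, ?f a2] = red [a1, a2]" using key[OF a(1,2)] by simp
 moreover have "red [?f a1, ?f a2] = [?f a1, ?f a2]" "red [a1, a2] = [a1, a2]"
  using a(4) finj[of a1 a2] by (auto intro!: red_distinct_adj)
 ultimately have "?f a1 = a1" by simp
 then have 0: "\<gamma> (p 0) = p 0" by (rule nf[OF a(1)])
 then have closed: "p 1 = p 0" using p(3) by simp
 have "even (length w)" using holD(2)[OF w] fS by simp
 obtain w' where w': "hol p 0 1 C C w'" using path_follows_word[OF p(1,2) C C(1)] C(2) closed by metis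
 have "red w' = []"
 proof -
  have c0: "hol (%_. p 0) 0 1 C (?f C) []"
  proof -
   have "hol (%_. p 0) 0 1 C (?f C) (letters C C @ letters C (?f C))"
    by (rule hol_chart) (use C fC closed in auto)
   moreover have "letters C (?f C) = []"
    using C(1)
   proof (cases rule: charts_cases)
    case 3
    then have "?f C \<in> BB" using \<gamma>(4) by blast
    then show ?thesis using 3 by (auto simp: letters_def)
   qed (use \<gamma>(2,3) in "auto simp: letters_def")
   ultimately show ?thesis by simp
  qed
  have "homotopic_paths (\<Union>charts) p (%_. p 0)"
   by (rule homotopic_if_same_word[OF p(2) w _ c0]) (use rw C closed in "auto simp: path_image_def")
  then have "null_loop (\<Union>charts) p" by (simp add: null_loop_def pathstart_def)
  then show ?thesis using null_loop_word[OF p(1,2) closed[symmetric] w'] by simp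
 qed
 then show ?thesis using closed null_loop_word[OF p(1,2) closed[symmetric] w'] by simp
qed

lemma path_to_point:
 assumes "x \<in> \<Union>charts" "y \<in> N" "BB ~= {}"
 obtains p where "path p" "path_image p \<subseteq> \<Union>charts" "p 0 = x" "p 1 = y"
proof -
 obtain C where C: "C \<in> charts" "x \<in> C" using assms(1) by blast
 obtain a where a: "a \<in> BB" using assms(3) by blast
 define ws where "ws = (if C = S then [a] else [])"
 have "set ws \<subseteq> BB" "((C = S) = (N = S)) = even (length ws)" using a by (auto simp: ws_def)
 then obtain p where "path p" "path_image p \<subseteq> \<Union>charts" "p 0 = x" "p 1 = y"
  using realize_word[OF C in_charts(1) assms(2)] by metis
 then show thesis by (rule that)
qed

lemma path_connected_comb:
 assumes "BB ~= {}" shows "path_connected (\<Union>charts)"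
 unfolding path_connected_def
proof (intro ballI)
 fix x y assume xy: "x \<in> \<Union>charts" "y \<in> \<Union>charts"
 obtain p where p: "path p" "path_image p \<subseteq> \<Union>charts" "p 0 = x" "p 1 = bN"
  using path_to_point[OF xy(1) bN assms] by blast
 obtain q where q: "path q" "path_image q \<subseteq> \<Union>charts" "q 0 = y" "q 1 = bN"
  using path_to_point[OF xy(2) bN assms] by blast
 show "\<exists>g. path g \<and> path_image g \<subseteq> \<Union>charts \<and> pathstart g = x \<and> pathfinish g = y"
  by (rule exI[of _ "p +++ reversepath q"])
    (use p q in "simp add: pathstart_def[symmetric] pathfinish_def[symmetric] subset_path_image_join")
qed

lemma twisted_rebase:
 assumes \<gamma>: "continuous_on (\<Union>charts) \<gamma>" "\<gamma> \<in> \<Union>charts \<rightarrow> \<Union>charts" "!!x. x \<in> \<Union>charts ==> \<gamma> (\<gamma> x) = x"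
  and p: "path p" "path_image p \<subseteq> \<Union>charts" "p 1 = \<gamma> (p 0)"
  and null: "null_loop (\<Union>charts) (twice \<gamma> p)" and y: "y \<in> N" "BB ~= {}"
 obtains q where "twisted_homotopic \<gamma> (\<Union>charts) p q" "path q" "path_image q \<subseteq> \<Union>charts" "q 0 = y" "q 1 = \<gamma> y"
  "null_loop (\<Union>charts) (twice \<gamma> q)"
proof -
 have "p 0 \<in> \<Union>charts" using p(2) unfolding path_image_def by (rule subsetD) simp
 then obtain k where k: "path k" "path_image k \<subseteq> \<Union>charts" "k 0 = p 0" "k 1 = y"
  using path_to_point[OF _ y] by blast
 obtain q where q: "twisted_homotopic \<gamma> (\<Union>charts) p q" "q 0 = k 1"
  using twisted_homotopic_move[OF p k(1-3) \<gamma>(1,2)] by blast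
 have "null_loop (\<Union>charts) (twice \<gamma> q)"
  using null_loop_homotopic[OF twisted_homotopic_twice[OF q(1) \<gamma>]] null by blast
 then show thesis using that q twisted_homotopicD[OF q(1)] k(4) by metis
qed

text \<open>\<gamma> exchanges the sides but keeps every bridge, so the word \<open>w\<close> of the
  path, rebased at \<open>bN\<close>, is odd with trivial square: it reads \<open>u\<close>, a
  letter \<open>a\<close>, and \<open>u\<close> backwards. Walking along \<open>u\<close> to a fixed
  point in \<open>a\<close> exhibits the path as a way out and its image back.\<close>

theorem swapping_involution:
 fixes \<gamma> :: "'v => 'v"
 assumes \<gamma>: "continuous_on (\<Union>charts) \<gamma>" "\<gamma> ` N = S" "\<gamma> ` S = N" "!!B. B \<in> BB ==> \<gamma> ` B = B" "!!x. \<gamma> (\<gamma> x) = x"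
  and fix_pt: "!!B. B \<in> BB ==> \<exists>y\<in>B. \<gamma> y = y" and ne: "BB ~= {}"
  and p: "path p" "path_image p \<subseteq> \<Union>charts" "p 1 = \<gamma> (p 0)"
  and null: "null_loop (\<Union>charts) (twice \<gamma> p)"
 shows "\<exists>y\<in>\<Union>charts. \<gamma> y = y \<and> twisted_homotopic \<gamma> (\<Union>charts) p (%_. y)"
proof -
 let ?f = "(`) \<gamma>"
 have \<gamma>U: "\<gamma> \<in> \<Union>charts \<rightarrow> \<Union>charts"
 proof
  fix x assume "x \<in> \<Union>charts"
  then obtain C where C: "C \<in> charts" "x \<in> C" by blast
  then have "\<gamma> x \<in> \<gamma> ` C" by simp
  moreover have "\<gamma> ` C \<in> charts" using C(1)
   by (cases rule: charts_cases) (simp_all add: \<gamma>(2-4))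
  ultimately show "\<gamma> x \<in> \<Union>charts" by blast
 qed
 obtain q where q: "twisted_homotopic \<gamma> (\<Union>charts) p q" "path q" "path_image q \<subseteq> \<Union>charts" "q 0 = bN" "q 1 = \<gamma> bN"
  "null_loop (\<Union>charts) (twice \<gamma> q)"
  using twisted_rebase[OF \<gamma>(1) \<gamma>U \<gamma>(5) p null bN ne] by blast
 have gb: "\<gamma> bN \<in> S" using \<gamma>(2) bN by blast
 obtain w where w: "hol q 0 1 N S w"
  using path_follows_word[OF q(2,3) in_charts(1) _ in_charts(2)] q(4,5) gb by auto
 have mapf: "map ?f v = v" if "set v \<subseteq> BB" for v using that \<gamma>(4) by (induction v) auto
 have hm: "hol (\<gamma> \<circ> r) 0 1 S (?f D) (v @ (if D \<in> BB then [D] else []))"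
  if "path r" "path_image r \<subseteq> \<Union>charts" "hol r 0 1 N D v" for r D v
  using hol_map[OF \<gamma>(1), of ?f True r N D v] that \<gamma>(2-4) mapf[OF holD(1)[OF that(3)]]
  by (simp add: side_def split: if_splits)
 have "hol (\<gamma> \<circ> q) 0 1 S N w" using hm[OF q(2,3) w] \<gamma>(3) by simp
 then have "hol (twice \<gamma> q) 0 1 N N (w @ w)"
  unfolding twice_def by (rule hol_join[OF w]) (simp add: pathstart_def pathfinish_def q(4,5))
 moreover have "path (twice \<gamma> q)" "path_image (twice \<gamma> q) \<subseteq> \<Union>charts" "twice \<gamma> q 0 = twice \<gamma> q 1"
  using homotopic_paths_imp_path[OF q(6)[unfolded null_loop_def]] homotopic_paths_imp_subset[OF q(6)[unfolded null_loop_def]]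
   homotopic_paths_imp_pathfinish[OF q(6)[unfolded null_loop_def]] by (auto simp: pathstart_def pathfinish_def)
 ultimately have "red (w @ w) = []" using null_loop_word q(6) by blast
 then have pal: "red w = rev (map (%x. x) (red w))" unfolding red_append_eq_Nil_iff red_rev by simp
 have odd: "odd (length (red w))" using holD(2)[OF w] even_length_red[of w] by simp
 obtain u a where ua: "red w = u @ [a] @ rev u"
 proof (rule palindrome_cases[OF pal])
  fix u assume "red w = u @ rev (map (%x. x) u)"
  then show thesis using odd by simp
 qed (use that in auto)
 have sub: "set (red w) \<subseteq> BB" using set_red[of w] holD(1)[OF w] by blast
 then have u: "set u \<subseteq> BB" "a \<in> BB" unfolding ua by auto
 obtain y where y: "y \<in> a" "\<gamma> y = y" using fix_pt[OF u(2)] by blast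
 \<comment> \<open>A path from \<open>N\<close> into the bridge \<open>a\<close> has an even word;
   for odd \<open>u\<close> a further \<open>a\<close> is added, which cancels in
   \<open>v @ [a] @ rev v\<close>.\<close>
 define v where "v = (if even (length u) then u else u @ [a])"
 have v: "set v \<subseteq> BB" "even (length v)" using u by (auto simp: v_def)
 have vv: "red (v @ [a] @ rev v) = red w"
 proof (cases "even (length u)")
  case True
  then show ?thesis using ua by (simp add: v_def) (metis red_red ua append_Cons append_Nil)
 next
  case False
  have aa: "red [a, a] = []" by (simp add: red_def act_def)
  have "red (u @ [a, a] @ [a] @ rev u) = red (u @ [] @ [a] @ rev u)"
   by (intro red_append_cong) (use aa in simp_all)
  then show ?thesis using False ua red_red[of w] by (simp add: v_def)
 qed
 obtain e where e: "path e" "path_image e \<subseteq> \<Union>charts" "e 0 = bN" "e 1 = y" "hol e 0 1 N a v"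
  using realize_word[OF in_charts(1) bN in_charts(3)[OF u(2)] y(1) v(1)] v(2) u(2) by auto
 have ge: "path (\<gamma> \<circ> e)" "path_image (\<gamma> \<circ> e) \<subseteq> \<Union>charts"
 proof -
  show "path (\<gamma> \<circ> e)" using e \<gamma>(1) by (meson continuous_on_subset path_continuous_image)
  show "path_image (\<gamma> \<circ> e) \<subseteq> \<Union>charts" unfolding path_image_compose using e(2) \<gamma>U by blast
 qed
 have "hol (\<gamma> \<circ> e) 0 1 S a (v @ [a])" using hm[OF e(1,2,5)] u(2) \<gamma>(4) by simp
 from hol_reverse[OF ge this] have r: "hol (reversepath (\<gamma> \<circ> e)) 0 1 a S (a # rev v)" by simp
 have ends: "pathfinish e = pathstart (reversepath (\<gamma> \<circ> e))"
  by (simp add: pathstart_def pathfinish_def reversepath_def e(4) y(2))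
 have h: "hol (e +++ reversepath (\<gamma> \<circ> e)) 0 1 N S (v @ [a] @ rev v)"
  using hol_join[OF e(5) r ends] by simp
 have "homotopic_paths (\<Union>charts) q (e +++ reversepath (\<gamma> \<circ> e))"
 proof (rule homotopic_if_same_word[OF q(3) w _ h])
  show "path_image (e +++ reversepath (\<gamma> \<circ> e)) \<subseteq> \<Union>charts" using e ge by (simp add: subset_path_image_join)
   show "red w = red (v @ [a] @ rev v)" by (rule vv[symmetric])
 qed (simp_all add: q(4,5) e(3) joinpaths_def reversepath_def)
 then have "twisted_homotopic \<gamma> (\<Union>charts) q (e +++ reversepath (\<gamma> \<circ> e))"
  by (rule homotopic_paths_imp_twisted) (simp add: q(4,5))
 also have "twisted_homotopic \<gamma> (\<Union>charts) (e +++ reversepath (\<gamma> \<circ> e)) (%_. e 1)"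
  by (rule twisted_homotopic_const[OF e(1,2) \<gamma>(1) \<gamma>U]) (simp add: e(4) y(2))
 finally have "twisted_homotopic \<gamma> (\<Union>charts) q (%_. y)" unfolding e(4) .
 with q(1) have "twisted_homotopic \<gamma> (\<Union>charts) p (%_. y)" by (rule twisted_homotopic_trans)
 then show ?thesis using y u(2) in_charts(3) by blast
qed

text \<open>Here the word times its image is trivial and no bridge is kept, so the word splits as
  \<open>u\<close> followed by the reversed image of \<open>u\<close>, without a middle letter. The
  path goes out along \<open>u\<close> to a fixed point on the side reached there, and back along
  the image.\<close>

theorem preserving_involution:
 fixes \<gamma> :: "'v => 'v"
 assumes \<gamma>: "continuous_on (\<Union>charts) \<gamma>" "\<gamma> ` N = N" "\<gamma> ` S = S" "!!B. B \<in> BB ==> \<gamma> ` B \<in> BB" "!!x. \<gamma> (\<gamma> x) = x"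
  and nf: "!!B. B \<in> BB ==> \<gamma> ` B ~= B" and ne: "BB ~= {}"
  and y: "!!s. y s \<in> side s" "!!s. \<gamma> (y s) = y s"
  and p: "path p" "path_image p \<subseteq> \<Union>charts" "p 1 = \<gamma> (p 0)"
  and null: "null_loop (\<Union>charts) (twice \<gamma> p)"
 shows "\<exists>y\<in>\<Union>charts. \<gamma> y = y \<and> twisted_homotopic \<gamma> (\<Union>charts) p (%_. y)"
proof -
 let ?f = "(`) \<gamma>"
 have ff: "?f (?f B) = B" for B using \<gamma>(5) by (simp add: image_image)
 have finj: "?f x = ?f y ==> x = y" for x y using ff by metis
 have \<gamma>U: "\<gamma> \<in> \<Union>charts \<rightarrow> \<Union>charts"
 proof
  fix x assume "x \<in> \<Union>charts"
  then obtain C where C: "C \<in> charts" "x \<in> C" by blast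
  then have "\<gamma> x \<in> \<gamma> ` C" by simp
  moreover have "\<gamma> ` C \<in> charts" using C(1)
   by (cases rule: charts_cases) (simp_all add: \<gamma>(2-4))
  ultimately show "\<gamma> x \<in> \<Union>charts" by blast
 qed
 have yN: "y False \<in> N" using y(1)[of False] by (simp add: side_def)
 obtain q where q: "twisted_homotopic \<gamma> (\<Union>charts) p q" "path q" "path_image q \<subseteq> \<Union>charts" "q 0 = y False" "q 1 = \<gamma> (y False)"
  "null_loop (\<Union>charts) (twice \<gamma> q)"
  using twisted_rebase[OF \<gamma>(1) \<gamma>U \<gamma>(5) p null yN ne] by blast
 have q1: "q 1 = y False" using q(5) y(2) by simp
 obtain w where w: "hol q 0 1 N N w"
  using path_follows_word[OF q(2,3) in_charts(1) _ in_charts(1)] q(4) q1 yN by auto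
 have hm: "hol (\<gamma> \<circ> r) 0 1 N (side s) (map ?f v)"
  if "path r" "path_image r \<subseteq> \<Union>charts" "hol r 0 1 N (side s) v" for r s v
  using hol_map[OF \<gamma>(1), of ?f False r N "side s" v] that \<gamma>(2-4) by (cases s) (simp_all add: side_def)
 have "hol (\<gamma> \<circ> q) 0 1 N (side False) (map ?f w)" using hm[OF q(2,3), of False] w by (simp add: side_def)
 then have "hol (twice \<gamma> q) 0 1 N N (w @ map ?f w)"
  unfolding twice_def sideN by (rule hol_join[OF w]) (simp add: pathstart_def pathfinish_def q(4) q1 y(2))
 moreover have "path (twice \<gamma> q)" "path_image (twice \<gamma> q) \<subseteq> \<Union>charts" "twice \<gamma> q 0 = twice \<gamma> q 1"
  using homotopic_paths_imp_path[OF q(6)[unfolded null_loop_def]] homotopic_paths_imp_subset[OF q(6)[unfolded null_loop_def]]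
   homotopic_paths_imp_pathfinish[OF q(6)[unfolded null_loop_def]] by (auto simp: pathstart_def pathfinish_def)
 ultimately have "red (w @ map ?f w) = []" using null_loop_word q(6) by blast
 then have 1: "red (map ?f w) = rev (red w)" unfolding red_append_eq_Nil_iff red_rev .
 have "red (map ?f w) = map ?f (red w)" by (rule red_map_inj) (rule injI, rule finj)
 then have "map ?f (red w) = rev (red w)" using 1 by simp
 then have "rev (map ?f (red w)) = red w" by simp
 then have pal: "red w = rev (map ?f (red w))" by (rule HOL.sym)
 have sub: "set (red w) \<subseteq> BB" using set_red[of w] holD(1)[OF w] by blast
 obtain u where u: "red w = u @ rev (map ?f u)"
 proof (rule palindrome_cases[OF pal ff])
  fix u a assume "red w = u @ [a] @ rev (map ?f u)" "?f a = a"
  then show thesis using nf[of a] sub by auto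
 qed (rule that)
 have uB: "set u \<subseteq> BB" using sub unfolding u by simp
 define s where "s = odd (length u)"
 have par: "((N = S) = (side s = S)) = even (length u)" by (simp add: s_def)
 obtain e where e: "path e" "path_image e \<subseteq> \<Union>charts" "e 0 = y False" "e 1 = y s" "hol e 0 1 N (side s) u"
  using realize_word[OF in_charts(1) yN side_charts y(1) uB par] by blast
 have ge: "path (\<gamma> \<circ> e)" "path_image (\<gamma> \<circ> e) \<subseteq> \<Union>charts"
 proof -
  show "path (\<gamma> \<circ> e)" using e \<gamma>(1) by (meson continuous_on_subset path_continuous_image)
  show "path_image (\<gamma> \<circ> e) \<subseteq> \<Union>charts" unfolding path_image_compose using e(2) \<gamma>U by blast
 qed
 have r: "hol (reversepath (\<gamma> \<circ> e)) 0 1 (side s) N (rev (map ?f u))"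
  by (rule hol_reverse[OF ge hm[OF e(1,2,5)]])
 have ends: "pathfinish e = pathstart (reversepath (\<gamma> \<circ> e))"
  by (simp add: pathstart_def pathfinish_def reversepath_def e(4) y(2))
 have h: "hol (e +++ reversepath (\<gamma> \<circ> e)) 0 1 N N (u @ rev (map ?f u))"
  by (rule hol_join[OF e(5) r ends])
 have "homotopic_paths (\<Union>charts) q (e +++ reversepath (\<gamma> \<circ> e))"
 proof (rule homotopic_if_same_word[OF q(3) w _ h])
  show "path_image (e +++ reversepath (\<gamma> \<circ> e)) \<subseteq> \<Union>charts" using e ge by (simp add: subset_path_image_join)
  show "red w = red (u @ rev (map ?f u))" using u red_red[of w] by simp
 qed (simp_all add: q(4) q1 e(3) y(2) joinpaths_def reversepath_def)
 then have "twisted_homotopic \<gamma> (\<Union>charts) q (e +++ reversepath (\<gamma> \<circ> e))"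
  by (rule homotopic_paths_imp_twisted) (simp add: q(4,5))
 also have "twisted_homotopic \<gamma> (\<Union>charts) (e +++ reversepath (\<gamma> \<circ> e)) (%_. e 1)"
  by (rule twisted_homotopic_const[OF e(1,2) \<gamma>(1) \<gamma>U]) (simp add: e(4) y(2))
 finally have "twisted_homotopic \<gamma> (\<Union>charts) q (%_. y s)" unfolding e(4) .
 with q(1) have "twisted_homotopic \<gamma> (\<Union>charts) p (%_. y s)" by (rule twisted_homotopic_trans)
 moreover have "y s \<in> \<Union>charts" using y(1)[of s] side_charts[of s] by blast
 ultimately show ?thesis using y(2) by blast
qed

end

section \<open>Half turn, special configurations, and the groups of their fibres\<close>

section \<open>Rotations about an axis and special configurations\<close>

definition vec3 :: "real => real => real => real ^ 3" where
 "vec3 a b c = vector [a, b, c]"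

lemma vec3_nth [simp]: "vec3 a b c $ 1 = a" "vec3 a b c $ 2 = b" "vec3 a b c $ 3 = c"
 by (simp_all add: vec3_def)

lemma vec3_eq_iff: "x = y \<longleftrightarrow> x $ 1 = y $ 1 \<and> x $ 2 = y $ 2 \<and> x $ 3 = y $ 3" for x y :: "real ^ 3"
 by (simp add: vec_eq_iff forall_3)

lemma continuous_on_vec3 [continuous_intros]:
 assumes "continuous_on X f" "continuous_on X g" "continuous_on X h"
 shows "continuous_on X (%x. vec3 (f x) (g x) (h x))"
proof -
 have "vec3 a b c = a *\<^sub>R axis 1 1 + b *\<^sub>R axis 2 1 + c *\<^sub>R axis 3 1" for a b c
  by (simp add: vec3_eq_iff axis_def)
 then show ?thesis using assms by (auto intro!: continuous_intros)
qed

lemma cross3_eq_0_iff: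
 "cross3 a x = 0 \<longleftrightarrow> a $ 2 * x $ 3 = a $ 3 * x $ 2 \<and> a $ 3 * x $ 1 = a $ 1 * x $ 3 \<and> a $ 1 * x $ 2 = a $ 2 * x $ 1"
 by (simp add: cross3_def vec_eq_iff forall_3)

definition half_turn :: "real ^ 3 => real ^ 3" where
 "half_turn x = vec3 (- (x $ 1)) (- (x $ 2)) (x $ 3)"

lemma half_turn_nth [simp]: "half_turn x $ 1 = - (x $ 1)" "half_turn x $ 2 = - (x $ 2)" "half_turn x $ 3 = x $ 3"
 by (simp_all add: half_turn_def)

definition planar :: "real ^ 3 => bool" where "planar x \<longleftrightarrow> x $ 3 = 0"
definition axial :: "real ^ 3 => bool" where "axial x \<longleftrightarrow> x $ 1 = 0 \<and> x $ 2 = 0"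

text \<open>The lines kept by the half turn about the vertical axis are the axis and the horizontal
  lines; these are the configurations of such lines.\<close>

definition special :: "nat => (nat => real ^ 3) set" where
 "special n = {c \<in> conf n. \<forall>i<n. planar (c i) \<or> axial (c i)}"

definition det2 :: "real ^ 3 => real ^ 3 => real" where
 "det2 a x = a $ 1 * x $ 2 - a $ 2 * x $ 1"

lemma det2_linear: "det2 a (u *\<^sub>R x + v *\<^sub>R y) = u * det2 a x + v * det2 a y"
 and det2_minus: "det2 a (- x) = - det2 a x" and det2_self: "det2 a a = 0"
 by (simp_all add: det2_def algebra_simps)

lemma continuous_on_det2 [continuous_intros]: "continuous_on X f ==> continuous_on X (%x. det2 a (f x))"
 unfolding det2_def by (intro continuous_intros)

lemma planar_cross: "planar a ==> a ~= 0 ==> cross3 a x ~= 0 \<longleftrightarrow> x $ 3 ~= 0 \<or> det2 a x ~= 0"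
 unfolding planar_def cross3_eq_0_iff det2_def vec3_eq_iff[of a 0] by auto

lemma axial_cross: "axial a ==> a ~= 0 ==> cross3 a x ~= 0 \<longleftrightarrow> x $ 1 ~= 0 \<or> x $ 2 ~= 0"
 unfolding axial_def cross3_eq_0_iff vec3_eq_iff[of a 0] by auto

lemma image_involution: "(!!x. g (g x) = x) ==> g ` A = {x. g x \<in> A}"
 by (auto simp: image_iff) metis

text \<open>The witnesses are \<open>c 0\<close> shifted slightly to either side along
  \<open>c 1\<close>, which crosses the line \<open>c 0\<close> and no other.\<close>

lemma off_lines_nonempty_separation:
 assumes c: "c \<in> conf n" "!!i. i < n ==> planar (c i)" "2 \<le> n"
 obtains v w where "!!i. i < n ==> det2 (c i) v ~= 0" "!!i. i < n ==> det2 (c i) w ~= 0"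
  "det2 (c 0) v * det2 (c 0) w < 0" "det2 (c 1) v * det2 (c 1) w > 0"
proof -
 have c0: "c i ~= 0" if "i < n" for i using c(1) that by (auto simp: conf_def)
 have d: "det2 (c i) (c j) ~= 0" if "i < n" "j < n" "i ~= j" for i j
 proof -
  have "cross3 (c i) (c j) ~= 0" using c(1) that by (auto simp: conf_def)
  then show ?thesis using planar_cross[OF c(2)[OF that(1)] c0[OF that(1)], of "c j"] c(2)[OF that(2)] by (simp add: planar_def)
 qed
 \<comment> \<open>Small enough that the contribution of \<open>c 1\<close> cannot change the sign
   of \<open>det2 (c i) (c 0)\<close> for any other line \<open>c i\<close>.\<close>
 define e where "e = Min (insert 1 ((%i. \<bar>det2 (c i) (c 0)\<bar> / (1 + \<bar>det2 (c i) (c 1)\<bar>)) ` {1..<n})) / 2"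
 have m0: "0 < Min (insert 1 ((%i. \<bar>det2 (c i) (c 0)\<bar> / (1 + \<bar>det2 (c i) (c 1)\<bar>)) ` {1..<n}))"
  using d c(3) by (subst Min_gr_iff) (auto intro!: divide_pos_pos)
 then have e0: "e > 0" by (simp add: e_def)
 have small: "e * \<bar>det2 (c i) (c 1)\<bar> < \<bar>det2 (c i) (c 0)\<bar>" if "i \<in> {1..<n}" for i
 proof -
  have "2 * e \<le> \<bar>det2 (c i) (c 0)\<bar> / (1 + \<bar>det2 (c i) (c 1)\<bar>)"
  proof -
   have "Min (insert 1 ((%i. \<bar>det2 (c i) (c 0)\<bar> / (1 + \<bar>det2 (c i) (c 1)\<bar>)) ` {1..<n})) \<le> \<bar>det2 (c i) (c 0)\<bar> / (1 + \<bar>det2 (c i) (c 1)\<bar>)"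
    by (rule Min_le) (use that in auto)
   then show ?thesis unfolding e_def by simp
  qed
  then have "2 * e * (1 + \<bar>det2 (c i) (c 1)\<bar>) \<le> \<bar>det2 (c i) (c 0)\<bar>" by (subst (asm) pos_le_divide_eq) auto
  moreover have "0 \<le> e * \<bar>det2 (c i) (c 1)\<bar>" using e0 by simp
  ultimately show ?thesis using e0 by (simp add: algebra_simps)
 qed
 define v where "v s = c 0 + (s * e) *\<^sub>R c 1" for s
 have dv: "det2 (c i) (v s) = det2 (c i) (c 0) + s * (e * det2 (c i) (c 1))" for i s
  using det2_linear[of "c i" 1 "c 0" "s * e" "c 1"] by (simp add: v_def)
 have d0: "det2 (c 0) (v s) = s * (e * det2 (c 0) (c 1))" for s by (simp add: dv det2_self)
 have d1: "det2 (c 1) (v s) = det2 (c 1) (c 0)" for s by (simp add: dv det2_self)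
 have nz: "det2 (c i) (v s) ~= 0" if "i < n" "s = 1 \<or> s = - 1" for i s
 proof (cases "i = 0")
  case True
  then show ?thesis using d[of 0 1] e0 c(3) that(2) by (auto simp: d0)
 next
  case False
  then have "\<bar>e * det2 (c i) (c 1)\<bar> < \<bar>det2 (c i) (c 0)\<bar>" using small[of i] that(1) e0 by (simp add: abs_mult)
  moreover have "\<bar>a\<bar> < \<bar>b\<bar> ==> s = 1 \<or> s = - 1 ==> b + s * a ~= 0" for a b s :: real by auto
  ultimately show ?thesis using that(2) unfolding dv by blast
 qed
 show thesis
 proof (rule that[of "v 1" "v (- 1)"])
  have "det2 (c 0) (c 1) ~= 0" "det2 (c 1) (c 0) ~= 0" using d c(3) by auto
  then have "0 < (e * det2 (c 0) (c 1))\<^sup>2" "0 < (det2 (c 1) (c 0))\<^sup>2" using e0 by simp_all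
  then show "det2 (c 0) (v 1) * det2 (c 0) (v (- 1)) < 0" "det2 (c 1) (v 1) * det2 (c 1) (v (- 1)) > 0"
   unfolding d0 d1 by (simp_all add: power2_eq_square)
 qed (use nz in auto)
qed

section \<open>Horizontal lines: half-spaces joined by sectors\<close>

subsection \<open>All lines in one plane\<close>

text \<open>The points whose horizontal part lies in the same sector between the lines as that of
  \<open>v\<close>. The height is free, so a sector is a bridge between the two half-spaces.\<close>

definition sector :: "nat => (nat => real ^ 3) => real ^ 3 => (real ^ 3) set" where
 "sector n c v = {x. \<forall>i<n. det2 (c i) v * det2 (c i) x > 0}"

definition sectors :: "nat => (nat => real ^ 3) => (real ^ 3) set set" where
 "sectors n c = sector n c ` {v. \<forall>i<n. det2 (c i) v ~= 0}"

abbreviation upper :: "(real ^ 3) set" where "upper \<equiv> {x. 0 < x $ 3}"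
abbreviation lower :: "(real ^ 3) set" where "lower \<equiv> {x. x $ 3 < 0}"

lemma sector_self: "(!!i. i < n ==> det2 (c i) v ~= 0) ==> v \<in> sector n c v"
 by (simp add: sector_def) (metis not_real_square_gt_zero)

lemma sector_eq: assumes "x \<in> sector n c v" shows "sector n c x = sector n c v"
proof -
 have "(a * b > 0) ==> (b * y > 0) = (a * y > (0::real))" for a b y
  by (auto simp: zero_less_mult_iff)
 then show ?thesis using assms unfolding sector_def by blast
qed

lemma sector_nth3: "x \<in> sector n c v ==> vec3 (x $ 1) (x $ 2) z \<in> sector n c v"
 by (simp add: sector_def det2_def)

lemma upper_lower:
 "open upper" "convex upper" "open lower" "convex lower" "upper \<inter> lower = {}" "upper ~= {}" "lower ~= {}"
proof -
 show "open upper" "open lower" by (auto intro!: open_Collect_less continuous_intros)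
 have "upper = {x. axis 3 1 \<bullet> x > 0}" "lower = {x. axis 3 1 \<bullet> x < 0}" by (simp_all add: inner_axis')
 then show "convex upper" "convex lower" by (simp_all add: convex_halfspace_gt convex_halfspace_lt)
 have "vec3 0 0 1 \<in> upper" "vec3 0 0 (- 1) \<in> lower" by simp_all
 then show "upper ~= {}" "lower ~= {}" by blast+
qed auto

lemma comb_planar: "comb upper lower (sectors n c)"
proof (unfold_locales; (rule upper_lower)?)
 fix B assume "B \<in> sectors n c"
 then obtain v where v: "!!i. i < n ==> det2 (c i) v ~= 0" "B = sector n c v" unfolding sectors_def by blast
 have "B = (\<Inter>i\<in>{..<n}. {x. det2 (c i) v * det2 (c i) x > 0})" unfolding v sector_def by auto
 moreover have "open {x. det2 (c i) v * det2 (c i) x > 0}" for i by (intro open_Collect_less continuous_intros)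
 ultimately show "open B" by (simp add: open_INT)
 show "convex B"
  unfolding v
 proof (rule convexI)
  fix x y and u w :: real assume *: "x \<in> sector n c v" "y \<in> sector n c v" "0 \<le> u" "0 \<le> w" "u + w = 1"
  show "u *\<^sub>R x + w *\<^sub>R y \<in> sector n c v"
   unfolding sector_def
  proof (intro CollectI allI impI)
   fix i assume i: "i < n"
   have "det2 (c i) v * det2 (c i) x > 0" "det2 (c i) v * det2 (c i) y > 0" using * i by (auto simp: sector_def)
   then have "u * (det2 (c i) v * det2 (c i) x) + w * (det2 (c i) v * det2 (c i) y) > 0"
    using *(3-5) by (smt (verit) mult_nonneg_nonneg mult_pos_pos)
   then show "det2 (c i) v * det2 (c i) (u *\<^sub>R x + w *\<^sub>R y) > 0" by (simp add: det2_linear algebra_simps)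
  qed
 qed
 have "vec3 (v $ 1) (v $ 2) 1 \<in> B \<inter> upper" "vec3 (v $ 1) (v $ 2) (- 1) \<in> B \<inter> lower"
  using sector_nth3[OF sector_self[of n c v]] v by simp_all
 then show "B \<inter> upper ~= {}" "B \<inter> lower ~= {}" by blast+
next
 fix B B' x assume "B \<in> sectors n c" "B' \<in> sectors n c" "x \<in> B" "x \<in> B'"
 then obtain v v' where "B = sector n c v" "B' = sector n c v'" "x \<in> sector n c v" "x \<in> sector n c v'"
  unfolding sectors_def by blast
 then show "B = B'" using sector_eq[of x n c v] sector_eq[of x n c v'] by simp
qed

lemma planar_charts:
 assumes c: "c \<in> conf n" "!!i. i < n ==> planar (c i)"
 shows "\<Union>(comb.charts upper lower (sectors n c)) = off_lines n c"
proof -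
 have c0: "c i ~= 0" if "i < n" for i using c(1) that by (auto simp: conf_def)
 have off: "x \<in> off_lines n c \<longleftrightarrow> (\<forall>i<n. x $ 3 ~= 0 \<or> det2 (c i) x ~= 0)" for x
  unfolding off_lines_def using planar_cross[OF c(2) c0] by auto
 have "x \<in> \<Union>(sectors n c) \<longleftrightarrow> (\<forall>i<n. det2 (c i) x ~= 0)" for x
 proof
  assume "x \<in> \<Union>(sectors n c)" then show "\<forall>i<n. det2 (c i) x ~= 0"
   unfolding sectors_def sector_def by auto
 next
  assume "\<forall>i<n. det2 (c i) x ~= 0" then show "x \<in> \<Union>(sectors n c)"
   using sector_self[of n c x] unfolding sectors_def by blast
 qed
 note sec = this
 show ?thesis
 proof (rule Set.set_eqI)
  fix x
  show "x \<in> \<Union>(comb.charts upper lower (sectors n c)) \<longleftrightarrow> x \<in> off_lines n c"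
   unfolding comb.charts_def[OF comb_planar] Union_insert Un_iff mem_Collect_eq sec off
   by (cases "x $ 3 = 0") auto
 qed
qed

lemma half_turn_half_turn [simp]: "half_turn (half_turn x) = x"
 by (simp add: vec3_eq_iff)

lemma half_turn_minus: "half_turn (- x) = - half_turn x"
 by (simp add: vec3_eq_iff)

lemma continuous_on_half_turn: "continuous_on X half_turn"
 unfolding half_turn_def by (intro continuous_intros)

text \<open>\<open>s = 1\<close> is the case of the reflection in the horizontal plane, which keeps
  every sector, and \<open>s = - 1\<close> that of the half turn, which sends a sector to its
  opposite.\<close>

lemma sector_sign_image:
 assumes g: "!!x. g (g x) = x" "!!i x. i < n ==> det2 (c i) (g x) = s * det2 (c i) x" "s = 1 \<or> s = - 1"
  and B: "B \<in> sectors n c"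
 shows "g ` B \<in> sectors n c" "s = 1 ==> g ` B = B" "s = - 1 ==> 0 < n ==> g ` B ~= B"
proof -
 obtain v where v: "!!i. i < n ==> det2 (c i) v ~= 0" "B = sector n c v" using B unfolding sectors_def by blast
 have ss: "s * s = 1" using g(3) by auto
 have "g ` B = {x. g x \<in> B}" by (rule image_involution[OF g(1)])
 also have "\<dots> = sector n c (g v)" unfolding v sector_def using g(2) by (auto simp: mult_ac)
 finally have gB: "g ` B = sector n c (g v)" .
 have "\<forall>i<n. det2 (c i) (g v) ~= 0" using v(1) g(2,3) by auto
 then show "g ` B \<in> sectors n c" unfolding gB sectors_def by blast
 show "g ` B = B" if "s = 1"
 proof -
  have "sector n c (g v) = sector n c v" unfolding sector_def using g(2) that by simp
  then show ?thesis using gB v(2) by simp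
 qed
 show "g ` B ~= B" if "s = - 1" "0 < n"
 proof
  assume "g ` B = B"
  then have "v \<in> sector n c (g v)" using gB v sector_self[of n c v] by simp
  then have "det2 (c 0) (g v) * det2 (c 0) v > 0" using that(2) by (simp add: sector_def)
  moreover have "det2 (c 0) (g v) = - det2 (c 0) v" using g(2)[OF that(2)] that(1) by simp
  ultimately show False by (simp add: mult_less_0_iff zero_less_mult_iff)
 qed
qed

lemma planar_sectors_three:
 assumes c: "c \<in> conf n" "!!i. i < n ==> planar (c i)" "2 \<le> n"
 obtains a1 a2 a3 where "a1 \<in> sectors n c" "a2 \<in> sectors n c" "a3 \<in> sectors n c" "a1 ~= a2" "a1 ~= a3" "a2 ~= a3"
proof -
 obtain v w where vw: "!!i. i < n ==> det2 (c i) v ~= 0" "!!i. i < n ==> det2 (c i) w ~= 0"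
  "det2 (c 0) v * det2 (c 0) w < 0" "det2 (c 1) v * det2 (c 1) w > 0"
  using off_lines_nonempty_separation[OF c] by blast
 have ne: "sector n c x ~= sector n c y" if "i < n" "det2 (c i) x * det2 (c i) y < 0" "!!i. i < n ==> det2 (c i) y ~= 0" for x y i
 proof
  assume "sector n c x = sector n c y"
  then have "y \<in> sector n c x" using sector_self[of n c y] that(3) by simp
  then show False using that(1,2) unfolding sector_def by force
 qed
 show thesis
 proof (rule that[of "sector n c v" "sector n c w" "sector n c (- v)"])
  show "sector n c v \<in> sectors n c" "sector n c w \<in> sectors n c" "sector n c (- v) \<in> sectors n c"
   unfolding sectors_def using vw(1,2) by (auto simp: det2_minus)
  show "sector n c v ~= sector n c w" by (rule ne[of 0]) (use vw c(3) in auto)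
  show "sector n c v ~= sector n c (- v)"
  proof (rule ne[of 0])
   have "0 < (det2 (c 0) v)\<^sup>2" using vw(1)[of 0] c(3) by simp
   then show "det2 (c 0) v * det2 (c 0) (- v) < 0" by (simp add: det2_minus power2_eq_square)
  qed (use vw(1) c(3) in "auto simp: det2_minus")
  show "sector n c w ~= sector n c (- v)"
   by (rule ne[of 1]) (use vw c(3) in "auto simp: det2_minus mult.commute")
 qed
qed

lemma planar_null_square:
 assumes c: "c \<in> conf n" "!!i. i < n ==> planar (c i)" "2 \<le> n"
  and p: "path p" "path_image p \<subseteq> off_lines n c" "p 0 = p 1" and null: "null_loop (off_lines n c) (p +++ p)"
 shows "null_loop (off_lines n c) p"
proof -
 have ch: "\<Union>(comb.charts upper lower (sectors n c)) = off_lines n c"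
  by (rule planar_charts[OF c(1)]) (rule c(2))
 show ?thesis
  using comb.null_loop_of_square[OF comb_planar, of p n c] p null unfolding ch by blast
qed

lemma planar_central:
 assumes c: "c \<in> conf n" "!!i. i < n ==> planar (c i)" "2 \<le> n"
  and p: "path p" "path_image p \<subseteq> off_lines n c" "p 0 = p 1"
  and comm: "!!q. path q ==> path_image q \<subseteq> off_lines n c ==> q 0 = p 0 ==> q 1 = p 0 ==>
    homotopic_paths (off_lines n c) (p +++ q) (q +++ p)"
 shows "null_loop (off_lines n c) p"
proof -
 have ch: "\<Union>(comb.charts upper lower (sectors n c)) = off_lines n c"
  by (rule planar_charts[OF c(1)]) (rule c(2))
 obtain a1 a2 a3 where a: "a1 \<in> sectors n c" "a2 \<in> sectors n c" "a3 \<in> sectors n c" "a1 ~= a2" "a1 ~= a3" "a2 ~= a3"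
  using planar_sectors_three[OF c] by blast
 have "p 1 = p 0 \<and> null_loop (\<Union>(comb.charts upper lower (sectors n c))) p"
 proof (rule comb.central_loop[OF comb_planar a, where \<gamma> = "%x. x"])
  show "homotopic_paths (\<Union>(comb.charts upper lower (sectors n c))) (p +++ ((%x. x) \<circ> q)) (q +++ p)"
   if "path q" "path_image q \<subseteq> \<Union>(comb.charts upper lower (sectors n c))" "q 0 = p 0" "q 1 = p 0" for q
   using comm[OF that(1)] that unfolding ch by (simp add: o_def)
 qed (use p ch in "auto simp: continuous_on_id")
 then show ?thesis unfolding ch by blast
qed

text \<open>The half turn keeps the half-spaces and moves every sector; its fixed points are on the
  axis. Its negative is the reflection in the plane, which exchanges the half-spaces and keeps every
  sector; its fixed points are in the plane. These are the two kinds of involution treated for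
  combs.\<close>

lemma planar_twisted:
 assumes c: "c \<in> conf n" "!!i. i < n ==> planar (c i)" "2 \<le> n"
  and g: "g = half_turn \<or> g = (%x. - half_turn x)"
  and p: "path p" "path_image p \<subseteq> off_lines n c" "p 1 = g (p 0)" and null: "null_loop (off_lines n c) (twice g p)"
 shows "\<exists>y\<in>off_lines n c. g y = y \<and> twisted_homotopic g (off_lines n c) p (%_. y)"
proof -
 have ch: "\<Union>(comb.charts upper lower (sectors n c)) = off_lines n c"
  by (rule planar_charts[OF c(1)]) (rule c(2))
 obtain a where a: "a \<in> sectors n c" using planar_sectors_three[OF c] by blast
 then have ne: "sectors n c ~= {}" by blast
 have inv: "g (g x) = x" for x using g by (auto simp: half_turn_minus)
 have cg: "continuous_on X g" for X using g by (auto intro!: continuous_intros continuous_on_half_turn)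
 from g show ?thesis
 proof
  assume gt: "g = half_turn"
  have "\<exists>y\<in>\<Union>(comb.charts upper lower (sectors n c)). g y = y \<and>
    twisted_homotopic g (\<Union>(comb.charts upper lower (sectors n c))) p (%_. y)"
  proof (rule comb.preserving_involution[OF comb_planar cg _ _ _ inv _ ne, where y = "%s. if s then vec3 0 0 (- 1) else vec3 0 0 1"])
   show "g ` upper = upper" "g ` lower = lower" unfolding image_involution[OF inv] by (auto simp: gt)
   have d: "det2 (c i) (g x) = - 1 * det2 (c i) x" for i x by (simp add: gt det2_def)
   show "g ` B \<in> sectors n c" if "B \<in> sectors n c" for B
    using sector_sign_image(1)[OF inv d _ that] by simp
   show "g ` B ~= B" if "B \<in> sectors n c" for B
    using sector_sign_image(3)[OF inv d _ that] c(3) by simp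
   show "(if s then vec3 0 0 (- 1) else vec3 0 0 1) \<in> comb.side upper lower s" for s
    by (simp add: comb.side_def[OF comb_planar])
   show "g (if s then vec3 0 0 (- 1) else vec3 0 0 1) = (if s then vec3 0 0 (- 1) else vec3 0 0 1)" for s
    by (simp add: gt vec3_eq_iff)
  qed (use p null ch in auto)
  then show ?thesis unfolding ch .
 next
  assume gr: "g = (%x. - half_turn x)"
  have "\<exists>y\<in>\<Union>(comb.charts upper lower (sectors n c)). g y = y \<and>
    twisted_homotopic g (\<Union>(comb.charts upper lower (sectors n c))) p (%_. y)"
  proof (rule comb.swapping_involution[OF comb_planar cg _ _ _ inv _ ne])
   show "g ` upper = lower" "g ` lower = upper" unfolding image_involution[OF inv] by (auto simp: gr)
   have d: "det2 (c i) (g x) = 1 * det2 (c i) x" for i x by (simp add: gr det2_def)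
   show "g ` B = B" if "B \<in> sectors n c" for B
    using sector_sign_image(2)[OF inv d _ that] by simp
   show "\<exists>y\<in>B. g y = y" if B: "B \<in> sectors n c" for B
   proof -
    obtain v where v: "!!i. i < n ==> det2 (c i) v ~= 0" "B = sector n c v" using B unfolding sectors_def by blast
    have "vec3 (v $ 1) (v $ 2) 0 \<in> B" using sector_nth3[OF sector_self[of n c v]] v by simp
    then show ?thesis by (rule bexI[rotated]) (simp add: gr vec3_eq_iff)
   qed
  qed (use p null ch in auto)
  then show ?thesis unfolding ch .
 qed
qed

section \<open>One vertical line: a comb in the universal covering of the complement of the
  axis\<close>

subsection \<open>One line orthogonal to the plane of the others\<close>

lemma twisted_homotopic_image:
 assumes tw: "twisted_homotopic E S p q" and f: "continuous_on S f" "f \<in> S \<rightarrow> T"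
  and comm: "!!x. x \<in> S ==> f (E x) = E' (f x)"
 shows "twisted_homotopic E' T (f \<circ> p) (f \<circ> q)"
proof -
 from tw obtain h where
  H: "continuous_on ({0..1::real} \<times> {0..1::real}) (%z. h (fst z) (snd z))"
   "!!s t. s \<in> {0..1} ==> t \<in> {0..1} ==> h s t \<in> S"
   "!!t. t \<in> {0..1} ==> h 0 t = p t" "!!t. t \<in> {0..1} ==> h 1 t = q t"
   "!!s. s \<in> {0..1} ==> h s 1 = E (h s 0)"
  by (rule twisted_homotopicE) blast
 show ?thesis
 proof (rule twisted_homotopicI)
  show "continuous_on ({0..1} \<times> {0..1}) (%z. f (h (fst z) (snd z)))"
   by (rule continuous_on_compose2[OF f(1) H(1)]) (use H(2) in auto)
  show "f (h s t) \<in> T" if "s \<in> {0..1}" "t \<in> {0..1}" for s t using H(2)[OF that] f(2) by blast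
  show "f (h s 1) = E' (f (h s 0))" if "s \<in> {0..1}" for s
   using H(5)[OF that] comm[OF H(2)[OF that]] by simp
 qed (use H(3,4) in simp_all)
qed

lemma null_loop_image:
 assumes "null_loop S p" "continuous_on S f" "f \<in> S \<rightarrow> T"
 shows "null_loop T (f \<circ> p)"
proof -
 have "homotopic_paths T (f \<circ> p) (f \<circ> (%_. pathstart p))"
  using homotopic_paths_continuous_image[OF assms(1)[unfolded null_loop_def] assms(2,3)] .
 then show ?thesis by (simp add: null_loop_def o_def pathstart_def)
qed

text \<open>Uniqueness of lifts through the exponential covering.\<close>

lemma exp_lift_unique:
 assumes "connected T" "continuous_on T g" "continuous_on T g'" "!!x. x \<in> T ==> exp (g x) = exp (g' x)" "a \<in> T" "x \<in> T"
 shows "g x - g' x = g a - (g' a :: complex)"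
proof -
 have d: "exp (g a - g' a) = 1" using assms(4)[OF assms(5)] by (simp add: exp_diff)
 have "g x = g' x + (g a - g' a)"
 proof (rule covering_space_lift_unique[OF covering_space_exp_punctured_plane, of g a "%x. g' x + (g a - g' a)" T "%x. exp (g x)"])
  show "exp (g x) = exp (g' x + (g a - g' a))" if "x \<in> T" for x
   using assms(4)[OF that] d by (simp add: exp_add)
 qed (use assms in "auto intro!: continuous_intros")
 then show ?thesis by simp
qed

text \<open>The universal covering of the complement of the vertical axis: the exponential in the
  horizontal plane, the identity in height.\<close>

definition cyl :: "complex \<times> real => real ^ 3" where
 "cyl w = vec3 (Re (exp (fst w))) (Im (exp (fst w))) (snd w)"

definition horiz :: "real ^ 3 => complex" where "horiz x = Complex (x $ 1) (x $ 2)"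

lemma cyl_eq_iff: "cyl w = x \<longleftrightarrow> exp (fst w) = horiz x \<and> snd w = x $ 3"
 by (auto simp: cyl_def horiz_def vec3_eq_iff complex_eq_iff)

lemma horiz_eq_0: "horiz x = 0 \<longleftrightarrow> axial x"
 by (auto simp: horiz_def axial_def complex_eq_iff)

lemma continuous_on_horiz [continuous_intros]: "continuous_on X f ==> continuous_on X (%x. horiz (f x))"
 unfolding horiz_def Complex_eq by (intro continuous_intros)

lemma continuous_on_cyl: "continuous_on X cyl"
 unfolding cyl_def by (intro continuous_intros)

lemma square_contractible: "contractible ({0..1} \<times> {0..1} :: (real \<times> real) set)"
 by (intro convex_imp_contractible convex_Times) auto

lemma cyl_lift_path:
 assumes p: "path p" "path_image p \<subseteq> U" and U: "!!x. x \<in> U ==> \<not> axial x" and w: "cyl w = p 0"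
 obtains q where "path q" "path_image q \<subseteq> {w. cyl w \<in> U}" "q 0 = w" "!!t. t \<in> {0..1} ==> cyl (q t) = p t"
proof -
 have pc: "continuous_on {0..1} p" using p(1) by (simp add: path_def)
 have pU: "p t \<in> U" if "t \<in> {0..1}" for t using p(2) that unfolding path_image_def by blast
 have "continuous_on {0..1} (%t. horiz (p t))" by (intro continuous_intros pc)
 moreover have "contractible {0..1::real}" by (intro convex_imp_contractible) auto
 moreover have "horiz (p t) ~= 0" if "t \<in> {0..1}" for t using U[OF pU[OF that]] horiz_eq_0 by blast
 ultimately obtain g where g: "continuous_on {0..1} g" "!!t. t \<in> {0..1} ==> horiz (p t) = exp (g t)"
  using continuous_logarithm_on_contractible[of "{0..1}" "%t. horiz (p t)"] by blast
 define d where "d = fst w - g 0"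
 have "exp (fst w) = exp (g 0)" using w g(2)[of 0] by (simp add: cyl_eq_iff)
 then have d: "exp d = 1" by (simp add: d_def exp_diff)
 define q where "q t = (g t + d, p t $ 3)" for t
 have qp: "cyl (q t) = p t" if "t \<in> {0..1}" for t
  using g(2)[OF that] d by (simp add: cyl_eq_iff q_def exp_add)
 show thesis
 proof (rule that[of q])
  show "path q" unfolding path_def q_def by (intro continuous_intros g(1) pc)
  show "path_image q \<subseteq> {w. cyl w \<in> U}" using qp pU unfolding path_image_def by auto
  show "q 0 = w" using w by (simp add: q_def d_def prod_eq_iff cyl_eq_iff)
 qed (rule qp)
qed

text \<open>The horizontal part of the homotopy has a logarithm because the square is contractible;
  the four edges are identified by uniqueness of logarithms.\<close>

lemma cyl_lift_homotopic:
 assumes hom: "homotopic_paths U p p'" and U: "!!x. x \<in> U ==> \<not> axial x"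
  and q: "path q" "path_image q \<subseteq> {w. cyl w \<in> U}" "!!t. t \<in> {0..1} ==> cyl (q t) = p t"
  and q': "path q'" "path_image q' \<subseteq> {w. cyl w \<in> U}" "!!t. t \<in> {0..1} ==> cyl (q' t) = p' t"
  and start: "q 0 = q' 0"
 shows "homotopic_paths {w. cyl w \<in> U} q q'"
proof -
 let ?I = "{0..1::real}"
 from hom obtain k where k: "continuous_on (?I \<times> ?I) k" "k \<in> ?I \<times> ?I \<rightarrow> U"
   "\<forall>x\<in>?I. k (0, x) = p x" "\<forall>x\<in>?I. k (1, x) = p' x"
   "\<forall>t\<in>?I. pathstart (k \<circ> Pair t) = pathstart p \<and> pathfinish (k \<circ> Pair t) = pathfinish p"
  unfolding homotopic_paths by blast
 have ends: "k (s, 0) = p 0" "k (s, 1) = p 1" if "s \<in> ?I" for s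
  using k(5) that by (auto simp: pathstart_def pathfinish_def)
 have "continuous_on (?I \<times> ?I) (%z. horiz (k z))" by (intro continuous_intros k(1))
 moreover have "horiz (k z) ~= 0" if "z \<in> ?I \<times> ?I" for z using U k(2) that horiz_eq_0 by blast
 ultimately obtain g where g: "continuous_on (?I \<times> ?I) g" "!!z. z \<in> ?I \<times> ?I ==> horiz (k z) = exp (g z)"
  using continuous_logarithm_on_contractible[OF _ square_contractible, of "%z. horiz (k z)"] by blast
 define d where "d = fst (q 0) - g (0, 0)"
 have "exp (fst (q 0)) = horiz (p 0)" using q(3)[of 0] by (simp add: cyl_eq_iff)
 moreover have "horiz (p 0) = exp (g (0, 0))" using g(2)[of "(0, 0)"] k(3) by simp
 ultimately have d: "exp d = 1" by (simp add: d_def exp_diff)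
 define H where "H z = (g z + d, k z $ 3)" for z
 have cH: "continuous_on (?I \<times> ?I) H" unfolding H_def by (intro continuous_intros g(1) k(1))
 have EH: "cyl (H z) = k z" if "z \<in> ?I \<times> ?I" for z
  using g(2)[OF that] d by (simp add: cyl_eq_iff H_def exp_add)
 have uniq: "H (f x) = r x" if f: "continuous_on ?I f" "f \<in> ?I \<rightarrow> ?I \<times> ?I" and r: "continuous_on ?I r"
  and e: "!!x. x \<in> ?I ==> cyl (r x) = k (f x)" and a: "a \<in> ?I" "H (f a) = r a" and x: "x \<in> ?I"
  for f :: "real => real \<times> real" and r a x
 proof -
  have 1: "cyl (H (f x)) = cyl (r x)" if "x \<in> ?I" for x
  proof -
   have "f x \<in> ?I \<times> ?I" using f(2) that by blast
   then show ?thesis using EH e[OF that] by simp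
  qed
  then have 2: "exp (fst (H (f x))) = exp (fst (r x))" "snd (H (f x)) = snd (r x)" if "x \<in> ?I" for x
   using 1[OF that] unfolding cyl_eq_iff[of "H (f x)"] by (simp_all add: cyl_def horiz_def complex_eq_iff)
  have "fst (H (f x)) - fst (r x) = fst (H (f a)) - fst (r a)"
  proof (rule exp_lift_unique[OF _ _ _ 2(1) a(1) x])
   have "continuous_on ?I (%x. H (f x))" by (rule continuous_on_compose2[OF cH f(1)]) (use f(2) in blast)
   then show "continuous_on ?I (%x. fst (H (f x)))" by (intro continuous_intros)
   show "continuous_on ?I (%x. fst (r x))" by (intro continuous_intros r)
  qed auto
  then show ?thesis using 2(2)[OF x] a(2) by (simp add: prod_eq_iff)
 qed
 have qc: "continuous_on ?I q" "continuous_on ?I q'" using q(1) q'(1) by (simp_all add: path_def)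
 have "snd (q 0) = k (0, 0) $ 3" using q(3)[of 0] k(3) by (simp add: cyl_eq_iff)
 then have H00: "H (0, 0) = q 0" by (simp add: H_def d_def prod_eq_iff)
 have b0: "H (0, t) = q t" if "t \<in> ?I" for t
  by (rule uniq[of "%t. (0, t)" q 0 t]) (use that H00 q(3) k(3) qc in "auto intro!: continuous_intros")
 have l0: "H (s, 0) = q 0" if "s \<in> ?I" for s
  by (rule uniq[of "%s. (s, 0)" "%_. q 0" 0 s]) (use that H00 q(3)[of 0] ends in "auto intro!: continuous_intros")
 have b1: "H (1, t) = q' t" if "t \<in> ?I" for t
  by (rule uniq[of "%t. (1, t)" q' 0 t]) (use that l0[of 1] start q'(3) k(4) qc in "auto intro!: continuous_intros")
 have l1: "H (s, 1) = q 1" if "s \<in> ?I" for s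
  by (rule uniq[of "%s. (s, 1)" "%_. q 1" 0 s]) (use that b0[of 1] q(3)[of 1] ends in "auto intro!: continuous_intros")
 show ?thesis
  unfolding homotopic_paths
 proof (intro exI[of _ H] conjI ballI)
  show "H \<in> ?I \<times> ?I \<rightarrow> {w. cyl w \<in> U}" using EH k(2) by auto
 qed (use cH b0 b1 l0 l1 in "auto simp: pathstart_def pathfinish_def")
qed

definition shift :: "complex => complex \<times> real => complex \<times> real" where
 "shift d w = (fst w + d, snd w)"

lemma cyl_shift: "exp d = 1 ==> cyl (shift d w) = cyl w"
 by (simp add: cyl_def shift_def exp_add)

lemma cyl_shift_iff: "cyl w = cyl w' \<longleftrightarrow> exp (fst w - fst w') = 1 \<and> snd w = snd w'"
proof -
 have "exp (fst w') = horiz (cyl w')" "snd w' = cyl w' $ 3" using cyl_eq_iff[of w' "cyl w'"] by simp_all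
 then show ?thesis unfolding cyl_eq_iff[of w] by (auto simp: exp_diff)
qed

lemma continuous_on_shift: "continuous_on X (shift d)"
 unfolding shift_def by (intro continuous_intros)

lemma cyl_surj: "\<not> axial x ==> \<exists>w. cyl w = x"
 using exp_Ln[of "horiz x"] horiz_eq_0[of x] by (intro exI[of _ "(Ln (horiz x), x $ 3)"]) (simp add: cyl_eq_iff)

context
 fixes n :: nat and c :: "nat => real ^ 3" and P :: nat
 assumes cn: "c \<in> conf n" and P: "P < n" "axial (c P)" and pl: "!!i. i < n ==> i ~= P ==> planar (c i)" and n2: "2 \<le> n"
begin

definition ang :: "nat => real => real" where
 "ang i \<phi> = c i $ 1 * sin \<phi> - c i $ 2 * cos \<phi>"

text \<open>The directions that meet none of the horizontal lines. Its components index the strips,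
  which are the sectors as seen in the covering.\<close>

definition good :: "real set" where
 "good = {\<phi>. \<forall>i<n. i ~= P --> ang i \<phi> ~= 0}"

definition strip :: "real set => (complex \<times> real) set" where
 "strip J = {w. Im (fst w) \<in> J}"

abbreviation "cyl_up \<equiv> {w :: complex \<times> real. 0 < snd w}"
abbreviation "cyl_dn \<equiv> {w :: complex \<times> real. snd w < 0}"
abbreviation "strips \<equiv> strip ` components good"
abbreviation "cover \<equiv> {w. cyl w \<in> off_lines n c}"

lemma ang_pi: "ang i (\<phi> + pi) = - ang i \<phi>"
 by (simp add: ang_def)

lemma good_pi: "\<phi> + pi \<in> good \<longleftrightarrow> \<phi> \<in> good"
 by (simp add: good_def ang_pi)

lemma good_pi_int: "\<phi> + pi * of_int k \<in> good \<longleftrightarrow> \<phi> \<in> good"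
proof (induction k rule: int_induct[where k = 0])
 case (step1 i)
 then show ?case using good_pi[of "\<phi> + pi * of_int i"] by (simp add: algebra_simps)
next
 case (step2 i)
 then show ?case using good_pi[of "\<phi> + pi * of_int (i - 1)"] by (simp add: algebra_simps)
qed simp

lemma open_good: "open good"
proof -
 have "good = (\<Inter>i\<in>{..<n}. {\<phi>. i = P \<or> ang i \<phi> ~= 0})" by (auto simp: good_def)
 moreover have "open {\<phi>. i = P \<or> ang i \<phi> ~= 0}" for i
 proof (cases "i = P")
  case False
  have "open {\<phi>. ang i \<phi> ~= 0}" unfolding ang_def by (intro open_Collect_neq continuous_intros)
  then show ?thesis using False by simp
 qed simp
 ultimately show ?thesis by (simp add: open_INT)
qed

lemma other: obtains i where "i < n" "i ~= P" "c i ~= 0" "planar (c i)"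
proof -
 obtain i where i: "i < n" "i ~= P" using n2 by (cases "P = 0") (auto intro: that[of 0] that[of 1])
 then show thesis using that cn pl by (auto simp: conf_def)
qed

text \<open>\<open>ang i\<close> changes sign over any interval of length \<pi>. Strips are
  therefore narrow, and no nontrivial deck transformation keeps one.\<close>

lemma component_short:
 assumes J: "J \<in> components good" and "\<phi> \<in> J" "\<psi> \<in> J" shows "\<psi> < \<phi> + pi"
proof (rule ccontr)
 assume "\<not> \<psi> < \<phi> + pi"
 then have le: "\<phi> + pi \<le> \<psi>" by simp
 have "connected J" using J in_components_connected by blast
 then have iv: "{\<phi>..\<psi>} \<subseteq> J" using assms(2,3) by (rule connected_contains_Icc)
 obtain i where i: "i < n" "i ~= P" using other by blast
 have cont: "continuous_on {\<phi>..\<phi> + pi} (ang i)" unfolding ang_def by (intro continuous_intros)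
 have "\<exists>x\<in>{\<phi>..\<phi> + pi}. ang i x = 0"
 proof (cases "ang i \<phi> \<le> 0")
  case True
  then show ?thesis using IVT'[of "ang i" \<phi> 0 "\<phi> + pi"] cont ang_pi[of i \<phi>] by auto
 next
  case False
  then show ?thesis using IVT2'[of "ang i" "\<phi> + pi" 0 \<phi>] cont ang_pi[of i \<phi>] by auto
 qed
 then obtain x where x: "x \<in> {\<phi>..\<phi> + pi}" "ang i x = 0" by blast
 then have "x \<in> J" using iv le by auto
 then have "x \<in> good" using J in_components_subset by blast
 then show False using x(2) i by (simp add: good_def)
qed

lemma component_shift:
 assumes J: "J \<in> components good" shows "(%\<phi>. \<phi> + pi * of_int k) ` J \<in> components good"
proof -
 let ?a = "pi * of_int k"
 obtain x where x: "x \<in> good" "J = connected_component_set good x" using J by (auto simp: components_def)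
 have sub: "J \<subseteq> good" using J in_components_subset by blast
 have "(%\<phi>. \<phi> + ?a) ` J = connected_component_set good (x + ?a)"
 proof (rule equalityI)
  show "(%\<phi>. \<phi> + ?a) ` J \<subseteq> connected_component_set good (x + ?a)"
  proof (rule connected_component_maximal)
   show "x + ?a \<in> (%\<phi>. \<phi> + ?a) ` J" using x by simp
   show "connected ((%\<phi>. \<phi> + ?a) ` J)"
    by (intro connected_continuous_image continuous_intros) (use J in_components_connected in blast)
   show "(%\<phi>. \<phi> + ?a) ` J \<subseteq> good" using sub good_pi_int by auto
  qed
  let ?K = "connected_component_set good (x + ?a)"
  have "(%\<phi>. \<phi> - ?a) ` ?K \<subseteq> connected_component_set good x"
  proof (rule connected_component_maximal)
   have "x + ?a \<in> ?K" using x good_pi_int by simp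
   then show "x \<in> (%\<phi>. \<phi> - ?a) ` ?K" by (rule rev_image_eqI) simp
   show "connected ((%\<phi>. \<phi> - ?a) ` ?K)"
    by (intro connected_continuous_image continuous_intros connected_connected_component)
   have "?K \<subseteq> good" by (rule connected_component_subset)
   then show "(%\<phi>. \<phi> - ?a) ` ?K \<subseteq> good" using good_pi_int[of "_ - ?a" k] by auto
  qed
  then have "\<phi> - ?a \<in> J" if "\<phi> \<in> ?K" for \<phi> using that x(2) by blast
  then show "?K \<subseteq> (%\<phi>. \<phi> + ?a) ` J" by (intro subsetI rev_image_eqI) auto
 qed
 moreover have "x + ?a \<in> good" using x good_pi_int by simp
 ultimately show ?thesis by (auto simp: components_def)
qed

lemma comb_axis: "comb cyl_up cyl_dn strips"
proof (unfold_locales)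
 show "open cyl_up" "open cyl_dn" by (intro open_Collect_less continuous_intros)+
 have "cyl_up = snd -` {0<..}" "cyl_dn = snd -` {..<0}" by auto
 then show "convex cyl_up" "convex cyl_dn" by (simp_all add: convex_linear_vimage linear_snd)
 have "(0, 1) \<in> cyl_up" "(0, - 1) \<in> cyl_dn" by simp_all
 then show "cyl_up ~= {}" "cyl_dn ~= {}" by blast+
 show "cyl_up \<inter> cyl_dn = {}" by auto
 fix B assume "B \<in> strips"
 then obtain J where J: "J \<in> components good" "B = strip J" by blast
 have "open J" using open_components[OF open_good J(1)] .
 then have "open ((%w :: complex \<times> real. Im (fst w)) -` J)" by (intro open_vimage continuous_intros)
 then show "open B" by (simp add: J(2) strip_def vimage_def)
 have "convex J" using in_components_connected[OF J(1)] by (simp add: is_interval_connected_1[symmetric] is_interval_convex_1)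
 then show "convex B" unfolding J(2) strip_def
 proof (intro convexI)
  fix x y :: "complex \<times> real" and u v :: real
  assume *: "convex J" "x \<in> {w. Im (fst w) \<in> J}" "y \<in> {w. Im (fst w) \<in> J}" "0 \<le> u" "0 \<le> v" "u + v = 1"
  then have "u *\<^sub>R Im (fst x) + v *\<^sub>R Im (fst y) \<in> J" using convexD[OF *(1)] by blast
  then show "u *\<^sub>R x + v *\<^sub>R y \<in> {w. Im (fst w) \<in> J}" by simp
 qed
 obtain \<phi> where \<phi>: "\<phi> \<in> J" using in_components_nonempty[OF J(1)] by blast
 have "(Complex 0 \<phi>, 1) \<in> B \<inter> cyl_up" "(Complex 0 \<phi>, - 1) \<in> B \<inter> cyl_dn" using \<phi> by (simp_all add: J(2) strip_def)
 then show "B \<inter> cyl_up ~= {}" "B \<inter> cyl_dn ~= {}" by blast+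
next
 fix B B' x assume "B \<in> strips" "B' \<in> strips" "x \<in> B" "x \<in> B'"
 then obtain J J' where J: "J \<in> components good" "B = strip J" "J' \<in> components good" "B' = strip J'" "Im (fst x) \<in> J" "Im (fst x) \<in> J'"
  unfolding strip_def by blast
 then have "J \<inter> J' ~= {}" by blast
 then have "J = J'" using components_eq[OF J(1,3)] by blast
 then show "B = B'" using J by simp
qed

lemma not_axial: "x \<in> off_lines n c ==> \<not> axial x"
 using off_linesD[of x n c P] P axial_cross[of "c P" x] cn by (auto simp: conf_def axial_def)

lemma axis_charts: "\<Union>(comb.charts cyl_up cyl_dn strips) = cover"
proof (rule Set.set_eqI)
 fix w :: "complex \<times> real"
 have c0: "c i ~= 0" if "i < n" for i using cn that by (auto simp: conf_def)
 have "\<not> axial (cyl w)" using horiz_eq_0[of "cyl w"] cyl_eq_iff[of w "cyl w"] by (metis exp_not_eq_zero)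
 then have PP: "cross3 (c P) (cyl w) ~= 0" using axial_cross[OF P(2) c0[OF P(1)]] by (auto simp: axial_def)
 have d: "det2 (c i) (cyl w) = exp (Re (fst w)) * ang i (Im (fst w))" for i
  by (simp add: det2_def cyl_def ang_def Re_exp Im_exp algebra_simps)
 have "cyl w \<in> off_lines n c \<longleftrightarrow> (\<forall>i<n. i ~= P --> cross3 (c i) (cyl w) ~= 0)"
  using PP unfolding off_lines_def by auto
 also have "\<dots> \<longleftrightarrow> (\<forall>i<n. i ~= P --> snd w ~= 0 \<or> ang i (Im (fst w)) ~= 0)"
 proof -
  have "cross3 (c i) (cyl w) ~= 0 \<longleftrightarrow> snd w ~= 0 \<or> ang i (Im (fst w)) ~= 0" if "i < n" "i ~= P" for i
   using planar_cross[OF pl[OF that] c0[OF that(1)], of "cyl w"] unfolding d by (simp add: cyl_def)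
  then show ?thesis by blast
 qed
 also have "\<dots> \<longleftrightarrow> snd w ~= 0 \<or> Im (fst w) \<in> good" by (auto simp: good_def)
 finally have 1: "cyl w \<in> off_lines n c \<longleftrightarrow> snd w ~= 0 \<or> Im (fst w) \<in> good" .
 have "w \<in> \<Union>strips \<longleftrightarrow> (\<exists>J\<in>components good. Im (fst w) \<in> J)"
  by (auto simp: strip_def)
 moreover have "Im (fst w) \<in> \<Union>(components good) \<longleftrightarrow> Im (fst w) \<in> good" by simp
 ultimately have 2: "w \<in> \<Union>strips \<longleftrightarrow> Im (fst w) \<in> good" by blast
 show "w \<in> \<Union>(comb.charts cyl_up cyl_dn strips) \<longleftrightarrow> w \<in> cover"
  unfolding comb.charts_def[OF comb_axis] Union_insert Un_iff mem_Collect_eq 1 2 by (cases "snd w = 0") auto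
qed

text \<open>Only finitely many slopes \<open>t\<close> are excluded, namely those of the horizontal
  lines.\<close>

lemma good_nonempty: "\<exists>\<phi>. \<phi> \<in> good"
proof -
 define Z where "Z = (\<Union>i\<in>{..<n} - {P}. {t. c i $ 1 * t = c i $ 2})"
 have "finite {t. c i $ 1 * t = c i $ 2}" if "i < n" "i ~= P" for i
 proof (cases "c i $ 1 = 0")
  case True
  have "c i ~= 0" using cn that by (auto simp: conf_def)
  then have "c i $ 2 ~= 0" using True pl[OF that] by (auto simp: vec3_eq_iff planar_def)
  then show ?thesis using True by simp
 next
  case False
  then have "{t. c i $ 1 * t = c i $ 2} \<subseteq> {c i $ 2 / c i $ 1}" by (auto simp: field_simps)
  then show ?thesis by (rule finite_subset) simp
 qed
 then have "finite Z" unfolding Z_def by auto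
 then obtain t where t: "t \<notin> Z" using infinite_UNIV_char_0 ex_new_if_finite by blast
 have "ang i (arctan t) ~= 0" if "i < n" "i ~= P" for i
 proof -
  have c: "cos (arctan t) ~= 0" by (rule cos_arctan_not_zero)
  have "sin (arctan t) = t * cos (arctan t)" using tan_arctan[of t] c by (simp add: tan_def field_simps)
  then have "ang i (arctan t) = (c i $ 1 * t - c i $ 2) * cos (arctan t)" by (simp add: ang_def algebra_simps)
  moreover have "c i $ 1 * t ~= c i $ 2" using t that by (auto simp: Z_def)
  ultimately show ?thesis using c by simp
 qed
 then show ?thesis by (auto simp: good_def)
qed

text \<open>\<open>f\<close> is a lift of \<open>g\<close> to the covering. The null homotopy of
  \<open>twice g p\<close> lifts as well, and its lift starts with \<open>twice f q\<close>.\<close>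

lemma axis_null_twice:
 assumes p: "path p" "path_image p \<subseteq> off_lines n c" "p 1 = g (p 0)"
  and null: "null_loop (off_lines n c) (twice g p)" and g: "g \<in> off_lines n c \<rightarrow> off_lines n c"
  and q: "path q" "path_image q \<subseteq> cover" "!!t. t \<in> {0..1} ==> cyl (q t) = p t" "q 1 = f (q 0)"
  and f: "continuous_on UNIV f" "!!w. cyl (f w) = g (cyl w)"
 shows "f (q 1) = q 0" "null_loop cover (twice f q)"
proof -
 have fq: "path (f \<circ> q)" by (rule path_continuous_image[OF q(1) continuous_on_subset[OF f(1)]]) simp
 have qc: "cyl (q t) \<in> off_lines n c" if "t \<in> {0..1}" for t using q(2) that unfolding path_image_def by blast
 have fqc: "path_image (f \<circ> q) \<subseteq> cover"
  unfolding path_image_def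
 proof (rule image_subsetI)
  fix t :: real assume "t \<in> {0..1}"
  then have "g (cyl (q t)) \<in> off_lines n c" using qc g by blast
  then show "(f \<circ> q) t \<in> cover" using f(2) by simp
 qed
 have pt: "path (twice f q)" "path_image (twice f q) \<subseteq> cover"
  unfolding twice_def using q fq fqc by (auto simp: pathstart_def pathfinish_def subset_path_image_join)
 have q0: "q 0 \<in> cover" using qc[of 0] by simp
 have "homotopic_paths cover (twice f q) (%_. q 0)"
 proof (rule cyl_lift_homotopic[OF null[unfolded null_loop_def] not_axial pt])
  show "cyl (twice f q t) = twice g p t" if "t \<in> {0..1}" for t
   using that q(3) f(2) by (auto simp: twice_def joinpaths_def)
  show "cyl (q 0) = pathstart (twice g p)" using q(3)[of 0] by (simp add: twice_def pathstart_def joinpaths_def)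
  show "twice f q 0 = q 0" by (simp add: twice_def joinpaths_def)
 qed (use q0 in "auto simp: path_def path_image_def")
 note H = this
 show "f (q 1) = q 0" using homotopic_paths_imp_pathfinish[OF H] by (simp add: twice_def joinpaths_def pathfinish_def)
 show "null_loop cover (twice f q)" using H by (simp add: null_loop_def pathstart_def) (simp add: twice_def joinpaths_def)
qed

lemma axis_lift:
 assumes p: "path p" "path_image p \<subseteq> off_lines n c"
 obtains q where "path q" "path_image q \<subseteq> cover" "!!t. t \<in> {0..1} ==> cyl (q t) = p t"
proof -
 have "p 0 \<in> off_lines n c" using p(2) by (auto simp: path_image_def)
 then obtain w where "cyl w = p 0" using cyl_surj[OF not_axial] by blast
 then show thesis using cyl_lift_path[OF p not_axial] that by metis
qed

lemma axis_push:
 assumes "null_loop cover q" "path p" "path_image p \<subseteq> off_lines n c" "!!t. t \<in> {0..1} ==> cyl (q t) = p t" "p 1 = p 0"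
 shows "null_loop (off_lines n c) p"
proof -
 have 1: "null_loop (off_lines n c) (cyl \<circ> q)"
  by (rule null_loop_image[OF assms(1) continuous_on_cyl]) auto
 have "homotopic_paths (off_lines n c) p (cyl \<circ> q)"
  by (rule homotopic_paths_eq[OF assms(2,3)]) (use assms(4) in auto)
 moreover have "pathstart (cyl \<circ> q) = pathstart p" using assms(4)[of 0] by (simp add: pathstart_def)
 ultimately show ?thesis using 1 homotopic_paths_trans unfolding null_loop_def by metis
qed

lemma axis_null_square:
 assumes p: "path p" "path_image p \<subseteq> off_lines n c" "p 0 = p 1" and null: "null_loop (off_lines n c) (p +++ p)"
 shows "null_loop (off_lines n c) p"
proof -
 obtain q where q: "path q" "path_image q \<subseteq> cover" "!!t. t \<in> {0..1} ==> cyl (q t) = p t"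
  using axis_lift[OF p(1,2)] by blast
 define d where "d = fst (q 1) - fst (q 0)"
 have "cyl (q 1) = cyl (q 0)" using q(3)[of 0] q(3)[of 1] p(3) by simp
 then have d: "exp d = 1" "q 1 = shift d (q 0)" unfolding cyl_shift_iff by (auto simp: d_def shift_def prod_eq_iff)
 have n2': "null_loop (off_lines n c) (twice (%x. x) p)" using null by (simp add: twice_def o_def)
 note N = axis_null_twice[OF p(1,2) _ n2' _ q d(2) continuous_on_shift cyl_shift[OF d(1)]]
 have "shift d (q 1) = q 0" "null_loop cover (twice (shift d) q)" using N p(3) by auto
 \<comment> \<open>The lift of the square closes up only for the trivial deck transformation, since
   translations have infinite order.\<close>
 then have "d = 0" using d(2) by (simp add: shift_def prod_eq_iff)
 then have sh: "shift d = (%x. x)" by (auto simp: shift_def)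
 then have q10: "q 0 = q 1" using d(2) by simp
 have nq: "null_loop cover (q +++ q)" using N(2) p(3) unfolding sh by (simp add: twice_def o_def)
 have "null_loop cover q"
  using comb.null_loop_of_square[OF comb_axis, of q] q(1,2) q10 nq unfolding axis_charts by blast
 then show ?thesis using axis_push p q(3) by metis
qed

lemma strip_image: assumes "J \<in> components good" "exp d = 1" shows "shift d ` strip J \<in> strips"
proof -
 obtain k :: int where k: "Re d = 0" "Im d = of_int (2 * k) * pi" using assms(2) unfolding exp_eq_1 by blast
 have "shift d ` strip J = strip ((%\<phi>. \<phi> + pi * of_int (2 * k)) ` J)"
 proof (intro equalityI subsetI)
  fix w assume "w \<in> strip ((%\<phi>. \<phi> + pi * of_int (2 * k)) ` J)"
  then have "Im (fst w) - Im d \<in> J" unfolding strip_def k by (auto simp: mult_ac)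
  then show "w \<in> shift d ` strip J"
   by (intro image_eqI[of _ _ "(fst w - d, snd w)"]) (auto simp: strip_def shift_def)
 next
  fix w assume "w \<in> shift d ` strip J"
  then obtain v where v: "w = shift d v" "Im (fst v) \<in> J" unfolding strip_def by blast
  then have "Im (fst w) = Im (fst v) + pi * of_int (2 * k)" by (simp add: shift_def k mult_ac)
  then show "w \<in> strip ((%\<phi>. \<phi> + pi * of_int (2 * k)) ` J)" unfolding strip_def using v(2) by blast
 qed
 then show ?thesis using component_shift[OF assms(1), of "2 * k"] by auto
qed

lemma three_strips:
 obtains a1 a2 a3 where "a1 \<in> strips" "a2 \<in> strips" "a3 \<in> strips" "a1 ~= a2" "a1 ~= a3" "a2 ~= a3"
proof -
 obtain \<phi> where \<phi>: "\<phi> \<in> good" using good_nonempty by blast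
 define J where "J k = connected_component_set good (\<phi> + pi * of_int k)" for k
 have in_good: "\<phi> + pi * of_int k \<in> good" for k using \<phi> good_pi_int by blast
 have Jc: "J k \<in> components good" for k unfolding J_def components_def using in_good by blast
 have Jm: "\<phi> + pi * of_int k \<in> J k" for k unfolding J_def using in_good by simp
 have ne: "strip (J k) ~= strip (J l)" if "k < l" for k l
 proof
  assume "strip (J k) = strip (J l)"
  moreover have "(Complex 0 x, 0) \<in> strip (J k) \<longleftrightarrow> x \<in> J k" for x k by (simp add: strip_def)
  ultimately have "J k = J l" by blast
  then have "\<phi> + pi * of_int l < \<phi> + pi * of_int k + pi"
   using component_short[OF Jc[of k]] Jm by metis
  then have "pi * of_int l < pi * of_int (k + 1)" by (simp add: algebra_simps)
  then have "real_of_int l < of_int (k + 1)" by (simp add: mult_less_cancel_left)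
  then show False using that by linarith
 qed
 show thesis by (rule that[of "strip (J 0)" "strip (J 1)" "strip (J 2)"]) (use Jc ne in auto)
qed

text \<open>\<open>central_loop\<close> is applied in the covering, to a lift \<open>q\<close> of
  \<open>p\<close> and the deck transformation \<open>shift d\<close> joining its ends. Commutation
  with loops lifts, and by \<open>component_short\<close> a deck transformation keeping a strip is
  trivial.\<close>

lemma axis_central:
 assumes p: "path p" "path_image p \<subseteq> off_lines n c" "p 0 = p 1"
  and comm: "!!q. path q ==> path_image q \<subseteq> off_lines n c ==> q 0 = p 0 ==> q 1 = p 0 ==>
    homotopic_paths (off_lines n c) (p +++ q) (q +++ p)"
 shows "null_loop (off_lines n c) p"
proof -
 obtain q where q: "path q" "path_image q \<subseteq> cover" "!!t. t \<in> {0..1} ==> cyl (q t) = p t"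
  using axis_lift[OF p(1,2)] by blast
 define d where "d = fst (q 1) - fst (q 0)"
 have "cyl (q 1) = cyl (q 0)" using q(3)[of 0] q(3)[of 1] p(3) by simp
 then have d: "exp d = 1" "q 1 = shift d (q 0)" unfolding cyl_shift_iff by (auto simp: d_def shift_def prod_eq_iff)
 obtain a1 a2 a3 where a: "a1 \<in> strips" "a2 \<in> strips" "a3 \<in> strips" "a1 ~= a2" "a1 ~= a3" "a2 ~= a3"
  using three_strips by blast
 have sd: "shift d (fst w - d, snd w) = w" for w by (simp add: shift_def)
 have "q 1 = q 0 \<and> null_loop (\<Union>(comb.charts cyl_up cyl_dn strips)) q"
 proof (rule comb.central_loop[OF comb_axis a, where \<gamma> = "shift d"])
  show "shift d ` cyl_up = cyl_up" "shift d ` cyl_dn = cyl_dn"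
   by (auto simp: shift_def image_iff intro: exI[of _ "_ - d"])
    (metis diff_add_cancel)+
  show "shift d ` B \<in> strips" if "B \<in> strips" for B using strip_image[OF _ d(1)] that by auto
  show "inj (shift d)" by (auto simp: inj_def shift_def prod_eq_iff)
  show "homotopic_paths (\<Union>(comb.charts cyl_up cyl_dn strips)) (q +++ (shift d \<circ> r)) (r +++ q)"
   if r: "path r" "path_image r \<subseteq> \<Union>(comb.charts cyl_up cyl_dn strips)" "r 0 = q 0" "r 1 = q 0" for r
  proof -
   have rc: "path_image r \<subseteq> cover" using r(2) unfolding axis_charts .
   have r2: "path (cyl \<circ> r)" "path_image (cyl \<circ> r) \<subseteq> off_lines n c" "(cyl \<circ> r) 0 = p 0" "(cyl \<circ> r) 1 = p 0"
    using path_continuous_image[OF r(1) continuous_on_cyl] rc r(3,4) q(3)[of 0] by (auto simp: path_image_def)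
   have sr: "path (shift d \<circ> r)" "path_image (shift d \<circ> r) \<subseteq> cover"
    using path_continuous_image[OF r(1) continuous_on_shift] rc by (auto simp: path_image_def cyl_shift[OF d(1)])
   show ?thesis
    unfolding axis_charts
   proof (rule cyl_lift_homotopic[OF comm[OF r2] not_axial])
    show "path (q +++ (shift d \<circ> r))" "path_image (q +++ (shift d \<circ> r)) \<subseteq> cover"
     "path (r +++ q)" "path_image (r +++ q) \<subseteq> cover"
     using q(1,2) sr r rc d(2) by (auto simp: pathstart_def pathfinish_def subset_path_image_join)
    show "cyl ((q +++ (shift d \<circ> r)) t) = (p +++ (cyl \<circ> r)) t" if "t \<in> {0..1}" for t
     using that q(3) cyl_shift[OF d(1)] by (auto simp: joinpaths_def)
    show "cyl ((r +++ q) t) = ((cyl \<circ> r) +++ p) t" if "t \<in> {0..1}" for t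
     using that q(3) by (auto simp: joinpaths_def)
    show "(q +++ (shift d \<circ> r)) 0 = (r +++ q) 0" using r(3) by (simp add: joinpaths_def)
   qed
  qed
  show "shift d (q 0) = q 0" if B: "B \<in> strips" "shift d ` B = B" for B
  proof -
   obtain J where J: "J \<in> components good" "B = strip J" using B(1) by blast
   obtain \<phi> where \<phi>: "\<phi> \<in> J" using in_components_nonempty[OF J(1)] by blast
   obtain k :: int where k: "Re d = 0" "Im d = of_int (2 * k) * pi" using d(1) unfolding exp_eq_1 by blast
   have 1: "(Complex 0 \<phi>, 0) \<in> B" using \<phi> J(2) by (simp add: strip_def)
   then have "shift d (Complex 0 \<phi>, 0) \<in> B" using B(2) by blast
   then have u: "\<phi> + Im d \<in> J" using J(2) by (simp add: strip_def shift_def)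
   have "(Complex 0 \<phi>, 0) \<in> shift d ` B" using 1 B(2) by simp
   then obtain v where v: "v \<in> B" "shift d v = (Complex 0 \<phi>, 0)" by auto
   then have "fst v + d = Complex 0 \<phi>" by (simp add: shift_def)
   then have "Im (fst v) = \<phi> - Im d" by (auto simp: complex_eq_iff)
   then have l: "\<phi> - Im d \<in> J" using v(1) J(2) by (simp add: strip_def)
   have "Im d < pi" "- Im d < pi" using component_short[OF J(1) \<phi> u] component_short[OF J(1) \<phi> l] by auto
   then have "real_of_int (2 * k) * pi < 1 * pi" "(- 1) * pi < real_of_int (2 * k) * pi" unfolding k by auto
   then have "real_of_int (2 * k) < 1" "- 1 < real_of_int (2 * k)"
    using mult_less_cancel_right_pos[OF pi_gt_zero] by blast+
   then have "k = 0" by linarith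
   then have "d = 0" using k by (simp add: complex_eq_iff)
   then show ?thesis by (simp add: shift_def)
  qed
 qed (use q d in "auto simp: axis_charts continuous_on_shift")
 then show ?thesis using axis_push p q(3) unfolding axis_charts by metis
qed

text \<open>The half turn lifts to a nontrivial translation, which has infinite order, whereas the
  null \<open>twice g p\<close> would make it an involution; so only the reflection can occur. It
  lifts to an involution that exchanges the halves of the covering and keeps the strips.\<close>

lemma axis_twisted:
 assumes g: "g = half_turn \<or> g = (%x. - half_turn x)"
  and gU: "g \<in> off_lines n c \<rightarrow> off_lines n c"
  and p: "path p" "path_image p \<subseteq> off_lines n c" "p 1 = g (p 0)" and null: "null_loop (off_lines n c) (twice g p)"
 shows "\<exists>y\<in>off_lines n c. g y = y \<and> twisted_homotopic g (off_lines n c) p (%_. y)"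
proof -
 obtain q where q: "path q" "path_image q \<subseteq> cover" "!!t. t \<in> {0..1} ==> cyl (q t) = p t"
  using axis_lift[OF p(1,2)] by blast
 define d where "d = fst (q 1) - fst (q 0)"
 have c1: "cyl (q 1) = g (cyl (q 0))" using q(3)[of 0] q(3)[of 1] p(3) by simp
 have ed: "exp (fst (q 1)) = exp d * exp (fst (q 0))" by (simp add: d_def exp_diff)
 have hc: "exp (fst w) = horiz (cyl w)" "snd w = cyl w $ 3" for w by (simp_all add: cyl_def horiz_def complex_eq_iff)
 from g show ?thesis
 proof
  assume gh: "g = half_turn"
  have hm: "horiz (half_turn x) = - horiz x" for x by (simp add: horiz_def complex_eq_iff)
  have "exp d * exp (fst (q 0)) = - exp (fst (q 0))" using ed unfolding hc c1 gh hm by simp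
  then have "(exp d + 1) * exp (fst (q 0)) = 0" by (simp add: algebra_simps)
  then have e: "exp d = - 1" by (simp add: eq_neg_iff_add_eq_0)
  have s: "snd (q 1) = snd (q 0)" using c1 unfolding hc gh by simp
  have f: "cyl (shift d w) = g (cyl w)" for w using e by (simp add: cyl_def shift_def exp_add gh vec3_eq_iff)
  have q1: "q 1 = shift d (q 0)" using s by (simp add: d_def shift_def prod_eq_iff)
  have "shift d (q 1) = q 0" by (rule axis_null_twice(1)[OF p null gU q q1 continuous_on_shift f])
  then have "d = 0" using q1 by (simp add: shift_def prod_eq_iff)
  then show ?thesis using e by simp
 next
  assume gh: "g = (%x. - half_turn x)"
  have hm: "horiz (- half_turn x) = horiz x" for x by (simp add: horiz_def complex_eq_iff)
  have "exp d * exp (fst (q 0)) = exp (fst (q 0))" using ed unfolding hc c1 gh hm by simp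
  then have e: "exp d = 1" by simp
  have s: "snd (q 1) = - snd (q 0)" using c1 unfolding hc gh by simp
  define f where "f w = (fst w + d, - snd w)" for w :: "complex \<times> real"
  have f: "continuous_on X f" "cyl (f w) = g (cyl w)" for w X using e
   by (auto simp: cyl_def f_def exp_add gh vec3_eq_iff intro!: continuous_intros)
  have q1: "q 1 = f (q 0)" using s by (simp add: d_def f_def prod_eq_iff)
  have N: "f (q 1) = q 0" "null_loop cover (twice f q)"
   using axis_null_twice[OF p null gU q q1 f] by blast+
  then have "d = 0" using q1 by (simp add: f_def prod_eq_iff)
  then have fd: "f w = (fst w, - snd w)" for w by (simp add: f_def)
  have ff: "f (f w) = w" for w by (simp add: fd)
  obtain a where a: "a \<in> strips" using three_strips by blast
  have fstrip: "f ` B = B" if "B \<in> strips" for B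
   using that unfolding image_involution[OF ff] by (auto simp: strip_def fd)
  have "\<exists>y\<in>\<Union>(comb.charts cyl_up cyl_dn strips). f y = y \<and>
    twisted_homotopic f (\<Union>(comb.charts cyl_up cyl_dn strips)) q (%_. y)"
  proof (rule comb.swapping_involution[OF comb_axis f(1) _ _ fstrip ff])
   show "f ` cyl_up = cyl_dn" "f ` cyl_dn = cyl_up" unfolding image_involution[OF ff] by (auto simp: fd)
   show "\<exists>y\<in>B. f y = y" if B: "B \<in> strips" for B
   proof -
    obtain J where J: "J \<in> components good" "B = strip J" using B by blast
    obtain \<phi> where \<phi>: "\<phi> \<in> J" using in_components_nonempty[OF J(1)] by blast
    then have "(Complex 0 \<phi>, 0) \<in> B" using J(2) by (simp add: strip_def)
    then show ?thesis by (rule bexI[rotated]) (simp add: fd)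
   qed
   show "strips ~= {}" using a by blast
  qed (use q N q1 in "auto simp: axis_charts")
  then obtain y where y: "cyl y \<in> off_lines n c" "f y = y" "twisted_homotopic f cover q (%_. y)"
   unfolding axis_charts by blast
  have "twisted_homotopic g (off_lines n c) (cyl \<circ> q) (cyl \<circ> (%_. y))"
   by (rule twisted_homotopic_image[OF y(3) continuous_on_cyl]) (auto simp: f(2))
  then have "twisted_homotopic g (off_lines n c) p (%_. cyl y)"
   by (rule twisted_homotopic_cong) (use q(3) in auto)
  moreover have "g (cyl y) = cyl y" using f(2)[of y] y(2) by simp
  ultimately show ?thesis using y(1) by blast
 qed
qed

lemma axis_path_connected: "path_connected (off_lines n c)"
proof -
 obtain a where a: "a \<in> strips" using three_strips by blast
 then have "path_connected cover" using comb.path_connected_comb[OF comb_axis] unfolding axis_charts by blast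
 then have "path_connected (cyl ` cover)" by (rule path_connected_continuous_image[OF continuous_on_cyl])
 moreover have "cyl ` cover = off_lines n c" using cyl_surj[OF not_axial] by (auto simp: image_iff)
 ultimately show ?thesis by simp
qed

end

section \<open>Both kinds of special configurations together\<close>

lemma axial_unique:
 assumes "c \<in> special n" "P < n" "axial (c P)" "i < n" "i ~= P" shows "planar (c i)"
proof (rule ccontr)
 assume "\<not> planar (c i)"
 then have "axial (c i)" using assms by (auto simp: special_def)
 then have "cross3 (c P) (c i) = 0" using assms(3) by (simp add: cross3_eq_0_iff axial_def)
 moreover have "cross3 (c P) (c i) ~= 0" using assms by (auto simp: special_def conf_def)
 ultimately show False by blast
qed

lemma specialE:
 assumes "c \<in> special n"
 obtains "c \<in> conf n" "!!i. i < n ==> planar (c i)"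
 | P where "c \<in> conf n" "P < n" "axial (c P)" "!!i. i < n ==> i ~= P ==> planar (c i)"
proof (cases "\<exists>P<n. axial (c P)")
 case True
 then obtain P where P: "P < n" "axial (c P)" by blast
 show thesis by (rule that(2)[of P]) (use P axial_unique[OF assms] assms in "auto simp: special_def")
next
 case False
 show thesis by (rule that(1)) (use False assms in "auto simp: special_def")
qed

theorem special_null_square:
 assumes "c \<in> special n" "2 \<le> n"
  and "path p" "path_image p \<subseteq> off_lines n c" "p 0 = p 1" "null_loop (off_lines n c) (p +++ p)"
 shows "null_loop (off_lines n c) p"
 using assms(1)
proof (cases rule: specialE)
 case 1
 show ?thesis by (rule planar_null_square[OF 1 assms(2-6)])
next
 case (2 P)
 show ?thesis by (rule axis_null_square[OF 2 assms(2-6)])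
qed

theorem special_central:
 assumes "c \<in> special n" "2 \<le> n"
  and p: "path p" "path_image p \<subseteq> off_lines n c" "p 0 = p 1"
  and comm: "!!q. path q ==> path_image q \<subseteq> off_lines n c ==> q 0 = p 0 ==> q 1 = p 0 ==>
    homotopic_paths (off_lines n c) (p +++ q) (q +++ p)"
 shows "null_loop (off_lines n c) p"
 using assms(1)
proof (cases rule: specialE)
 case 1
 show ?thesis by (rule planar_central[OF 1 assms(2) p comm])
next
 case (2 P)
 show ?thesis by (rule axis_central[OF 2 assms(2) p comm])
qed

theorem special_twisted:
 assumes "c \<in> special n" "2 \<le> n"
  and g: "g = half_turn \<or> g = (%x. - half_turn x)" "g \<in> off_lines n c \<rightarrow> off_lines n c"
  and p: "path p" "path_image p \<subseteq> off_lines n c" "p 1 = g (p 0)" "null_loop (off_lines n c) (twice g p)"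
 shows "\<exists>y\<in>off_lines n c. g y = y \<and> twisted_homotopic g (off_lines n c) p (%_. y)"
 using assms(1)
proof (cases rule: specialE)
 case 1
 show ?thesis by (rule planar_twisted[OF 1 assms(2) g(1) p])
next
 case (2 P)
 show ?thesis by (rule axis_twisted[OF 2 assms(2) g p])
qed

theorem special_path_connected:
 assumes "c \<in> special n" "2 \<le> n" shows "path_connected (off_lines n c)"
 using assms(1)
proof (cases rule: specialE)
 case 1
 obtain a where a: "a \<in> sectors n c" using planar_sectors_three[OF 1 assms(2)] by blast
 have ch: "\<Union>(comb.charts upper lower (sectors n c)) = off_lines n c"
  by (rule planar_charts[OF 1(1)]) (rule 1(2))
 show ?thesis using comb.path_connected_comb[OF comb_planar, of n c] a unfolding ch by blast
next
 case (2 P)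
 show ?thesis by (rule axis_path_connected[OF 2 assms(2)])
qed

section \<open>Rotations, sign changes, and removal of two full turns\<close>

section \<open>Rotations and sign changes\<close>

lemma homotopic_pathsI:
 assumes "continuous_on ({0..1::real} \<times> {0..1::real}) (%z. h (fst z) (snd z))"
  and "!!s t. s \<in> {0..1} ==> t \<in> {0..1} ==> h s t \<in> S"
  and "!!t. t \<in> {0..1} ==> h 0 t = p t" "!!t. t \<in> {0..1} ==> h 1 t = q t"
  and "!!s. s \<in> {0..1} ==> h s 0 = p 0" "!!s. s \<in> {0..1} ==> h s 1 = p 1"
 shows "homotopic_paths S p q"
 unfolding homotopic_paths
proof (intro exI[of _ "%z. h (fst z) (snd z)"] conjI ballI)
 show "(%z. h (fst z) (snd z)) \<in> {0..1} \<times> {0..1} \<rightarrow> S" using assms(2) by auto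
qed (use assms in "auto simp: pathstart_def pathfinish_def")

lemma homotopic_pathsE:
 assumes "homotopic_paths S p q"
 obtains h where "continuous_on ({0..1::real} \<times> {0..1::real}) (%z. h (fst z) (snd z))"
  and "!!s t. s \<in> {0..1} ==> t \<in> {0..1} ==> h s t \<in> S"
  and "!!t. t \<in> {0..1} ==> h 0 t = p t" "!!t. t \<in> {0..1} ==> h 1 t = q t"
  and "!!s. s \<in> {0..1} ==> h s 0 = p 0" "!!s. s \<in> {0..1} ==> h s 1 = p 1"
proof -
 from assms obtain h where h: "continuous_on ({0..1::real} \<times> {0..1::real}) h" "h \<in> {0..1} \<times> {0..1} \<rightarrow> S"
   "\<forall>x\<in>{0..1}. h (0, x) = p x" "\<forall>x\<in>{0..1}. h (1, x) = q x"
   "\<forall>t\<in>{0..1}. h (t, 0) = p 0 \<and> h (t, 1) = p 1"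
  unfolding homotopic_paths by (auto simp: pathstart_def pathfinish_def)
 show thesis by (rule that[of "%s t. h (s, t)"]) (use h in auto)
qed

lemma continuous_on_funI:
 fixes f :: "'a::topological_space => 'b => 'c::topological_space"
 shows "(!!i. continuous_on X (%z. f z i)) ==> continuous_on X f"
 by (rule continuous_on_coordinatewise_then_product)

lemma continuous_on_funD:
 fixes f :: "'a::topological_space => 'b => 'c::topological_space"
 shows "continuous_on X f ==> continuous_on X (%z. f z i)"
 by (rule continuous_on_product_then_coordinatewise)

definition rot :: "real => real ^ 3 => real ^ 3" where
 "rot \<theta> x = vec3 (cos \<theta> * x $ 1 - sin \<theta> * x $ 2) (sin \<theta> * x $ 1 + cos \<theta> * x $ 2) (x $ 3)"

definition tilt :: "real => real ^ 3 => real ^ 3" where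
 "tilt \<theta> x = vec3 (x $ 1) (cos \<theta> * x $ 2 - sin \<theta> * x $ 3) (sin \<theta> * x $ 2 + cos \<theta> * x $ 3)"

lemma rot_0 [simp]: "rot 0 x = x" and tilt_0 [simp]: "tilt 0 x = x"
 by (simp_all add: rot_def tilt_def vec3_eq_iff)

lemma rot_rot: "rot a (rot b x) = rot (a + b) x" and tilt_tilt: "tilt a (tilt b x) = tilt (a + b) x"
 by (simp_all add: rot_def tilt_def vec3_eq_iff cos_add sin_add algebra_simps)

lemma rot_pi: "rot pi x = half_turn x"
 by (simp add: rot_def vec3_eq_iff)

lemma rot_scaleR: "rot a (l *\<^sub>R x) = l *\<^sub>R rot a x" and tilt_scaleR: "tilt a (l *\<^sub>R x) = l *\<^sub>R tilt a x"
 by (simp_all add: rot_def tilt_def vec3_eq_iff algebra_simps)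

lemma rot_periodic: "rot (a + 2 * pi * of_int m) x = rot a x"
proof -
 have "sin (a + 2 * pi * of_int m) = sin a" "cos (a + 2 * pi * of_int m) = cos a"
  using sin_cos_eq_iff[of "a + 2 * pi * of_int m" a] by blast+
 then show ?thesis by (simp add: rot_def)
qed

lemma rot_2pi_int: "rot (2 * pi * of_int m) x = x"
 using rot_periodic[of 0 m x] by simp

lemma rot_eq_0: "rot a x = 0 \<longleftrightarrow> x = 0"
proof
 assume "rot a x = 0"
 then have "rot (- a) (rot a x) = 0 *\<^sub>R rot (- a) 0" using rot_scaleR[of "- a" 0 0] by simp
 then show "x = 0" by (simp add: rot_rot)
qed (use rot_scaleR[of a 0 0] in simp)

lemma tilt_eq_0: "tilt a x = 0 \<longleftrightarrow> x = 0"
proof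
 assume "tilt a x = 0"
 then have "tilt (- a) (tilt a x) = 0 *\<^sub>R tilt (- a) 0" using tilt_scaleR[of "- a" 0 0] by simp
 then show "x = 0" by (simp add: tilt_tilt)
qed (use tilt_scaleR[of a 0 0] in simp)

lemma sin_cos_mult: "sin a * (sin a * x) = x - cos a * (cos a * x)" for a x :: real
proof -
 have *: "y * (y * x) = y\<^sup>2 * x" for y :: real by (simp add: power2_eq_square)
 show ?thesis unfolding * sin_squared_eq left_diff_distrib by simp
qed

lemma cross3_rot: "cross3 (rot a x) (rot a y) = rot a (cross3 x y)"
 by (simp add: rot_def cross3_def vec3_eq_iff algebra_simps sin_cos_mult)

lemma cross3_tilt: "cross3 (tilt a x) (tilt a y) = tilt a (cross3 x y)"
 by (simp add: tilt_def cross3_def vec3_eq_iff algebra_simps sin_cos_mult)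

lemma continuous_on_rot [continuous_intros]:
 fixes f :: "'a::t2_space => real"
 shows "continuous_on X f ==> continuous_on X g ==> continuous_on X (%z. rot (f z) (g z))"
 unfolding rot_def by (intro continuous_intros)

lemma continuous_on_tilt [continuous_intros]:
 fixes f :: "'a::t2_space => real"
 shows "continuous_on X f ==> continuous_on X g ==> continuous_on X (%z. tilt (f z) (g z))"
 unfolding tilt_def by (intro continuous_intros)

lemma conf_rot: "c \<in> conf n ==> (%i. rot a (c i)) \<in> conf n"
 by (simp add: conf_def cross3_rot rot_eq_0)

lemma conf_tilt: "c \<in> conf n ==> (%i. tilt a (c i)) \<in> conf n"
 by (simp add: conf_def cross3_tilt tilt_eq_0)

lemma off_lines_rot: "rot a x \<in> off_lines n (%i. rot a (c i)) \<longleftrightarrow> x \<in> off_lines n c"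
 by (simp add: off_lines_def cross3_rot rot_eq_0)

definition signs :: "(nat => real) => bool" where
 "signs e \<longleftrightarrow> (\<forall>i. e i = 1 \<or> e i = - 1)"

definition sg :: "(nat => real) => (nat => real ^ 3) => nat => real ^ 3" where
 "sg e c i = e i *\<^sub>R c i"

lemma signs_cases: "signs e ==> e i = 1 \<or> e i = - 1"
 by (simp add: signs_def)

lemma signs_sq [simp]: "signs e ==> e i * e i = 1"
 using signs_cases[of e i] by auto

lemma signs_ne [simp]: "signs e ==> e i ~= 0"
 using signs_cases[of e i] by auto

lemma sg_sg: "signs e ==> sg e (sg e c) = c"
 by (simp add: sg_def fun_eq_iff)

lemma sg_one: "sg (%_. 1) = (%c. c)"
 by (simp add: sg_def fun_eq_iff)

lemma signs_one: "signs (%_. 1)"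
 by (simp add: signs_def)

lemma cross3_scaleR_eq_0: "a ~= 0 ==> b ~= 0 ==> cross3 (a *\<^sub>R x) (b *\<^sub>R y) = 0 \<longleftrightarrow> cross3 x y = 0"
 by (simp add: cross_mult_left cross_mult_right)

lemma conf_sg: "signs e ==> c \<in> conf n ==> sg e c \<in> conf n"
 by (simp add: conf_def sg_def cross3_scaleR_eq_0)

lemma continuous_on_sg: "continuous_on X (sg e)"
proof (rule continuous_on_funI)
 fix i show "continuous_on X (%c. sg e c i)"
  unfolding sg_def by (intro continuous_intros continuous_on_funD[OF continuous_on_id, of X i, simplified])
qed

lemma sg_maps: "signs e ==> sg e \<in> conf n \<rightarrow> conf n"
 using conf_sg by blast

text \<open>The half turn as a path. Over a configuration in \<open>special n\<close> it ends at a
  sign change of its start and so becomes a loop of lines.\<close>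

definition rotloop :: "(nat => real ^ 3) => real => nat => real ^ 3" where
 "rotloop c t i = rot (pi * t) (c i)"

lemma rotloop_0: "rotloop c 0 = c" and rotloop_1: "rotloop c 1 = (%i. half_turn (c i))"
 by (simp_all add: rotloop_def fun_eq_iff rot_pi)

lemma continuous_on_rotloop: "continuous_on X (rotloop c)"
 by (rule continuous_on_funI) (unfold rotloop_def, intro continuous_intros)

lemma rotloop_conf: "c \<in> conf n ==> rotloop c t \<in> conf n"
 unfolding rotloop_def using conf_rot[of c n "pi * t"] by (simp add: rotloop_def)

lemma path_rotloop: "path (rotloop c)"
 unfolding path_def by (rule continuous_on_rotloop)

text \<open>Rotating by \<open>4\<pi>m\<close> is null homotopic: conjugating one of two factors of angle \<open>2\<pi>m\<close> by a half turn
 about a horizontal axis inverts it.\<close>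

definition spin :: "int => real => real => real ^ 3 => real ^ 3" where
 "spin m s t x = tilt (pi * s) (rot (2 * pi * of_int m * t) (tilt (- (pi * s)) (rot (2 * pi * of_int m * t) x)))"

lemma spin_bdry: "spin m 0 t x = rot (4 * pi * of_int m * t) x" "spin m 1 t x = x" "spin m s 0 x = x" "spin m s 1 x = x"
proof -
 show "spin m 0 t x = rot (4 * pi * of_int m * t) x" by (simp add: spin_def rot_rot flip: distrib_right)
 have "tilt pi (rot a (tilt (- pi) y)) = rot (- a) y" for a y
  by (simp add: tilt_def rot_def vec3_eq_iff)
 then show "spin m 1 t x = x" by (simp add: spin_def rot_rot)
 show "spin m s 0 x = x" "spin m s 1 x = x" by (simp_all add: spin_def tilt_tilt rot_2pi_int)
qed

lemma spin_conf: "c \<in> conf n ==> (%i. spin m s t (c i)) \<in> conf n"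
 unfolding spin_def by (intro conf_tilt conf_rot)

text \<open>\<open>spin\<close> is applied at each time to the moving configuration
  \<open>A\<close>, so a superposed rotation through a multiple of 4\<pi> can be removed from any
  path.\<close>

lemma homotopic_spin:
 assumes A: "path A" "path_image A \<subseteq> conf n"
 shows "homotopic_paths (conf n) (%t i. rot (4 * pi * of_int m * t) (A t i)) A"
proof (rule homotopic_pathsI)
 have "continuous_on {0..1} (%t. A t i)" for i using A(1) continuous_on_funD by (auto simp: path_def)
 then have *: "continuous_on ({0..1} \<times> {0..1}) (%z :: real \<times> real. A (snd z) i)" for i
  by (rule continuous_on_compose2[OF _ continuous_on_snd[OF continuous_on_id]]) auto
 show "continuous_on ({0..1} \<times> {0..1}) (%z :: real \<times> real. %i. spin m (fst z) (snd z) (A (snd z) i))"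
  by (rule continuous_on_funI) (unfold spin_def, intro continuous_intros *)
 show "(%i. spin m s t (A t i)) \<in> conf n" if "t \<in> {0..1}" for s t
  using A(2) that by (intro spin_conf) (auto simp: path_image_def)
 have "rot (4 * pi * of_int m) x = x" for x using rot_2pi_int[of "2 * m" x] by (simp add: mult.assoc)
 then show "(%i. spin m s 1 (A 1 i)) = (%i. rot (4 * pi * of_int m * 1) (A 1 i))" for s by (simp add: spin_bdry)
qed (simp_all add: spin_bdry)

lemma homotopic_rotations:
 assumes c: "c \<in> conf n" and k: "k = l + 4 * m"
 shows "homotopic_paths (conf n) (%t i. rot (pi * of_int k * t) (c i)) (%t i. rot (pi * of_int l * t) (c i))"
proof -
 have "homotopic_paths (conf n) (%t i. rot (4 * pi * of_int m * t) (rot (pi * of_int l * t) (c i))) (%t i. rot (pi * of_int l * t) (c i))"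
 proof (rule homotopic_spin)
  show "path (%t i. rot (pi * of_int l * t) (c i))"
   unfolding path_def by (rule continuous_on_funI) (intro continuous_intros)
  show "path_image (%t i. rot (pi * of_int l * t) (c i)) \<subseteq> conf n"
   unfolding path_image_def using conf_rot[OF c] by blast
 qed
 then show ?thesis by (simp add: rot_rot k algebra_simps)
qed

section \<open>The fibration forgetting the last line; injectivity of the fibre group\<close>

section \<open>Forgetting the last line\<close>

lemma conf_cong: "(!!i. i < n ==> c i = d i) ==> c \<in> conf n \<longleftrightarrow> d \<in> conf n"
 by (simp add: conf_def)

lemma off_lines_cong: "(!!i. i < n ==> c i = d i) ==> off_lines n c = off_lines n d"
 by (simp add: off_lines_def)

lemma conf_upd: assumes "1 \<le> n" "c \<in> conf n" "x \<in> off_lines n c" shows "c(n := x) \<in> conf (Suc n)"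
proof -
 have "c(n := x) \<in> conf n \<longleftrightarrow> c \<in> conf n" by (rule conf_cong) simp
 moreover have "off_lines n (c(n := x)) = off_lines n c" by (rule off_lines_cong) simp
 ultimately show ?thesis using assms by (simp add: conf_Suc_iff)
qed

lemma conf_SucD: assumes "1 \<le> n" "c \<in> conf (Suc n)" shows "c \<in> conf n" "c n \<in> off_lines n c"
 using assms by (simp_all add: conf_Suc_iff)

lemma continuous_on_upd:
 fixes f :: "'a::topological_space => nat => 'b::topological_space"
 assumes "continuous_on X f" "continuous_on X g" shows "continuous_on X (%z. (f z)(n := g z))"
proof (rule continuous_on_funI)
 fix i show "continuous_on X (%z. ((f z)(n := g z)) i)"
  using assms continuous_on_funD[OF assms(1), of i] by (cases "i = n") simp_all
qed

lemma homotopic_paths_cong: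
 assumes "homotopic_paths S p q" "!!t. t \<in> {0..1} ==> p t = p' t" "!!t. t \<in> {0..1} ==> q t = q' t"
 shows "homotopic_paths S p' q'"
proof -
 have "homotopic_paths S p p'" by (rule homotopic_paths_eq) (use homotopic_paths_imp_path[OF assms(1)] homotopic_paths_imp_subset[OF assms(1)] assms(2) in auto)
 moreover have "homotopic_paths S q q'" by (rule homotopic_paths_eq) (use homotopic_paths_imp_path[OF assms(1)] homotopic_paths_imp_subset[OF assms(1)] assms(3) in auto)
 ultimately show ?thesis using assms(1) homotopic_paths_sym homotopic_paths_trans by blast
qed

text \<open>Homotopy lifting: \<open>transport\<close> carries the last vector along. Start and end
  of each intermediate path differ by signs only, so their transports agree, and homogeneity makes
  the lift twisted by \<open>sg e\<close> again.\<close>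

theorem lift_twisted:
 assumes tw: "twisted_homotopic (sg e) (conf n) p q" and n: "1 \<le> n" and e: "signs e"
  and p: "path p" "path_image p \<subseteq> conf (Suc n)"
 obtains q' where "!!t i. i ~= n ==> q' t i = q t i" "twisted_homotopic (sg e) (conf (Suc n)) p q'"
proof -
 let ?I = "{0..1::real}"
 from tw obtain h where
  h: "continuous_on ({0..1::real} \<times> {0..1::real}) (%z. h (fst z) (snd z))"
   "!!s t. s \<in> {0..1} ==> t \<in> {0..1} ==> h s t \<in> conf n"
   "!!t. t \<in> {0..1} ==> h 0 t = p t" "!!t. t \<in> {0..1} ==> h 1 t = q t"
   "!!s. s \<in> {0..1} ==> h s 1 = sg e (h s 0)"
  by (rule twisted_homotopicE) blast
 have p1: "p 1 = sg e (p 0)" using h(3)[of 0] h(3)[of 1] h(5)[of 0] by simp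
 obtain T :: "real => real => real ^ 3 => real ^ 3" where
  T: "continuous_on (?I \<times> ?I \<times> UNIV) (%(s, z, x). T s z x)"
   "!!z x. z \<in> ?I ==> T 0 z x = x"
   "!!s z x. s \<in> {0..1} ==> z \<in> ?I ==> x \<in> off_lines n (h 0 z) ==> T s z x \<in> off_lines n (h s z)"
   "!!s z z' e x. s \<in> {0..1} ==> z \<in> ?I ==> z' \<in> ?I ==>
      (!!s i. s \<in> {0..1} ==> i < n ==> (e i = 1 \<or> e i = - 1) \<and> h s z' i = e i *\<^sub>R h s z i) ==> T s z' x = T s z x"
   "!!s z l x. T s z (l *\<^sub>R x) = l *\<^sub>R T s z x"
 proof (rule transport[of ?I n h])
  show "continuous_on (?I \<times> ?I) (%z. h (fst z) (snd z) i)" for i by (rule continuous_on_funD[OF h(1)])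
  show "compact ?I" by simp
  show "h s z \<in> conf n" if "s \<in> ?I" "z \<in> ?I" for s z using h(2) that by blast
 qed blast
 define H where "H s t = (h s t)(n := T s t (p t n))" for s t
 have pc: "continuous_on ?I (%t. p t n)" using p(1) continuous_on_funD by (auto simp: path_def)
 have pm: "p t \<in> conf (Suc n)" if "t \<in> ?I" for t using p(2) that by (auto simp: path_image_def)
 show thesis
 proof (rule that[of "%t. (q t)(n := T 1 t (p t n))"])
  show "twisted_homotopic (sg e) (conf (Suc n)) p (%t. (q t)(n := T 1 t (p t n)))"
  proof (rule twisted_homotopicI[of H])
   have "continuous_on (?I \<times> ?I) (%z. (%(s, z, x). T s z x) (fst z, snd z, p (snd z) n))"
    by (rule continuous_on_compose2[OF T(1)])
      (auto intro!: continuous_intros continuous_on_compose2[OF pc])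
   then show "continuous_on (?I \<times> ?I) (%z. H (fst z) (snd z))"
    unfolding H_def by (intro continuous_on_upd h(1)) simp
   show "H s t \<in> conf (Suc n)" if "s \<in> ?I" "t \<in> ?I" for s t
    unfolding H_def using conf_SucD(2)[OF n pm[OF that(2)]] T(3) h(2,3) that by (intro conf_upd n) auto
   show "H 0 t = p t" if "t \<in> ?I" for t using that by (simp add: H_def h(3) T(2))
   show "H 1 t = (q t)(n := T 1 t (p t n))" if "t \<in> ?I" for t using that by (simp add: H_def h(4))
   show "H s 1 = sg e (H s 0)" if s: "s \<in> ?I" for s
   proof -
    have "T s 1 x = T s 0 x" for x
     by (rule T(4)[where e = e]) (use s h(5) signs_cases[OF e] in "auto simp: sg_def")
    then have "T s 1 (p 1 n) = e n *\<^sub>R T s 0 (p 0 n)" using T(5) p1 by (simp add: sg_def)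
    then show ?thesis using h(5)[OF s] by (auto simp: H_def sg_def fun_eq_iff)
   qed
  qed
 qed simp
qed

text \<open>The transport along a null homotopy of \<open>(c, \<alpha>)\<close> homotopes \<open>\<alpha>\<close>, within the complement of the lines
 \<open>c\<close>, to the inverse of a loop \<open>\<eta>\<close> along which every loop can be pushed; hence \<open>\<eta>\<close> is central.\<close>

theorem fiber_null:
 assumes c: "c \<in> special n" and n: "2 \<le> n"
  and \<alpha>: "path \<alpha>" "path_image \<alpha> \<subseteq> off_lines n c" "\<alpha> 0 = \<alpha> 1"
  and null: "null_loop (conf (Suc n)) (%t. c(n := \<alpha> t))"
 shows "null_loop (off_lines n c) \<alpha>"
proof -
 let ?I = "{0..1::real}" and ?U = "off_lines n c"
 define y where "y = \<alpha> 0"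
 have n1: "1 \<le> n" using n by simp
 have "homotopic_paths (conf (Suc n)) (%t. c(n := \<alpha> t)) (%_. c(n := y))"
  using null by (simp add: null_loop_def pathstart_def y_def)
 then obtain h where h: "continuous_on ({0..1::real} \<times> {0..1::real}) (%z. h (fst z) (snd z))"
  "!!s t. s \<in> {0..1} ==> t \<in> {0..1} ==> h s t \<in> conf (Suc n)"
  "!!t. t \<in> {0..1} ==> h 0 t = c(n := \<alpha> t)" "!!t. t \<in> {0..1} ==> h 1 t = c(n := y)"
  "!!s. s \<in> {0..1} ==> h s 0 = c(n := \<alpha> 0)" "!!s. s \<in> {0..1} ==> h s 1 = c(n := \<alpha> 1)"
  by (rule homotopic_pathsE) blast
 \<comment> \<open>The configuration over \<open>(s, t)\<close> is drawn back along \<open>t\<close>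
   to the edge \<open>t = 0\<close>, where its first \<open>n\<close> lines are those of
   \<open>c\<close>. The transport \<open>T 1\<close> thus trivializes the fibration over the
   square.\<close>
 define g where "g u z = h (fst z) ((1 - u) * snd z)" for u and z :: "real \<times> real"
 have prod_I: "(1 - u) * t \<in> ?I" if "u \<in> ?I" "t \<in> ?I" for u t
  using that mult_le_one[of "1 - u" t] by auto
 obtain T :: "real => real \<times> real => real ^ 3 => real ^ 3" where
  T: "continuous_on (?I \<times> (?I \<times> ?I) \<times> UNIV) (%(s, z, x). T s z x)"
   "!!s z x. s \<in> {0..1} ==> z \<in> ?I \<times> ?I ==> x \<in> off_lines n (g 0 z) ==> T s z x \<in> off_lines n (g s z)"
   "!!s z x. s \<in> {0..1} ==> z \<in> ?I \<times> ?I ==> (!!s i. s \<in> {0..1} ==> i < n ==> g s z i = g 0 z i) ==> T s z x = x"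
 proof (rule transport[of "?I \<times> ?I" n g])
  show "compact (?I \<times> ?I)" by (intro compact_Times) auto
  have "continuous_on (?I \<times> ?I \<times> ?I) (%w. (%z. h (fst z) (snd z)) (fst (snd w), (1 - fst w) * snd (snd w)))"
  proof (rule continuous_on_compose2[OF h(1)])
   show "(%w. (fst (snd w), (1 - fst w) * snd (snd w))) ` (?I \<times> ?I \<times> ?I) \<subseteq> ?I \<times> ?I"
    using prod_I by fastforce
  qed (intro continuous_intros)
  then have "continuous_on (?I \<times> ?I \<times> ?I) (%w. h (fst (snd w)) ((1 - fst w) * snd (snd w)))" by simp
  then show "continuous_on (?I \<times> (?I \<times> ?I)) (%z. g (fst z) (snd z) i)" for i
   unfolding g_def by (rule continuous_on_funD)
  show "g s z \<in> conf n" if "s \<in> ?I" "z \<in> ?I \<times> ?I" for s z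
   unfolding g_def using h(2) prod_I that conf_SucD(1)[OF n1] by fastforce
 qed blast
 have yU: "y \<in> ?U" using \<alpha>(2) by (auto simp: y_def path_image_def)
 have T1: "T 1 (s, t) x \<in> ?U" if "s \<in> ?I" "t \<in> ?I" "x \<in> off_lines n (h s t)" for s t x
 proof -
  have "T 1 (s, t) x \<in> off_lines n (g 1 (s, t))" using T(2)[of 1 "(s, t)" x] that by (simp add: g_def)
  moreover have "off_lines n (g 1 (s, t)) = ?U"
   by (rule off_lines_cong) (use h(5) that in "simp add: g_def")
  ultimately show ?thesis by simp
 qed
 have hU: "off_lines n (h s t) = ?U" if "s \<in> ?I" "t \<in> ?I" "s = 0 \<or> s = 1 \<or> t = 0 \<or> t = 1" for s t
  by (rule off_lines_cong) (use h(3-6) that in auto)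
 have Tid: "T 1 (s, t) x = x" if st: "s \<in> ?I" "t \<in> ?I" "s = 0 \<or> s = 1 \<or> t = 0" for s t x
 proof (rule T(3))
  show "g u (s, t) i = g 0 (s, t) i" if "u \<in> ?I" "i < n" for u i
   using st h(3-5) that prod_I[OF that(1) st(2)] by (auto simp: g_def)
 qed (use st in auto)
 \<comment> \<open>The loop described by the fixed vector \<open>y\<close> under the trivialization
   along the edge \<open>t = 1\<close>. It is the image, under the boundary map from the second
   homotopy group of the base, of the null homotopy projected to the first \<open>n\<close>
   lines.\<close>
 define \<eta> where "\<eta> s = T 1 (s, 1) y" for s
 have c3: "continuous_on (?I \<times> ?I) (%w. T 1 (f w) (k w))"
  if "continuous_on (?I \<times> ?I) f" "f \<in> ?I \<times> ?I \<rightarrow> ?I \<times> ?I" "continuous_on (?I \<times> ?I) k"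
  for f :: "real \<times> real => real \<times> real" and k
 proof -
  have "continuous_on (?I \<times> ?I) (%w. (%(s, z, x). T s z x) (1, f w, k w))"
  proof (rule continuous_on_compose2[OF T(1)])
   show "continuous_on (?I \<times> ?I) (%w. (1, f w, k w))" by (intro continuous_intros that)
   show "(%w. (1, f w, k w)) ` (?I \<times> ?I) \<subseteq> ?I \<times> (?I \<times> ?I) \<times> UNIV"
    using that(2) by (intro image_subsetI SigmaI UNIV_I) auto
  qed
  then show ?thesis by simp
 qed
 \<comment> \<open>Trivialized, the last entry of the null homotopy fills a square in the fibre with
   edges \<alpha>, \<eta> and two constants.\<close>
 have "homotopic_paths ?U (\<alpha> +++ \<eta>) (%_. y)"
 proof -
  define W where "W z = T 1 z (h (fst z) (snd z) n)" for z
  have sq: "homotopic_paths ?U ((%t. W (0, t)) +++ (%s. W (s, 1))) ((%s. W (s, 0)) +++ (%t. W (1, t)))"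
  proof (rule homotopic_square)
   show "continuous_on (?I \<times> ?I) W"
    unfolding W_def by (rule c3) (auto intro!: continuous_intros continuous_on_funD[OF h(1)])
   show "W \<in> ?I \<times> ?I \<rightarrow> ?U"
   proof
    fix z assume "z \<in> ?I \<times> ?I"
    then show "W z \<in> ?U"
     unfolding W_def using T1[of "fst z" "snd z"] conf_SucD(2)[OF n1 h(2)] by auto
   qed
  qed
  have "((%t. W (0, t)) +++ (%s. W (s, 1))) t = (\<alpha> +++ \<eta>) t" if "t \<in> ?I" for t
   using that h(3,6) Tid \<alpha>(3) by (auto simp: joinpaths_def W_def \<eta>_def y_def)
  moreover have "((%s. W (s, 0)) +++ (%t. W (1, t))) t = y" if "t \<in> ?I" for t
   using that h(4,5) Tid by (auto simp: joinpaths_def W_def y_def)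
  ultimately have "homotopic_paths ?U (\<alpha> +++ \<eta>) (%_. y)" by (rule homotopic_paths_cong[OF sq])
  then show ?thesis .
 qed
 note \<alpha>\<eta> = this
 have \<eta>p: "path \<eta>" "path_image \<eta> \<subseteq> ?U" "\<eta> 0 = y" "\<eta> 1 = y"
 proof -
  have "continuous_on ?I (%s. (%(s, z, x). T s z x) (1, (s, 1), y))"
   by (rule continuous_on_compose2[OF T(1)]) (auto intro!: continuous_intros)
  then show "path \<eta>" by (simp add: path_def \<eta>_def)
  show "path_image \<eta> \<subseteq> ?U" using T1[of _ 1 y] hU[of _ 1] yU by (auto simp: path_image_def \<eta>_def)
  show "\<eta> 0 = y" "\<eta> 1 = y" using Tid by (simp_all add: \<eta>_def)
 qed
 have "null_loop ?U \<eta>"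
 proof (rule special_central[OF c n \<eta>p(1,2)])
  show "\<eta> 0 = \<eta> 1" using \<eta>p by simp
  fix q assume q: "path q" "path_image q \<subseteq> ?U" "q 0 = \<eta> 0" "q 1 = \<eta> 0"
  \<comment> \<open>The trivialization along the edge \<open>t = 1\<close>, applied to the whole
    loop \<open>q\<close>, gives a square with edges \<open>q\<close> and \<eta>, each occurring
    twice.\<close>
  define V where "V z = T 1 (fst z, 1) (q (snd z))" for z :: "real \<times> real"
  have sq: "homotopic_paths ?U ((%t. V (0, t)) +++ (%s. V (s, 1))) ((%s. V (s, 0)) +++ (%t. V (1, t)))"
  proof (rule homotopic_square)
   have "continuous_on ?I q" using q(1) by (simp add: path_def)
   then show "continuous_on (?I \<times> ?I) V"
    unfolding V_def by (intro c3) (auto intro!: continuous_intros continuous_on_compose2[of ?I q _ snd])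
   show "V \<in> ?I \<times> ?I \<rightarrow> ?U"
    using T1[of _ 1] hU[of _ 1] q(2) by (auto simp: V_def path_image_def)
  qed
  have "((%t. V (0, t)) +++ (%s. V (s, 1))) t = (q +++ \<eta>) t" if "t \<in> ?I" for t
   using that Tid[of 0 1] q(4) \<eta>p by (auto simp: joinpaths_def V_def \<eta>_def)
  moreover have "((%s. V (s, 0)) +++ (%t. V (1, t))) t = (\<eta> +++ q) t" if "t \<in> ?I" for t
   using that Tid[of 1 1] q(3) \<eta>p by (auto simp: joinpaths_def V_def \<eta>_def)
  ultimately have "homotopic_paths ?U (q +++ \<eta>) (\<eta> +++ q)" by (rule homotopic_paths_cong[OF sq])
  then show "homotopic_paths ?U (\<eta> +++ q) (q +++ \<eta>)" by (rule homotopic_paths_sym)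
 qed
 then have "homotopic_paths ?U \<eta> (%_. y)" using \<eta>p(3) by (simp add: null_loop_def pathstart_def)
 then have "homotopic_paths ?U (\<alpha> +++ \<eta>) (\<alpha> +++ (%_. y))"
  by (intro homotopic_paths_join) (use \<alpha> \<eta>p in "auto simp: pathstart_def pathfinish_def y_def")
 moreover have "homotopic_paths ?U (\<alpha> +++ (%_. y)) \<alpha>"
  by (rule homotopic_paths_join_const) (use \<alpha> in "auto simp: loops_at_def pathstart_def pathfinish_def y_def")
 ultimately have "homotopic_paths ?U (\<alpha> +++ \<eta>) \<alpha>" by (rule homotopic_paths_trans)
 then have "homotopic_paths ?U \<alpha> (%_. y)" using \<alpha>\<eta> homotopic_paths_sym homotopic_paths_trans by blast
 then show ?thesis by (simp add: null_loop_def pathstart_def y_def)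
qed

section \<open>Connectedness, and the passage from \<open>Suc n\<close> to \<open>n\<close>
  lines\<close>

section \<open>Connectedness of the configuration space\<close>

text \<open>With the entries from \<open>n\<close> on set to 0, the points of this set are genuine
  \<open>n\<close>-tuples.\<close>

definition conf0 :: "nat => (nat => real ^ 3) set" where
 "conf0 n = {c \<in> conf n. \<forall>i\<ge>n. c i = 0}"

definition std :: "nat => real ^ 3" where "std i = vec3 1 (real i) 0"

lemma std_special: "std \<in> special n"
proof -
 have "std i ~= 0" for i by (simp add: std_def vec3_eq_iff)
 then show ?thesis by (auto simp: special_def conf_def planar_def cross3_eq_0_iff std_def)
qed

lemma path_connected_off_std: assumes "1 \<le> n" shows "path_connected (off_lines n std)"
proof (cases "n = 1")
 case False
 then show ?thesis using assms by (intro special_path_connected[OF std_special]) simp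
next
 case True
 have "path_connected ((UNIV :: real set) \<times> (- {0 :: complex}))"
  by (intro path_connected_Times path_connected_punctured_universe) simp_all
 then have "path_connected ((%w. vec3 (fst w) (Re (snd w)) (Im (snd w))) ` ((UNIV :: real set) \<times> (- {0 :: complex})))"
  by (rule path_connected_continuous_image[rotated]) (intro continuous_intros)
 moreover have "(%w. vec3 (fst w) (Re (snd w)) (Im (snd w))) ` ((UNIV :: real set) \<times> (- {0 :: complex})) = off_lines n std"
 proof (intro equalityI subsetI)
  fix x assume x: "x \<in> off_lines n std"
  then have "Complex (x $ 2) (x $ 3) ~= 0" using True
   by (auto simp: off_lines_def cross3_eq_0_iff std_def complex_eq_iff)
  then show "x \<in> (%w. vec3 (fst w) (Re (snd w)) (Im (snd w))) ` ((UNIV :: real set) \<times> (- {0 :: complex}))"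
   by (intro image_eqI[of _ _ "(x $ 1, Complex (x $ 2) (x $ 3))"]) (auto simp: vec3_eq_iff)
 next
  fix x assume "x \<in> (%w. vec3 (fst w) (Re (snd w)) (Im (snd w))) ` ((UNIV :: real set) \<times> (- {0 :: complex}))"
  then show "x \<in> off_lines n std"
   using True by (auto simp: off_lines_def cross3_eq_0_iff std_def complex_eq_iff)
 qed
 ultimately show ?thesis by simp
qed

text \<open>The last line is transported while the others move to their standard places, and is then
  moved within the connected complement of the standard lines.\<close>

lemma conf0_to_std:
 assumes "1 \<le> n" "c \<in> conf0 n" shows "path_component (conf0 n) c (%i. if i < n then std i else 0)"
 using assms
proof (induction n arbitrary: c rule: dec_induct)
 case base
 have "path_connected (- {0 :: real ^ 3})" by (rule path_connected_punctured_universe) simp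
 moreover have "c 0 \<in> - {0}" "std 0 \<in> - {0}" using base by (auto simp: conf0_def conf_def std_def vec3_eq_iff)
 ultimately obtain g where g: "path g" "path_image g \<subseteq> - {0}" "pathstart g = c 0" "pathfinish g = std 0"
  unfolding path_connected_def by blast
 show ?case
  unfolding path_component_def
 proof (intro exI conjI)
  have "continuous_on {0..1} (%t. (%_ :: nat. 0 :: real ^ 3)(0 := g t))"
   by (rule continuous_on_upd) (use g(1) in "auto simp: path_def")
  then show "path (%t. (%_ :: nat. 0 :: real ^ 3)(0 := g t))" by (simp add: path_def)
  show "path_image (%t. (%_ :: nat. 0 :: real ^ 3)(0 := g t)) \<subseteq> conf0 1"
   using g(2) by (auto simp: path_image_def conf0_def conf_def)
 qed (use g base in "auto simp: pathstart_def pathfinish_def conf0_def fun_eq_iff")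
next
 case (step n)
 let ?I = "{0..1::real}"
 define d where "d = (%i. if i < n then std i else 0)"
 have cS: "c \<in> conf n" "c n \<in> off_lines n c" "c i = 0" if "i > n" for i
  using step.prems conf_SucD[OF step.hyps(1), of c] that by (auto simp: conf0_def)
 have c: "c \<in> conf n" "c n \<in> off_lines n c" using cS[of "Suc n"] by simp_all
 have "c(n := 0) \<in> conf0 n"
  using conf_cong[of n "c(n := 0)" c] cS by (auto simp: conf0_def le_less)
 then have "path_component (conf0 n) (c(n := 0)) d" unfolding d_def by (rule step.IH)
 then obtain k where k: "path k" "path_image k \<subseteq> conf0 n" "k 0 = c(n := 0)" "k 1 = d"
  unfolding path_component_def pathstart_def pathfinish_def by blast
 have kc: "continuous_on ?I k" and km: "k s \<in> conf0 n" if "s \<in> ?I" for s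
  using k(1,2) that by (auto simp: path_def path_image_def)
 obtain T :: "real => real => real ^ 3 => real ^ 3" where
  T: "continuous_on (?I \<times> {0} \<times> UNIV) (%(s, z, x). T s z x)"
   "!!z x. z \<in> {0} ==> T 0 z x = x"
   "!!s z x. s \<in> {0..1} ==> z \<in> {0} ==> x \<in> off_lines n (k 0) ==> T s z x \<in> off_lines n (k s)"
 proof (rule transport[of "{0::real}" n "%s z. k s"])
  have "continuous_on ?I (%s. k s i)" for i using k(1) continuous_on_funD by (auto simp: path_def)
  then show "continuous_on (?I \<times> {0}) (%z. k (fst z) i)" for i
   by (rule continuous_on_compose2[OF _ continuous_on_fst[OF continuous_on_id]]) auto
  show "k s \<in> conf n" if "s \<in> ?I" for s using km[OF that] by (simp add: conf0_def)
 qed (simp, blast)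
 have T0: "T s 0 (c n) \<in> off_lines n (k s)" if "s \<in> ?I" for s
  using T(3)[OF that, of 0] c(2) off_lines_cong[of n "k 0" c] k(3) by simp
 have 1: "path_component (conf0 (Suc n)) c (d(n := T 1 0 (c n)))"
  unfolding path_component_def
 proof (intro exI[of _ "%s. (k s)(n := T s 0 (c n))"] conjI)
  have "continuous_on ?I (%s. (%(s, z, x). T s z x) (s, 0, c n))"
   by (rule continuous_on_compose2[OF T(1)]) (auto intro!: continuous_intros)
  then show "path (%s. (k s)(n := T s 0 (c n)))"
   unfolding path_def by (intro continuous_on_upd) (use k(1) in "simp_all add: path_def")
  show "path_image (%s. (k s)(n := T s 0 (c n))) \<subseteq> conf0 (Suc n)"
  proof -
   have "(k s)(n := T s 0 (c n)) \<in> conf0 (Suc n)" if "s \<in> ?I" for s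
    using conf_upd[OF step.hyps(1) _ T0[OF that]] km[OF that] by (auto simp: conf0_def)
   then show ?thesis by (auto simp: path_image_def)
  qed
 qed (use k(3,4) T(2) in "auto simp: pathstart_def pathfinish_def fun_eq_iff")
 have dO: "off_lines n d = off_lines n std" by (rule off_lines_cong) (simp add: d_def)
 have "T 1 0 (c n) \<in> off_lines n std" using T0[of 1] k(4) dO by simp
 moreover have "std n \<in> off_lines n std"
  using conf_SucD(2)[OF step.hyps(1), of std] std_special[of "Suc n"] by (simp add: special_def)
 ultimately obtain g where g: "path g" "path_image g \<subseteq> off_lines n std" "g 0 = T 1 0 (c n)" "g 1 = std n"
  using path_connected_off_std[OF step.hyps(1)] unfolding path_connected_def pathstart_def pathfinish_def by meson
 have dc: "d \<in> conf n" using conf_cong[of n d std] std_special[of n] by (auto simp: d_def special_def)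
 have 2: "path_component (conf0 (Suc n)) (d(n := T 1 0 (c n))) (d(n := std n))"
  unfolding path_component_def
 proof (intro exI[of _ "%s. d(n := g s)"] conjI)
  show "path (%s. d(n := g s))"
   unfolding path_def by (intro continuous_on_upd) (use g(1) in "simp_all add: path_def")
  have "d(n := x) \<in> conf0 (Suc n)" if "x \<in> off_lines n std" for x
   using conf_upd[OF step.hyps(1) dc, of x] that dO by (auto simp: conf0_def d_def)
  then show "path_image (%s. d(n := g s)) \<subseteq> conf0 (Suc n)" using g(2) by (auto simp: path_image_def)
 qed (use g(3,4) in "auto simp: pathstart_def pathfinish_def")
 have "d(n := std n) = (%i. if i < Suc n then std i else 0)" by (auto simp: d_def fun_eq_iff)
 then show ?case using path_component_trans[OF 1 2] by simp
qed

theorem path_connected_conf0: "1 \<le> n ==> path_connected (conf0 n)"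
 unfolding path_connected_component
 by (intro ballI) (rule path_component_trans[OF conf0_to_std path_component_sym[OF conf0_to_std]])

text \<open>\<open>p\<close> lifts a loop whose fourth power is trivial and whose square is not; for
  a group element this means order four.\<close>

definition order_four :: "nat => (nat => real) => (real => nat => real ^ 3) => bool" where
 "order_four n e p \<longleftrightarrow> null_loop (conf n) (twice (sg e) p +++ twice (sg e) p) \<and> \<not> null_loop (conf n) (twice (sg e) p)"

text \<open>If the square became null after forgetting the line, it would be freely homotopic to a
  loop \<alpha> in a fibre, with \<alpha> squared null in the total space. By
  \<open>fiber_null\<close> it is null in the fibre, whose group has no elements of order two, so
  \<alpha> and with it the original square would be null.\<close>

theorem order_four_forget:
 assumes n: "2 \<le> n" and e: "signs e" and p: "path p" "path_image p \<subseteq> conf (Suc n)" "p 1 = sg e (p 0)"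
  and o4: "order_four (Suc n) e p"
 shows "order_four n e p"
proof -
 let ?P = "twice (sg e) p"
 have n1: "1 \<le> n" using n by simp
 have sub: "conf (Suc n) \<subseteq> conf n" by (rule conf_subset) simp
 have sp: "path (sg e \<circ> p)" "path_image (sg e \<circ> p) \<subseteq> conf (Suc n)"
  using path_continuous_image[OF p(1) continuous_on_sg] p(2) conf_sg[OF e] by (auto simp: path_image_def)
 have P: "path ?P" "path_image ?P \<subseteq> conf (Suc n)" "?P 0 = p 0" "?P 1 = p 0"
  unfolding twice_def using p sp sg_sg[OF e]
  by (simp_all add: pathstart_def pathfinish_def subset_path_image_join) (simp_all add: joinpaths_def sg_sg[OF e])
 have "False" if null: "null_loop (conf n) ?P"
 proof -
  define trunc where "trunc c = (%i. if i < n then c i else 0)" for c :: "nat => real ^ 3"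
  have tr: "trunc c \<in> conf0 n" if "c \<in> conf n" for c
   using conf_cong[of n "trunc c" c] that by (auto simp: conf0_def trunc_def)
  have p0: "p 0 \<in> conf n" using p(2) sub by (auto simp: path_image_def image_subset_iff)
  have "std \<in> conf n" using std_special[of n] by (simp add: special_def)
  then obtain k where k: "path k" "path_image k \<subseteq> conf0 n" "k 0 = trunc (p 0)" "k 1 = trunc std"
   using path_connected_conf0[OF n1] tr[OF p0] tr[of std] unfolding path_connected_def pathstart_def pathfinish_def by meson
  \<comment> \<open>The first \<open>n\<close> lines move to the standard position, which is
    special, so that the results about fibres apply over \<open>c\<close>.\<close>
  define K where "K s = (%i. if i < n then k s i else p 0 i)" for s
  define c where "c = K 1"
  have "c \<in> special n" using std_special[of n] k(4) conf_cong[of n c std] by (auto simp: special_def c_def K_def trunc_def)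
  note c = this
  have l1: "homotopic_loops (conf n) ?P (%_. p 0)"
   unfolding twisted_homotopic_id[symmetric] by (rule homotopic_paths_imp_twisted) (use null P(3,4) in "simp_all add: null_loop_def pathstart_def")
  have l2: "homotopic_loops (conf n) (%_. p 0) (%_. c)"
   unfolding twisted_homotopic_id[symmetric]
  proof (rule twisted_homotopicI[of "%s t. K s"])
   have "continuous_on {0..1} K"
   proof (rule continuous_on_funI)
    fix i show "continuous_on {0..1} (%s. K s i)"
     using continuous_on_funD[OF k(1)[unfolded path_def], of i] by (cases "i < n") (simp_all add: K_def)
   qed
   then show "continuous_on ({0..1} \<times> {0..1}) (%z. K (fst z))"
    by (rule continuous_on_compose2[OF _ continuous_on_fst[OF continuous_on_id]]) auto
   show "K s \<in> conf n" if "s \<in> {0..1}" for s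
    
   proof -
    have "k s \<in> conf0 n" using k(2) that by (auto simp: path_image_def image_subset_iff)
    then have "k s \<in> conf n" by (simp add: conf0_def)
    then show ?thesis using conf_cong[of n "K s" "k s"] by (simp add: K_def)
   qed
   show "K 0 = p 0" by (auto simp: K_def k(3) trunc_def fun_eq_iff)
  qed (simp_all add: c_def)
  have "twisted_homotopic (sg (%_. 1)) (conf n) ?P (%_. c)"
   using homotopic_loops_trans[OF l1 l2] by (simp add: sg_one twisted_homotopic_id)
  then obtain q where q: "!!t i. i ~= n ==> q t i = c i" "twisted_homotopic (sg (%_. 1)) (conf (Suc n)) ?P q"
   using lift_twisted[OF _ n1 signs_one P(1,2)] by blast
  note qD = twisted_homotopicD[OF q(2)]
  define \<alpha> where "\<alpha> t = q t n" for t
  have qa: "q = (%t. c(n := \<alpha> t))" using q(1) by (auto simp: \<alpha>_def fun_eq_iff)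
  have loops: "homotopic_loops (conf (Suc n)) ?P q" using q(2) by (simp add: sg_one twisted_homotopic_id)
  have \<alpha>: "path \<alpha>" "path_image \<alpha> \<subseteq> off_lines n c" "\<alpha> 0 = \<alpha> 1"
  proof -
   show "path \<alpha>" using continuous_on_funD[OF qD(2)[unfolded path_def], of n] by (simp add: path_def \<alpha>_def)
   show "path_image \<alpha> \<subseteq> off_lines n c"
   proof
    fix x assume "x \<in> path_image \<alpha>"
    then obtain t where t: "t \<in> {0..1}" "x = \<alpha> t" by (auto simp: path_image_def)
    then have "q t \<in> conf (Suc n)" using qD(4) by (auto simp: path_image_def)
    then have "q t n \<in> off_lines n (q t)" by (rule conf_SucD(2)[OF n1])
    moreover have "off_lines n (q t) = off_lines n c" by (rule off_lines_cong) (use q(1) in simp)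
    ultimately show "x \<in> off_lines n c" using t by (simp add: \<alpha>_def)
   qed
   show "\<alpha> 0 = \<alpha> 1" using qD(6) by (simp add: \<alpha>_def sg_one)
  qed
  have "null_loop (conf (Suc n)) (q +++ q)"
   using o4 null_loop_homotopic[OF homotopic_loops_join[OF loops]] by (simp add: order_four_def)
  moreover have "q +++ q = (%t. c(n := (\<alpha> +++ \<alpha>) t))" by (auto simp: qa joinpaths_def fun_eq_iff)
  moreover have "path (\<alpha> +++ \<alpha>)" "path_image (\<alpha> +++ \<alpha>) \<subseteq> off_lines n c" "(\<alpha> +++ \<alpha>) 0 = (\<alpha> +++ \<alpha>) 1"
   using \<alpha> by (simp_all add: pathstart_def pathfinish_def subset_path_image_join) (simp add: joinpaths_def)
  ultimately have "null_loop (off_lines n c) (\<alpha> +++ \<alpha>)" by (intro fiber_null[OF c n]) simp_all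
  then have "null_loop (off_lines n c) \<alpha>" by (rule special_null_square[OF c n \<alpha>])
  then have "homotopic_paths (off_lines n c) \<alpha> (%_. \<alpha> 0)" by (simp add: null_loop_def pathstart_def)
  then have "homotopic_paths (conf (Suc n)) ((%x. c(n := x)) \<circ> \<alpha>) ((%x. c(n := x)) \<circ> (%_. \<alpha> 0))"
  proof (rule homotopic_paths_continuous_image)
   show "continuous_on (off_lines n c) (%x. c(n := x))" by (intro continuous_on_upd continuous_intros)
   show "(%x. c(n := x)) \<in> off_lines n c \<rightarrow> conf (Suc n)"
    using conf_upd[OF n1] c by (auto simp: special_def)
  qed
  then have "null_loop (conf (Suc n)) q" by (simp add: null_loop_def qa o_def pathstart_def)
  then have "null_loop (conf (Suc n)) ?P" using null_loop_homotopic[OF loops] by simp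
  then show False using o4 by (simp add: order_four_def)
 qed
 moreover have "null_loop (conf n) (?P +++ ?P)" using o4 null_loop_subset[OF _ sub] by (simp add: order_four_def)
 ultimately show ?thesis by (auto simp: order_four_def)
qed

section \<open>The turning frame, and the induction over the number of lines\<close>

section \<open>Pure braids of order four are rotations\<close>

lemma special_if_signs:
 assumes c: "c \<in> conf n" and e: "signs e" and h: "!!i. i < n ==> half_turn (c i) = e i *\<^sub>R c i"
 shows "c \<in> special n"
 unfolding special_def
proof (intro CollectI conjI allI impI c)
 fix i assume "i < n"
 then show "planar (c i) \<or> axial (c i)"
  using h[of i] signs_cases[OF e, of i] by (auto simp: vec3_eq_iff planar_def axial_def)
qed

lemma rotloop_signs:
 assumes "twisted_homotopic (sg e) S p (rotloop c)" shows "half_turn (c i) = e i *\<^sub>R c i"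
 using fun_cong[OF twisted_homotopicD(6)[OF assms], of i] by (simp add: rotloop_0 rotloop_1 sg_def)

text \<open>In the frame turning with the first \<open>n\<close> lines these are at rest and the
  last vector moves in a fixed complement. Its twist is \<open>e n\<close> times the half turn
  because the frame itself makes a half turn.\<close>

lemma rotate_fiber:
 assumes c: "c \<in> conf n" "1 \<le> n" and h: "!!i. i ~= n ==> half_turn (c i) = e i *\<^sub>R c i" and e: "signs e"
  and tw: "twisted_homotopic (%x. e n *\<^sub>R half_turn x) (off_lines n c) \<delta> \<epsilon>"
 shows "twisted_homotopic (sg e) (conf (Suc n)) (%t. (rotloop c t)(n := rot (pi * t) (\<delta> t))) (%t. (rotloop c t)(n := rot (pi * t) (\<epsilon> t)))"
proof -
 from tw obtain h where
  h': "continuous_on ({0..1::real} \<times> {0..1::real}) (%z. h (fst z) (snd z))"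
   "!!s t. s \<in> {0..1} ==> t \<in> {0..1} ==> h s t \<in> off_lines n c"
   "!!t. t \<in> {0..1} ==> h 0 t = \<delta> t" "!!t. t \<in> {0..1} ==> h 1 t = \<epsilon> t"
   "!!s. s \<in> {0..1} ==> h s 1 = e n *\<^sub>R half_turn (h s 0)"
  by (rule twisted_homotopicE) blast
 show ?thesis
 proof (rule twisted_homotopicI[of "%s t. (rotloop c t)(n := rot (pi * t) (h s t))"])
  have r: "continuous_on ({0..1::real} \<times> {0..1::real}) (%z. rotloop c (snd z))"
   by (rule continuous_on_compose2[OF continuous_on_rotloop[of UNIV]]) (auto intro!: continuous_intros)
  show "continuous_on ({0..1::real} \<times> {0..1::real}) (%z. (rotloop c (snd z))(n := rot (pi * snd z) (h (fst z) (snd z))))"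
   by (rule continuous_on_upd[OF r]) (intro continuous_intros h'(1))
  show "(rotloop c t)(n := rot (pi * t) (h s t)) \<in> conf (Suc n)" if "s \<in> {0..1}" "t \<in> {0..1}" for s t
  proof (rule conf_upd[OF c(2) rotloop_conf[OF c(1)]])
   show "rot (pi * t) (h s t) \<in> off_lines n (rotloop c t)"
    using off_lines_rot[of "pi * t" "h s t" n c] h'(2)[OF that] unfolding rotloop_def by simp
  qed
  show "(rotloop c 1)(n := rot (pi * 1) (h s 1)) = sg e ((rotloop c 0)(n := rot (pi * 0) (h s 0)))" if "s \<in> {0..1}" for s
   using h h'(5)[OF that] by (auto simp: fun_eq_iff sg_def rotloop_0 rotloop_1 rot_pi rot_scaleR)
 qed (use h' in auto)
qed

lemma rotloop_upd: "rotloop (c(n := y)) = (%t. (rotloop c t)(n := rot (pi * t) y))"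
 by (auto simp: rotloop_def fun_eq_iff)

text \<open>The converse passage: a path over \<open>rotloop c\<close> is seen from the turning
  frame.\<close>

lemma fiber_path:
 assumes q: "path q" "path_image q \<subseteq> conf (Suc n)" "q 1 = sg e (q 0)" and n: "1 \<le> n" and e: "signs e"
  and qc: "!!t i. i ~= n ==> q t i = rotloop c t i"
 defines "\<delta> \<equiv> %t. rot (- (pi * t)) (q t n)"
 shows "q = (%t. (rotloop c t)(n := rot (pi * t) (\<delta> t)))" "path \<delta>" "path_image \<delta> \<subseteq> off_lines n c"
  "\<delta> 1 = e n *\<^sub>R half_turn (\<delta> 0)"
proof -
 show "q = (%t. (rotloop c t)(n := rot (pi * t) (\<delta> t)))" using qc by (auto simp: \<delta>_def fun_eq_iff rot_rot)
 show "path \<delta>" unfolding path_def \<delta>_def by (intro continuous_intros continuous_on_funD[OF q(1)[unfolded path_def]])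
 show "path_image \<delta> \<subseteq> off_lines n c"
  unfolding path_image_def
 proof (rule image_subsetI)
  fix t :: real assume "t \<in> {0..1}"
  then have "q t \<in> conf (Suc n)" using q(2) by (auto simp: path_image_def image_subset_iff)
  then have "q t n \<in> off_lines n (q t)" by (rule conf_SucD(2)[OF n])
  also have "off_lines n (q t) = off_lines n (%i. rot (pi * t) (c i))" by (rule off_lines_cong) (simp add: qc rotloop_def)
  finally have "rot (pi * t) (\<delta> t) \<in> off_lines n (%i. rot (pi * t) (c i))" by (simp add: \<delta>_def rot_rot)
  then show "\<delta> t \<in> off_lines n c" by (simp add: off_lines_rot)
 qed
 have *: "rot (- pi) x = half_turn x" for x using rot_periodic[of "- pi" 1 x] by (simp add: rot_pi)
 show "\<delta> 1 = e n *\<^sub>R half_turn (\<delta> 0)" using q(3) by (simp add: \<delta>_def sg_def * rot_scaleR[of pi, unfolded rot_pi])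
qed

lemma rot_minus_2pi: "rot (a - 2 * pi) x = rot a x"
 using rot_periodic[of a "- 1" x] by simp

text \<open>Squaring lets the frame make a full turn, in which the last vector runs through the
  double of \<delta>.\<close>

lemma twice_rotating:
 assumes e: "signs e" and h: "!!i. i ~= n ==> half_turn (c i) = e i *\<^sub>R c i"
 shows "twice (sg e) (%t. (rotloop c t)(n := rot (pi * t) (\<delta> t))) t
  = (%i. rot (2 * pi * t) ((c(n := twice (%x. e n *\<^sub>R half_turn x) \<delta> t)) i))"
proof
 fix i
 have a: "rot (pi * (2 * t - 1)) (half_turn x) = rot (2 * pi * t) x" for x
  by (simp add: rot_rot algebra_simps flip: rot_pi)
 have b: "rot (2 * pi * t) (half_turn x) = rot (pi * (2 * t - 1)) x" for x
  using rot_minus_2pi[of "2 * pi * t + pi" x] by (simp add: rot_rot algebra_simps flip: rot_pi)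
 have p2: "pi * (2 * t) = 2 * pi * t" by simp
 show "twice (sg e) (%t. (rotloop c t)(n := rot (pi * t) (\<delta> t))) t i
  = rot (2 * pi * t) ((c(n := twice (%x. e n *\<^sub>R half_turn x) \<delta> t)) i)"
 proof (cases "i = n")
  case True
  then show ?thesis by (simp add: twice_def joinpaths_def sg_def rot_scaleR b p2)
 next
  case False
  have "e i *\<^sub>R rot (pi * (2 * t - 1)) (c i) = rot (2 * pi * t) (c i)"
   using a[of "c i"] h[OF False] by (simp add: rot_scaleR)
  then show ?thesis using False by (simp add: twice_def joinpaths_def sg_def rotloop_def p2)
 qed
qed

lemma join_rotating:
 "((%t i. rot (2 * pi * t) (A t i)) +++ (%t i. rot (2 * pi * t) (A t i))) = (%t i. rot (4 * pi * of_int 1 * t) ((A +++ A) t i))"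
proof (intro ext)
 fix t i
 have "rot (2 * pi * (2 * t - 1)) x = rot (4 * pi * t) x" for x
  using rot_minus_2pi[of "4 * pi * t" x] by (simp add: algebra_simps)
 moreover have "2 * pi * (2 * t) = 4 * pi * t" by simp
 ultimately show "((%t i. rot (2 * pi * t) (A t i)) +++ (%t i. rot (2 * pi * t) (A t i))) t i = rot (4 * pi * of_int 1 * t) ((A +++ A) t i)"
  by (simp add: joinpaths_def mult.assoc)
qed

lemma order_four_homotopic:
 assumes tw: "twisted_homotopic (sg e) (conf n) p q" and e: "signs e"
 shows "order_four n e p \<longleftrightarrow> order_four n e q"
proof -
 have *: "homotopic_loops (conf n) (twice (sg e) p) (twice (sg e) q)"
  by (rule twisted_homotopic_twice[OF tw continuous_on_sg sg_maps[OF e]]) (simp add: sg_sg[OF e])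
 show ?thesis unfolding order_four_def
  using null_loop_homotopic[OF *] null_loop_homotopic[OF homotopic_loops_join[OF *]] by simp
qed

text \<open>In the turning frame the fourth power is a turn through 4\<pi>, removable by
  \<open>homotopic_spin\<close>, applied to the double \<open>B\<close> of \<delta> run through
  twice over fixed lines \<open>c\<close>. By \<open>fiber_null\<close> and
  \<open>special_null_square\<close>, \<open>B\<close> is null in the fibre. Then
  \<open>special_twisted\<close> contracts \<delta> to a vector \<open>y\<close> fixed by the twist,
  and \<open>c(n := y)\<close> turns rigidly.\<close>

lemma order_four_extend:
 assumes n: "2 \<le> n" and c: "c \<in> special n" and e: "signs e" and h: "!!i. half_turn (c i) = e i *\<^sub>R c i"
  and q: "path q" "path_image q \<subseteq> conf (Suc n)" "q 1 = sg e (q 0)" "order_four (Suc n) e q"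
  and qc: "!!t i. i ~= n ==> q t i = rotloop c t i"
 shows "\<exists>c'\<in>special (Suc n). twisted_homotopic (sg e) (conf (Suc n)) q (rotloop c')"
proof -
 define g where "g = (%x. e n *\<^sub>R half_turn x)"
 define \<delta> where "\<delta> = (%t. rot (- (pi * t)) (q t n))"
 have n1: "1 \<le> n" using n by simp
 note F = fiber_path[OF q(1-3) n1 e qc, folded \<delta>_def g_def]
 have \<delta>1: "\<delta> 1 = g (\<delta> 0)" using F(4) by (simp add: g_def \<delta>_def)
 have F1: "q = (%t. (rotloop c t)(n := rot (pi * t) (\<delta> t)))" using F(1) by (simp add: \<delta>_def)
 have cn: "c \<in> conf n" using c by (simp add: special_def)
 have gg: "g (g x) = x" for x using signs_sq[OF e, of n] by (simp add: g_def vec3_eq_iff mult.assoc[symmetric])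
 have cg: "continuous_on X g" for X unfolding g_def by (intro continuous_intros continuous_on_half_turn)
 have gU: "g \<in> off_lines n c \<rightarrow> off_lines n c"
 proof
  fix x assume "x \<in> off_lines n c"
  then have "half_turn x \<in> off_lines n (%i. half_turn (c i))" using off_lines_rot[of pi x n c] by (simp add: rot_pi)
  then show "g x \<in> off_lines n c"
   using e by (simp add: off_lines_def g_def h cross_mult_left cross_mult_right)
 qed
 define B where "B = twice g \<delta>"
 have gd: "path (g \<circ> \<delta>)" "path_image (g \<circ> \<delta>) \<subseteq> off_lines n c"
  using path_continuous_image[OF F(2) cg] F(3) gU by (auto simp: path_image_def)
 have B: "path B" "path_image B \<subseteq> off_lines n c" "B 0 = B 1"
  unfolding B_def twice_def using F(2,3) gd \<delta>1 gg
  by (simp_all add: pathstart_def pathfinish_def subset_path_image_join) (simp add: joinpaths_def)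
 have BB: "path (B +++ B)" "path_image (B +++ B) \<subseteq> off_lines n c" "(B +++ B) 0 = (B +++ B) 1"
  using B by (simp_all add: pathstart_def pathfinish_def subset_path_image_join) (simp add: joinpaths_def)
 define A where "A t = c(n := (B +++ B) t)" for t
 have tq: "twice (sg e) q = (%t i. rot (2 * pi * t) ((c(n := B t)) i))"
  by (rule ext) (subst F1, subst twice_rotating[OF e h], simp add: B_def g_def)
 have jA: "(%t. c(n := B t)) +++ (%t. c(n := B t)) = A" by (auto simp: A_def joinpaths_def fun_eq_iff)
 have "null_loop (conf (Suc n)) (twice (sg e) q +++ twice (sg e) q)" using q(4) by (simp add: order_four_def)
 then have "null_loop (conf (Suc n)) (%t i. rot (4 * pi * of_int 1 * t) (A t i))"
  unfolding tq join_rotating jA .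
 moreover have pA: "path A" "path_image A \<subseteq> conf (Suc n)"
 proof -
  show "path A" unfolding path_def A_def by (intro continuous_on_upd continuous_intros BB(1)[unfolded path_def])
  show "path_image A \<subseteq> conf (Suc n)" using conf_upd[OF n1 cn] BB(2) by (auto simp: path_image_def A_def)
 qed
 ultimately have "null_loop (conf (Suc n)) A" using null_loop_homotopic_paths[OF homotopic_spin[OF pA]] by blast
 then have "null_loop (off_lines n c) (B +++ B)" unfolding A_def by (rule fiber_null[OF c n BB])
 then have "null_loop (off_lines n c) B" by (rule special_null_square[OF c n B])
 moreover have "g = half_turn \<or> g = (%x. - half_turn x)" using signs_cases[OF e, of n] by (auto simp: g_def)
 ultimately obtain y where y: "y \<in> off_lines n c" "g y = y" "twisted_homotopic g (off_lines n c) \<delta> (%_. y)"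
  using special_twisted[OF c n _ gU F(2,3) \<delta>1] unfolding B_def by blast
 have "twisted_homotopic (sg e) (conf (Suc n)) q (rotloop (c(n := y)))"
  unfolding rotloop_upd by (subst F1) (rule rotate_fiber[OF cn n1 h e y(3)[unfolded g_def]])
 moreover have "c(n := y) \<in> special (Suc n)"
 proof (rule special_if_signs[OF conf_upd[OF n1 cn y(1)] e])
  have "half_turn y = e n *\<^sub>R g y" using e by (simp add: g_def)
  then show "half_turn ((c(n := y)) i) = e i *\<^sub>R (c(n := y)) i" for i using h y(2) by simp
 qed
 ultimately show ?thesis by blast
qed

text \<open>The induction in \<open>order_four_special\<close> sets entry \<open>n\<close> to 0
  before the hypothesis for \<open>n\<close> is applied; this puts the entry back.\<close>

lemma twisted_junk:
 assumes tw: "twisted_homotopic (sg e) (conf n) (%t. (p t)(n := 0)) q" and p: "path p" "p 1 = sg e (p 0)"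
 shows "twisted_homotopic (sg e) (conf n) p (%t. (q t)(n := p t n))"
proof -
 from tw obtain h where
  h: "continuous_on ({0..1::real} \<times> {0..1::real}) (%z. h (fst z) (snd z))"
   "!!s t. s \<in> {0..1} ==> t \<in> {0..1} ==> h s t \<in> conf n"
   "!!t. t \<in> {0..1} ==> h 0 t = (p t)(n := 0)" "!!t. t \<in> {0..1} ==> h 1 t = q t"
   "!!s. s \<in> {0..1} ==> h s 1 = sg e (h s 0)"
  by (rule twisted_homotopicE) blast
 show ?thesis
 proof (rule twisted_homotopicI[of "%s t. (h s t)(n := p t n)"])
  have "continuous_on ({0..1::real} \<times> {0..1::real}) (%z. p (snd z) n)"
   by (rule continuous_on_compose2[OF continuous_on_funD[OF p(1)[unfolded path_def]]]) (auto intro!: continuous_intros)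
  then show "continuous_on ({0..1::real} \<times> {0..1::real}) (%z. (h (fst z) (snd z))(n := p (snd z) n))"
   by (intro continuous_on_upd h(1))
  show "(h s t)(n := p t n) \<in> conf n" if "s \<in> {0..1}" "t \<in> {0..1}" for s t
   using h(2)[OF that] conf_cong[of n "(h s t)(n := p t n)" "h s t"] by simp
  show "(h s 1)(n := p 1 n) = sg e ((h s 0)(n := p 0 n))" if "s \<in> {0..1}" for s
   using h(5)[OF that] p(2) by (auto simp: fun_eq_iff sg_def)
 qed (use h(3,4) in auto)
qed

text \<open>The complement of the origin in space is simply connected, so once the start has been
  moved to \<open>a\<close> the endpoints determine the path up to homotopy.\<close>

lemma signed_path_to_rotation:
 assumes x: "path x" "path_image x \<subseteq> - {0 :: real ^ 3}" "x 1 = l *\<^sub>R x 0" and l: "l ~= 0"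
  and a: "a ~= 0" "half_turn a = l *\<^sub>R a"
 shows "twisted_homotopic (%v. l *\<^sub>R v) (- {0}) x (%t. rot (pi * t) a)"
proof -
 have "path_connected (- {0 :: real ^ 3})" by (rule path_connected_punctured_universe) simp
 moreover have "x 0 \<in> - {0}" using x(2) by (auto simp: path_image_def)
 ultimately obtain k where k: "path k" "path_image k \<subseteq> - {0}" "k 0 = x 0" "k 1 = a"
  using a(1) unfolding path_connected_def pathstart_def pathfinish_def by (metis ComplI singletonD)
 obtain q where q: "twisted_homotopic (%v. l *\<^sub>R v) (- {0}) x q" "q 0 = k 1"
 proof (rule twisted_homotopic_move[where E = "%v. l *\<^sub>R v" and p = x and S = "- {0}" and k = k])
  show "continuous_on (- {0}) (%v :: real ^ 3. l *\<^sub>R v)" by (intro continuous_intros)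
 qed (use x k l in auto)
 note qD = twisted_homotopicD[OF q(1)]
 have "simply_connected (- {0 :: real ^ 3})"
  by (rule simply_connected_punctured_universe) simp
 moreover have "path (%t. rot (pi * t) a)" unfolding path_def by (intro continuous_intros)
 moreover have "path_image (%t. rot (pi * t) a) \<subseteq> - {0}" using a(1) by (auto simp: path_image_def rot_eq_0)
 ultimately have "homotopic_paths (- {0}) q (%t. rot (pi * t) a)"
  using qD(2,4,6) q(2) k(4) a(2) unfolding simply_connected_eq_homotopic_paths
  by (auto simp: pathstart_def pathfinish_def rot_pi)
 then have "twisted_homotopic (%v. l *\<^sub>R v) (- {0}) q (%t. rot (pi * t) a)"
  by (rule homotopic_paths_imp_twisted) (rule qD(6))
 with q(1) show ?thesis by (rule twisted_homotopic_trans)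
qed


text \<open>Tilting by a half turn about a horizontal axis reverses the sense of rotation.\<close>

lemma rotations_tilt:
 assumes c: "c \<in> conf n" and s: "!!i. half_turn (c i) = e i *\<^sub>R c i"
 shows "twisted_homotopic (sg e) (conf n) (%t i. rot (pi * of_int (- 1) * t) (c i)) (rotloop (%i. tilt pi (c i)))"
proof (rule twisted_homotopicI[of "%s t i. tilt (pi * s) (rot (pi * of_int (- 1) * t) (c i))"])
 show "continuous_on ({0..1::real} \<times> {0..1::real}) (%z i. tilt (pi * fst z) (rot (pi * of_int (- 1) * snd z) (c i)))"
  by (rule continuous_on_funI) (intro continuous_intros)
 show "(%i. tilt (pi * s) (rot (pi * of_int (- 1) * t) (c i))) \<in> conf n" for s t
  by (intro conf_tilt conf_rot c)
 show "(%i. tilt (pi * 1) (rot (pi * of_int (- 1) * t) (c i))) = rotloop (%i. tilt pi (c i)) t" for t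
  by (simp add: rotloop_def fun_eq_iff tilt_def rot_def vec3_eq_iff)
 have "rot (- pi) x = half_turn x" for x using rot_periodic[of "- pi" 1 x] by (simp add: rot_pi)
 then show "(%i. tilt (pi * s) (rot (pi * of_int (- 1) * 1) (c i))) = sg e (%i. tilt (pi * s) (rot (pi * of_int (- 1) * 0) (c i)))" for s
  by (simp add: sg_def fun_eq_iff s tilt_scaleR)
qed simp

text \<open>An even number \<open>k\<close> of half turns has a square that turns through a multiple
  of 4\<pi> and is null. For odd \<open>k\<close>, multiples of 4\<pi> are removed until one half
  turn in either sense remains, and \<open>rotations_tilt\<close> corrects the sense.\<close>

lemma order_four_rotations:
 assumes c: "c \<in> conf n" and e: "signs e" and k: "!!i. rot (pi * of_int k) (c i) = e i *\<^sub>R c i"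
  and o4: "order_four n e (%t i. rot (pi * of_int k * t) (c i))"
 shows "\<exists>c'\<in>special n. twisted_homotopic (sg e) (conf n) (%t i. rot (pi * of_int k * t) (c i)) (rotloop c')"
proof -
 have od: "odd k"
 proof
  assume "even k"
  then obtain m where m: "k = 2 * m" by blast
  have "twice (sg e) (%t i. rot (pi * of_int k * t) (c i)) = (%t i. rot (pi * of_int (2 * k) * t) (c i))"
  proof (intro ext)
   fix t i
   have "e i *\<^sub>R rot (pi * of_int k * (2 * t - 1)) (c i) = rot (pi * of_int (2 * k) * t) (c i)"
    by (simp add: rot_rot algebra_simps flip: k rot_scaleR)
   then show "twice (sg e) (%t i. rot (pi * of_int k * t) (c i)) t i = rot (pi * of_int (2 * k) * t) (c i)"
    by (simp add: twice_def joinpaths_def sg_def mult_ac)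
  qed
  moreover have "homotopic_paths (conf n) (%t i. rot (pi * of_int (2 * k) * t) (c i)) (%t i. rot (pi * of_int 0 * t) (c i))"
   by (rule homotopic_rotations[OF c, of _ _ m]) (simp add: m)
  ultimately have "null_loop (conf n) (twice (sg e) (%t i. rot (pi * of_int k * t) (c i)))"
   by (simp add: null_loop_def pathstart_def)
  then show False using o4 by (simp add: order_four_def)
 qed
 have "\<exists>m. k = 1 + 4 * m \<or> k = - 1 + 4 * m" using od by presburger
 then obtain m where m: "k = 1 + 4 * m \<or> k = - 1 + 4 * m" by blast
 have r1: "rot (pi * of_int k * 1) (c i) = e i *\<^sub>R rot (pi * of_int k * 0) (c i)" for i using k by simp
 have tw1: "twisted_homotopic (sg e) (conf n) (%t i. rot (pi * of_int k * t) (c i)) (%t i. rot (pi * of_int l * t) (c i))"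
  if "k = l + 4 * m" for l
  by (rule homotopic_paths_imp_twisted[OF homotopic_rotations[OF c that]]) (use r1 in "simp add: sg_def fun_eq_iff")
 have sp: "c' \<in> special n" if tw: "twisted_homotopic (sg e) (conf n) p (rotloop c')" for p c'
 proof (rule special_if_signs[OF _ e])
  show "c' \<in> conf n" using twisted_homotopicD(4)[OF tw] by (auto simp: path_image_def image_subset_iff rotloop_0 dest!: bspec[of _ _ 0])
 qed (rule rotloop_signs[OF tw])
 from m show ?thesis
 proof
  assume "k = 1 + 4 * m"
  from tw1[OF this] have "twisted_homotopic (sg e) (conf n) (%t i. rot (pi * of_int k * t) (c i)) (rotloop c)"
   by (simp add: rotloop_def[abs_def])
  then show ?thesis using sp by blast
 next
  assume km: "k = - 1 + 4 * m"
  have "half_turn (c i) = e i *\<^sub>R c i" for i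
   using k[of i] rot_periodic[of "pi * of_int k" "1 - 2 * m" "c i"] by (simp add: km rot_pi algebra_simps)
  from twisted_homotopic_trans[OF tw1[OF km] rotations_tilt[OF c this]] show ?thesis using sp by blast
 qed
qed

lemma contractible_unit: "contractible {0..1::real}"
 by (rule convex_imp_contractible) simp

lemma path_logarithm:
 assumes "continuous_on {0..1::real} w" "!!t. t \<in> {0..1} ==> w t ~= (0::complex)"
 obtains L where "continuous_on {0..1} L" "!!t. t \<in> {0..1} ==> w t = exp (L t)"
 using continuous_logarithm_on_contractible[OF assms(1) contractible_unit assms(2)] by blast

text \<open>The complement of one line has an infinite cyclic group, which is its own centre, so the
  argument for larger fibres does not apply. The last vector is instead straightened by means of a
  logarithm.\<close>

lemma order_four_base:
 assumes e: "signs e" and p: "path p" "path_image p \<subseteq> conf 2" "p 1 = sg e (p 0)" "order_four 2 e p"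
  and zero: "!!t i. 2 \<le> i ==> p t i = 0"
 shows "\<exists>c\<in>special 2. twisted_homotopic (sg e) (conf 2) p (rotloop c)"
proof -
 let ?I = "{0..1::real}"
 \<comment> \<open>The first line is put on the axis or into the plane so that the half turn acts on
   it by \<open>e 0\<close>.\<close>
 define a where "a = (if e 0 = 1 then vec3 0 0 1 else vec3 1 0 0)"
 define c where "c = (%_ :: nat. 0 :: real ^ 3)(0 := a)"
 have a0: "a ~= 0" by (simp add: a_def vec3_eq_iff)
 have ha: "half_turn a = e 0 *\<^sub>R a" using signs_cases[OF e, of 0] by (auto simp: a_def vec3_eq_iff)
 have h0: "half_turn 0 = 0" by (simp add: vec3_eq_iff)
 have hc: "half_turn (c i) = e i *\<^sub>R c i" for i using ha h0 by (simp add: c_def)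
 have cc: "c \<in> conf 1" using a0 by (simp add: conf_def c_def)
 have pm: "p t \<in> conf 2" if "t \<in> ?I" for t using p(2) that by (auto simp: path_image_def image_subset_iff)
 have tw0: "twisted_homotopic (%v. e 0 *\<^sub>R v) (- {0}) (%t. p t 0) (%t. rot (pi * t) a)"
 proof (rule signed_path_to_rotation[OF _ _ _ _ a0 ha])
  show "path (%t. p t 0)" using continuous_on_funD[OF p(1)[unfolded path_def], of 0] by (simp add: path_def)
  show "path_image (%t. p t 0) \<subseteq> - {0}" using pm by (auto simp: path_image_def conf_def)
 qed (use p(3) e in "simp_all add: sg_def")
 then obtain h where
  h: "continuous_on ({0..1::real} \<times> {0..1::real}) (%z. h (fst z) (snd z))"
   "!!s t. s \<in> {0..1} ==> t \<in> {0..1} ==> h s t \<in> - {0}"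
   "!!t. t \<in> {0..1} ==> h 0 t = p t 0" "!!t. t \<in> {0..1} ==> h 1 t = rot (pi * t) a"
   "!!s. s \<in> {0..1} ==> h s 1 = e 0 *\<^sub>R h s 0"
  by (rule twisted_homotopicE) blast
 have tw1: "twisted_homotopic (sg e) (conf 1) p (%t. (p t)(0 := rot (pi * t) a))"
 proof (rule twisted_homotopicI[of "%s t. (p t)(0 := h s t)"])
  have "continuous_on (?I \<times> ?I) (%z. p (snd z))"
   by (rule continuous_on_compose2[OF p(1)[unfolded path_def]]) (auto intro!: continuous_intros)
  then show "continuous_on (?I \<times> ?I) (%z. (p (snd z))(0 := h (fst z) (snd z)))" by (intro continuous_on_upd h(1))
  show "(p t)(0 := h s t) \<in> conf 1" if "s \<in> ?I" "t \<in> ?I" for s t using h(2)[OF that] by (simp add: conf_def)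
  show "(p 1)(0 := h s 1) = sg e ((p 0)(0 := h s 0))" if "s \<in> ?I" for s
   using h(5)[OF that] p(3) by (auto simp: fun_eq_iff sg_def)
 qed (use h(3,4) in auto)
 have p2: "path_image p \<subseteq> conf (Suc 1)" using p(2) by (simp add: numeral_2_eq_2)
 obtain q where q: "!!t i. i ~= 1 ==> q t i = ((p t)(0 := rot (pi * t) a)) i" "twisted_homotopic (sg e) (conf (Suc 1)) p q"
  using lift_twisted[OF tw1 le_refl e p(1) p2] by blast
 note qD = twisted_homotopicD[OF q(2)]
 have qc: "q t i = rotloop c t i" if "i ~= 1" for t i
 proof -
  have "rot b 0 = 0" for b by (simp add: rot_eq_0)
  moreover have "i = 0 \<or> 2 \<le> i" using that by auto
  ultimately show ?thesis using q(1)[OF that, of t] zero[of i t] by (auto simp: rotloop_def c_def)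
 qed
 define \<delta> where "\<delta> = (%t. rot (- (pi * t)) (q t 1))"
 note F = fiber_path[OF qD(2,4,6) le_refl e qc]
 have F1: "q = (%t. (rotloop c t)(1 := rot (pi * t) (\<delta> t)))" using F(1) by (simp add: \<delta>_def)
 have \<delta>c: "continuous_on ?I \<delta>" using F(2) by (simp add: \<delta>_def path_def)
 have \<delta>m: "\<delta> t \<in> off_lines 1 c" if "t \<in> ?I" for t using F(3) that by (auto simp: \<delta>_def path_image_def image_subset_iff)
 have \<delta>1: "\<delta> 1 = e 1 *\<^sub>R half_turn (\<delta> 0)" using F(4) by (simp add: \<delta>_def)
 have hc': "half_turn (c i) = e i *\<^sub>R c i" if "i ~= 1" for i by (rule hc)
 have S2: "Suc 1 = 2" by simp
 have sp: "c' \<in> special 2" if tw: "twisted_homotopic (sg e) (conf 2) p (rotloop c')" for p c'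
 proof (rule special_if_signs[OF _ e])
  show "c' \<in> conf 2" using twisted_homotopicD(4)[OF tw] by (auto simp: path_image_def image_subset_iff rotloop_0 dest!: bspec[of _ _ 0])
 qed (rule rotloop_signs[OF tw])
 have r: "of_real (- e 1) * exp z = exp (z + d) \<and> Re d = 0" if "exp d = of_real (- e 1)" for z d
 proof -
  have "exp (Re d) = norm (exp d)" by (simp add: norm_exp_eq_Re)
  also have "\<dots> = 1" using that signs_cases[OF e, of 1] by auto
  finally show ?thesis using that by (simp add: exp_add mult.commute)
 qed
 from signs_cases[OF e, of 0] show ?thesis
 proof
  assume e0: "e 0 = - 1"
  then have off: "x \<in> off_lines 1 c \<longleftrightarrow> x $ 2 ~= 0 \<or> x $ 3 ~= 0" for x
   by (auto simp: off_lines_def c_def a_def cross3_eq_0_iff)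
  define w where "w t = Complex (\<delta> t $ 2) (\<delta> t $ 3)" for t
  have "continuous_on ?I w" unfolding w_def Complex_eq by (intro continuous_intros \<delta>c)
  moreover have "w t ~= 0" if "t \<in> ?I" for t using \<delta>m[OF that] off by (auto simp: w_def complex_eq_iff)
  ultimately obtain L where L: "continuous_on ?I L" "!!t. t \<in> ?I ==> w t = exp (L t)"
   using path_logarithm[of w] by blast
  \<comment> \<open>Over a horizontal first line the twist acts on \<open>w\<close> through complex
    conjugation. This reverses winding, so the logarithm contracts to the constant
    \<open>d / 2\<close>.\<close>
  define d where "d = L 1 - cnj (L 0)"
  have "w 1 = of_real (- e 1) * cnj (w 0)" using \<delta>1 by (simp add: w_def complex_eq_iff)
  then have "exp (L 1) = of_real (- e 1) * exp (cnj (L 0))" using L(2)[of 0] L(2)[of 1] by (simp add: exp_cnj)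
  then have d: "exp d = of_real (- e 1)" by (simp add: d_def exp_diff)
  have Rd: "Re d = 0" using r[OF d] by blast
  define K where "K s t = of_real (1 - s) * L t + of_real s * d / 2" for s t
  have K1: "K s 1 = cnj (K s 0) + d" for s
   using Rd by (simp add: K_def d_def complex_eq_iff algebra_simps add_divide_distrib diff_divide_distrib)
  have eK: "exp (K s 1) = of_real (- e 1) * cnj (exp (K s 0))" for s
   using r[OF d, of "cnj (K s 0)"] unfolding K1 by (simp add: exp_cnj)
  define H where "H s t = vec3 ((1 - s) * \<delta> t $ 1) (Re (exp (K s t))) (Im (exp (K s t)))" for s t
  have tw: "twisted_homotopic (%x. e 1 *\<^sub>R half_turn x) (off_lines 1 c) \<delta> (%_. H 1 0)"
  proof (rule twisted_homotopicI[of H])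
   show "continuous_on (?I \<times> ?I) (%z. H (fst z) (snd z))"
    unfolding H_def K_def
    by (intro continuous_intros continuous_on_compose2[OF \<delta>c] continuous_on_compose2[OF L(1)]) auto
   show "H s t \<in> off_lines 1 c" for s t using off exp_not_eq_zero[of "K s t"] by (auto simp: H_def complex_eq_iff)
   show "H 0 t = \<delta> t" if "t \<in> ?I" for t using L(2)[OF that] by (simp add: H_def K_def w_def vec3_eq_iff complex_eq_iff)
   show "H 1 t = H 1 0" for t by (simp add: H_def K_def)
   show "H s 1 = e 1 *\<^sub>R half_turn (H s 0)" for s
    using \<delta>1 by (simp add: H_def eK vec3_eq_iff)
  qed
  have "twisted_homotopic (sg e) (conf (Suc 1)) q (rotloop (c(1 := H 1 0)))"
   unfolding rotloop_upd by (subst F1) (rule rotate_fiber[OF cc le_refl hc' e tw])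
  with q(2) have "twisted_homotopic (sg e) (conf 2) p (rotloop (c(1 := H 1 0)))"
   unfolding S2 by (rule twisted_homotopic_trans)
  then show ?thesis using sp by blast
 next
  assume e0: "e 0 = 1"
  then have ca: "c = (%_. 0)(0 := vec3 0 0 1)" by (simp add: c_def a_def)
  have off: "x \<in> off_lines 1 c \<longleftrightarrow> x $ 1 ~= 0 \<or> x $ 2 ~= 0" for x
   by (auto simp: off_lines_def ca cross3_eq_0_iff)
  define w where "w t = Complex (\<delta> t $ 1) (\<delta> t $ 2)" for t
  have "continuous_on ?I w" unfolding w_def Complex_eq by (intro continuous_intros \<delta>c)
  moreover have "w t ~= 0" if "t \<in> ?I" for t using \<delta>m[OF that] off by (auto simp: w_def complex_eq_iff)
  ultimately obtain L where L: "continuous_on ?I L" "!!t. t \<in> ?I ==> w t = exp (L t)"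
   using path_logarithm[of w] by blast
  \<comment> \<open>Over a vertical first line the twist multiplies \<open>w\<close> by a sign only,
    and the winding \<open>d\<close> survives. The path straightens to \<open>j\<close> half turns,
    and the turn of the frame makes them \<open>k = j + 1\<close>.\<close>
  define d where "d = L 1 - L 0"
  have "w 1 = of_real (- e 1) * w 0" using \<delta>1 by (simp add: w_def complex_eq_iff)
  then have "exp (L 1) = of_real (- e 1) * exp (L 0)" using L(2)[of 0] L(2)[of 1] by simp
  then have d: "exp d = of_real (- e 1)" by (simp add: d_def exp_diff)
  have Rd: "Re d = 0" using r[OF d] by blast
  have "Im (exp d) = 0" using d by simp
  then have "sin (Im d) = 0" by (simp add: Im_exp)
  then obtain j :: int where j: "Im d = of_int j * pi" unfolding sin_zero_iff_int2 by blast
  define K where "K s t = of_real (1 - s) * L t + of_real s * of_real t * d" for s t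
  have K1: "K s 1 = K s 0 + d" for s by (simp add: K_def d_def algebra_simps)
  have eK: "exp (K s 1) = of_real (- e 1) * exp (K s 0)" for s
   using r[OF d, of "K s 0"] unfolding K1 by simp
  define H where "H s t = vec3 (Re (exp (K s t))) (Im (exp (K s t))) ((1 - s) * \<delta> t $ 3)" for s t
  have tw: "twisted_homotopic (%x. e 1 *\<^sub>R half_turn x) (off_lines 1 c) \<delta> (H 1)"
  proof (rule twisted_homotopicI[of H])
   show "continuous_on (?I \<times> ?I) (%z. H (fst z) (snd z))"
    unfolding H_def K_def
    by (intro continuous_intros continuous_on_compose2[OF \<delta>c] continuous_on_compose2[OF L(1)]) auto
   show "H s t \<in> off_lines 1 c" for s t using off exp_not_eq_zero[of "K s t"] by (auto simp: H_def complex_eq_iff)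
   show "H 0 t = \<delta> t" if "t \<in> ?I" for t using L(2)[OF that] by (simp add: H_def K_def w_def vec3_eq_iff complex_eq_iff)
   show "H s 1 = e 1 *\<^sub>R half_turn (H s 0)" for s
    using \<delta>1 by (simp add: H_def eK vec3_eq_iff)
  qed simp
  define k where "k = j + 1"
  define c' where "c' = c(1 := vec3 1 0 0)"
  have R: "(%t. (rotloop c t)(1 := rot (pi * t) (H 1 t))) = (%t i. rot (pi * of_int k * t) (c' i))"
  proof (intro ext)
   fix t i
   have "H 1 t = rot (of_int j * pi * t) (vec3 1 0 0)"
    using Rd j by (simp add: H_def K_def rot_def vec3_eq_iff Re_exp Im_exp mult_ac)
   then have "rot (pi * t) (H 1 t) = rot (pi * of_int k * t) (vec3 1 0 0)"
    by (simp add: rot_rot k_def algebra_simps)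
   moreover have "rot b (vec3 0 0 1) = vec3 0 0 1" "rot b 0 = 0" for b by (simp_all add: rot_def vec3_eq_iff)
   ultimately show "((rotloop c t)(1 := rot (pi * t) (H 1 t))) i = rot (pi * of_int k * t) (c' i)"
    by (simp add: c'_def rotloop_def ca)
  qed
  have "twisted_homotopic (sg e) (conf (Suc 1)) q (%t i. rot (pi * of_int k * t) (c' i))"
   unfolding R[symmetric] by (subst F1) (rule rotate_fiber[OF cc le_refl hc' e tw])
  with q(2) have pt: "twisted_homotopic (sg e) (conf 2) p (%t i. rot (pi * of_int k * t) (c' i))"
   unfolding S2 by (rule twisted_homotopic_trans)
  have "\<exists>c\<in>special 2. twisted_homotopic (sg e) (conf 2) (%t i. rot (pi * of_int k * t) (c' i)) (rotloop c)"
  proof (rule order_four_rotations[OF _ e])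
   show "c' \<in> conf 2" using twisted_homotopicD(4)[OF pt] by (auto simp: path_image_def image_subset_iff dest!: bspec[of _ _ 0])
   show "rot (pi * of_int k) (c' i) = e i *\<^sub>R c' i" for i
    using fun_cong[OF twisted_homotopicD(6)[OF pt], of i] by (simp add: sg_def)
   show "order_four 2 e (%t i. rot (pi * of_int k * t) (c' i))" using order_four_homotopic[OF pt e] p(4) by blast
  qed
  then show ?thesis using twisted_homotopic_trans[OF pt] by blast
 qed
qed

text \<open>The order survives forgetting the last line, so by induction the other lines can be made
  to rotate. This homotopy is lifted to all lines, and \<open>order_four_extend\<close> straightens
  the last one.\<close>

theorem order_four_special:
 assumes n: "2 \<le> n" and e: "signs e"
  and p: "path p" "path_image p \<subseteq> conf n" "p 1 = sg e (p 0)" "order_four n e p" "!!t i. n \<le> i ==> p t i = 0"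
 shows "\<exists>c\<in>special n. twisted_homotopic (sg e) (conf n) p (rotloop c)"
 using n p
proof (induction n arbitrary: p rule: dec_induct)
 case base
 then show ?case by (intro order_four_base[OF e])
next
 case (step n)
 have n1: "1 \<le> n" using step.hyps(1) by simp
 note p = step.prems
 have pm: "p t \<in> conf n" if "t \<in> {0..1}" for t
  using p(2) that conf_SucD(1)[OF n1] by (auto simp: path_image_def image_subset_iff)
 define p' where "p' t = (p t)(n := 0)" for t
 have c0: "(p t)(n := x) \<in> conf n" if "t \<in> {0..1}" for t x
  using conf_cong[of n "(p t)(n := x)" "p t"] pm[OF that] by simp
 have tw: "twisted_homotopic (sg e) (conf n) p' p"
 proof (rule twisted_homotopicI[of "%s t. (p t)(n := s *\<^sub>R p t n)"])
  have s: "continuous_on ({0..1::real} \<times> {0..1::real}) (%z. p (snd z))"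
   by (rule continuous_on_compose2[OF p(1)[unfolded path_def]]) (auto intro!: continuous_intros)
  show "continuous_on ({0..1::real} \<times> {0..1::real}) (%z. (p (snd z))(n := fst z *\<^sub>R p (snd z) n))"
   by (rule continuous_on_upd[OF s]) (intro continuous_on_scaleR continuous_on_fst continuous_on_id continuous_on_funD[OF s])
  show "(p 1)(n := s *\<^sub>R p 1 n) = sg e ((p 0)(n := s *\<^sub>R p 0 n))" for s using p(3) by (auto simp: sg_def fun_eq_iff)
 qed (use c0 in "auto simp: p'_def")
 note D = twisted_homotopicD[OF tw]
 have "order_four n e p" by (rule order_four_forget[OF step.hyps(1) e p(1-4)])
 then have "order_four n e p'" using order_four_homotopic[OF tw e] by blast
 moreover have "p' t i = 0" if "n \<le> i" for t i using p(5)[of i t] that by (cases "i = n") (simp_all add: p'_def)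
 ultimately obtain c where c: "c \<in> special n" "twisted_homotopic (sg e) (conf n) p' (rotloop c)"
  using step.IH[OF D(1,3,5)] by blast
 have h: "half_turn (c i) = e i *\<^sub>R c i" for i by (rule rotloop_signs[OF c(2)])
 have tj: "twisted_homotopic (sg e) (conf n) p (%t. (rotloop c t)(n := p t n))"
  by (rule twisted_junk[OF _ p(1,3)]) (use c(2) in "simp add: p'_def[abs_def]")
 then obtain q where q: "!!t i. i ~= n ==> q t i = ((rotloop c t)(n := p t n)) i" "twisted_homotopic (sg e) (conf (Suc n)) p q"
  using lift_twisted[OF tj n1 e p(1,2)] by blast
 note qD = twisted_homotopicD[OF q(2)]
 have "\<exists>c'\<in>special (Suc n). twisted_homotopic (sg e) (conf (Suc n)) q (rotloop c')"
 proof (rule order_four_extend[OF step.hyps(1) c(1) e h qD(2,4,6)])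
  show "order_four (Suc n) e q" using order_four_homotopic[OF q(2) e] p(4) by blast
 qed (simp add: q(1))
 then show ?case using twisted_homotopic_trans[OF q(2)] by blast
qed

section \<open>A criterion for coverings with fibres \<open>x\<close>, \<open>- x\<close>\<close>

section \<open>Two-sheeted coverings\<close>

text \<open>Over the domain of a local section \<open>s\<close> the preimage splits into the points
  with \<open>s (q x) = x\<close> and those with \<open>s (q x) = - x\<close>. The two parts are
  closed and complementary, hence also open.\<close>

lemma covering_space_two_sheeted:
 fixes q :: "'a::real_normed_vector => 'b::real_normed_vector"
 assumes q: "continuous_on C q" "q ` C = S" and C: "!!x. x \<in> C ==> - x \<in> C" "0 \<notin> C"
  and fib: "!!x y. x \<in> C ==> y \<in> C ==> q x = q y \<longleftrightarrow> x = y \<or> x = - y"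
  and sec: "!!x. x \<in> C ==> \<exists>T s. q x \<in> T \<and> openin (top_of_set S) T \<and> continuous_on T s \<and> (\<forall>y\<in>T. s y \<in> C \<and> q (s y) = y)"
 shows "covering_space C q S"
proof
 show "continuous_on C q" "q ` C = S" by (rule q)+
 fix y0 assume "y0 \<in> S"
 then obtain x0 where x0: "x0 \<in> C" "y0 = q x0" using q(2) by blast
 obtain T s where T: "q x0 \<in> T" "openin (top_of_set S) T" "continuous_on T s" "!!y. y \<in> T ==> s y \<in> C" "!!y. y \<in> T ==> q (s y) = y"
  using sec[OF x0(1)] by metis
 let ?D = "C \<inter> q -` T"
 have oD: "openin (top_of_set C) ?D" using continuous_openin_preimage[OF q(1) _ T(2)] q(2) by blast
 have cq: "continuous_on ?D q" using q(1) continuous_on_subset by blast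
 have csq: "continuous_on ?D (%x. s (q x))" by (rule continuous_on_compose2[OF T(3) cq]) auto
 have pm: "s (q x) = x \<or> s (q x) = - x" if "x \<in> ?D" for x
 proof -
  have "q (s (q x)) = q x" "s (q x) \<in> C" using T(4,5)[of "q x"] that by auto
  then show ?thesis using fib[of "s (q x)" x] that by auto
 qed
 define u where "u e = {x \<in> ?D. s (q x) = e *\<^sub>R x}" for e :: real
 have clo: "closedin (top_of_set ?D) (u e)" for e
 proof -
  have "closedin (top_of_set ?D) (?D \<inter> (%x. s (q x) - e *\<^sub>R x) -` {0})"
   by (rule continuous_closedin_preimage) (intro continuous_intros csq, simp)
  moreover have "?D \<inter> (%x. s (q x) - e *\<^sub>R x) -` {0} = u e" by (auto simp: u_def)
  ultimately show ?thesis by simp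
 qed
 have un: "u 1 \<union> u (- 1) = ?D" using pm by (auto simp: u_def)
 have x2: "x ~= - x" if "x \<in> C" for x
 proof
  assume "x = - x"
  then have "x + x = 0" by (metis add.right_inverse)
  then have "2 *\<^sub>R x = 0" by (simp add: scaleR_2)
  then show False using that C(2) by simp
 qed
 have dj: "u 1 \<inter> u (- 1) = {}"
 proof -
  have False if "x \<in> u 1" "x \<in> u (- 1)" for x
  proof -
   have "x = - x" "x \<in> C" using that by (simp_all add: u_def)
   then show False using x2 by blast
  qed
  then show ?thesis by blast
 qed
 have "u 1 = ?D - u (- 1)" "u (- 1) = ?D - u 1" using un dj by blast+
 then have "openin (top_of_set ?D) (u 1)" "openin (top_of_set ?D) (u (- 1))"
  using clo[of 1] clo[of "- 1"] by (metis openin_diff openin_subtopology_self)+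
 then have op: "openin (top_of_set C) (u 1)" "openin (top_of_set C) (u (- 1))"
  using openin_trans[OF _ oD] by blast+
 have hom: "homeomorphism (u e) T q (%y. e *\<^sub>R s y)" if e: "e = 1 \<or> e = - 1" for e
 proof (rule homeomorphismI)
  show "continuous_on (u e) q" by (rule continuous_on_subset[OF cq]) (auto simp: u_def)
  show "continuous_on T (%y. e *\<^sub>R s y)" by (intro continuous_intros T(3))
  show "q ` u e \<subseteq> T" by (auto simp: u_def)
  have ee: "e *\<^sub>R s y \<in> C" "q (e *\<^sub>R s y) = y" if "y \<in> T" for y
   using e T(4,5)[OF that] C(1)[OF T(4)[OF that]] fib[of "- s y" "s y"] by auto
  have "e * e = 1" using e by auto
  then show "(%y. e *\<^sub>R s y) ` T \<subseteq> u e" using ee by (auto simp: u_def)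
  show "e *\<^sub>R s (q x) = x" if "x \<in> u e" for x using that \<open>e * e = 1\<close> by (simp add: u_def)
  show "q (e *\<^sub>R s y) = y" if "y \<in> T" for y by (rule ee(2)[OF that])
 qed
 show "\<exists>T. y0 \<in> T \<and> openin (top_of_set S) T \<and>
    (\<exists>v. \<Union>v = C \<inter> q -` T \<and> (\<forall>u\<in>v. openin (top_of_set C) u) \<and> pairwise disjnt v \<and> (\<forall>u\<in>v. \<exists>p. homeomorphism u T q p))"
 proof (intro exI[of _ T] exI[of _ "{u 1, u (- 1)}"] conjI)
  show "pairwise disjnt {u 1, u (- 1)}" using dj by (auto simp: pairwise_def disjnt_def)
  show "\<forall>u\<in>{u 1, u (- 1)}. \<exists>p. homeomorphism u T q p" using hom by blast
 qed (use T x0 un op in auto)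
qed

lemma lift_on_convex:
 fixes q :: "'a::real_normed_vector => 'b::real_normed_vector" and f :: "'c::real_normed_vector => 'b"
 assumes "covering_space C q S" "convex U" "continuous_on U f" "f \<in> U \<rightarrow> S"
 obtains g where "continuous_on U g" "g \<in> U \<rightarrow> C" "!!y. y \<in> U ==> q (g y) = f y"
 using covering_space_lift[OF assms(1) convex_imp_simply_connected[OF assms(2)] convex_imp_locally_path_connected[OF assms(2)] assms(3,4)]
 by blast

section \<open>Spinors: the full turn is not null, and the orientation of two lines is
  invariant\<close>

section \<open>The spinor of a pair of vectors\<close>

text \<open>A pair of independent vectors yields two orthogonal vectors \<open>u\<close>, \<open>v\<close> of equal length; then
 \<open>u + \<i>v\<close> is isotropic and thus the square of a vector of \<open>\<complex>\<^sup>2\<close>, unique up to sign.\<close>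

definition square2 :: "complex \<times> complex => complex \<times> complex \<times> complex" where
 "square2 a = (fst a * fst a, fst a * snd a, snd a * snd a)"

text \<open>The cone of isotropic vectors without its apex, in coordinates in which its equation is
  \<open>P * R = S * S\<close>.\<close>

definition cone2 :: "(complex \<times> complex \<times> complex) set" where
 "cone2 = {(P, S, R). P * R = S * S \<and> (P, S, R) ~= 0}"

lemma covering_square2: "covering_space (- {0}) square2 cone2"
proof (rule covering_space_two_sheeted)
 show "continuous_on (- {0}) square2" unfolding square2_def by (intro continuous_intros)
 show fib: "square2 x = square2 y \<longleftrightarrow> x = y \<or> x = - y" for x y
 proof
  assume *: "square2 x = square2 y"
  then have "fst x = fst y \<or> fst x = - fst y" "snd x = snd y \<or> snd x = - snd y"
   using square_eq_iff by (auto simp: square2_def)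
  then show "x = y \<or> x = - y" using * by (auto simp: square2_def prod_eq_iff)
 qed (auto simp: square2_def)
 show "square2 ` (- {0}) = cone2"
 proof (intro equalityI subsetI)
  fix N assume "N \<in> cone2"
  then obtain P S R where N: "N = (P, S, R)" "P * R = S * S" "(P, S, R) ~= 0" by (auto simp: cone2_def)
  show "N \<in> square2 ` (- {0})"
  proof (cases "P = 0")
   case True
   have "csqrt R * csqrt R = R" using power2_csqrt[of R] by (simp add: power2_eq_square)
   then show ?thesis using N True by (intro image_eqI[of _ _ "(0, csqrt R)"]) (auto simp: square2_def zero_prod_def)
  next
   case False
   have c: "csqrt P * csqrt P = P" using power2_csqrt[of P] by (simp add: power2_eq_square)
   have c0: "csqrt P ~= 0" using False by simp
   have "S / csqrt P * (S / csqrt P) = S * S / (csqrt P * csqrt P)" by simp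
   also have "\<dots> = R" using N(2) False unfolding c by (metis nonzero_mult_div_cancel_left)
   finally show ?thesis
    using N c c0 by (intro image_eqI[of _ _ "(csqrt P, S / csqrt P)"]) (auto simp: square2_def zero_prod_def)
  qed
 qed (auto simp: square2_def cone2_def zero_prod_def prod_eq_iff)
 fix x :: "complex \<times> complex" assume x: "x \<in> - {0}"
 define a b where "a = cnj (fst x)" and "b = cnj (snd x)"
 \<comment> \<open>On \<open>N = square2 z\<close> this is the square of the Hermitian product of
   \<open>z\<close> with \<open>x\<close>. It is positive at \<open>square2 x\<close>, so nearby a
   branch of the root is defined and recovers \<open>z\<close> up to sign.\<close>
 define f where "f N = a * a * fst N + 2 * a * b * fst (snd N) + b * b * snd (snd N)" for N :: "complex \<times> complex \<times> complex"
 define T where "T = {N \<in> cone2. f N \<notin> \<real>\<^sub>\<le>\<^sub>0}"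
 define s where "s N = ((a * fst N + b * fst (snd N)) / csqrt (f N), (a * fst (snd N) + b * snd (snd N)) / csqrt (f N))" for N
 have cf: "continuous_on X f" for X unfolding f_def by (intro continuous_intros)
 have "f (square2 x) = (a * fst x + b * snd x) * (a * fst x + b * snd x)"
  by (simp add: f_def square2_def algebra_simps)
 also have "a * fst x + b * snd x = of_real ((norm (fst x))\<^sup>2 + (norm (snd x))\<^sup>2)"
  by (simp add: a_def b_def mult.commute[of "cnj _"] complex_norm_square del: of_real_power)
 finally have fx: "f (square2 x) = of_real (((norm (fst x))\<^sup>2 + (norm (snd x))\<^sup>2) * ((norm (fst x))\<^sup>2 + (norm (snd x))\<^sup>2))"
  by simp
 have "(norm (fst x))\<^sup>2 + (norm (snd x))\<^sup>2 > 0"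
  using x by (auto simp: prod_eq_iff sum_power2_gt_zero_iff)
 from mult_pos_pos[OF this this] obtain r :: real where "f (square2 x) = of_real r" "0 < r" using fx by blast
 then have "f (square2 x) \<notin> \<real>\<^sub>\<le>\<^sub>0" by (simp add: complex_nonpos_Reals_iff)
 moreover have "square2 x \<in> cone2" using x by (auto simp: square2_def cone2_def zero_prod_def prod_eq_iff)
 ultimately have xT: "square2 x \<in> T" by (simp add: T_def)
 have "openin (top_of_set cone2) (cone2 \<inter> f -` (- \<real>\<^sub>\<le>\<^sub>0))"
  by (rule continuous_openin_preimage_gen[OF cf]) (simp add: closed_nonpos_Reals_complex open_Compl)
 moreover have "cone2 \<inter> f -` (- \<real>\<^sub>\<le>\<^sub>0) = T" by (auto simp: T_def)
 ultimately have oT: "openin (top_of_set cone2) T" by simp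
 have cs: "continuous_on T s"
  unfolding s_def
 proof (intro continuous_intros continuous_on_compose2[OF continuous_on_csqrt cf])
  show "\<forall>x\<in>T. csqrt (f x) ~= 0" by (auto simp: T_def)
 qed (auto simp: T_def)
 have sT: "s N \<in> - {0} \<and> square2 (s N) = N" if "N \<in> T" for N
 proof -
  obtain P S R where N: "N = (P, S, R)" "P * R = S * S" "(P, S, R) ~= 0" "f N \<notin> \<real>\<^sub>\<le>\<^sub>0"
   using \<open>N \<in> T\<close> by (auto simp: T_def cone2_def)
  have c: "csqrt (f N) * csqrt (f N) = f N" using power2_csqrt[of "f N"] by (simp add: power2_eq_square)
  have f0: "f N ~= 0" using N(4) by auto
  have fN: "f N = a * a * P + 2 * a * b * S + b * b * R" by (simp add: f_def N(1))
  have 1: "(a * P + b * S) * (a * P + b * S) = P * f N" "(a * P + b * S) * (a * S + b * R) = S * f N"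
   "(a * S + b * R) * (a * S + b * R) = R * f N"
  proof -
   have "(a * P + b * S) * (a * P + b * S) = P * (a * a * P + 2 * a * b * S) + b * b * (S * S)"
    "(a * P + b * S) * (a * S + b * R) = S * (a * a * P + b * b * R) + a * b * (S * S) + a * b * (P * R)"
    "(a * S + b * R) * (a * S + b * R) = R * (2 * a * b * S + b * b * R) + a * a * (S * S)"
    by (simp_all add: algebra_simps)
   then show "(a * P + b * S) * (a * P + b * S) = P * f N" "(a * P + b * S) * (a * S + b * R) = S * f N"
    "(a * S + b * R) * (a * S + b * R) = R * f N"
    unfolding fN N(2)[symmetric] using N(2) by (simp_all add: algebra_simps)
  qed
  have fs: "fst N = P" "fst (snd N) = S" "snd (snd N) = R" by (simp_all add: N(1))
  have "square2 (s N) = (P, S, R)"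
   unfolding square2_def s_def fs fst_conv snd_conv times_divide_times_eq 1 c using f0 by simp
  then have "square2 (s N) = N" by (simp add: N(1))
  moreover have "s N ~= 0"
  proof
   assume "s N = 0"
   then have "N = 0" using \<open>square2 (s N) = N\<close> by (simp add: square2_def zero_prod_def)
   then show False using N(1,3) by simp
  qed
  ultimately show ?thesis by simp
 qed
 show "\<exists>T s. square2 x \<in> T \<and> openin (top_of_set cone2) T \<and> continuous_on T s \<and> (\<forall>y\<in>T. s y \<in> - {0} \<and> square2 (s y) = y)"
  using xT oT cs sT by blast
qed auto

text \<open>The components of \<open>u + \<i> v\<close> with \<open>u = |x \<times> y| x\<close> and
  \<open>v = (x \<times> y) \<times> x\<close>, which are orthogonal and of equal length.\<close>

definition iso :: "real ^ 3 => real ^ 3 => 3 => complex" where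
 "iso x y k = Complex (norm (cross3 x y) * x $ k) (cross3 (cross3 x y) x $ k)"

text \<open>This isotropic vector in the coordinates of \<open>cone2\<close>, in which rotations
  about the vertical axis act diagonally.\<close>

definition spin_form :: "real ^ 3 => real ^ 3 => complex \<times> complex \<times> complex" where
 "spin_form x y = ((iso x y 1 - \<i> * iso x y 2) / 2, - iso x y 3 / 2, - (iso x y 1 + \<i> * iso x y 2) / 2)"

lemma continuous_on_cross3_comp [continuous_intros]:
 fixes f g :: "'a::t2_space => real ^ 3"
 shows "continuous_on X f ==> continuous_on X g ==> continuous_on X (%z. cross3 (f z) (g z))"
 by (rule continuous_on_cross)

lemma continuous_on_spin_form:
 fixes f g :: "'a::t2_space => real ^ 3"
 shows "continuous_on X f ==> continuous_on X g ==> continuous_on X (%z. spin_form (f z) (g z))"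
 unfolding spin_form_def iso_def Complex_eq by (intro continuous_intros) auto

lemma inner3: "x \<bullet> y = x $ 1 * y $ 1 + x $ 2 * y $ 2 + x $ 3 * y $ 3" for x y :: "real ^ 3"
 by (simp add: inner_vec_def sum_3)

lemma iso_sum: "iso x y 1 * iso x y 1 + iso x y 2 * iso x y 2 + iso x y 3 * iso x y 3 = 0"
proof -
 let ?w = "cross3 x y"
 define v where "v = cross3 ?w x"
 have nw: "norm ?w * norm ?w = ?w \<bullet> ?w" by (simp add: power2_norm_eq_inner[symmetric] power2_eq_square)
 have vv: "v \<bullet> v = (?w \<bullet> ?w) * (x \<bullet> x)"
 proof -
  have "cross3 w x \<bullet> cross3 w x = (w \<bullet> w) * (x \<bullet> x) - (w \<bullet> x) * (w \<bullet> x)" for w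
   by (simp add: inner3 cross3_def algebra_simps)
  moreover have "?w \<bullet> x = 0" by (simp add: dot_cross_self inner_commute)
  ultimately show ?thesis by (simp add: v_def)
 qed
 have xv: "x \<bullet> v = 0" by (simp add: v_def dot_cross_self)
 have "(norm ?w * norm ?w) * (x \<bullet> x) = v \<bullet> v" using nw vv by simp
 define N where "N = norm ?w"
 have 1: "N * x $ 1 * (N * x $ 1) + N * x $ 2 * (N * x $ 2) + N * x $ 3 * (N * x $ 3) = v $ 1 * v $ 1 + v $ 2 * v $ 2 + v $ 3 * v $ 3"
  using \<open>(norm ?w * norm ?w) * (x \<bullet> x) = v \<bullet> v\<close> unfolding N_def[symmetric] inner3 by (simp add: algebra_simps)
 have "N * (x \<bullet> v) = 0" using xv by simp
 then have 2: "N * x $ 1 * v $ 1 + N * x $ 2 * v $ 2 + N * x $ 3 * v $ 3 = 0" unfolding inner3 by (simp add: algebra_simps)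
 show ?thesis
 proof (rule complex_eqI)
  show "Re (iso x y 1 * iso x y 1 + iso x y 2 * iso x y 2 + iso x y 3 * iso x y 3) = Re 0"
   unfolding iso_def v_def[symmetric] N_def[symmetric] using 1 by simp
  have "Im (iso x y 1 * iso x y 1 + iso x y 2 * iso x y 2 + iso x y 3 * iso x y 3)
    = 2 * (N * x $ 1 * v $ 1 + N * x $ 2 * v $ 2 + N * x $ 3 * v $ 3)"
   unfolding iso_def v_def[symmetric] N_def[symmetric] by (simp add: algebra_simps)
  then show "Im (iso x y 1 * iso x y 1 + iso x y 2 * iso x y 2 + iso x y 3 * iso x y 3) = Im 0"
   unfolding 2 by simp
 qed
qed

lemma spin_form_cone:
 assumes "cross3 x y ~= 0" shows "spin_form x y \<in> cone2"
proof -
 have "(iso x y 1 - \<i> * iso x y 2) / 2 * (- (iso x y 1 + \<i> * iso x y 2) / 2) = - iso x y 3 / 2 * (- iso x y 3 / 2)"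
 proof -
  have "(a - \<i> * b) / 2 * (- (a + \<i> * b) / 2) = - c / 2 * (- c / 2)" if "a * a + b * b + c * c = 0" for a b c
  proof -
   have "(a - \<i> * b) * (a + \<i> * b) = a * a + b * b" by (simp add: algebra_simps)
   also have "\<dots> = - (c * c)" using that by (simp add: eq_neg_iff_add_eq_0)
   finally have *: "(a - \<i> * b) * (a + \<i> * b) = - (c * c)" .
   have "(a - \<i> * b) / 2 * (- (a + \<i> * b) / 2) = - ((a - \<i> * b) * (a + \<i> * b)) / 4" by (simp add: algebra_simps)
   then show ?thesis unfolding * by simp
  qed
  from this[OF iso_sum] show ?thesis .
 qed
 moreover have "spin_form x y ~= 0"
 proof
  assume "spin_form x y = 0"
  then have 0: "iso x y 1 - \<i> * iso x y 2 = 0" "iso x y 1 + \<i> * iso x y 2 = 0" "iso x y 3 = 0"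
   by (auto simp: spin_form_def zero_prod_def)
  have "iso x y 1 + iso x y 1 = 0" using 0(1,2) by (metis add.right_neutral add_diff_eq diff_add_cancel diff_eq_eq)
  then have "iso x y 1 = 0" "iso x y 2 = 0" "iso x y 3 = 0" using 0 by auto
  then have "x $ 1 = 0" "x $ 2 = 0" "x $ 3 = 0" using assms by (auto simp: iso_def complex_eq_iff)
  then have "x = 0" by (simp add: vec3_eq_iff)
  then show False using assms by simp
 qed
 ultimately show ?thesis by (simp add: cone2_def spin_form_def)
qed

lemma norm_rot: "norm (rot a x) = norm x"
proof -
 have "rot a x \<bullet> rot a x = x \<bullet> x"
  unfolding inner3 by (simp add: rot_def algebra_simps sin_cos_mult)
 then show ?thesis by (simp add: norm_eq_sqrt_inner)
qed

lemma spin_form_rot: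
 "spin_form (rot a x) (rot a y) = (cis (- a) * fst (spin_form x y), fst (snd (spin_form x y)), cis a * snd (snd (spin_form x y)))"
proof -
 have "iso (rot a x) (rot a y) 1 = cos a * iso x y 1 - sin a * iso x y 2"
  "iso (rot a x) (rot a y) 2 = sin a * iso x y 1 + cos a * iso x y 2"
  "iso (rot a x) (rot a y) 3 = iso x y 3"
  unfolding iso_def cross3_rot norm_rot by (simp_all add: rot_def complex_eq_iff algebra_simps)
 then show ?thesis by (simp add: spin_form_def complex_eq_iff field_simps)
qed

lemma spin_form_minus: "spin_form (- x) (- y) = - spin_form x y"
proof -
 have "iso (- x) (- y) k = - iso x y k" for k
  by (simp add: iso_def cross_minus_left cross_minus_right complex_eq_iff)
 then show ?thesis by (simp add: spin_form_def add_divide_distrib diff_divide_distrib)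
qed

lemma spinor_exists:
 assumes h: "continuous_on ({0..1::real} \<times> {0..1::real}) f" "continuous_on ({0..1} \<times> {0..1}) g"
  and ne: "!!z. z \<in> {0..1} \<times> {0..1} ==> cross3 (f z) (g z) ~= 0"
 obtains A where "continuous_on ({0..1} \<times> {0..1}) A" "!!z. z \<in> {0..1} \<times> {0..1} ==> square2 (A z) = spin_form (f z) (g z)"
proof -
 have "convex ({0..1} \<times> {0..1} :: (real \<times> real) set)" by (intro convex_Times) auto
 moreover have "(%z. spin_form (f z) (g z)) \<in> {0..1} \<times> {0..1} \<rightarrow> cone2" using spin_form_cone ne by blast
 ultimately show thesis
  using lift_on_convex[OF covering_square2 _ continuous_on_spin_form[OF h]] that by blast
qed

lemma spinor_unique:
 fixes T :: "real set"
 assumes T: "connected T" "continuous_on T A" "continuous_on T B" and a: "a \<in> T" "A a = B a" and x: "x \<in> T"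
  and eq: "!!x. x \<in> T ==> square2 (A x) = square2 (B x)" "!!x. x \<in> T ==> A x ~= 0"
 shows "A x = B x"
proof (rule covering_space_lift_unique[OF covering_square2, where T = T and f = "%x. square2 (A x)" and ?g1.0 = A and ?g2.0 = B and a = a])
 have B0: "B x ~= 0" if "x \<in> T" for x using eq[OF that] by (auto simp: square2_def prod_eq_iff)
 show "A \<in> T \<rightarrow> - {0}" "B \<in> T \<rightarrow> - {0}" using eq(2) B0 by auto
 show "continuous_on T (%x. square2 (A x))" unfolding square2_def by (intro continuous_intros T)
 show "(%x. square2 (A x)) \<in> T \<rightarrow> cone2"
  using eq(2) by (auto simp: square2_def cone2_def zero_prod_def prod_eq_iff)
qed (use assms in auto)

text \<open>A rotation multiplies the outer coordinates of the form by \<open>cis\<close> of its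
  angle, so a continuous root turns through half the angle.\<close>

lemma spinor_rot:
 assumes A: "continuous_on {0..1::real} A" "!!t. t \<in> {0..1} ==> square2 (A t) = spin_form (rot (a * t) x) (rot (a * t) y)"
  and xy: "cross3 x y ~= 0"
 shows "A 1 = (cis (- a / 2) * fst (A 0), cis (a / 2) * snd (A 0))"
proof -
 define B where "B t = (cis (- (a * t / 2)) * fst (A 0), cis (a * t / 2) * snd (A 0))" for t
 have A0: "A t ~= 0" if "t \<in> {0..1}" for t
 proof
  assume "A t = 0"
  then have "spin_form (rot (a * t) x) (rot (a * t) y) = 0" using A(2)[OF that] by (simp add: square2_def zero_prod_def)
  moreover have "spin_form (rot (a * t) x) (rot (a * t) y) \<in> cone2" using xy by (intro spin_form_cone) (simp add: cross3_rot rot_eq_0)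
  ultimately show False by (simp add: cone2_def zero_prod_def)
 qed
 have "A 1 = B 1"
 proof (rule spinor_unique[of "{0..1}" A B 0 1])
  show "continuous_on {0..1} B" unfolding B_def by (intro continuous_intros) simp_all
  show "A 0 = B 0" by (simp add: B_def)
  fix t :: real assume t: "t \<in> {0..1}"
  have c2: "cis b * z * (cis b * z) = cis (2 * b) * (z * z)" "cis (- b) * z * (cis b * w) = z * w" for b z w
  proof -
   have cc: "cis b * cis b = cis (2 * b)" "cis (- b) * cis b = 1" unfolding cis_mult by simp_all
   have "cis b * z * (cis b * z) = (cis b * cis b) * (z * z)" "cis (- b) * z * (cis b * w) = (cis (- b) * cis b) * (z * w)"
    by (simp_all only: mult_ac)
   then show "cis b * z * (cis b * z) = cis (2 * b) * (z * z)" "cis (- b) * z * (cis b * w) = z * w"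
    unfolding cc by simp_all
  qed
  have "square2 (B t) = (cis (2 * - (a * t / 2)) * fst (square2 (A 0)), fst (snd (square2 (A 0))), cis (2 * (a * t / 2)) * snd (snd (square2 (A 0))))"
   unfolding square2_def B_def fst_conv snd_conv c2 ..
  also have "\<dots> = (cis (- (a * t)) * fst (square2 (A 0)), fst (snd (square2 (A 0))), cis (a * t) * snd (snd (square2 (A 0))))"
   by simp
  also have "\<dots> = square2 (A t)" using A(2)[of 0] A(2)[OF t] by (simp add: spin_form_rot)
  finally show "square2 (A t) = square2 (B t)" by simp
  show "A t ~= 0" using A0 t by blast
 qed (use A in auto)
 then show ?thesis by (simp add: B_def)
qed

lemma spinor_nonzero: "square2 a = spin_form x y ==> cross3 x y ~= 0 ==> a ~= 0"
 using spin_form_cone[of x y] by (auto simp: square2_def cone2_def zero_prod_def)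

lemma conf_cross: "c \<in> conf n ==> i < n ==> j < n ==> i ~= j ==> cross3 (c i) (c j) ~= 0"
 by (simp add: conf_def)

lemma continuous_on_slice:
 assumes "continuous_on ({0..1::real} \<times> {0..1::real}) A" "a \<in> {0..1}"
 shows "continuous_on {0..1} (%t. A (a, t))" "continuous_on {0..1} (%s. A (s, a))"
 by (rule continuous_on_compose2[OF assms(1)]; use assms(2) in "auto intro!: continuous_intros")+

text \<open>A null homotopy would carry continuous spinors of the first two lines on a square. They
  are constant along three sides but change sign along the side on which the configuration makes a
  full turn.\<close>

theorem rotation_not_null:
 assumes c: "c \<in> conf n" and n: "2 \<le> n"
 shows "\<not> null_loop (conf n) (%t i. rot (2 * pi * t) (c i))"
proof
 assume "null_loop (conf n) (%t i. rot (2 * pi * t) (c i))"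
 then have "homotopic_paths (conf n) (%t i. rot (2 * pi * t) (c i)) (%_. c)" by (simp add: null_loop_def pathstart_def)
 then obtain h where h: "continuous_on ({0..1::real} \<times> {0..1::real}) (%z. h (fst z) (snd z))"
  "!!s t. s \<in> {0..1} ==> t \<in> {0..1} ==> h s t \<in> conf n"
  "!!t. t \<in> {0..1} ==> h 0 t = (%i. rot (2 * pi * t) (c i))" "!!t. t \<in> {0..1} ==> h 1 t = c"
  "!!s. s \<in> {0..1} ==> h s 0 = (%i. rot (2 * pi * 0) (c i))" "!!s. s \<in> {0..1} ==> h s 1 = (%i. rot (2 * pi * 1) (c i))"
  by (rule homotopic_pathsE) blast
 have r2: "rot (2 * pi) x = x" for x using rot_2pi_int[of 1 x] by simp
 have n01: "0 < n" "1 < n" using n by auto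
 obtain A where A: "continuous_on ({0..1} \<times> {0..1}) A"
  "!!z. z \<in> {0..1} \<times> {0..1} ==> square2 (A z) = spin_form (h (fst z) (snd z) 0) (h (fst z) (snd z) 1)"
  by (rule spinor_exists[OF continuous_on_funD[OF h(1), of 0] continuous_on_funD[OF h(1), of 1]])
    (use conf_cross[OF h(2) n01] in auto)
 have c01: "cross3 (c 0) (c 1) ~= 0" using conf_cross[OF c n01] by simp
 have const: "B 1 = B 0" if B: "continuous_on {0..1::real} B" "!!t. t \<in> {0..1} ==> square2 (B t) = spin_form (c 0) (c 1)" for B
  using spinor_rot[OF B(1), of 0 "c 0" "c 1"] B(2) c01 by simp
 have bl: "A (0, 1) = - A (0, 0)"
 proof -
  have "A (0, 1) = (cis (- (2 * pi) / 2) * fst (A (0, 0)), cis (2 * pi / 2) * snd (A (0, 0)))"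
   by (rule spinor_rot[OF continuous_on_slice(1)[OF A(1)] _ c01]) (use A(2) h(3) in auto)
  moreover have "cis (- pi) = - 1" by (simp add: complex_eq_iff)
  ultimately show ?thesis by (simp add: prod_eq_iff)
 qed
 have "A (1, 0) = A (0, 0)"
  by (rule const[OF continuous_on_slice(2)[OF A(1)]]) (use A(2) h(5) in auto)
 moreover have "A (1, 1) = A (1, 0)"
  by (rule const[OF continuous_on_slice(1)[OF A(1)]]) (use A(2) h(4) in auto)
 moreover have "A (1, 1) = A (0, 1)"
  by (rule const[OF continuous_on_slice(2)[OF A(1)]]) (use A(2) h(6) r2 in auto)
 ultimately have "A (0, 0) = 0" using bl by (auto simp: prod_eq_iff)
 then show False using spinor_nonzero[OF A(2)[of "(0, 0)"]] h(3)[of 0] c01 by simp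
qed

text \<open>For a horizontal pair the isotropic vector is horizontal too, and the orientation of the
  pair decides which outer coordinate of the form vanishes.\<close>

lemma planar_spin_form:
 assumes "planar x" "planar y"
 shows "0 \<le> det2 x y ==> snd (snd (spin_form x y)) = 0" "det2 x y \<le> 0 ==> fst (spin_form x y) = 0"
proof -
 have cr: "cross3 x y = vec3 0 0 (det2 x y)" using assms by (simp add: cross3_def vec3_eq_iff planar_def det2_def)
 have "norm (vec3 0 0 d) = \<bar>d\<bar>" for d by (simp add: norm_eq_sqrt_inner inner3)
 then have nc: "norm (cross3 x y) = \<bar>det2 x y\<bar>" by (simp add: cr)
 have i: "iso x y 1 = Complex (\<bar>det2 x y\<bar> * x $ 1) (- (det2 x y * x $ 2))" "iso x y 2 = Complex (\<bar>det2 x y\<bar> * x $ 2) (det2 x y * x $ 1)"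
  unfolding iso_def nc unfolding cr by (simp_all add: cross3_def)
 show "0 \<le> det2 x y ==> snd (snd (spin_form x y)) = 0" "det2 x y \<le> 0 ==> fst (spin_form x y) = 0"
  by (simp_all add: spin_form_def i complex_eq_iff)
qed

lemma planar_det2: "planar x ==> planar y ==> cross3 x y ~= 0 ==> det2 x y ~= 0"
 by (auto simp: planar_def det2_def cross3_eq_0_iff)

text \<open>Both vectors always end at their negatives, so a spinor ends at \<open>w\<close> times
  its start with \<open>w = \<i>\<close> or \<open>w = - \<i>\<close>, and \<open>w\<close> is
  constant along the homotopy. For a rotation the half turn multiplies the two spinor coordinates by
  \<open>- \<i>\<close> and \<open>\<i>\<close>, so \<open>w\<close> tells which of them vanishes,
  that is, the orientation.\<close>

lemma rotloop_orientation:
 assumes tw: "twisted_homotopic (sg e) (conf n) (rotloop c) (rotloop c')"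
  and ij: "i < n" "j < n" "i ~= j" "e i = - 1" "e j = - 1"
  and pl: "planar (c i)" "planar (c j)" "planar (c' i)" "planar (c' j)"
 shows "det2 (c i) (c j) > 0 \<longleftrightarrow> det2 (c' i) (c' j) > 0"
proof -
 from tw obtain h where
  h: "continuous_on ({0..1::real} \<times> {0..1::real}) (%z. h (fst z) (snd z))"
   "!!s t. s \<in> {0..1} ==> t \<in> {0..1} ==> h s t \<in> conf n"
   "!!t. t \<in> {0..1} ==> h 0 t = rotloop c t" "!!t. t \<in> {0..1} ==> h 1 t = rotloop c' t"
   "!!s. s \<in> {0..1} ==> h s 1 = sg e (h s 0)"
  by (rule twisted_homotopicE) blast
 have cr: "cross3 (h s t i) (h s t j) ~= 0" if "s \<in> {0..1}" "t \<in> {0..1}" for s t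
  using conf_cross[OF h(2)[OF that] ij(1-3)] .
 obtain A where A: "continuous_on ({0..1} \<times> {0..1}) A"
  "!!z. z \<in> {0..1} \<times> {0..1} ==> square2 (A z) = spin_form (h (fst z) (snd z) i) (h (fst z) (snd z) j)"
  by (rule spinor_exists[OF continuous_on_funD[OF h(1), of i] continuous_on_funD[OF h(1), of j]]) (use cr in auto)
 have cc: "cross3 (c i) (c j) ~= 0" "cross3 (c' i) (c' j) ~= 0"
  using cr[of 0 0] cr[of 1 0] h(3,4)[of 0] by (simp_all add: rotloop_0)
 have A0: "A (s, t) ~= 0" if "s \<in> {0..1}" "t \<in> {0..1}" for s t
  using spinor_nonzero[OF A(2)[of "(s, t)"]] cr that by simp
 define D where "D w s = (w * fst (A (s, 0)), w * snd (A (s, 0)))" for w and s :: real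
 have sq: "square2 (A (s, 1)) = square2 (D w s)" if "s \<in> {0..1}" "w * w = - 1" for s w
 proof -
  have "square2 (A (s, 1)) = spin_form (- h s 0 i) (- h s 0 j)"
   using A(2)[of "(s, 1)"] h(5)[OF that(1)] that(1) ij by (simp add: sg_def)
  also have "\<dots> = - square2 (A (s, 0))" using A(2)[of "(s, 0)"] that(1) by (simp add: spin_form_minus)
  also have "w * x * (w * y) = - (x * y)" for x y
  proof -
   have "w * x * (w * y) = (w * w) * (x * y)" by (simp add: mult_ac)
   then show ?thesis using that(2) by simp
  qed
  then have "- square2 (A (s, 0)) = square2 (D w s)" by (simp add: square2_def D_def)
  finally show ?thesis .
 qed
 have "square2 (A (0, 1)) = square2 (D \<i> 0)" using sq[of 0 \<i>] by simp
 then have "A (0, 1) = D \<i> 0 \<or> A (0, 1) = - D \<i> 0"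
  by (auto simp: square2_def prod_eq_iff square_eq_iff)
 moreover have "- D \<i> 0 = D (- \<i>) 0" by (simp add: D_def)
 ultimately obtain w where w: "w = \<i> \<or> w = - \<i>" "A (0, 1) = D w 0" by metis
 have ww: "w * w = - 1" using w(1) by auto
 have "A (1, 1) = D w 1"
 proof (rule spinor_unique[of "{0..1}" "%s. A (s, 1)" "D w" 0 1])
  show "continuous_on {0..1} (%s. A (s, 1))" using continuous_on_slice(2)[OF A(1)] by simp
  show "continuous_on {0..1} (D w)" unfolding D_def using continuous_on_slice(2)[OF A(1), of 0] by (intro continuous_intros) simp_all
 qed (use w sq ww A0 in auto)
 moreover have e0: "A (0, 1) = (cis (- pi / 2) * fst (A (0, 0)), cis (pi / 2) * snd (A (0, 0)))"
  by (rule spinor_rot[OF continuous_on_slice(1)[OF A(1)] _ cc(1)]) (use A(2) h(3) in "auto simp: rotloop_def")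
 moreover have e1: "A (1, 1) = (cis (- pi / 2) * fst (A (1, 0)), cis (pi / 2) * snd (A (1, 0)))"
  by (rule spinor_rot[OF continuous_on_slice(1)[OF A(1)] _ cc(2)]) (use A(2) h(4) in "auto simp: rotloop_def")
 ultimately have E: "A (s, 0) ~= 0 \<and> (- \<i> * fst (A (s, 0)), \<i> * snd (A (s, 0))) = (w * fst (A (s, 0)), w * snd (A (s, 0)))" if "s = 0 \<or> s = 1" for s
  using that w(2) A0[of s 0] by (auto simp: D_def cis_minus_pi_half)
 have main: "det2 x y > 0 \<longleftrightarrow> w = - \<i>"
  if a: "square2 a = spin_form x y" "planar x" "planar y" "cross3 x y ~= 0"
   "a ~= 0" "(- \<i> * fst a, \<i> * snd a) = (w * fst a, w * snd a)" for x y and a :: "complex \<times> complex"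
 proof -
  have "det2 x y ~= 0" using planar_det2 a by blast
  moreover have "snd a = 0" if "det2 x y > 0" using planar_spin_form(1)[OF a(2,3)] that by (simp flip: a(1) add: square2_def)
  moreover have "fst a = 0" if "det2 x y < 0" using planar_spin_form(2)[OF a(2,3)] that by (simp flip: a(1) add: square2_def)
  ultimately show ?thesis using a(5,6) w(1)
   by (cases "det2 x y" "0 :: real" rule: linorder_cases) (auto simp: prod_eq_iff complex_eq_iff)
 qed
 have "det2 (c i) (c j) > 0 \<longleftrightarrow> w = - \<i>"
  by (rule main[of "A (0, 0)"]) (use E[of 0] cc pl A(2)[of "(0, 0)"] h(3)[of 0] in "auto simp: rotloop_0")
 moreover have "det2 (c' i) (c' j) > 0 \<longleftrightarrow> w = - \<i>"
  by (rule main[of "A (1, 0)"]) (use E[of 1] cc pl A(2)[of "(1, 0)"] h(4)[of 0] in "auto simp: rotloop_0")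
 ultimately show ?thesis by simp
qed

section \<open>Invariance of the cyclic order of three lines\<close>

section \<open>The cyclic order of three lines\<close>

definition det3 :: "real ^ 3 => real ^ 3 => real ^ 3 => real" where
 "det3 x y z = x \<bullet> cross3 y z"

text \<open>For independent \<open>x\<close> and \<open>y\<close> the real part is, up to a positive
  factor, minus the product of the coordinates with respect to \<open>x\<close> and \<open>y\<close>
  of the projection of \<open>z\<close> to their plane. The function is real on coplanar vectors and
  never vanishes on three distinct lines.\<close>

definition tri :: "real ^ 3 => real ^ 3 => real ^ 3 => complex" where
 "tri x y z = Complex (- (cross3 z y \<bullet> cross3 x y) * (cross3 x z \<bullet> cross3 x y)) (det3 x y z)"

text \<open>The sign is the cyclic order of three horizontal lines; changing the sign of a vector
  does not affect it.\<close>

definition cyc :: "real ^ 3 => real ^ 3 => real ^ 3 => real" where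
 "cyc x y z = det2 x y * det2 y z * det2 z x"

lemma tri_nonzero:
 assumes "cross3 x y ~= 0" "cross3 y z ~= 0" "cross3 x z ~= 0"
 shows "tri x y z ~= 0"
proof
 assume "tri x y z = 0"
 then have d: "det3 x y z = 0" and p: "cross3 z y \<bullet> cross3 x y = 0 \<or> cross3 x z \<bullet> cross3 x y = 0"
  by (auto simp: tri_def complex_eq_iff)
 have "cross3 (cross3 z y) (cross3 x y) = det3 x y z *\<^sub>R y" "cross3 (cross3 x z) (cross3 x y) = - det3 x y z *\<^sub>R x"
  by (simp_all add: det3_def inner3 cross3_def vec3_eq_iff algebra_simps)
 then have c: "cross3 (cross3 z y) (cross3 x y) = 0" "cross3 (cross3 x z) (cross3 x y) = 0" using d by simp_all
 have zy: "cross3 z y ~= 0" using assms(2) cross_skew[of z y] by simp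
 from p show False
 proof
  assume "cross3 z y \<bullet> cross3 x y = 0"
  then show False using c(1) zy assms(1) norm_and_cross_eq_0 by blast
 next
  assume "cross3 x z \<bullet> cross3 x y = 0"
  then show False using c(2) assms norm_and_cross_eq_0 by blast
 qed
qed

lemma tri_minus: "tri (- x) (- y) (- z) = cnj (tri x y z)"
 by (simp add: tri_def det3_def cross_minus_left cross_minus_right complex_eq_iff)

lemma inner_rot: "rot a x \<bullet> rot a y = x \<bullet> y"
 unfolding inner3 by (simp add: rot_def algebra_simps sin_cos_mult)

lemma tri_rot: "tri (rot a x) (rot a y) (rot a z) = tri x y z"
 by (simp add: tri_def det3_def cross3_rot inner_rot)

lemma continuous_on_tri:
 fixes f g k :: "'a::t2_space => real ^ 3"
 shows "continuous_on X f ==> continuous_on X g ==> continuous_on X k ==> continuous_on X (%z. tri (f z) (g z) (k z))"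
 unfolding tri_def det3_def Complex_eq by (intro continuous_intros)

lemma planar_tri:
 assumes "planar x" "planar y" "planar z"
 shows "Re (tri x y z) * det2 x y = - (det2 x y)\<^sup>2 * cyc x y z"
 using assms by (simp add: tri_def cyc_def planar_def cross3_def inner3 det2_def power2_eq_square algebra_simps)

text \<open>Negating all three vectors conjugates \<open>tri\<close>, and rotations preserve it.
  Hence the imaginary part of a logarithm of \<open>tri\<close> is the same at both ends of the
  homotopy, and so is the sign of the real part. Combined with \<open>rotloop_orientation\<close>
  this gives the sign of \<open>cyc\<close>.\<close>

lemma rotloop_cyclic:
 assumes tw: "twisted_homotopic (sg e) (conf n) (rotloop c) (rotloop c')"
  and ijk: "i < n" "j < n" "k < n" "i ~= j" "j ~= k" "i ~= k" "e i = - 1" "e j = - 1" "e k = - 1"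
  and pl: "planar (c i)" "planar (c j)" "planar (c k)" "planar (c' i)" "planar (c' j)" "planar (c' k)"
 shows "cyc (c i) (c j) (c k) > 0 \<longleftrightarrow> cyc (c' i) (c' j) (c' k) > 0"
proof -
 let ?I = "{0..1::real}"
 from tw obtain h where
  h: "continuous_on ({0..1::real} \<times> {0..1::real}) (%z. h (fst z) (snd z))"
   "!!s t. s \<in> {0..1} ==> t \<in> {0..1} ==> h s t \<in> conf n"
   "!!t. t \<in> {0..1} ==> h 0 t = rotloop c t" "!!t. t \<in> {0..1} ==> h 1 t = rotloop c' t"
   "!!s. s \<in> {0..1} ==> h s 1 = sg e (h s 0)"
  by (rule twisted_homotopicE) blast
 define F where "F z = tri (h (fst z) (snd z) i) (h (fst z) (snd z) j) (h (fst z) (snd z) k)" for z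
 have "continuous_on (?I \<times> ?I) F" unfolding F_def by (intro continuous_on_tri continuous_on_funD[OF h(1)])
 moreover have "F z ~= 0" if "z \<in> ?I \<times> ?I" for z
 proof -
  have "h (fst z) (snd z) \<in> conf n" using h(2) that by auto
  then show ?thesis unfolding F_def by (intro tri_nonzero conf_cross) (use ijk in auto)
 qed
 ultimately obtain L where L: "continuous_on (?I \<times> ?I) L" "!!z. z \<in> ?I \<times> ?I ==> F z = exp (L z)"
  using continuous_logarithm_on_contractible[OF _ square_contractible, of F] by blast
 have "L (1, 1) - cnj (L (1, 0)) = L (0, 1) - cnj (L (0, 0))"
 proof (rule exp_lift_unique[where T = ?I and g = "%s. L (s, 1)" and g' = "%s. cnj (L (s, 0))"])
  show "continuous_on ?I (%s. L (s, 1))" "continuous_on ?I (%s. cnj (L (s, 0)))"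
   using continuous_on_slice(2)[OF L(1)] by (auto intro!: continuous_intros)
  fix s assume s: "s \<in> ?I"
  have "F (s, 1) = cnj (F (s, 0))" using h(5)[OF s] ijk by (simp add: F_def sg_def tri_minus)
  then show "exp (L (s, 1)) = exp (cnj (L (s, 0)))" using L(2) s by (simp add: exp_cnj)
 qed auto
 moreover have "L (0, 1) - 0 = L (0, 0) - 0"
 proof -
  have "L (0, 1) - L (0, 0) = L (0, 0) - L (0, 0)"
  proof (rule exp_lift_unique[where T = ?I and g = "%t. L (0, t)" and g' = "%t. L (0, 0)"])
   show "continuous_on ?I (%t. L (0, t))" using continuous_on_slice(1)[OF L(1)] by simp
   fix t assume t: "t \<in> ?I"
   have "F (0, t) = F (0, 0)" using h(3) t by (simp add: F_def rotloop_def tri_rot)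
   then show "exp (L (0, t)) = exp (L (0, 0))" using L(2) t by simp
  qed auto
  then show ?thesis by simp
 qed
 moreover have "L (1, 1) - 0 = L (1, 0) - 0"
 proof -
  have "L (1, 1) - L (1, 0) = L (1, 0) - L (1, 0)"
  proof (rule exp_lift_unique[where T = ?I and g = "%t. L (1, t)" and g' = "%t. L (1, 0)"])
   show "continuous_on ?I (%t. L (1, t))" using continuous_on_slice(1)[OF L(1)] by simp
   fix t assume t: "t \<in> ?I"
   have "F (1, t) = F (1, 0)" using h(4) t by (simp add: F_def rotloop_def tri_rot)
   then show "exp (L (1, t)) = exp (L (1, 0))" using L(2) t by simp
  qed auto
  then show ?thesis by simp
 qed
 ultimately have "Im (L (1, 0)) = Im (L (0, 0))" by (auto simp: complex_eq_iff)
 moreover have "Re (F (s, 0)) > 0 \<longleftrightarrow> cos (Im (L (s, 0))) > 0" if "s \<in> ?I" for s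
  using L(2)[of "(s, 0)"] that by (simp add: Re_exp zero_less_mult_iff)
 ultimately have F: "Re (F (0, 0)) > 0 \<longleftrightarrow> Re (F (1, 0)) > 0" by simp
 have or: "det2 (c i) (c j) > 0 \<longleftrightarrow> det2 (c' i) (c' j) > 0"
  by (rule rotloop_orientation[OF tw]) (use ijk pl in auto)
 have cC: "c \<in> conf n" "c' \<in> conf n" using h(2)[of 0 0] h(2)[of 1 0] h(3,4)[of 0] by (simp_all add: rotloop_0)
 have sgn: "cyc x y z > 0 \<longleftrightarrow> (Re (tri x y z) > 0) ~= (det2 x y > 0)"
  if "planar x" "planar y" "planar z" "cross3 x y ~= 0" "cross3 y z ~= 0" "cross3 x z ~= 0" for x y z
 proof -
  have d: "det2 x y ~= 0" "det2 y z ~= 0" "det2 x z ~= 0" using that planar_det2 by blast+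
  moreover have "det2 z x = - det2 x z" by (simp add: det2_def)
  ultimately have zx: "det2 z x ~= 0" by simp
  have "cyc x y z ~= 0" using d zx by (simp add: cyc_def)
  moreover have "0 < (det2 x y)\<^sup>2" using d by simp
  moreover note planar_tri[OF that(1-3)]
  ultimately show ?thesis using d(1)
   by (smt (verit) mult_neg_neg mult_neg_pos mult_pos_neg mult_pos_pos mult_minus_left)
 qed
 have "cyc (c i) (c j) (c k) > 0 \<longleftrightarrow> (Re (F (0, 0)) > 0) ~= (det2 (c i) (c j) > 0)"
  unfolding F_def using sgn[OF pl(1-3)] conf_cross[OF cC(1)] ijk h(3)[of 0] by (simp add: rotloop_0)
 moreover have "cyc (c' i) (c' j) (c' k) > 0 \<longleftrightarrow> (Re (F (1, 0)) > 0) ~= (det2 (c' i) (c' j) > 0)"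
  unfolding F_def using sgn[OF pl(4-6)] conf_cross[OF cC(2)] ijk h(4)[of 0] by (simp add: rotloop_0)
 ultimately show ?thesis using F or by simp
qed

section \<open>Model configurations, their types, and the number of types\<close>

section \<open>Types of special configurations\<close>

definition dir :: "real => real ^ 3" where "dir \<theta> = vec3 (cos \<theta>) (sin \<theta>) 0"

text \<open>The model with line \<open>P\<close> vertical and the others horizontal at the angles
  \<theta>; \<open>P = n\<close> makes all lines horizontal.\<close>

definition rep :: "nat => nat => (nat => real) => nat => real ^ 3" where
 "rep n P \<theta> i = (if n \<le> i then 0 else if i = P then vec3 0 0 1 else dir (\<theta> i))"

text \<open>All angles differ by less than \<pi>, so that distinct angles give distinct lines and
  the order of the angles describes the cyclic order of the lines.\<close>

definition spread :: "nat => nat => (nat => real) => bool" where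
 "spread n P \<theta> \<longleftrightarrow> (\<forall>i<n. \<forall>j<n. i ~= P --> j ~= P --> i ~= j --> \<theta> i ~= \<theta> j \<and> \<bar>\<theta> j - \<theta> i\<bar> < pi)"

definition pole_signs :: "nat => nat => real" where
 "pole_signs P i = (if i = P then 1 else - 1)"

text \<open>A type is a pole \<open>P\<close> (\<open>P = n\<close> meaning that there is none) and a permutation giving the order of the
 angles of the remaining lines, measured from the first of them.\<close>

definition first_planar :: "nat => nat" where "first_planar P = (if P = 0 then 1 else 0)"

definition others :: "nat => nat => nat set" where "others n P = {..<n} - {P, first_planar P}"

definition types :: "nat => (nat \<times> (nat => nat)) set" where
 "types n = (SIGMA P:{..n}. {p. p permutes others n P})"

text \<open>The first horizontal line, fixed by \<open>p\<close>, gets the least angle among the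
  horizontal lines because all indices in \<open>others n P\<close> exceed its own.\<close>

definition angle :: "nat => (nat => nat) => nat => real" where
 "angle n p i = pi * real (p i) / real n"

lemma signs_pole: "signs (pole_signs P)"
 by (simp add: signs_def pole_signs_def)

lemma det2_dir: "det2 (dir a) (dir b) = sin (b - a)"
 by (simp add: det2_def dir_def sin_diff mult.commute)

lemma sin_cos_not_both_zero: "\<not> (sin a = 0 \<and> cos a = (0::real))"
 using sin_zero_abs_cos_one[of a] by auto

lemma dir_nonzero: "dir a ~= 0"
 using sin_cos_not_both_zero[of a] by (auto simp: dir_def vec3_eq_iff)

lemma planar_dir: "planar (dir a)"
 by (simp add: planar_def dir_def)

lemma sin_nonzero: "x ~= 0 ==> \<bar>x\<bar> < pi ==> sin x ~= 0"
 using sin_gt_zero[of x] sin_gt_zero[of "- x"] by (cases "x > 0") auto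

lemma spreadD:
 "spread n P \<theta> ==> i < n ==> j < n ==> i ~= P ==> j ~= P ==> i ~= j ==> \<theta> i ~= \<theta> j \<and> \<bar>\<theta> j - \<theta> i\<bar> < pi"
 by (simp add: spread_def)

lemma rep_conf:
 assumes "spread n P \<theta>" shows "rep n P \<theta> \<in> conf n"
 unfolding conf_def
proof (intro CollectI conjI allI impI)
 show "rep n P \<theta> i ~= 0" if "i < n" for i using that dir_nonzero by (simp add: rep_def vec3_eq_iff)
 fix i j assume ij: "i < n" "j < n" "i ~= j"
 have pole: "cross3 (vec3 0 0 1) (dir a) ~= 0" "cross3 (dir a) (vec3 0 0 1) ~= 0" for a
  using sin_cos_not_both_zero[of a] by (auto simp: dir_def cross3_eq_0_iff)
 have "cross3 (dir (\<theta> i)) (dir (\<theta> j)) ~= 0" if "i ~= P" "j ~= P"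
 proof -
  have "sin (\<theta> j - \<theta> i) ~= 0" by (rule sin_nonzero) (use assms ij that in "auto simp: spread_def")
  then have "det2 (dir (\<theta> i)) (dir (\<theta> j)) ~= 0" by (simp add: det2_dir)
  then show ?thesis using planar_cross[OF planar_dir dir_nonzero] by blast
 qed
 then show "cross3 (rep n P \<theta> i) (rep n P \<theta> j) ~= 0" using ij pole by (auto simp: rep_def)
qed

lemma rep_signs: "half_turn (rep n P \<theta> i) = pole_signs P i *\<^sub>R rep n P \<theta> i"
 by (simp add: rep_def pole_signs_def dir_def vec3_eq_iff)

lemma continuous_on_rep:
 fixes \<theta> :: "'a::t2_space => nat => real"
 assumes "!!i. continuous_on X (%z. \<theta> z i)" shows "continuous_on X (%z. rep n P (\<theta> z) i)"
 using assms[of i] unfolding rep_def dir_def by (cases "n \<le> i"; cases "i = P") (auto intro!: continuous_intros)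

text \<open>Linear interpolation of the angles preserves their order and keeps the differences below
  \<pi>, so the lines stay distinct.\<close>

lemma spread_homotopic:
 assumes s: "spread n P \<theta>" "spread n P \<theta>'"
  and mono: "!!i j. i < n ==> j < n ==> i ~= P ==> j ~= P ==> \<theta> i < \<theta> j \<longleftrightarrow> \<theta>' i < \<theta>' j"
 shows "twisted_homotopic (sg (pole_signs P)) (conf n) (rotloop (rep n P \<theta>)) (rotloop (rep n P \<theta>'))"
proof (rule twisted_homotopicI[of "%s. rotloop (rep n P (%i. (1 - s) * \<theta> i + s * \<theta>' i))"])
 show "continuous_on ({0..1::real} \<times> {0..1::real}) (%z. rotloop (rep n P (%i. (1 - fst z) * \<theta> i + fst z * \<theta>' i)) (snd z))"
  unfolding rotloop_def by (rule continuous_on_funI) (intro continuous_intros continuous_on_rep)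
 show "rotloop (rep n P (%i. (1 - u) * \<theta> i + u * \<theta>' i)) t \<in> conf n" if u: "u \<in> {0..1}" for u t
 proof (rule rotloop_conf[OF rep_conf])
  have pos: "0 < (1 - u) * x + u * y \<and> (1 - u) * x + u * y < pi" if "0 < x" "0 < y" "x < pi" "y < pi" for x y
  proof (cases "u = 0")
   case False
   have "0 \<le> (1 - u) * x" "0 < u * y" "(1 - u) * x \<le> (1 - u) * pi" "u * y < u * pi"
    using u False that by (auto intro: mult_nonneg_nonneg mult_left_mono)
   then show ?thesis by (auto simp: algebra_simps)
  qed (use that in simp)
  show "spread n P (%i. (1 - u) * \<theta> i + u * \<theta>' i)"
   unfolding spread_def
  proof (intro allI impI)
   have main: "0 < ((1 - u) * \<theta> j + u * \<theta>' j) - ((1 - u) * \<theta> i + u * \<theta>' i) \<and>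
     ((1 - u) * \<theta> j + u * \<theta>' j) - ((1 - u) * \<theta> i + u * \<theta>' i) < pi"
    if ij: "i < n" "j < n" "i ~= P" "j ~= P" "\<theta> i < \<theta> j" for i j
   proof -
    have "i ~= j" using ij(5) by auto
    then have A: "\<theta> j - \<theta> i < pi" "\<theta>' j - \<theta>' i < pi"
     using spreadD[OF s(1) ij(1-4)] spreadD[OF s(2) ij(1-4)] by linarith+
    have "\<theta>' i < \<theta>' j" using mono ij by blast
    then have "0 < (1 - u) * (\<theta> j - \<theta> i) + u * (\<theta>' j - \<theta>' i) \<and> (1 - u) * (\<theta> j - \<theta> i) + u * (\<theta>' j - \<theta>' i) < pi"
     by (intro pos) (use ij A in auto)
    then show ?thesis by (simp add: algebra_simps)
   qed
   fix i j assume ij: "i < n" "j < n" "i ~= P" "j ~= P" "i ~= j"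
   then have "\<theta> i ~= \<theta> j" using s(1) by (auto simp: spread_def)
   then consider "\<theta> i < \<theta> j" | "\<theta> j < \<theta> i" by linarith
   then show "(1 - u) * \<theta> i + u * \<theta>' i ~= (1 - u) * \<theta> j + u * \<theta>' j \<and>
     \<bar>(1 - u) * \<theta> j + u * \<theta>' j - ((1 - u) * \<theta> i + u * \<theta>' i)\<bar> < pi"
   proof cases
    case 1
    from main[OF ij(1-4) 1] show ?thesis by linarith
   next
    case 2
    from main[OF ij(2,1,4,3) 2] show ?thesis by linarith
   qed
  qed
 qed
 show "rotloop (rep n P (%i. (1 - u) * \<theta> i + u * \<theta>' i)) 1 = sg (pole_signs P) (rotloop (rep n P (%i. (1 - u) * \<theta> i + u * \<theta>' i)) 0)" for u
  by (simp add: rotloop_0 rotloop_1 rep_signs sg_def fun_eq_iff)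
qed auto

lemma others_first: "first_planar P \<notin> others n P" "P \<notin> others n P" "first_planar P ~= P" "i \<in> others n P ==> first_planar P < i"
 "i \<in> others n P ==> i < n" "i < n ==> i ~= P ==> i = first_planar P \<or> i \<in> others n P" "2 \<le> n ==> first_planar P < n" "finite (others n P)"
 by (auto simp: others_def first_planar_def split: if_splits)

lemma typesD:
 assumes "(P, p) \<in> types n"
 shows "P \<le> n" "p permutes others n P" "p (first_planar P) = first_planar P" "i \<in> others n P ==> p i \<in> others n P" "inj p"
proof -
 show "P \<le> n" and p: "p permutes others n P" using assms by (auto simp: types_def)
 show "p (first_planar P) = first_planar P" using permutes_not_in[OF p] others_first(1) by blast
 show "p i \<in> others n P" if "i \<in> others n P" using permutes_in_image[OF p] that by blast
 show "inj p" by (rule permutes_inj[OF p])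
qed

lemma angle_spread:
 assumes t: "(P, p) \<in> types n" and n: "2 \<le> n" shows "spread n P (angle n p)"
 unfolding spread_def
proof (intro allI impI)
 fix i j assume ij: "i < n" "j < n" "i ~= P" "j ~= P" "i ~= j"
 have lt: "p i < n" if "i < n" "i ~= P" for i
  using others_first(6)[OF that] typesD(3,4)[OF t] others_first(5)[of _ n P] others_first(7)[OF n] by metis
 have n0: "real n > 0" using n by simp
 have "p i ~= p j" using typesD(5)[OF t] ij(5) by (auto dest: injD)
 then have ne: "angle n p i ~= angle n p j" using n0 by (simp add: angle_def)
 have b: "0 \<le> angle n p i \<and> angle n p i < pi" if "i < n" "i ~= P" for i
 proof -
  have "pi * real (p i) < pi * real n" using lt[OF that] by simp
  then show ?thesis using n0 by (simp add: angle_def pos_divide_less_eq)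
 qed
 have "\<bar>angle n p j - angle n p i\<bar> < pi" using b[OF ij(1,3)] b[OF ij(2,4)] by linarith
 then show "angle n p i ~= angle n p j \<and> \<bar>angle n p j - angle n p i\<bar> < pi" using ne by blast
qed

text \<open>Each of the \<open>n\<close> poles leaves n - 2 lines to be ordered after the first
  horizontal one; without a pole there are n - 1.\<close>

lemma card_types: assumes n: "2 \<le> n" shows "card (types n) = fact (n - 2) * (2 * n - 1)"
proof -
 have co: "card (others n P) = (if P < n then n - 2 else n - 1)" if "P \<le> n" for P
 proof -
  have h: "first_planar P < n" "first_planar P ~= P" using others_first(3,7) n by auto
  show ?thesis
  proof (cases "P < n")
   case True
   then have "{P, first_planar P} \<subseteq> {..<n}" "card {P, first_planar P} = 2" using h by auto
   then show ?thesis using True by (simp add: others_def card_Diff_subset)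
  next
   case False
   then have "others n P = {..<n} - {first_planar P}" by (auto simp: others_def)
   then show ?thesis using False h by simp
  qed
 qed
 obtain m where m: "n = m + 2" using n by (metis add.commute le_Suc_ex)
 have "card (types n) = (\<Sum>P\<in>{..n}. card {p. p permutes others n P})"
  unfolding types_def by (rule card_SigmaI) (auto intro!: finite_permutations others_first(8))
 also have "\<dots> = (\<Sum>P\<in>{..n}. fact (card (others n P)))"
  by (intro sum.cong refl card_permutations) (auto simp: others_first(8))
 also have "\<dots> = (\<Sum>P\<in>{..<n}. fact (n - 2)) + fact (n - 1)"
  by (simp add: co sum.cong flip: lessThan_Suc_atMost)
 also have "\<dots> = fact (n - 2) * (2 * n - 1)" by (simp add: m algebra_simps)
 finally show ?thesis .
qed

text \<open>\<open>p\<close> sends an index to the element of \<open>R\<close> whose rank in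
  \<open>R\<close> is the rank of its angle.\<close>

lemma permutation_of_order:
 fixes \<theta> :: "nat => real"
 assumes R: "finite R" and inj: "inj_on \<theta> R"
 obtains p where "p permutes R" "!!i j. i \<in> R ==> j \<in> R ==> p i < p j \<longleftrightarrow> \<theta> i < \<theta> j"
proof -
 define rk where "rk f i = card {j \<in> R. f j < f i}" for f :: "nat => real" and i
 have mono: "rk f i < rk f j" if "f i < f j" "i \<in> R" for f i j
  unfolding rk_def by (rule psubset_card_mono) (use R that in "auto simp: psubset_eq")
 have less: "rk f i < rk f j \<longleftrightarrow> f i < f j" if "inj_on f R" "i \<in> R" "j \<in> R" for f i j
  using mono[of f i j] mono[of f j i] that by (metis inj_onD linorder_less_linear not_less_iff_gr_or_eq)
 have lt: "rk f i < card R" if "i \<in> R" for f i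
  unfolding rk_def by (rule psubset_card_mono) (use R that in auto)
 have bij: "bij_betw (rk f) R {..<card R}" if "inj_on f R" for f
 proof -
  have "inj_on (rk f) R"
  proof (rule inj_onI)
   fix x y assume xy: "x \<in> R" "y \<in> R" "rk f x = rk f y"
   then have "\<not> f x < f y" "\<not> f y < f x" using less[OF that] by (metis less_irrefl)+
   then have "f x = f y" by simp
   then show "x = y" using that xy by (simp add: inj_on_def)
  qed
  moreover have "rk f ` R = {..<card R}"
   by (rule card_subset_eq) (use lt calculation in "auto simp: card_image")
  ultimately show ?thesis by (simp add: bij_betw_def)
 qed
 have ir: "inj_on real R" by (simp add: inj_on_def)
 define p where "p i = (if i \<in> R then inv_into R (rk real) (rk \<theta> i) else i)" for i
 have b: "bij_betw (%i. inv_into R (rk real) (rk \<theta> i)) R R"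
  using bij_betw_trans[OF bij[OF inj] bij_betw_inv_into[OF bij[OF ir]]] by (simp add: o_def)
 have bp: "bij_betw p R R" using b by (rule bij_betw_cong[THEN iffD1, rotated]) (simp add: p_def)
 show thesis
 proof (rule that[of p])
  show "p permutes R" by (rule bij_imp_permutes[OF bp]) (simp add: p_def)
  fix i j assume ij: "i \<in> R" "j \<in> R"
  have e: "rk real (p i) = rk \<theta> i" "p i \<in> R" if "i \<in> R" for i
   using that bij_betw_inv_into_right[OF bij[OF ir]] lt[OF that] bp by (auto simp: p_def bij_betw_def)
  show "p i < p j \<longleftrightarrow> \<theta> i < \<theta> j"
   using less[OF ir e(2)[OF ij(1)] e(2)[OF ij(2)]] less[OF inj ij] e(1) ij by simp
 qed
qed

text \<open>The value at \<open>i\<close> is recovered from the number of indices with smaller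
  value.\<close>

lemma permutation_determined_by_order:
 fixes p q :: "nat => nat"
 assumes R: "finite R" and p: "p permutes R" and q: "q permutes R"
  and eq: "!!i j. i \<in> R ==> j \<in> R ==> i ~= j ==> p i < p j \<longleftrightarrow> q i < q j"
 shows "p = q"
proof
 fix i
 show "p i = q i"
 proof (cases "i \<in> R")
  case True
  have im: "p ` {j \<in> R. p j < p i} = {v \<in> R. v < p i}" if "p permutes R" for p
   using permutes_image[OF that] by auto
  have cd: "card {v \<in> R. v < p i} = card {j \<in> R. p j < p i}" if "p permutes R" for p
   using im[OF that] card_image[of p "{j \<in> R. p j < p i}"] permutes_inj[OF that] by (metis inj_on_subset subset_UNIV)
  have "{j \<in> R. p j < p i} = {j \<in> R. q j < q i}" using eq[OF _ True] by (metis less_irrefl)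
  then have c: "card {v \<in> R. v < p i} = card {v \<in> R. v < q i}" using cd[OF p] cd[OF q] by simp
  have L: "card {v \<in> R. v < a} < card {v \<in> R. v < b}" if "a < b" "a \<in> R" for a b
   by (rule psubset_card_mono) (use R that in auto)
  have m: "p i \<in> R" "q i \<in> R" using True permutes_in_image[OF p] permutes_in_image[OF q] by simp_all
  have "\<not> p i < q i" "\<not> q i < p i" using L[OF _ m(1), of "q i"] L[OF _ m(2), of "p i"] c by auto
  then show ?thesis by simp
 next
  case False
  then show ?thesis using permutes_not_in[OF p] permutes_not_in[OF q] by simp
 qed
qed

text \<open>Allowing a negative factor \<open>r\<close> makes an interval of length \<pi> sufficient
  for the angle.\<close>

lemma planar_polar:
 assumes "planar x" "x ~= 0"
 obtains \<theta> r where "r ~= 0" "x = r *\<^sub>R dir \<theta>" "a \<le> \<theta>" "\<theta> < a + pi"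
proof -
 define z where "z = Complex (x $ 1) (x $ 2)"
 define \<phi> where "\<phi> = Arg2pi (z * cis (- a))"
 have z0: "z ~= 0" using assms by (auto simp: z_def planar_def vec3_eq_iff complex_eq_iff)
 have "z * cis (- a) = of_real (norm (z * cis (- a))) * exp (\<i> * of_real \<phi>)" and \<phi>: "0 \<le> \<phi>" "\<phi> < 2 * pi"
  using Arg2pi[of "z * cis (- a)"] by (simp_all add: \<phi>_def is_Arg_def)
 then have "z * cis (- a) * cis a = of_real (norm z) * (cis \<phi> * cis a)" by (simp add: norm_mult cis_conv_exp)
 moreover have "z * cis (- a) * cis a = z" by (simp add: mult.assoc cis_mult)
 ultimately have "z = of_real (norm z) * cis (a + \<phi>)" by (simp add: cis_mult add.commute)
 then have x: "x = norm z *\<^sub>R dir (a + \<phi>)"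
  using assms(1) by (simp add: vec3_eq_iff dir_def z_def planar_def complex_eq_iff)
 show thesis
 proof (cases "\<phi> < pi")
  case True
  show thesis by (rule that[of "norm z" "a + \<phi>"]) (use True \<phi> x z0 in auto)
 next
  case False
  have "dir (a + \<phi>) = - dir (a + \<phi> - pi)" by (simp add: dir_def vec3_eq_iff)
  then have "x = (- norm z) *\<^sub>R dir (a + \<phi> - pi)" using x by simp
  then show thesis using False \<phi> z0 by (intro that[of "- norm z" "a + \<phi> - pi"]) auto
 qed
qed

text \<open>Rescaling a vector by a nonzero real of either sign does not change its line. Measured
  from the first horizontal line, the angles then fit into an interval of length \<pi>, and their
  order is the type.\<close>

theorem special_has_type:
 assumes c: "c \<in> special n" and n: "2 \<le> n"
 obtains P p d r where "(P, p) \<in> types n" "!!i. i < n ==> r i ~= 0 \<and> c i = r i *\<^sub>R d i"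
  "twisted_homotopic (sg (pole_signs P)) (conf n) (rotloop d) (rotloop (rep n P (angle n p)))"
proof -
 have cn: "c \<in> conf n" using c by (simp add: special_def)
 have c0: "c i ~= 0" if "i < n" for i using cn that by (simp add: conf_def)
 obtain P where P: "P \<le> n" "P < n ==> axial (c P)" "!!i. i < n ==> i ~= P ==> planar (c i)"
  using c
 proof (cases rule: specialE)
  case 1
  show thesis by (rule that[of n]) (use 1 in auto)
 next
  case (2 P)
  show thesis by (rule that[of P]) (use 2 in auto)
 qed
 let ?h = "first_planar P"
 have h: "?h < n" "?h ~= P" using others_first(3,7) n by auto
 obtain a r0 where a: "r0 ~= 0" "c ?h = r0 *\<^sub>R dir a" using planar_polar[OF P(3)[OF h] c0[OF h(1)], of 0] by blast
 have "\<exists>w. i < n --> i ~= P --> fst w ~= 0 \<and> c i = fst w *\<^sub>R dir (snd w) \<and> a \<le> snd w \<and> snd w < a + pi" for i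
 proof (cases "i < n \<and> i ~= P")
  case True
  then obtain \<theta> r where "r ~= 0" "c i = r *\<^sub>R dir \<theta>" "a \<le> \<theta>" "\<theta> < a + pi"
   using planar_polar[OF P(3) c0, of i a] by blast
  then show ?thesis by (intro exI[of _ "(r, \<theta>)"]) simp
 qed auto
 then obtain w where w: "!!i. i < n ==> i ~= P ==> fst (w i) ~= 0 \<and> c i = fst (w i) *\<^sub>R dir (snd (w i)) \<and> a \<le> snd (w i) \<and> snd (w i) < a + pi"
  by metis
 define \<theta> where "\<theta> i = (if i = ?h then a else snd (w i))" for i
 define r where "r i = (if i = P then c P $ 3 else if i = ?h then r0 else fst (w i))" for i
 have rc: "r i ~= 0" "c i = r i *\<^sub>R dir (\<theta> i)" "a \<le> \<theta> i" "\<theta> i < a + pi" if "i < n" "i ~= P" for i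
  using w[OF that] a that pi_gt_zero by (auto simp: r_def \<theta>_def)
 have ne: "\<theta> i ~= \<theta> j" if "i < n" "j < n" "i ~= P" "j ~= P" "i ~= j" for i j
 proof
  assume "\<theta> i = \<theta> j"
  then have "cross3 (c i) (c j) = 0" using rc(2)[of i] rc(2)[of j] that by (simp add: cross_mult_left cross_mult_right)
  then show False using cn that by (simp add: conf_def)
 qed
 have sp: "spread n P \<theta>"
  unfolding spread_def
 proof (intro allI impI conjI)
  fix i j assume "i < n" "j < n" "i ~= P" "j ~= P" "i ~= j"
  then show "\<theta> i ~= \<theta> j" "\<bar>\<theta> j - \<theta> i\<bar> < pi" using ne rc(3,4)[of i] rc(3,4)[of j] by (blast, linarith)
 qed
 have "inj_on \<theta> (others n P)" by (rule inj_onI) (use ne others_first(2,5) in metis)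
 then obtain p where p: "p permutes others n P" "!!i j. i \<in> others n P ==> j \<in> others n P ==> p i < p j \<longleftrightarrow> \<theta> i < \<theta> j"
  using permutation_of_order[OF others_first(8)] by blast
 have t: "(P, p) \<in> types n" using p(1) P(1) by (simp add: types_def)
 have mono: "p i < p j \<longleftrightarrow> \<theta> i < \<theta> j" if ij: "i < n" "j < n" "i ~= P" "j ~= P" for i j
 proof -
  have f1: "\<theta> ?h < \<theta> k" "?h < p k" if "k \<in> others n P" for k
  proof -
   have "k < n" "k ~= P" "k ~= ?h" using that others_first by metis+
   then show "\<theta> ?h < \<theta> k" using ne[OF h(1) _ h(2)] rc(3)[of k] by (force simp: \<theta>_def)
   show "?h < p k" using typesD(4)[OF t that] others_first(4) by blast
  qed
  consider "i = ?h" "j = ?h" | "i = ?h" "j \<in> others n P" | "i \<in> others n P" "j = ?h" | "i \<in> others n P" "j \<in> others n P"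
   using others_first(6) ij by metis
  then show ?thesis
  proof cases
   case 2 then show ?thesis using f1 typesD(3)[OF t] by simp
  next
   case 3 then show ?thesis using f1[of i] typesD(3)[OF t] by auto
  qed (use p(2) in auto)
 qed
 show thesis
 proof (rule that[OF t, of r "rep n P \<theta>"])
  show "r i ~= 0 \<and> c i = r i *\<^sub>R rep n P \<theta> i" if i: "i < n" for i
  proof (cases "i = P")
   case True
   then show ?thesis using P(2) i c0[OF i] by (auto simp: r_def rep_def axial_def vec3_eq_iff)
  next
   case False
   then show ?thesis using rc[OF i] i by (simp add: rep_def)
  qed
  show "twisted_homotopic (sg (pole_signs P)) (conf n) (rotloop (rep n P \<theta>)) (rotloop (rep n P (angle n p)))"
  proof (rule spread_homotopic[OF sp angle_spread[OF t n]])
   show "\<theta> i < \<theta> j \<longleftrightarrow> angle n p i < angle n p j" if "i < n" "j < n" "i ~= P" "j ~= P" for i j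
    using mono[OF that] n by (simp add: angle_def divide_less_cancel)
  qed
 qed
qed

lemma twice_rotloop:
 assumes h: "!!i. half_turn (c i) = e i *\<^sub>R c i"
 shows "twice (sg e) (rotloop c) = (%t i. rot (2 * pi * t) (c i))"
proof (intro ext)
 fix t i
 have p2: "pi * (2 * t) = 2 * pi * t" by simp
 have "e i *\<^sub>R rot (pi * (2 * t - 1)) (c i) = rot (pi * (2 * t - 1)) (half_turn (c i))"
  by (simp add: h rot_scaleR)
 also have "\<dots> = rot (2 * pi * t) (c i)" by (simp add: rot_rot algebra_simps flip: rot_pi)
 finally show "twice (sg e) (rotloop c) t i = rot (2 * pi * t) (c i)"
  by (simp add: twice_def joinpaths_def sg_def rotloop_def p2)
qed

text \<open>The square is the full turn, and the fourth power is the turn through 4\<pi>.\<close>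

lemma order_four_rotloop:
 assumes c: "c \<in> conf n" "2 \<le> n" and h: "!!i. half_turn (c i) = e i *\<^sub>R c i"
 shows "order_four n e (rotloop c)"
proof -
 have cc: "(%_. c) +++ (%_. c) = (%_ :: real. c)" by (auto simp: joinpaths_def)
 have "homotopic_paths (conf n) (%t i. rot (4 * pi * of_int 1 * t) (c i)) (%_. c)"
  using homotopic_spin[of "%_. c" n 1] c(1) by (auto simp: path_def path_image_def)
 then have "null_loop (conf n) (twice (sg e) (rotloop c) +++ twice (sg e) (rotloop c))"
  unfolding twice_rotloop[OF h] join_rotating cc by (simp add: null_loop_def pathstart_def)
 then show ?thesis unfolding order_four_def twice_rotloop[OF h] using rotation_not_null[OF c] by simp
qed

lemma cyc_sg: "signs f ==> cyc (sg f c i) (sg f c j) (sg f c k) = cyc (c i) (c j) (c k)"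
proof -
 assume f: "signs f"
 have d: "det2 (a *\<^sub>R x) (b *\<^sub>R y) = a * b * det2 x y" for a b x y by (simp add: det2_def algebra_simps)
 have "cyc (sg f c i) (sg f c j) (sg f c k) = (f i * f i) * (f j * f j) * (f k * f k) * cyc (c i) (c j) (c k)"
  unfolding cyc_def sg_def d by (simp only: mult_ac)
 then show ?thesis using f by simp
qed

lemma cyc_dir:
 assumes "a < b" "b < a + pi" "a < c" "c < a + pi" "b ~= c"
 shows "cyc (dir a) (dir b) (dir c) > 0 \<longleftrightarrow> c < b"
proof -
 have s: "sin (b - a) > 0" "sin (c - a) > 0" using assms by (auto intro!: sin_gt_zero)
 have "sin (a - c) = - sin (c - a)" by (metis minus_diff_eq sin_minus)
 then have e: "cyc (dir a) (dir b) (dir c) = (sin (b - a) * sin (c - a)) * - sin (c - b)"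
  by (simp add: cyc_def det2_dir)
 have pos: "sin (b - a) * sin (c - a) > 0" using s by simp
 show ?thesis
 proof (cases "c < b")
  case True
  then have "sin (b - c) > 0" using assms by (intro sin_gt_zero) auto
  moreover have "sin (b - c) = - sin (c - b)" by (metis minus_diff_eq sin_minus)
  ultimately show ?thesis using True pos unfolding e by (simp only: mult_pos_pos)
 next
  case False
  then have "sin (c - b) > 0" using assms by (intro sin_gt_zero) auto
  then have "(sin (b - a) * sin (c - a)) * sin (c - b) > 0" using pos by (rule mult_pos_pos[rotated])
  then show ?thesis using False unfolding e by simp
 qed
qed

text \<open>The signs \<open>e\<close> show which line is the pole. The cyclic orders of the first
  horizontal line with any two others are invariant by \<open>rotloop_cyclic\<close> and determine
  \<open>p\<close>. The sign change \<open>f\<close> accounts for the ambiguity in lifting lines to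
  vectors.\<close>

theorem types_distinct:
 assumes t: "(P, p) \<in> types n" "(P', p') \<in> types n" and n: "2 \<le> n" and f: "signs f"
  and tw: "twisted_homotopic (sg e) (conf n) (rotloop (rep n P (angle n p))) (rotloop (sg f (rep n P' (angle n p'))))"
 shows "(P, p) = (P', p')"
proof -
 define c c' where "c = rep n P (angle n p)" and "c' = rep n P' (angle n p')"
 note T = tw[folded c_def c'_def]
 have cn: "c \<in> conf n" "c' \<in> conf n" unfolding c_def c'_def using t n by (auto intro!: rep_conf angle_spread)
 have nz: "c i ~= 0" "c' i ~= 0" if "i < n" for i using cn that by (auto simp: conf_def)
 have ee: "e i = pole_signs P i" "e i = pole_signs P' i" if i: "i < n" for i
 proof -
  have "e i *\<^sub>R c i = half_turn (c i)" using fun_cong[OF twisted_homotopicD(5)[OF T], of i]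
   by (simp add: rotloop_0 rotloop_1 sg_def)
  then have "e i *\<^sub>R c i = pole_signs P i *\<^sub>R c i" by (simp add: c_def rep_signs)
  then show "e i = pole_signs P i" using nz[OF i] by simp
  have "half_turn (sg f c' i) = e i *\<^sub>R sg f c' i" by (rule rotloop_signs[OF T])
  moreover have "half_turn (sg f c' i) = f i *\<^sub>R half_turn (c' i)" using rot_scaleR[of pi] by (simp add: sg_def rot_pi)
  ultimately have "e i *\<^sub>R sg f c' i = pole_signs P' i *\<^sub>R sg f c' i" by (simp add: c'_def rep_signs sg_def mult.commute)
  then show "e i = pole_signs P' i" using nz[OF i] f by (simp add: sg_def)
 qed
 have "P \<le> n" "P' \<le> n" using typesD(1) t by blast+
 have PP: "P = P'"
 proof (rule ccontr)
  assume ne: "P ~= P'"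
  have "P < n \<or> P' < n" using ne \<open>P \<le> n\<close> \<open>P' \<le> n\<close> by linarith
  then show False using ee[of P] ee[of P'] ne by (auto simp: pole_signs_def)
 qed
 let ?h = "first_planar P"
 have h: "?h < n" "?h ~= P" using others_first(3,7) n by auto
 have angles: "cyc (c ?h) (c i) (c j) > 0 \<longleftrightarrow> p j < p i"
  if t: "(P, p) \<in> types n" "c = rep n P (angle n p)" and ij: "i \<in> others n P" "j \<in> others n P" "i ~= j" for p c i j
 proof -
  have n0: "real n > 0" using n by simp
  have less: "angle n p i < angle n p j \<longleftrightarrow> p i < p j" for i j using n0 by (simp add: angle_def divide_less_cancel)
  have i: "i < n" "i ~= P" "j < n" "j ~= P" "i ~= ?h" "j ~= ?h" using ij others_first by metis+
  have "p ?h < p k" if "k \<in> others n P" for k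
   using typesD(3)[OF t(1)] others_first(4)[OF typesD(4)[OF t(1) that]] by simp
  then have "angle n p ?h < angle n p i" "angle n p ?h < angle n p j" using less ij by blast+
  moreover have "angle n p i < angle n p ?h + pi" "angle n p j < angle n p ?h + pi" "angle n p i ~= angle n p j"
   using spreadD[OF angle_spread[OF t(1) n] h(1) i(1) h(2) i(2)] spreadD[OF angle_spread[OF t(1) n] h(1) i(3) h(2) i(4)]
    spreadD[OF angle_spread[OF t(1) n] i(1) i(3) i(2) i(4)] i(5,6) ij(3) by linarith+
  ultimately show ?thesis using cyc_dir less i h by (simp add: t(2) rep_def)
 qed
 have "p = p'"
 proof (rule permutation_determined_by_order[OF others_first(8)])
  show "p permutes others n P" "p' permutes others n P" using typesD(2) t PP by blast+
  fix i j assume ij: "i \<in> others n P" "j \<in> others n P" "i ~= j"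
  have i: "i < n" "i ~= P" "j < n" "j ~= P" "i ~= ?h" "j ~= ?h" using ij others_first by metis+
  have pl: "planar (c k)" "planar (sg f c' k)" if "k < n" "k ~= P" for k
   using that planar_dir[unfolded planar_def] by (auto simp: c_def c'_def PP rep_def sg_def planar_def)
  have "cyc (c ?h) (c j) (c i) > 0 \<longleftrightarrow> cyc (sg f c' ?h) (sg f c' j) (sg f c' i) > 0"
   by (rule rotloop_cyclic[OF T]) (use i h ij pl ee(1) in "auto simp: pole_signs_def")
  also have "\<dots> \<longleftrightarrow> cyc (c' ?h) (c' j) (c' i) > 0" by (simp add: cyc_sg[OF f])
  finally show "p i < p j \<longleftrightarrow> p' i < p' j"
   using angles[OF t(1) c_def ij(2,1)] angles[of p' c' j i] t(2) c'_def PP ij by simp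
 qed
 then show ?thesis using PP by simp
qed

section \<open>From lines to vectors: lifting loops and free homotopies\<close>

section \<open>Lifting to vectors\<close>

text \<open>The Veronese map, sending a unit vector to the projection onto its line. It realizes the
  projective plane inside a normed space, where \<open>covering_space_two_sheeted\<close>
  applies.\<close>

definition tensor :: "real ^ 3 => real ^ 3 ^ 3" where "tensor x = (\<chi> i j. x $ i * x $ j)"

lemma tensor_mult: "tensor y *v x = (y \<bullet> x) *\<^sub>R y"
 by (simp add: matrix_vector_mult_def tensor_def inner_vec_def vec_eq_iff sum_distrib_left mult_ac)

lemma tensor_eq_iff:
 assumes "norm x = 1" "norm y = 1" shows "tensor x = tensor y \<longleftrightarrow> x = y \<or> x = - y"
proof
 assume *: "tensor x = tensor y"
 have "x \<bullet> x = 1" using assms(1) by (simp add: norm_eq_1)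
 then have x: "x = (y \<bullet> x) *\<^sub>R y" using tensor_mult[of x x] tensor_mult[of y x] * by simp
 then have "norm x = \<bar>y \<bullet> x\<bar> * norm y" by (metis norm_scaleR)
 then have "y \<bullet> x = 1 \<or> y \<bullet> x = - 1" using assms by auto
 then show "x = y \<or> x = - y" using x by auto
qed (auto simp: tensor_def vec_eq_iff)

lemma continuous_on_matrix_mult: "continuous_on X (%M :: real ^ 3 ^ 3. M *v x)"
 unfolding matrix_vector_mult_def by (intro continuous_on_vec_lambda continuous_intros)

lemma covering_tensor: "covering_space (sphere 0 1) tensor (tensor ` sphere 0 1)"
proof (rule covering_space_two_sheeted)
 show "continuous_on (sphere 0 1) tensor" unfolding tensor_def by (intro continuous_on_vec_lambda continuous_intros)
 show "tensor x = tensor y \<longleftrightarrow> x = y \<or> x = - y" if "x \<in> sphere 0 1" "y \<in> sphere 0 1" for x y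
  using tensor_eq_iff that by simp
 fix x :: "real ^ 3" assume x: "x \<in> sphere 0 1"
 let ?S = "tensor ` sphere 0 1"
 \<comment> \<open>For \<open>M = tensor y\<close> this is \<open>(y \<bullet> x)\<^sup>2\<close>,
   and where it is positive \<open>s M\<close> is the one of \<open>y\<close> and \<open>- y\<close>
   on the side of \<open>x\<close>.\<close>
 define q where "q M = x \<bullet> (M *v x)" for M :: "real ^ 3 ^ 3"
 define s where "s M = (1 / sqrt (q M)) *\<^sub>R (M *v x)" for M
 have cq: "continuous_on X q" for X unfolding q_def by (intro continuous_intros continuous_on_matrix_mult)
 define T where "T = {M \<in> ?S. q M > 0}"
 have qt: "q (tensor y) = (y \<bullet> x)\<^sup>2" for y by (simp add: q_def tensor_mult inner_commute power2_eq_square)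
 have "openin (top_of_set ?S) (?S \<inter> q -` {0<..})" by (rule continuous_openin_preimage_gen[OF cq]) simp
 moreover have "?S \<inter> q -` {0<..} = T" by (auto simp: T_def)
 ultimately have oT: "openin (top_of_set ?S) T" by simp
 have xT: "tensor x \<in> T" using x qt[of x] by (auto simp: T_def norm_eq_1)
 have cs: "continuous_on T s" unfolding s_def
  by (intro continuous_intros continuous_on_matrix_mult cq) (auto simp: T_def)
 have sM: "s M \<in> sphere 0 1 \<and> tensor (s M) = M" if "M \<in> T" for M
 proof -
  have M: "M \<in> tensor ` sphere 0 1" "q M > 0" using that by (simp_all add: T_def)
  from M(1) obtain y where "M = tensor y" "y \<in> sphere 0 1" by (rule imageE)
  then have y: "norm y = 1" "M = tensor y" "q M > 0" using M(2) by simp_all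
  have y0: "(y \<bullet> x)\<^sup>2 > 0" using y(3) qt[of y] unfolding y(2) by metis
  have "s M = ((y \<bullet> x) / \<bar>y \<bullet> x\<bar>) *\<^sub>R y" by (simp add: s_def y(2) qt tensor_mult)
  then have "s M = y \<or> s M = - y" using y0 by (cases "y \<bullet> x > 0") (auto simp: abs_if)
  moreover have "tensor (- y) = tensor y" by (simp add: tensor_def)
  ultimately show ?thesis using y(1,2) by auto
 qed
 show "\<exists>T s. tensor x \<in> T \<and> openin (top_of_set ?S) T \<and> continuous_on T s \<and> (\<forall>y\<in>T. s y \<in> sphere 0 1 \<and> tensor (s y) = y)"
  by (intro exI[of _ T] exI[of _ s] conjI ballI xT oT cs sM)
qed auto

lemma continuous_on_sphere_proj: "continuous_on (sphere 0 1) sphere_proj"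
 using quotient_imp_continuous_map[OF quotient_map_sphere_proj] by simp

text \<open>By the quotient topology \<open>tensor\<close> induces a continuous map of the
  projective plane into matrices; \<open>f\<close> followed by it lifts through
  \<open>covering_tensor\<close>.\<close>

lemma sphere_lift:
 fixes f :: "'c::real_normed_vector => projective_plane"
 assumes U: "convex U" and f: "continuous_on U f"
 shows "\<exists>g. continuous_on U g \<and> (\<forall>z\<in>U. norm (g z) = 1 \<and> sphere_proj (g z) = f z)"
proof -
 have "\<exists>x. norm x = 1 \<and> sphere_proj x = u" for u using sphere_proj_surj by (metis UNIV_I imageE mem_sphere_0)
 then obtain r where r: "!!u. norm (r u) = 1" "!!u. sphere_proj (r u) = u" by metis
 define \<Psi> where "\<Psi> u = tensor (r u)" for u
 have \<Psi>: "\<Psi> (sphere_proj x) = tensor x" if "norm x = 1" for x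
  using sphere_proj_eq_iff[OF r(1)[of "sphere_proj x"] that] r(2)[of "sphere_proj x"]
   tensor_eq_iff[OF r(1)[of "sphere_proj x"] that] by (simp add: \<Psi>_def)
 have "continuous_on (sphere 0 1) (\<Psi> \<circ> sphere_proj)"
  by (rule continuous_on_cong[THEN iffD1, OF refl _ covering_space_imp_continuous[OF covering_tensor]]) (simp add: \<Psi>)
 then have "continuous_map (top_of_set (sphere 0 1)) euclidean (\<Psi> \<circ> sphere_proj)" by simp
 then have "continuous_map euclidean euclidean \<Psi>"
  by (rule continuous_compose_quotient_map[OF quotient_map_sphere_proj])
 then have "continuous_on UNIV \<Psi>" by simp
 then have c: "continuous_on U (%z. \<Psi> (f z))" by (rule continuous_on_compose2[OF _ f]) simp
 have "(%z. \<Psi> (f z)) \<in> U \<rightarrow> tensor ` sphere 0 1" using r by (auto simp: \<Psi>_def)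
 then obtain g where g: "continuous_on U g" "g \<in> U \<rightarrow> sphere 0 1" "!!z. z \<in> U ==> tensor (g z) = \<Psi> (f z)"
  using lift_on_convex[OF covering_tensor U c] by blast
 have n1: "norm (g z) = 1" if "z \<in> U" for z using g(2) that by auto
 have "sphere_proj (g z) = f z" if "z \<in> U" for z
 proof -
  have "g z = r (f z) \<or> g z = - r (f z)" using g(3)[OF that] tensor_eq_iff[OF n1[OF that] r(1)] by (simp add: \<Psi>_def)
  then have "sphere_proj (g z) = sphere_proj (r (f z))" using sphere_proj_eq_iff[OF n1[OF that] r(1)] by simp
  then show ?thesis by (simp add: r(2))
 qed
 then show ?thesis using g(1) n1 by blast
qed

definition ray :: "real ^ 3 => projective_plane" where "ray x = sphere_proj (x /\<^sub>R norm x)"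

definition lines :: "nat => (nat => real ^ 3) => nat => projective_plane" where
 "lines n c = restrict (%i. ray (c i)) {..<n}"

text \<open>Unit vectors with zeros from entry \<open>n\<close> on make the lift of a configuration
  of lines unique up to signs.\<close>

definition uconf :: "nat => (nat => real ^ 3) set" where
 "uconf n = {c \<in> conf n. (\<forall>i<n. norm (c i) = 1) \<and> (\<forall>i\<ge>n. c i = 0)}"

lemma ray_eq_iff:
 assumes "x ~= 0" "y ~= 0" shows "ray x = ray y \<longleftrightarrow> cross3 x y = 0"
proof -
 have n: "norm (x /\<^sub>R norm x) = 1" "norm (y /\<^sub>R norm y) = 1" using assms by simp_all
 have "x /\<^sub>R norm x = y /\<^sub>R norm y \<or> x /\<^sub>R norm x = - (y /\<^sub>R norm y) \<longleftrightarrow> cross3 x y = 0"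
 proof
  assume *: "x /\<^sub>R norm x = y /\<^sub>R norm y \<or> x /\<^sub>R norm x = - (y /\<^sub>R norm y)"
  have "cross3 (x /\<^sub>R norm x) (y /\<^sub>R norm y) = 0" using * by (auto simp: cross_minus_left)
  then show "cross3 x y = 0" using assms cross3_scaleR_eq_0[of "inverse (norm x)" "inverse (norm y)" x y] by simp
 next
  assume "cross3 x y = 0"
  then obtain l where l: "y = l *\<^sub>R x" using cross3_eq_0_iff_scaleR[OF assms(1)] by blast
  then have "l ~= 0" using assms by auto
  then have "y /\<^sub>R norm y = (l / \<bar>l\<bar>) *\<^sub>R (x /\<^sub>R norm x)" by (simp add: l divide_simps)
  moreover have "l / \<bar>l\<bar> = 1 \<or> l / \<bar>l\<bar> = - 1" using \<open>l ~= 0\<close> by (auto simp: abs_if)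
  ultimately obtain s where s: "y /\<^sub>R norm y = s *\<^sub>R (x /\<^sub>R norm x)" "s = 1 \<or> s = - 1" by blast
  from s(2) show "x /\<^sub>R norm x = y /\<^sub>R norm y \<or> x /\<^sub>R norm x = - (y /\<^sub>R norm y)"
   by (rule disjE) (simp_all only: s(1) scaleR_one scaleR_minus_left minus_minus simp_thms)
 qed
 then show ?thesis unfolding ray_def sphere_proj_eq_iff[OF n] .
qed

lemma ray_unit: "norm x = 1 ==> ray x = sphere_proj x"
 by (simp add: ray_def)

lemma ray_scaleR: "r ~= 0 ==> ray (r *\<^sub>R x) = ray x"
proof (cases "x = 0")
 case False
 assume "r ~= 0"
 then show ?thesis using False ray_eq_iff[of "r *\<^sub>R x" x] by (simp add: cross_mult_left)
qed simp

lemma lines_conf: assumes "c \<in> conf n" shows "lines n c \<in> configuration_space n UNIV"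
 unfolding configuration_space_def
proof (intro CollectI conjI inj_onI)
 show "lines n c \<in> {..<n} \<rightarrow>\<^sub>E UNIV" by (simp add: lines_def)
 fix i j assume ij: "i \<in> {..<n}" "j \<in> {..<n}" "lines n c i = lines n c j"
 then have "cross3 (c i) (c j) = 0" using ray_eq_iff[of "c i" "c j"] assms by (auto simp: lines_def conf_def)
 then show "i = j" using assms ij by (auto simp: conf_def)
qed

lemma continuous_on_lines: "continuous_on (conf n) (lines n)"
proof (rule continuous_on_funI)
 fix i
 have ray: "continuous_on (- {0}) ray" unfolding ray_def
 proof (rule continuous_on_compose2[OF continuous_on_sphere_proj])
  show "continuous_on (- {0}) (%x :: real ^ 3. x /\<^sub>R norm x)" by (auto intro!: continuous_intros)
  show "(%x :: real ^ 3. x /\<^sub>R norm x) ` (- {0}) \<subseteq> sphere 0 1"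
  proof (rule image_subsetI)
   fix x :: "real ^ 3" assume "x \<in> - {0}"
   then have "norm (x /\<^sub>R norm x) = 1" by simp
   then show "x /\<^sub>R norm x \<in> sphere 0 1" by simp
  qed
 qed
 show "continuous_on (conf n) (%c. lines n c i)"
 proof (cases "i < n")
  case True
  have "continuous_on (conf n) (%c. ray (c i))"
   by (rule continuous_on_compose2[OF ray continuous_on_funD[OF continuous_on_id]]) (use True in "auto simp: conf_def")
  then show ?thesis using True by (simp add: lines_def)
 qed (simp add: lines_def)
qed

lemma lines_sg: assumes "signs e" shows "lines n (sg e c) = lines n c"
 using assms by (auto simp: lines_def sg_def ray_scaleR fun_eq_iff)

lemma lift_conf:
 fixes H :: "'c::real_normed_vector => nat => projective_plane"
 assumes U: "convex U" and H: "continuous_on U H" "!!z. z \<in> U ==> H z \<in> configuration_space n UNIV"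
 obtains G where "continuous_on U G" "!!z. z \<in> U ==> G z \<in> uconf n" "!!z. z \<in> U ==> lines n (G z) = H z"
proof -
 have "\<exists>g. continuous_on U g \<and> (\<forall>z\<in>U. norm (g z) = 1 \<and> sphere_proj (g z) = H z i)" for i
  by (rule sphere_lift[OF U continuous_on_funD[OF H(1)]])
 then obtain g where g: "!!i. continuous_on U (g i)" "!!i z. z \<in> U ==> norm (g i z) = 1" "!!i z. z \<in> U ==> sphere_proj (g i z) = H z i"
  by metis
 define G where "G z i = (if i < n then g i z else 0)" for z i
 show thesis
 proof (rule that[of G])
  show "continuous_on U G"
  proof (rule continuous_on_funI)
   show "continuous_on U (%z. G z i)" for i using g(1)[of i] by (cases "i < n") (simp_all add: G_def)
  qed
  fix z assume z: "z \<in> U"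
  have Hz: "H z \<in> {..<n} \<rightarrow>\<^sub>E UNIV" "inj_on (H z) {..<n}" using H(2)[OF z] by (auto simp: configuration_space_def)
  have r: "ray (G z i) = H z i" "G z i ~= 0" if "i < n" for i
   using g(2,3)[OF z, of i] that by (auto simp: G_def ray_unit)
  show "lines n (G z) = H z"
  proof
   show "lines n (G z) i = H z i" for i using r(1)[of i] Hz(1) by (cases "i < n") (auto simp: lines_def PiE_def extensional_def)
  qed
  have "cross3 (G z i) (G z j) ~= 0" if "i < n" "j < n" "i ~= j" for i j
   using ray_eq_iff[OF r(2)[OF that(1)] r(2)[OF that(2)]] r(1) that Hz(2) by (auto dest: inj_onD)
  then show "G z \<in> uconf n" using r(2) g(2)[OF z] by (auto simp: uconf_def conf_def) (simp_all add: G_def)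
 qed
qed

text \<open>The inner product of two unit vectors on the same line is 1 or -1; being continuous, it
  is constant on \<open>T\<close>.\<close>

lemma sign_unique:
 fixes G G' :: "'c::topological_space => nat => real ^ 3"
 assumes T: "connected T" and G: "continuous_on T G" "!!z. z \<in> T ==> G z \<in> uconf n"
  and G': "continuous_on T G'" "!!z. z \<in> T ==> G' z \<in> uconf n" and eq: "!!z. z \<in> T ==> lines n (G z) = lines n (G' z)"
 obtains f where "signs f" "!!z. z \<in> T ==> G' z = sg f (G z)"
proof -
 have "\<exists>s. (s = 1 \<or> s = - 1) \<and> (\<forall>z\<in>T. G' z i = s *\<^sub>R G z i)" for i
 proof (cases "i < n")
  case False
  then show ?thesis using G(2) G'(2) by (intro exI[of _ 1]) (auto simp: uconf_def)
 next
  case True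
  have n1: "norm (G z i) = 1" "norm (G' z i) = 1" if "z \<in> T" for z using G(2) G'(2) that True by (auto simp: uconf_def)
  have pm: "G' z i = G z i \<or> G' z i = - G z i" if "z \<in> T" for z
  proof -
   have "ray (G z i) = ray (G' z i)" using fun_cong[OF eq[OF that], of i] True by (simp add: lines_def)
   then have "sphere_proj (G' z i) = sphere_proj (G z i)" using n1[OF that] by (simp add: ray_unit)
   then show ?thesis using sphere_proj_eq_iff[OF n1(2)[OF that] n1(1)[OF that]] by simp
  qed
  have dot: "G z i \<bullet> G z i = 1" if "z \<in> T" for z using n1[OF that] by (simp add: norm_eq_1)
  have "continuous_on T (%z. G z i \<bullet> G' z i)" by (intro continuous_on_inner continuous_on_funD[OF G(1)] continuous_on_funD[OF G'(1)])
  moreover have "(%z. G z i \<bullet> G' z i) ` T \<subseteq> {1, - 1}"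
  proof (rule image_subsetI)
   fix z assume z: "z \<in> T"
   from pm[OF z] show "G z i \<bullet> G' z i \<in> {1, - 1}" by (rule disjE) (simp_all add: dot[OF z])
  qed
  then have "finite ((%z. G z i \<bullet> G' z i) ` T)" by (rule finite_subset) simp
  ultimately have "(%z. G z i \<bullet> G' z i) constant_on T" by (rule continuous_finite_range_constant[OF T])
  then have "\<exists>s. \<forall>z\<in>T. G z i \<bullet> G' z i = s" by (simp only: constant_on_def)
  then obtain s where s: "!!z. z \<in> T ==> G z i \<bullet> G' z i = s" by (elim exE) blast
  have 1: "G' z i = s *\<^sub>R G z i \<and> (s = 1 \<or> s = - 1)" if "z \<in> T" for z
   using pm[OF that]
  proof
   assume e: "G' z i = G z i"
   then have "s = 1" using s[OF that] dot[OF that] by simp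
   then show ?thesis using e by simp
  next
   assume e: "G' z i = - G z i"
   then have "- 1 = s" using s[OF that] dot[OF that] by simp
   then have "s = - 1" by (rule HOL.sym)
   then show ?thesis using e by simp
  qed
  show ?thesis
  proof (cases "T = {}")
   case False then show ?thesis using 1 by blast
  qed auto
 qed
 then have "\<forall>i. \<exists>s. (s = 1 \<or> s = - 1) \<and> (\<forall>z\<in>T. G' z i = s *\<^sub>R G z i)" by (rule allI)
 from choice[OF this] obtain f where f: "!!i. f i = 1 \<or> f i = - 1" "!!i. \<forall>z\<in>T. G' z i = f i *\<^sub>R G z i" by blast
 show thesis
 proof (rule that[of f])
  show "signs f" using f(1) by (simp add: signs_def)
  show "G' z = sg f (G z)" if "z \<in> T" for z using f(2) that by (simp add: sg_def fun_eq_iff)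
 qed
qed

lemma uconf_sg: "signs f ==> c \<in> uconf n ==> sg f c \<in> uconf n"
proof -
 assume f: "signs f" and c: "c \<in> uconf n"
 have "\<bar>f i\<bar> = 1" for i using signs_cases[OF f, of i] by auto
 then show ?thesis using c conf_sg[OF f] by (auto simp: uconf_def sg_def)
qed

abbreviation RPconf :: "nat => (nat => projective_plane) set" where
 "RPconf n \<equiv> configuration_space n UNIV"

text \<open>Both ends of the lifted path span the same lines, so they differ by signs
  \<open>e\<close>.\<close>

lemma loop_lift:
 assumes g: "path g" "path_image g \<subseteq> RPconf n" "g 0 = g 1"
 obtains p e where "signs e" "path p" "path_image p \<subseteq> uconf n" "p 1 = sg e (p 0)"
  "!!t. t \<in> {0..1} ==> lines n (p t) = g t" "!!t i. n \<le> i ==> p t i = 0"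
proof -
 have gm: "g t \<in> RPconf n" if "t \<in> {0..1}" for t using g(2) that by (auto simp: path_image_def image_subset_iff)
 obtain G where G: "continuous_on {0..1} G" "!!z. z \<in> {0..1} ==> G z \<in> uconf n" "!!z. z \<in> {0..1} ==> lines n (G z) = g z"
  using lift_conf[of "{0..1::real}" g n] g(1) gm by (auto simp: path_def)
 define p where "p t i = (if i < n then G t i else 0)" for t i
 have pG: "p t = G t" if "t \<in> {0..1}" for t using G(2)[OF that] by (auto simp: p_def uconf_def fun_eq_iff)
 obtain e where e: "signs e" "G 1 = sg e (G 0)"
  using sign_unique[of "{0::real}" "%_. G 0" n "%_. G 1"] G(2,3)[of 0] G(2,3)[of 1] g(3) by auto
 show thesis
 proof (rule that[OF e(1), of p])
  show "path p" unfolding path_def using G(1) pG by (simp cong: continuous_on_cong_simp)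
  show "path_image p \<subseteq> uconf n" using G(2) pG by (auto simp: path_image_def)
 qed (use pG G e in "auto simp: p_def")
qed

text \<open>The free homotopy lifts to vectors on the square. Signs \<open>f0\<close> make the lift
  start at \<open>p\<close>; its two edges over the base point track differ by \<open>f2\<close>,
  which agrees with \<open>e\<close> on the first \<open>n\<close> entries; and it arrives at
  \<open>q\<close> only up to signs.\<close>

lemma loops_lift:
 assumes hom: "homotopic_loops (RPconf n) (lines n \<circ> p) (lines n \<circ> q)"
  and p: "path p" "path_image p \<subseteq> uconf n" "p 1 = sg e (p 0)" and q: "path q" "path_image q \<subseteq> uconf n" and e: "signs e"
 obtains f where "signs f" "twisted_homotopic (sg e) (conf n) p (%t. sg f (q t))"
proof -
 let ?I = "{0..1::real}"
 have "twisted_homotopic (%x. x) (RPconf n) (lines n \<circ> p) (lines n \<circ> q)" using hom by (simp add: twisted_homotopic_id)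
 then obtain h where
  h: "continuous_on ({0..1::real} \<times> {0..1::real}) (%z. h (fst z) (snd z))"
   "!!s t. s \<in> {0..1} ==> t \<in> {0..1} ==> h s t \<in> RPconf n"
   "!!t. t \<in> {0..1} ==> h 0 t = (lines n \<circ> p) t" "!!t. t \<in> {0..1} ==> h 1 t = (lines n \<circ> q) t"
   "!!s. s \<in> {0..1} ==> h s 1 = h s 0"
  by (rule twisted_homotopicE) blast
 have cv: "convex (?I \<times> ?I)" by (intro convex_Times) auto
 obtain G where G: "continuous_on (?I \<times> ?I) G" "!!z. z \<in> ?I \<times> ?I ==> G z \<in> uconf n"
  "!!z. z \<in> ?I \<times> ?I ==> lines n (G z) = h (fst z) (snd z)"
 proof (rule lift_conf[OF cv h(1), of n])
  show "h (fst z) (snd z) \<in> RPconf n" if "z \<in> ?I \<times> ?I" for z using that h(2) by auto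
 qed blast+
 have pm: "p t \<in> uconf n" "q t \<in> uconf n" if "t \<in> ?I" for t using p(2) q(2) that by (auto simp: path_image_def image_subset_iff)
 have pq: "continuous_on ?I p" "continuous_on ?I q" using p(1) q(1) by (simp_all add: path_def)
 have cI: "connected ?I" by simp
 obtain f0 where f0: "signs f0" "!!t. t \<in> ?I ==> p t = sg f0 (G (0, t))"
  by (rule sign_unique[OF cI continuous_on_slice(1)[OF G(1), of 0] _ pq(1), where n = n]) (use G h(3) pm in auto)
 obtain f1 where f1: "signs f1" "!!t. t \<in> ?I ==> G (1, t) = sg f1 (q t)"
  by (rule sign_unique[OF cI pq(2) _ continuous_on_slice(1)[OF G(1), of 1], where n = n]) (use G h(4) pm in auto)
 obtain f2 where f2: "signs f2" "!!s. s \<in> ?I ==> G (s, 1) = sg f2 (G (s, 0))"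
  by (rule sign_unique[OF cI continuous_on_slice(2)[OF G(1), of 0] _ continuous_on_slice(2)[OF G(1), of 1], where n = n]) (use G h(5) in auto)
 have ee: "e i = f2 i" if "i < n" for i
 proof -
  have "e i *\<^sub>R p 0 i = sg f0 (sg f2 (G (0, 0))) i" using fun_cong[OF p(3), of i] f0(2)[of 1] f2(2)[of 0] by (simp add: sg_def)
  also have "\<dots> = f2 i *\<^sub>R p 0 i" using f0(2)[of 0] by (simp add: sg_def mult.commute)
  finally show ?thesis using pm(1)[of 0] that by (auto simp: uconf_def conf_def)
 qed
 define F where "F i = f0 i * f1 i" for i
 have "F i = 1 \<or> F i = - 1" for i
  using signs_cases[OF f0(1), of i] signs_cases[OF f1(1), of i] by (elim disjE) (simp_all add: F_def)
 then have F: "signs F" by (simp add: signs_def)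
 show thesis
 proof (rule that[OF F], rule twisted_homotopicI[of "%s t. sg f0 (G (s, t))"])
  show "continuous_on (?I \<times> ?I) (%z. sg f0 (G (fst z, snd z)))"
   using continuous_on_compose2[OF continuous_on_sg[of UNIV f0] G(1)] by simp
  show "sg f0 (G (s, t)) \<in> conf n" if "s \<in> ?I" "t \<in> ?I" for s t
   using conf_sg[OF f0(1)] G(2)[of "(s, t)"] that by (simp add: uconf_def)
  show "sg f0 (G (1, t)) = sg F (q t)" if "t \<in> ?I" for t by (simp add: f1(2)[OF that] sg_def F_def fun_eq_iff)
  show "sg f0 (G (s, 1)) = sg e (sg f0 (G (s, 0)))" if s: "s \<in> ?I" for s
  proof
   fix i
   have "G (s, 0) i = 0" if "\<not> i < n" using G(2)[of "(s, 0)"] s that by (auto simp: uconf_def)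
   then show "sg f0 (G (s, 1)) i = sg e (sg f0 (G (s, 0))) i"
    using ee[of i] f2(2)[OF s] by (cases "i < n") (auto simp: sg_def)
  qed
 qed (simp add: f0(2))
qed

lemma twisted_imp_loops:
 assumes "twisted_homotopic (sg e) (conf n) p q" "signs e"
 shows "homotopic_loops (RPconf n) (lines n \<circ> p) (lines n \<circ> q)"
 unfolding twisted_homotopic_id[symmetric]
 by (rule twisted_homotopic_image[OF assms(1) continuous_on_lines]) (use lines_conf lines_sg[OF assms(2)] in auto)

lemma null_lift:
 assumes p: "path p" "path_image p \<subseteq> uconf n" "p 1 = p 0"
 shows "null_loop (RPconf n) (lines n \<circ> p) \<longleftrightarrow> null_loop (conf n) p"
proof
 assume "null_loop (conf n) p"
 then show "null_loop (RPconf n) (lines n \<circ> p)"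
  by (rule null_loop_image[OF _ continuous_on_lines]) (use lines_conf in auto)
next
 assume N: "null_loop (RPconf n) (lines n \<circ> p)"
 have "twisted_homotopic (%x. x) (RPconf n) (lines n \<circ> p) (lines n \<circ> (%_. p 0))"
  by (rule homotopic_paths_imp_twisted) (use N p(3) in "simp_all add: null_loop_def pathstart_def o_def")
 then have "homotopic_loops (RPconf n) (lines n \<circ> p) (lines n \<circ> (%_. p 0))" by (simp add: twisted_homotopic_id)
 moreover have "path (%_ :: real. p 0)" "path_image (%_ :: real. p 0) \<subseteq> uconf n" using p(2) by (auto simp: path_def path_image_def)
 ultimately obtain f where "signs f" "twisted_homotopic (sg (%_. 1)) (conf n) p (%t. sg f (p 0))"
  using loops_lift[of n p "%_. p 0" "%_. 1"] p signs_one by (auto simp: sg_one)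
 then have "homotopic_loops (conf n) p (%_. sg f (p 0))" by (simp add: sg_one twisted_homotopic_id)
 then show "null_loop (conf n) p" unfolding null_loop_def null_loop_iff[symmetric] by blast
qed

text \<open>\<open>twice\<close> lifts squares, and by \<open>null_lift\<close> a closed lift is
  null exactly when its projection is.\<close>

lemma order_four_lines:
 assumes p: "path p" "path_image p \<subseteq> uconf n" "p 1 = sg e (p 0)" and e: "signs e"
 defines "g \<equiv> lines n \<circ> p"
 shows "order_four n e p \<longleftrightarrow> null_loop (RPconf n) ((g +++ g) +++ (g +++ g)) \<and> \<not> null_loop (RPconf n) (g +++ g)"
proof -
 let ?P = "twice (sg e) p"
 have sp: "path (sg e \<circ> p)" "path_image (sg e \<circ> p) \<subseteq> uconf n"
  using path_continuous_image[OF p(1) continuous_on_sg] p(2) uconf_sg[OF e] by (auto simp: path_image_def)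
 have P: "path ?P" "path_image ?P \<subseteq> uconf n" "?P 0 = p 0" "?P 1 = p 0"
  unfolding twice_def using p sp sg_sg[OF e]
  by (simp_all add: pathstart_def pathfinish_def subset_path_image_join) (simp_all add: joinpaths_def sg_sg[OF e])
 have PP: "path (?P +++ ?P)" "path_image (?P +++ ?P) \<subseteq> uconf n" "(?P +++ ?P) 1 = (?P +++ ?P) 0"
  using P by (simp_all add: pathstart_def pathfinish_def subset_path_image_join) (simp add: joinpaths_def)
 have 1: "lines n \<circ> ?P = g +++ g"
  by (auto simp: g_def twice_def joinpaths_def fun_eq_iff lines_sg[OF e])
 have 2: "lines n \<circ> (?P +++ ?P) = (g +++ g) +++ (g +++ g)"
  unfolding 1[symmetric] by (auto simp: joinpaths_def fun_eq_iff)
 show ?thesis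
  unfolding order_four_def using null_lift[OF P(1,2)] null_lift[OF PP] P(3,4) by (simp add: 1 2)
qed

section \<open>Conjugacy in the fundamental group as free homotopy\<close>

section \<open>Conjugacy classes and free homotopy\<close>

abbreviation loop_class :: "'a::topological_space set => 'a => (real => 'a) => (real => 'a) set" where
 "loop_class S a p \<equiv> loop_homotopy S a `` {p}"

lemma loop_class_eq_iff:
 assumes "p \<in> loops_at S a" "q \<in> loops_at S a"
 shows "loop_class S a p = loop_class S a q \<longleftrightarrow> homotopic_paths S p q"
 using eq_equiv_class_iff[OF equiv_loop_homotopy assms] assms by (simp add: loop_homotopy_def)

lemma fundamental_group_carrier: "carrier (fundamental_group S a) = loop_class S a ` loops_at S a"
 by (auto simp: fundamental_group_def quotient_def)

lemma fundamental_group_one: "\<one>\<^bsub>fundamental_group S a\<^esub> = loop_class S a (%_. a)"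
 by (simp add: fundamental_group_def)

lemma loop_class_one_iff:
 assumes "a \<in> S" "p \<in> loops_at S a"
 shows "loop_class S a p = \<one>\<^bsub>fundamental_group S a\<^esub> \<longleftrightarrow> null_loop S p"
 unfolding fundamental_group_one loop_class_eq_iff[OF assms(2) const_loop_in_loops_at[OF assms(1)]]
 using loops_atD(3)[OF assms(2)] by (simp add: null_loop_def)

lemma loops_at_iff: "p \<in> loops_at S a \<longleftrightarrow> path p \<and> path_image p \<subseteq> S \<and> p 0 = a \<and> p 1 = a"
 by (simp add: loops_at_def pathstart_def pathfinish_def)

text \<open>Sliding a loop along \<open>k\<close> conjugates it by \<open>k\<close>. Conversely, the
  boundary of a free homotopy square reads \<open>p k = k q\<close>, with \<open>k\<close> the track
  of the base point.\<close>

theorem conjugate_iff_homotopic_loops: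
 fixes S :: "'a::topological_space set"
 assumes a: "a \<in> S" and p: "p \<in> loops_at S a" and q: "q \<in> loops_at S a"
 defines "G \<equiv> fundamental_group S a"
 shows "(\<exists>g\<in>carrier G. loop_class S a q = g \<otimes>\<^bsub>G\<^esub> loop_class S a p \<otimes>\<^bsub>G\<^esub> inv\<^bsub>G\<^esub> g) \<longleftrightarrow> homotopic_loops S p q"
proof -
 interpret G: group G unfolding G_def by (rule group_fundamental_group[OF a])
 let ?c = "loop_class S a"
 have cl: "?c r \<in> carrier G" if "r \<in> loops_at S a" for r using that by (simp add: G_def fundamental_group_carrier)
 have mult: "?c r \<otimes>\<^bsub>G\<^esub> ?c s = ?c (r +++ s)" if "r \<in> loops_at S a" "s \<in> loops_at S a" for r s
  unfolding G_def by (rule fundamental_group_mult_class[OF that])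
 show ?thesis
 proof
  assume "\<exists>g\<in>carrier G. ?c q = g \<otimes>\<^bsub>G\<^esub> ?c p \<otimes>\<^bsub>G\<^esub> inv\<^bsub>G\<^esub> g"
  then obtain k where k: "k \<in> loops_at S a" "?c q = ?c k \<otimes>\<^bsub>G\<^esub> ?c p \<otimes>\<^bsub>G\<^esub> inv\<^bsub>G\<^esub> ?c k"
   by (auto simp: G_def fundamental_group_carrier)
  have qk: "?c q \<otimes>\<^bsub>G\<^esub> ?c k = ?c k \<otimes>\<^bsub>G\<^esub> ?c p"
   unfolding k(2) using cl[OF k(1)] cl[OF p] by (simp add: G.m_assoc)
  obtain r where r: "twisted_homotopic (%x. x) S q r" "r 0 = k 1"
   "(%x. x) = (%x :: 'a. x) ==> homotopic_paths S r (reversepath k +++ (q +++ k))"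
   by (rule twisted_homotopic_move[of q S "%x. x" k]) (use p q k(1) in "auto simp: loops_at_iff continuous_on_id")
  have h: "homotopic_paths S r (reversepath k +++ (q +++ k))" using r(3) by simp
  have rk: "reversepath k \<in> loops_at S a" by (rule reversepath_in_loops_at[OF k(1)])
  have "r 1 = r 0" using twisted_homotopicD(6)[OF r(1)] .
  then have rl: "r \<in> loops_at S a" using twisted_homotopicD[OF r(1)] r(2) k(1) by (simp add: loops_at_iff)
  have "?c r = ?c (reversepath k +++ (q +++ k))"
   using h loop_class_eq_iff[OF rl join_in_loops_at[OF rk join_in_loops_at[OF q k(1)]]] by blast
  also have "\<dots> = ?c (reversepath k) \<otimes>\<^bsub>G\<^esub> (?c k \<otimes>\<^bsub>G\<^esub> ?c p)"
   unfolding qk[symmetric] using rk q k(1) by (simp add: mult join_in_loops_at)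
  also have "\<dots> = (?c (reversepath k) \<otimes>\<^bsub>G\<^esub> ?c k) \<otimes>\<^bsub>G\<^esub> ?c p" using cl rk k(1) p by (simp add: G.m_assoc)
  also have "?c (reversepath k) \<otimes>\<^bsub>G\<^esub> ?c k = \<one>\<^bsub>G\<^esub>"
   unfolding mult[OF rk k(1)] unfolding G_def fundamental_group_one
   using homotopic_paths_reversepath_join[OF k(1)] loop_class_eq_iff[OF join_in_loops_at[OF rk k(1)] const_loop_in_loops_at[OF a]] by blast
  also have "\<one>\<^bsub>G\<^esub> \<otimes>\<^bsub>G\<^esub> ?c p = ?c p" using cl[OF p] by simp
  finally have "homotopic_paths S r p" using loop_class_eq_iff[OF rl p] by blast
  then have "twisted_homotopic (%x. x) S r p" by (rule homotopic_paths_imp_twisted) fact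
  then have "twisted_homotopic (%x. x) S q p" using r(1) twisted_homotopic_trans by blast
  then show "homotopic_loops S p q" by (simp add: twisted_homotopic_id homotopic_loops_sym)
 next
  assume "homotopic_loops S p q"
  then have "twisted_homotopic (%x. x) S p q" by (simp add: twisted_homotopic_id)
  then obtain h where
   h: "continuous_on ({0..1::real} \<times> {0..1::real}) (%z. h (fst z) (snd z))"
    "!!s t. s \<in> {0..1} ==> t \<in> {0..1} ==> h s t \<in> S"
    "!!t. t \<in> {0..1} ==> h 0 t = p t" "!!t. t \<in> {0..1} ==> h 1 t = q t"
    "!!s. s \<in> {0..1} ==> h s 1 = h s 0"
   by (rule twisted_homotopicE) blast
  define k where "k s = h s 0" for s
  have k: "k \<in> loops_at S a"
  proof -
   have "continuous_on {0..1} k" unfolding k_def using continuous_on_slice(2)[OF h(1), of 0] by simp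
   moreover have "h 0 0 = a" "h 1 0 = a" using h(3)[of 0] h(4)[of 0] p q by (simp_all add: loops_at_iff)
   ultimately show ?thesis using h(2) by (auto simp: loops_at_iff path_def path_image_def k_def)
  qed
  have "homotopic_paths S ((%t. h 0 t) +++ (%s. h s 1)) ((%s. h s 0) +++ (%t. h 1 t))"
  proof -
   have "(%z. h (fst z) (snd z)) \<in> {0..1} \<times> {0..1} \<rightarrow> S" using h(2) by auto
   from homotopic_square[OF h(1) this] show ?thesis by simp
  qed
  then have "homotopic_paths S (p +++ k) (k +++ q)"
   by (rule homotopic_paths_cong) (use h(3-5) in "auto simp: joinpaths_def k_def")
  then have e: "?c p \<otimes>\<^bsub>G\<^esub> ?c k = ?c k \<otimes>\<^bsub>G\<^esub> ?c q"
   using p q k by (simp add: mult loop_class_eq_iff join_in_loops_at)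
  have "?c q = inv\<^bsub>G\<^esub> ?c k \<otimes>\<^bsub>G\<^esub> (?c k \<otimes>\<^bsub>G\<^esub> ?c q)" using cl[OF k] cl[OF q] by (simp flip: G.m_assoc)
  also have "\<dots> = inv\<^bsub>G\<^esub> ?c k \<otimes>\<^bsub>G\<^esub> ?c p \<otimes>\<^bsub>G\<^esub> inv\<^bsub>G\<^esub> (inv\<^bsub>G\<^esub> ?c k)"
   unfolding e[symmetric] using cl[OF k] cl[OF p] by (simp add: G.m_assoc)
  finally show "\<exists>g\<in>carrier G. ?c q = g \<otimes>\<^bsub>G\<^esub> ?c p \<otimes>\<^bsub>G\<^esub> inv\<^bsub>G\<^esub> g" using cl[OF k] by blast
 qed
qed

lemma (in group) conjugacy_class_eq_iff:
 assumes x: "x \<in> carrier G" and y: "y \<in> carrier G"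
 shows "conjugacy_class G x = conjugacy_class G y \<longleftrightarrow> (\<exists>g\<in>carrier G. y = g \<otimes> x \<otimes> inv g)"
proof -
 have sub: "conjugacy_class G (g \<otimes> x \<otimes> inv g) \<subseteq> conjugacy_class G x" if g: "g \<in> carrier G" and x: "x \<in> carrier G" for g x
 proof
  fix z assume "z \<in> conjugacy_class G (g \<otimes> x \<otimes> inv g)"
  then obtain k where k: "k \<in> carrier G" "z = k \<otimes> (g \<otimes> x \<otimes> inv g) \<otimes> inv k" by (auto simp: conjugacy_class_def)
  then have "z = (k \<otimes> g) \<otimes> x \<otimes> inv (k \<otimes> g)" using g x by (simp add: inv_mult_group m_assoc)
  then show "z \<in> conjugacy_class G x" unfolding conjugacy_class_def using k g by blast
 qed
 show ?thesis
 proof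
  assume e: "conjugacy_class G x = conjugacy_class G y"
  have "y = \<one> \<otimes> y \<otimes> inv \<one>" using y by simp
  then have "y \<in> conjugacy_class G y" unfolding conjugacy_class_def by blast
  then show "\<exists>g\<in>carrier G. y = g \<otimes> x \<otimes> inv g" unfolding e[symmetric] by (auto simp: conjugacy_class_def)
 next
  assume "\<exists>g\<in>carrier G. y = g \<otimes> x \<otimes> inv g"
  then obtain g where g: "g \<in> carrier G" "y = g \<otimes> x \<otimes> inv g" by blast
  have "inv g \<otimes> y \<otimes> inv (inv g) = (inv g \<otimes> g) \<otimes> x \<otimes> (inv g \<otimes> g)" unfolding g(2) using g(1) x by (simp only: m_assoc inv_closed m_closed inv_inv)
  then have "x = inv g \<otimes> y \<otimes> inv (inv g)" using g(1) x by simp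
  then show "conjugacy_class G x = conjugacy_class G y"
   using sub[OF g(1) x] sub[OF inv_closed[OF g(1)] y] g(2) by auto
 qed
qed

lemma (in group) ord_eq_4_iff:
 assumes x: "x \<in> carrier G"
 shows "ord x = 4 \<longleftrightarrow> (x \<otimes> x) \<otimes> (x \<otimes> x) = \<one> \<and> x \<otimes> x ~= \<one>"
proof -
 have p2: "x [^] (2::nat) = x \<otimes> x" using x by (simp add: numeral_2_eq_2)
 have "x [^] (4::nat) = x [^] (2::nat) \<otimes> x [^] (2::nat)" using x by (simp add: nat_pow_mult)
 then have p4: "x [^] (4::nat) = (x \<otimes> x) \<otimes> (x \<otimes> x)" by (simp add: p2)
 have "d = 4" if "d dvd 4" "\<not> d dvd 2" for d :: nat
 proof -
  have "d \<le> 4" by (rule dvd_imp_le[OF that(1)]) simp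
  then have "d = 0 \<or> d = 1 \<or> d = 2 \<or> d = 3 \<or> d = 4" by linarith
  then show ?thesis using that by auto
 qed
 then have "ord x = 4 \<longleftrightarrow> ord x dvd 4 \<and> \<not> ord x dvd 2" by auto
 then show ?thesis using pow_eq_id[OF x] p2 p4 by metis
qed

section \<open>Bijection between types and conjugacy classes of elements of order four\<close>

section \<open>Counting\<close>

lemma rep_uconf: "spread n P \<theta> ==> rep n P \<theta> \<in> uconf n"
proof -
 have "norm (dir a) = 1" "norm (vec3 0 0 1) = 1" for a
  using sin_cos_squared_add2[of a] by (simp_all add: norm_eq_1 inner3 dir_def power2_eq_square add.commute)
 then show "spread n P \<theta> ==> rep n P \<theta> \<in> uconf n" by (auto simp: uconf_def rep_conf) (auto simp: rep_def)
qed

lemma rotloop_uconf: "c \<in> uconf n ==> rotloop c t \<in> uconf n"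
 by (auto simp: uconf_def rotloop_conf) (auto simp: rotloop_def norm_rot rot_eq_0)

lemma lines_surj: assumes "x \<in> RPconf n" shows "\<exists>c\<in>uconf n. lines n c = x"
proof -
 obtain G :: "real => nat => real ^ 3" where "G 0 \<in> uconf n" "lines n (G 0) = x"
  by (rule lift_conf[of "{0::real}" "%_. x" n]) (use assms in auto)
 then show ?thesis by blast
qed

lemma path_connected_RPconf: assumes "1 \<le> n" shows "path_connected (RPconf n)"
proof -
 have "conf0 n \<subseteq> conf n" by (auto simp: conf0_def)
 then have "path_connected (lines n ` conf0 n)"
  by (intro path_connected_continuous_image path_connected_conf0[OF assms] continuous_on_subset[OF continuous_on_lines])
 moreover have "lines n ` conf0 n = RPconf n"
 proof (intro equalityI subsetI)
  fix x assume "x \<in> RPconf n"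
  then obtain c where "c \<in> uconf n" "lines n c = x" using lines_surj by blast
  then show "x \<in> lines n ` conf0 n" by (intro image_eqI[of _ _ c]) (auto simp: uconf_def conf0_def)
 qed (use \<open>conf0 n \<subseteq> conf n\<close> lines_conf in auto)
 ultimately show ?thesis by simp
qed

lemma lines_cong_scale:
 assumes "!!i. i < n ==> r i ~= 0 \<and> c i = r i *\<^sub>R d i" shows "lines n \<circ> rotloop c = lines n \<circ> rotloop d"
proof (intro ext)
 fix t i
 show "(lines n \<circ> rotloop c) t i = (lines n \<circ> rotloop d) t i"
  using assms[of i] by (cases "i < n") (simp_all add: lines_def rotloop_def rot_scaleR ray_scaleR)
qed

theorem proposition11:
  fixes n :: nat and b :: "nat \<Rightarrow> projective_plane"
  assumes "n \<ge> 2"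
    and "b \<in> configuration_space n UNIV"
  shows "card {conjugacy_class (pure_braid_group n UNIV b) x |x.
                 x \<in> carrier (pure_braid_group n UNIV b) \<and>
                 group.ord (pure_braid_group n UNIV b) x = 4}
         = fact (n - 2) * (2 * n - 1)"
proof -
 let ?X = "RPconf n" and ?c = "loop_class (RPconf n) b"
 define G where "G = pure_braid_group n UNIV b"
 have Gf: "G = fundamental_group ?X b" by (simp add: G_def pure_braid_group_def)
 interpret G: group G unfolding G_def by (rule group_pure_braid_group[OF assms(2)])
 note n = assms(1) and b = assms(2)
 have cl: "?c r \<in> carrier G" if "r \<in> loops_at ?X b" for r using that by (simp add: Gf fundamental_group_carrier)
 have conj: "conjugacy_class G (?c p) = conjugacy_class G (?c q) \<longleftrightarrow> homotopic_loops ?X p q"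
  if "p \<in> loops_at ?X b" "q \<in> loops_at ?X b" for p q
  using G.conjugacy_class_eq_iff[OF cl[OF that(1)] cl[OF that(2)]] conjugate_iff_homotopic_loops[OF b that] by (simp add: Gf)
 have ord: "G.ord (?c p) = 4 \<longleftrightarrow> null_loop ?X ((p +++ p) +++ (p +++ p)) \<and> \<not> null_loop ?X (p +++ p)"
  if p: "p \<in> loops_at ?X b" for p
 proof -
  have pp: "p +++ p \<in> loops_at ?X b" by (rule join_in_loops_at[OF p p])
  have "?c p \<otimes>\<^bsub>G\<^esub> ?c p = ?c (p +++ p)" "?c (p +++ p) \<otimes>\<^bsub>G\<^esub> ?c (p +++ p) = ?c ((p +++ p) +++ (p +++ p))"
   unfolding Gf by (rule fundamental_group_mult_class[OF p p], rule fundamental_group_mult_class[OF pp pp])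
  then show ?thesis
   unfolding G.ord_eq_4_iff[OF cl[OF p]]
   using loop_class_one_iff[OF b pp] loop_class_one_iff[OF b join_in_loops_at[OF pp pp]] by (simp add: Gf)
 qed
 \<comment> \<open>The model loop of a type, as a path of vectors.\<close>
 define R where "R \<tau> = rotloop (rep n (fst \<tau>) (angle n (snd \<tau>)))" for \<tau>
 have Ru: "rep n (fst \<tau>) (angle n (snd \<tau>)) \<in> uconf n" if "\<tau> \<in> types n" for \<tau>
  using rep_uconf[OF angle_spread[OF _ n]] that by simp
 have Rp: "path (R \<tau>)" "path_image (R \<tau>) \<subseteq> uconf n" "R \<tau> 1 = sg (pole_signs (fst \<tau>)) (R \<tau> 0)" if "\<tau> \<in> types n" for \<tau>
 proof -
  show "path (R \<tau>)" unfolding R_def by (rule path_rotloop)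
  show "path_image (R \<tau>) \<subseteq> uconf n" unfolding R_def path_image_def using rotloop_uconf[OF Ru[OF that]] by blast
  show "R \<tau> 1 = sg (pole_signs (fst \<tau>)) (R \<tau> 0)" by (simp add: R_def rotloop_0 rotloop_1 rep_signs sg_def fun_eq_iff)
 qed
 have Rl: "path (lines n \<circ> R \<tau>)" "path_image (lines n \<circ> R \<tau>) \<subseteq> ?X" "(lines n \<circ> R \<tau>) 1 = (lines n \<circ> R \<tau>) 0" if \<tau>: "\<tau> \<in> types n" for \<tau>
 proof -
  have sub: "path_image (R \<tau>) \<subseteq> conf n" using Rp(2)[OF \<tau>] by (auto simp: uconf_def)
  show "path (lines n \<circ> R \<tau>)" by (rule path_continuous_image[OF Rp(1)[OF \<tau>] continuous_on_subset[OF continuous_on_lines sub]])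
  show "path_image (lines n \<circ> R \<tau>) \<subseteq> ?X" using sub lines_conf by (auto simp: path_image_def)
  show "(lines n \<circ> R \<tau>) 1 = (lines n \<circ> R \<tau>) 0" by (simp add: Rp(3)[OF \<tau>] lines_sg[OF signs_pole])
 qed
 have pc: "path_connected ?X" by (rule path_connected_RPconf) (use n in simp)
 have "\<exists>q. q \<in> loops_at ?X b \<and> homotopic_loops ?X (lines n \<circ> R \<tau>) q" if \<tau>: "\<tau> \<in> types n" for \<tau>
 proof -
  have "(lines n \<circ> R \<tau>) 0 \<in> ?X" using Rl(2)[OF \<tau>] by (auto simp: path_image_def)
  then obtain k where k: "path k" "path_image k \<subseteq> ?X" "k 0 = (lines n \<circ> R \<tau>) 0" "k 1 = b"
   using pc b unfolding path_connected_def pathstart_def pathfinish_def by blast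
  obtain q where q: "twisted_homotopic (%x. x) ?X (lines n \<circ> R \<tau>) q" "q 0 = k 1"
   by (rule twisted_homotopic_move[where E = "%x. x" and S = ?X and p = "lines n \<circ> R \<tau>" and k = k])
     (use Rl[OF \<tau>] k in "auto simp: continuous_on_id")
  then have "q \<in> loops_at ?X b" using twisted_homotopicD[OF q(1)] k(4) by (simp add: loops_at_iff)
  then show ?thesis using q(1) by (auto simp: twisted_homotopic_id)
 qed
 then have "\<forall>\<tau>\<in>types n. \<exists>q. q \<in> loops_at ?X b \<and> homotopic_loops ?X (lines n \<circ> R \<tau>) q" by (rule ballI)
 \<comment> \<open>Loops at \<open>b\<close> freely homotopic to the models; they exist because the
   configuration space is path connected.\<close>
 from bchoice[OF this] obtain L where "\<forall>\<tau>\<in>types n. L \<tau> \<in> loops_at ?X b \<and> homotopic_loops ?X (lines n \<circ> R \<tau>) (L \<tau>)"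
  by (rule exE)
 then have L: "!!\<tau>. \<tau> \<in> types n ==> L \<tau> \<in> loops_at ?X b" "!!\<tau>. \<tau> \<in> types n ==> homotopic_loops ?X (lines n \<circ> R \<tau>) (L \<tau>)"
  by simp_all
 \<comment> \<open>Whether the square and the fourth power are null depends only on the free
   homotopy class.\<close>
 have nl: "null_loop ?X (p +++ p) \<longleftrightarrow> null_loop ?X (q +++ q)"
  "null_loop ?X ((p +++ p) +++ (p +++ p)) \<longleftrightarrow> null_loop ?X ((q +++ q) +++ (q +++ q))" if "homotopic_loops ?X p q" for p q
  using null_loop_homotopic[OF homotopic_loops_join[OF that]] null_loop_homotopic[OF homotopic_loops_join[OF homotopic_loops_join[OF that]]]
  by blast+
 have ordL: "G.ord (?c (L \<tau>)) = 4" if \<tau>: "\<tau> \<in> types n" for \<tau>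
 proof -
  have "rep n (fst \<tau>) (angle n (snd \<tau>)) \<in> conf n" using Ru[OF \<tau>] by (simp add: uconf_def)
  then have "order_four n (pole_signs (fst \<tau>)) (R \<tau>)" unfolding R_def by (rule order_four_rotloop[OF _ n rep_signs])
  then have "null_loop ?X (((lines n \<circ> R \<tau>) +++ (lines n \<circ> R \<tau>)) +++ ((lines n \<circ> R \<tau>) +++ (lines n \<circ> R \<tau>))) \<and>
   \<not> null_loop ?X ((lines n \<circ> R \<tau>) +++ (lines n \<circ> R \<tau>))"
   using order_four_lines[OF Rp[OF \<tau>] signs_pole] by blast
  then show ?thesis unfolding ord[OF L(1)[OF \<tau>]] using nl[OF L(2)[OF \<tau>]] by blast
 qed
 \<comment> \<open>Equal conjugacy classes yield a twisted homotopy between the models up to a sign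
   change \<open>f\<close>, and \<open>types_distinct\<close> identifies the types.\<close>
 have inj: "inj_on (%\<tau>. conjugacy_class G (?c (L \<tau>))) (types n)"
 proof (rule inj_onI)
  fix \<tau> \<tau>' assume \<tau>: "\<tau> \<in> types n" "\<tau>' \<in> types n" and e: "conjugacy_class G (?c (L \<tau>)) = conjugacy_class G (?c (L \<tau>'))"
  have "homotopic_loops ?X (L \<tau>) (L \<tau>')" using e conj[OF L(1)[OF \<tau>(1)] L(1)[OF \<tau>(2)]] by blast
  then have "homotopic_loops ?X (lines n \<circ> R \<tau>) (lines n \<circ> R \<tau>')"
   using homotopic_loops_trans[OF L(2)[OF \<tau>(1)]] homotopic_loops_trans[OF _ homotopic_loops_sym[OF L(2)[OF \<tau>(2)]]] by blast
  then obtain f where f: "signs f" "twisted_homotopic (sg (pole_signs (fst \<tau>))) (conf n) (R \<tau>) (%t. sg f (R \<tau>' t))"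
   using loops_lift[OF _ Rp[OF \<tau>(1)] Rp(1,2)[OF \<tau>(2)] signs_pole] by blast
  have "(%t. sg f (R \<tau>' t)) = rotloop (sg f (rep n (fst \<tau>') (angle n (snd \<tau>'))))"
   by (simp add: R_def rotloop_def sg_def rot_scaleR fun_eq_iff)
  then have tw: "twisted_homotopic (sg (pole_signs (fst \<tau>))) (conf n) (rotloop (rep n (fst \<tau>) (angle n (snd \<tau>))))
    (rotloop (sg f (rep n (fst \<tau>') (angle n (snd \<tau>')))))"
   using f(2) by (simp add: R_def)
  have "(fst \<tau>, snd \<tau>) = (fst \<tau>', snd \<tau>')" by (rule types_distinct[OF _ _ n f(1) tw]) (use \<tau> in simp_all)
  then show "\<tau> = \<tau>'" by simp
 qed
 have "{conjugacy_class G x |x. x \<in> carrier G \<and> G.ord x = 4} = (%\<tau>. conjugacy_class G (?c (L \<tau>))) ` types n"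
 proof (intro equalityI subsetI)
  fix C assume "C \<in> (%\<tau>. conjugacy_class G (?c (L \<tau>))) ` types n"
  then obtain \<tau> where \<tau>: "\<tau> \<in> types n" "C = conjugacy_class G (?c (L \<tau>))" by blast
  then show "C \<in> {conjugacy_class G x |x. x \<in> carrier G \<and> G.ord x = 4}" using cl[OF L(1)[OF \<tau>(1)]] ordL[OF \<tau>(1)] by blast
 next
  fix C assume "C \<in> {conjugacy_class G x |x. x \<in> carrier G \<and> G.ord x = 4}"
  then obtain g where g: "g \<in> loops_at ?X b" "C = conjugacy_class G (?c g)" "G.ord (?c g) = 4"
   by (auto simp: Gf fundamental_group_carrier)
  have gl: "path g" "path_image g \<subseteq> ?X" "g 0 = g 1" using g(1) by (simp_all add: loops_at_iff)
  \<comment> \<open>The lift of a given element of order four becomes the rotation of a special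
    configuration, which rescaling and \<open>special_has_type\<close> deform to a model.\<close>
  obtain p e where p: "signs e" "path p" "path_image p \<subseteq> uconf n" "p 1 = sg e (p 0)"
   "!!t. t \<in> {0..1} ==> lines n (p t) = g t" "!!t i. n \<le> i ==> p t i = 0"
   by (rule loop_lift[OF gl]) blast
  have sub: "path_image p \<subseteq> conf n" using p(3) by (auto simp: uconf_def)
  have gp: "homotopic_loops ?X g (lines n \<circ> p)"
  proof -
   have "twisted_homotopic (%x. x) ?X g g" by (rule twisted_homotopic_refl) (use gl in auto)
   then have "twisted_homotopic (%x. x) ?X g (lines n \<circ> p)" by (rule twisted_homotopic_cong) (use p(5) in auto)
   then show ?thesis by (simp add: twisted_homotopic_id)
  qed
  have o4: "order_four n e p"
   using g(3) nl[OF gp] unfolding ord[OF g(1)] order_four_lines[OF p(2-4,1)] by blast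
  have "\<exists>c\<in>special n. twisted_homotopic (sg e) (conf n) p (rotloop c)"
   by (rule order_four_special[OF n p(1,2) sub p(4) o4]) (rule p(6))
  then obtain c where c: "c \<in> special n" "twisted_homotopic (sg e) (conf n) p (rotloop c)"
   by (rule bexE)
  obtain P \<pi> d r where t: "(P, \<pi>) \<in> types n" "!!i. i < n ==> r i ~= 0 \<and> c i = r i *\<^sub>R d i"
   "twisted_homotopic (sg (pole_signs P)) (conf n) (rotloop d) (rotloop (rep n P (angle n \<pi>)))"
   by (rule special_has_type[OF c(1) n]) blast
  have h1: "homotopic_loops ?X (lines n \<circ> p) (lines n \<circ> rotloop d)"
   using twisted_imp_loops[OF c(2) p(1)] lines_cong_scale[OF t(2)] by simp
  have h2: "homotopic_loops ?X (lines n \<circ> rotloop d) (lines n \<circ> R (P, \<pi>))"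
   using twisted_imp_loops[OF t(3) signs_pole] by (simp add: R_def)
  have "homotopic_loops ?X g (L (P, \<pi>))"
   by (rule homotopic_loops_trans[OF gp homotopic_loops_trans[OF h1 homotopic_loops_trans[OF h2 L(2)[OF t(1)]]]])
  then have "C = conjugacy_class G (?c (L (P, \<pi>)))" using conj[OF g(1) L(1)[OF t(1)]] g(2) by blast
  then show "C \<in> (%\<tau>. conjugacy_class G (?c (L \<tau>))) ` types n" using t(1) by blast
 qed
 then have "card {conjugacy_class G x |x. x \<in> carrier G \<and> G.ord x = 4} = card (types n)"
  using card_image[OF inj] by simp
 then show ?thesis unfolding G_def using card_types[OF n] by simp
qed

end
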